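(* Let $p:E\to Y$ be a stratified fibration with $Y$ paracompact, let $n$ be the filtered dimension of $E$, and let $y\in Y$. Then the stalk at $y$ of the derived sheaf $\mathcal{H}^*(\mathcal{I}^{\bar p}_{fc}\mathcal{Z}^* )$ is isomorphic to $I^{\bar p}H^c_{n-*}(E,E-p^{-1}(y))$.
   Context: Filtered spaces. A filtered space is a space $X$ with a finite filtration $X=X^n\supset X^{n-1}\supset\cdots\supset X^0\supset X^{-1}=\emptyset$ (superscripts are labels); $n$ is the filtered dimension and $X_i=X^i-X^{i-1}$ is the $i$th stratum. Subspaces carry the restricted filtration. Intersection chains. A perversity is a function $\bar p:\mathbb{Z}^{\ge 1}\to\mathbb{Z}$ with $\bar p(k)\le\bar p(k+1)\le\bar p(k)+1$; fix one. A singular simplex $\sigma:\Delta^i\to X$ is allowable if $\sigma^{-1}(X^{n-k}-X^{n-k-1})$ is contained in the $(i-k+\bar p(k))$-skeleton of $\Delta^i$ for all $k\ge1$. A chain $\xi$ is allowable if every simplex of $\xi$ and of $\partial\xi$ (with nonzero coefficient) is allowable. $I^{\bar p}C^c_*(X)$ is the complex of allowable finite singular chains; $I^{\bar p}C^\infty_*(X)$ is the complex of allowable locally finite (possibly infinite) singular chains: each point of $X$ has a neighborhood meeting only finitely many simplices of the chain. $I^{\bar p}H^c_*(X)=H_*(I^{\bar p}C^c_*(X))$ and $I^{\bar p}H^c_*(X,B)=H_*(I^{\bar p}C^c_*(X)/I^{\bar p}C^c_*(B))$. $|\xi|$ is the support of $\xi$. Coefficients are fixed and suppressed; with $R$ a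 ring with unit of finite cohomological dimension they may be: a constant group or $R$-module; a local system of groups or $R$-modules on $X-X^{n-1}$; or, if $\bar p(2)>0$, a stratified system equal to a local system on $X-X^{n-1}$ and to $0$ on $X^{n-1}$. Stratified fibrations. A map $F:Z\times I\to X$ to a filtered space is a stratum-preserving homotopy if $F(\{z\}\times I)$ lies in a single stratum of $X$ for each $z$. For filtered $E,Y$, a map $p:E\to Y$ is a stratified fibration if for every space $Z$, map $f:Z\to E$ and stratum-preserving homotopy $F:Z\times I\to Y$ with $F(z,0)=pf(z)$, there is a stratum-preserving homotopy $\tilde F:Z\times I\to E$ with $p\tilde F=F$, $\tilde F(\cdot,0)=f$. The sheaf. $I^{\bar p}C^{fc}_*(E)$ is the subcomplex of $\xi\in I^{\bar p}C^\infty_*(E)$ such that each $y\in Y$ has a neighborhood $N$ with $|\xi|\cap p^{-1}(N)=K\cap p^{-1}(N)$ for some compact $K\subset E$. For $U\subset Y$ open, $I^{\bar p}C^{fc}_*(E,E-\overline{p^{-1}(U)})$ is the quotient of $I^{\bar p}C^{fc}_*(E)$ by the subcomplex of those $\xi\in I^{\bar p}C^{fc}_*(E)$ with $|\xi|\subset E-\overline{p^{-1}(U)}$. $\mathcal{I}^{\bar p}_{fc}\mathcal{Z}^*$ is the complex of sheaves on $Y$ generated by the presheaves $U\mapsto I^{\bar p}C^{fc}_{n-i}(E,E-\overline{p^{-1}(U)})$ in degree $i$, with the evident restrictions. $\mathcal{H}^*(\cdot)$ denotes the derived (cohomology) sheaf. *)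

theory Defs
  imports "HOL-Analysis.Analysis" "HOL-Homology.Homology" "HOL-Algebra.Module" "HOL-Algebra.AbelCoset"
begin

section \<open>Modules over a possibly noncommutative ring\<close>

text \<open>
  The module locale of HOL-Algebra requires a commutative ring of scalars; only that requirement
  is dropped here. Abelian groups are the left modules over the ring of integers. The components
  \<open>mult\<close> and \<open>one\<close> of the record type for modules play no role.
\<close>

definition left_module :: "('r, 'm) ring_scheme \<Rightarrow> ('r, 'x, 'n) module_scheme \<Rightarrow> bool" where
  "left_module R M \<longleftrightarrow> ring R \<and> abelian_group M \<and> module_axioms R M"

definition module_isos ::
    "('r, 'm) ring_scheme \<Rightarrow> ('r, 'x) module \<Rightarrow> ('r, 'y) module \<Rightarrow> ('x \<Rightarrow> 'y) set" where
  "module_isos R M N =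
     {f \<in> iso (add_monoid M) (add_monoid N).
        \<forall>r\<in>carrier R. \<forall>x\<in>carrier M. f (r \<odot>\<^bsub>M\<^esub> x) = r \<odot>\<^bsub>N\<^esub> f x}"

definition modules_isomorphic ::
    "('r, 'm) ring_scheme \<Rightarrow> ('r, 'x) module \<Rightarrow> ('r, 'y) module \<Rightarrow> bool" where
  "modules_isomorphic R M N \<longleftrightarrow> module_isos R M N \<noteq> {}"

definition prod_module :: "'i set \<Rightarrow> ('i \<Rightarrow> ('r, 'x) module) \<Rightarrow> ('r, 'i \<Rightarrow> 'x) module" where
  "prod_module I M =
     \<lparr>carrier = (\<Pi>\<^sub>E i\<in>I. carrier (M i)), mult = (\<lambda>_ _. undefined), one = undefined,
      zero = (\<lambda>i\<in>I. \<zero>\<^bsub>M i\<^esub>), add = (\<lambda>x y. \<lambda>i\<in>I. x i \<oplus>\<^bsub>M i\<^esub> y i),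
      smult = (\<lambda>r x. \<lambda>i\<in>I. r \<odot>\<^bsub>M i\<^esub> x i)\<rparr>"

definition quot_module :: "('r, 'x) module \<Rightarrow> 'x set \<Rightarrow> ('r, 'x set) module" where
  "quot_module M N =
     \<lparr>carrier = a_rcosets\<^bsub>M\<^esub> N, mult = (\<lambda>_ _. undefined), one = undefined,
      zero = N, add = set_add M,
      smult = (\<lambda>r C. \<Union>c\<in>C. N +>\<^bsub>M\<^esub> (r \<odot>\<^bsub>M\<^esub> c))\<rparr>"

text \<open>The map into the quotient of \<open>M\<close> by \<open>N\<close> that \<open>f\<close> induces on cosets. When it is well
  defined, all cosets in the union coincide; the same device is used for stalks below.\<close>

definition coset_map :: "('r, 'y) module \<Rightarrow> 'y set \<Rightarrow> ('x \<Rightarrow> 'y) \<Rightarrow> 'x set \<Rightarrow> 'y set" where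
  "coset_map M N f C = (\<Union>c\<in>C. N +>\<^bsub>M\<^esub> f c)"

text \<open>The homology at \<open>M\<close> of a sequence \<open>A \<rightarrow> M \<rightarrow> B\<close> with maps \<open>f\<close> and \<open>g\<close>.\<close>

definition homology_at ::
    "('r, 'x) module \<Rightarrow> ('x \<Rightarrow> 'y) \<Rightarrow> ('r, 'y) module \<Rightarrow> ('y \<Rightarrow> 'z) \<Rightarrow> ('r, 'z) module
      \<Rightarrow> ('r, 'y set) module" where
  "homology_at A f M g B =
     quot_module (M\<lparr>carrier := {x \<in> carrier M. g x = \<zero>\<^bsub>B\<^esub>}\<rparr>) (f ` carrier A)"


section \<open>Presheaves, stalks, sheafification and derived sheaves\<close>

text \<open>\<open>restr P U V\<close> is the restriction from \<open>U\<close> to \<open>V \<subseteq> U\<close>. Only open sets matter.\<close>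

record ('b, 'r, 'x) presheaf =
  sections :: "'b set \<Rightarrow> ('r, 'x) module"
  restr :: "'b set \<Rightarrow> 'b set \<Rightarrow> 'x \<Rightarrow> 'x"

text \<open>The stalk is the direct limit of the modules of sections over the open neighbourhoods of
  \<open>y\<close>; its elements are the equivalence classes of pairs \<open>(U, s)\<close>.\<close>

definition germ ::
    "'b topology \<Rightarrow> ('b, 'r, 'x) presheaf \<Rightarrow> 'b \<Rightarrow> 'b set \<Rightarrow> 'x \<Rightarrow> ('b set \<times> 'x) set" where
  "germ Y P y U s =
     {(V, t). openin Y V \<and> y \<in> V \<and> t \<in> carrier (sections P V) \<and>
        (\<exists>W. openin Y W \<and> y \<in> W \<and> W \<subseteq> U \<inter> V \<and> restr P U W s = restr P V W t)}"

definition stalk ::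
    "'b topology \<Rightarrow> ('b, 'r, 'x) presheaf \<Rightarrow> 'b \<Rightarrow> ('r, ('b set \<times> 'x) set) module" where
  "stalk Y P y =
     \<lparr>carrier = {germ Y P y U s | U s. openin Y U \<and> y \<in> U \<and> s \<in> carrier (sections P U)},
      mult = (\<lambda>_ _. undefined), one = undefined,
      zero = germ Y P y (topspace Y) \<zero>\<^bsub>sections P (topspace Y)\<^esub>,
      add = (\<lambda>A B. \<Union>(U, s)\<in>A. \<Union>(V, t)\<in>B. germ Y P y (U \<inter> V)
               (restr P U (U \<inter> V) s \<oplus>\<^bsub>sections P (U \<inter> V)\<^esub> restr P V (U \<inter> V) t)),
      smult = (\<lambda>r A. \<Union>(U, s)\<in>A. germ Y P y U (r \<odot>\<^bsub>sections P U\<^esub> s))\<rparr>"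

text \<open>The sheaf generated by a presheaf: its sections are the functions into the stalks that are
  locally given by sections of the presheaf.\<close>

definition sheafify ::
    "'b topology \<Rightarrow> ('b, 'r, 'x) presheaf \<Rightarrow> ('b, 'r, 'b \<Rightarrow> ('b set \<times> 'x) set) presheaf" where
  "sheafify Y P =
     \<lparr>sections = (\<lambda>U. (prod_module U (stalk Y P))
        \<lparr>carrier := {g \<in> \<Pi>\<^sub>E y\<in>U. carrier (stalk Y P y).
            \<forall>y\<in>U. \<exists>V s. openin Y V \<and> y \<in> V \<and> V \<subseteq> U \<and> s \<in> carrier (sections P V) \<and>
              (\<forall>z\<in>V. g z = germ Y P z V s)}\<rparr>),
      restr = (\<lambda>U V g. restrict g V)\<rparr>"

text \<open>The map \<open>sheafify Y P \<rightarrow> sheafify Y Q\<close> induced by a map \<open>\<phi>\<close> of presheaves \<open>P \<rightarrow> Q\<close>.\<close>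

definition sheafify_map ::
    "'b topology \<Rightarrow> ('b, 'r, 'z) presheaf \<Rightarrow> ('b set \<Rightarrow> 'x \<Rightarrow> 'z) \<Rightarrow> 'b set
      \<Rightarrow> ('b \<Rightarrow> ('b set \<times> 'x) set) \<Rightarrow> ('b \<Rightarrow> ('b set \<times> 'z) set)" where
  "sheafify_map Y Q \<phi> U g = (\<lambda>y\<in>U. \<Union>(V, s)\<in>g y. germ Y Q y V (\<phi> V s))"

text \<open>The derived sheaf of a complex of sheaves \<open>F\<close> with coboundaries \<open>d i : F i \<rightarrow> F (i + 1)\<close> is
  the sheaf generated by the presheaf that assigns to \<open>U\<close> the cohomology of the sections over \<open>U\<close>.\<close>

definition cohomology_presheaf ::
    "(int \<Rightarrow> ('b, 'r, 'x) presheaf) \<Rightarrow> (int \<Rightarrow> 'b set \<Rightarrow> 'x \<Rightarrow> 'x) \<Rightarrow> int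
      \<Rightarrow> ('b, 'r, 'x set) presheaf" where
  "cohomology_presheaf F d i =
     \<lparr>sections = (\<lambda>U. homology_at (sections (F (i - 1)) U) (d (i - 1) U) (sections (F i) U)
                        (d i U) (sections (F (i + 1)) U)),
      restr = (\<lambda>U V. coset_map (sections (F i) V)
                 (d (i - 1) V ` carrier (sections (F (i - 1)) V)) (restr (F i) U V))\<rparr>"

definition derived_sheaf ::
    "'b topology \<Rightarrow> (int \<Rightarrow> ('b, 'r, 'x) presheaf) \<Rightarrow> (int \<Rightarrow> 'b set \<Rightarrow> 'x \<Rightarrow> 'x) \<Rightarrow> int
      \<Rightarrow> ('b, 'r, 'b \<Rightarrow> ('b set \<times> 'x set) set) presheaf" where
  "derived_sheaf Y F d i = sheafify Y (cohomology_presheaf F d i)"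


section \<open>Filtered spaces and stratified fibrations\<close>

text \<open>As usual in sheaf theory, paracompact spaces are Hausdorff by convention.\<close>

definition paracompact_space :: "'a topology \<Rightarrow> bool" where
  "paracompact_space X \<longleftrightarrow>
     Hausdorff_space X \<and>
     (\<forall>\<U>. (\<forall>U\<in>\<U>. openin X U) \<and> \<Union>\<U> = topspace X \<longrightarrow>
        (\<exists>\<V>. (\<forall>V\<in>\<V>. openin X V) \<and> \<Union>\<V> = topspace X \<and> locally_finite_in X \<V> \<and>
             (\<forall>V\<in>\<V>. \<exists>U\<in>\<U>. V \<subseteq> U)))"

record 'a filtered =
  ftop :: "'a topology"
  fdim :: nat
  filt :: "int \<Rightarrow> 'a set"

text \<open>The convention \<open>filt X i = {}\<close> for all \<open>i < 0\<close> makes \<open>stratum X i\<close> empty for \<open>i < 0\<close>.\<close>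

definition filtered_space :: "'a filtered \<Rightarrow> bool" where
  "filtered_space X \<longleftrightarrow>
     filt X (int (fdim X)) = topspace (ftop X) \<and>
     (\<forall>i < int (fdim X). filt X i \<subseteq> filt X (i + 1)) \<and>
     (\<forall>i < 0. filt X i = {})"

definition stratum :: "'a filtered \<Rightarrow> int \<Rightarrow> 'a set" where
  "stratum X i = filt X i - filt X (i - 1)"

definition stratum_preserving_homotopy ::
    "'z topology \<Rightarrow> 'a filtered \<Rightarrow> ('z \<times> real \<Rightarrow> 'a) \<Rightarrow> bool" where
  "stratum_preserving_homotopy Z X F \<longleftrightarrow>
     continuous_map (prod_topology Z (top_of_set {0..1})) (ftop X) F \<and>
     (\<forall>z\<in>topspace Z. \<exists>i\<in>{0..int (fdim X)}. \<forall>t\<in>{0..1}. F (z, t) \<in> stratum X i)"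

definition strat_homotopy_lifting ::
    "'z topology \<Rightarrow> 'a filtered \<Rightarrow> 'b filtered \<Rightarrow> ('a \<Rightarrow> 'b) \<Rightarrow> bool" where
  "strat_homotopy_lifting Z E Y p \<longleftrightarrow>
     (\<forall>f F. continuous_map Z (ftop E) f \<and> stratum_preserving_homotopy Z Y F \<and>
            (\<forall>z\<in>topspace Z. F (z, 0) = p (f z)) \<longrightarrow>
        (\<exists>F'. stratum_preserving_homotopy Z E F' \<and>
              (\<forall>z\<in>topspace Z. \<forall>t\<in>{0..1}. p (F' (z, t)) = F (z, t)) \<and>
              (\<forall>z\<in>topspace Z. F' (z, 0) = f z)))"

text \<open>A definition cannot quantify over the type of points of \<open>Z\<close>. Spaces whose points are pairs
  of a point of \<open>E\<close> and a path in \<open>Y\<close> suffice: \<open>stratified_fibration_lifting\<close> below shows that the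
  lifting property then holds for spaces over every type.\<close>

definition stratified_fibration :: "'a filtered \<Rightarrow> 'b filtered \<Rightarrow> ('a \<Rightarrow> 'b) \<Rightarrow> bool" where
  "stratified_fibration E Y p \<longleftrightarrow>
     continuous_map (ftop E) (ftop Y) p \<and>
     (\<forall>Z :: ('a \<times> (real \<Rightarrow> 'b)) topology. strat_homotopy_lifting Z E Y p)"

lemma stratified_fibration_lifting:
  fixes Z :: "'z topology"
  assumes "stratified_fibration E Y p"
  shows "strat_homotopy_lifting Z E Y p"
  unfolding strat_homotopy_lifting_def
proof (intro allI impI)
  fix f F
  let ?I = "top_of_set {0..1::real}"
  assume "continuous_map Z (ftop E) f \<and> stratum_preserving_homotopy Z Y F \<and>
            (\<forall>z\<in>topspace Z. F (z, 0) = p (f z))"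
  then have f: "continuous_map Z (ftop E) f"
    and F: "continuous_map (prod_topology Z ?I) (ftop Y) F"
    and FS: "\<And>z. z \<in> topspace Z \<Longrightarrow> \<exists>i\<in>{0..int (fdim Y)}. \<forall>t\<in>{0..1}. F (z, t) \<in> stratum Y i"
    and F0: "\<And>z. z \<in> topspace Z \<Longrightarrow> F (z, 0) = p (f z)"
    by (auto simp: stratum_preserving_homotopy_def)
  define \<phi> where "\<phi> = (\<lambda>z. (f z, \<lambda>t. F (z, t)))"
  define Q where "Q = topology (\<lambda>U. U \<subseteq> \<phi> ` topspace Z \<and> openin Z {z \<in> topspace Z. \<phi> z \<in> U})"
  have "istopology (\<lambda>U. U \<subseteq> \<phi> ` topspace Z \<and> openin Z {z \<in> topspace Z. \<phi> z \<in> U})"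
  proof (unfold istopology_def, intro conjI allI impI)
    fix S T
    assume "S \<subseteq> \<phi> ` topspace Z \<and> openin Z {z \<in> topspace Z. \<phi> z \<in> S}"
      and "T \<subseteq> \<phi> ` topspace Z \<and> openin Z {z \<in> topspace Z. \<phi> z \<in> T}"
    moreover have "{z \<in> topspace Z. \<phi> z \<in> S \<inter> T}
        = {z \<in> topspace Z. \<phi> z \<in> S} \<inter> {z \<in> topspace Z. \<phi> z \<in> T}" by auto
    ultimately show "S \<inter> T \<subseteq> \<phi> ` topspace Z" "openin Z {z \<in> topspace Z. \<phi> z \<in> S \<inter> T}"
      by auto
  next
    fix \<K>
    assume K: "\<forall>U\<in>\<K>. U \<subseteq> \<phi> ` topspace Z \<and> openin Z {z \<in> topspace Z. \<phi> z \<in> U}"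
    then show "\<Union>\<K> \<subseteq> \<phi> ` topspace Z" by blast
    have "{z \<in> topspace Z. \<phi> z \<in> \<Union>\<K>} = (\<Union>U\<in>\<K>. {z \<in> topspace Z. \<phi> z \<in> U})" by auto
    then show "openin Z {z \<in> topspace Z. \<phi> z \<in> \<Union>\<K>}" using K by auto
  qed
  then have openQ: "openin Q U \<longleftrightarrow> U \<subseteq> \<phi> ` topspace Z \<and> openin Z {z \<in> topspace Z. \<phi> z \<in> U}" for U
    unfolding Q_def by simp
  have "openin Q (\<phi> ` topspace Z)"
    by (auto simp: openQ intro: openin_subopen[THEN iffD2])
  then have topQ: "topspace Q = \<phi> ` topspace Z"
    by (metis openQ openin_subset openin_topspace subset_antisym)
  have q: "quotient_map Z Q \<phi>"
    by (auto simp: quotient_map_def topQ openQ)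
  have fst_cont: "continuous_map Q (ftop E) fst"
    by (rule continuous_compose_quotient_map[OF q])
       (use f in \<open>simp add: \<phi>_def o_def\<close>)
  have q2: "quotient_map (prod_topology Z ?I) (prod_topology Q ?I) (\<lambda>(z, t). (\<phi> z, t))"
    by (rule quotient_map_prod_left[OF _ _ q])
       (auto simp: Hausdorff_space_subtopology compact_imp_locally_compact_space compact_space_subtopology)
  have snd_cont: "continuous_map (prod_topology Q ?I) (ftop Y) (\<lambda>(w, t). snd w t)"
    by (rule continuous_compose_quotient_map[OF q2])
       (use F in \<open>simp add: \<phi>_def o_def case_prod_unfold\<close>)
  have "strat_homotopy_lifting Q E Y p"
    using assms by (simp add: stratified_fibration_def)
  moreover have "stratum_preserving_homotopy Q Y (\<lambda>(w, t). snd w t)"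
    using snd_cont FS by (auto simp: stratum_preserving_homotopy_def topQ \<phi>_def)
  moreover have "\<forall>w\<in>topspace Q. (\<lambda>(w, t). snd w t) (w, 0) = p (fst w)"
    using F0 by (auto simp: topQ \<phi>_def)
  ultimately obtain G where G: "stratum_preserving_homotopy Q E G"
    and G1: "\<forall>w\<in>topspace Q. \<forall>t\<in>{0..1}. p (G (w, t)) = (\<lambda>(w, t). snd w t) (w, t)"
    and G0: "\<forall>w\<in>topspace Q. G (w, 0) = fst w"
    using fst_cont unfolding strat_homotopy_lifting_def by metis
  have "continuous_map (prod_topology Z ?I) (ftop E) (G \<circ> (\<lambda>(z, t). (\<phi> z, t)))"
    by (rule continuous_map_compose[OF quotient_imp_continuous_map[OF q2]])
       (use G in \<open>simp add: stratum_preserving_homotopy_def\<close>)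
  then have "stratum_preserving_homotopy Z E (G \<circ> (\<lambda>(z, t). (\<phi> z, t)))"
    using G by (auto simp: stratum_preserving_homotopy_def topQ)
  with G1 G0 show "\<exists>F'. stratum_preserving_homotopy Z E F' \<and>
              (\<forall>z\<in>topspace Z. \<forall>t\<in>{0..1}. p (F' (z, t)) = F (z, t)) \<and>
              (\<forall>z\<in>topspace Z. F' (z, 0) = f z)"
    by (intro exI[of _ "G \<circ> (\<lambda>(z, t). (\<phi> z, t))"]) (auto simp: topQ \<phi>_def)
qed


section \<open>Coefficients\<close>

text \<open>
  A local system of left \<open>R\<close>-modules on \<open>X\<close>, as a bundle: the fibre over \<open>x\<close> is \<open>G x\<close>, and
  \<open>T\<close> is the topology of the total space, which is trivial over small open sets, with
  discrete fibre.
\<close>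

definition local_system ::
    "('r, 'm) ring_scheme \<Rightarrow> 'a topology \<Rightarrow> ('a \<Rightarrow> ('r, 'g) module) \<Rightarrow> ('a \<times> 'g) topology
      \<Rightarrow> bool" where
  "local_system R X G T \<longleftrightarrow>
     (\<forall>x\<in>topspace X. left_module R (G x)) \<and>
     topspace T = Sigma (topspace X) (\<lambda>x. carrier (G x)) \<and>
     continuous_map T X fst \<and>
     (\<forall>x\<in>topspace X. \<exists>U \<phi>. openin X U \<and> x \<in> U \<and>
        (\<forall>u\<in>U. \<phi> u \<in> module_isos R (G x) (G u)) \<and>
        homeomorphic_map
          (prod_topology (subtopology X U) (discrete_topology (carrier (G x))))
          (subtopology T (fst -` U))
          (\<lambda>(u, m). (u, \<phi> u m)))"

text \<open>
  With \<open>n = fdim X\<close>: the coefficients are either a constant module, or a local system on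
  the complement of \<open>X\<^sup>n\<^sup>-\<^sup>1\<close>. In the second case the coefficient of a simplex \<open>\<sigma>\<close> is a lift to the
  bundle of \<open>\<sigma>\<close> restricted to the inverse image of that complement. The
  stratified system that is extended by \<open>0\<close> over \<open>X\<^sup>n\<^sup>-\<^sup>1\<close> has the same lifts, since a lift to the
  zero bundle is unique; so \<open>Local_System\<close> renders both. In particular, simplices
  inside \<open>X\<^sup>n\<^sup>-\<^sup>1\<close> only have the coefficient \<open>0\<close>.
\<close>

datatype ('a, 'r, 'g) coefficients =
    Constant "('r, 'g) module"
  | Local_System "'a \<Rightarrow> ('r, 'g) module" "('a \<times> 'g) topology"

definition regular_part :: "'a filtered \<Rightarrow> 'a set" where
  "regular_part X = topspace (ftop X) - filt X (int (fdim X) - 1)"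

fun coefficient_system ::
    "('r, 'm) ring_scheme \<Rightarrow> 'a filtered \<Rightarrow> ('a, 'r, 'g) coefficients \<Rightarrow> bool" where
  "coefficient_system R X (Constant M) = left_module R M"
| "coefficient_system R X (Local_System G T) =
     local_system R (subtopology (ftop X) (regular_part X)) G T"

fun fibre :: "('a, 'r, 'g) coefficients \<Rightarrow> 'a \<Rightarrow> ('r, 'g) module" where
  "fibre (Constant M) x = M"
| "fibre (Local_System G T) x = G x"

text \<open>Dimensions are integers; there are no simplices of negative dimension, hence the chain
  modules below vanish there.\<close>

definition simplices :: "'a filtered \<Rightarrow> int \<Rightarrow> ((nat \<Rightarrow> real) \<Rightarrow> 'a) set" where
  "simplices X j = {\<sigma>. 0 \<le> j \<and> singular_simplex (nat j) (ftop X) \<sigma>}"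

fun coeff_dom ::
    "'a filtered \<Rightarrow> ('a, 'r, 'g) coefficients \<Rightarrow> int \<Rightarrow> ((nat \<Rightarrow> real) \<Rightarrow> 'a)
      \<Rightarrow> (nat \<Rightarrow> real) set" where
  "coeff_dom X (Constant M) j \<sigma> = standard_simplex (nat j)"
| "coeff_dom X (Local_System G T) j \<sigma> = {t \<in> standard_simplex (nat j). \<sigma> t \<in> regular_part X}"

text \<open>For \<open>Constant M\<close>, an element of \<open>M\<close> is represented by a constant function on the simplex.\<close>

fun coeff_lifts ::
    "'a filtered \<Rightarrow> ('a, 'r, 'g) coefficients \<Rightarrow> int \<Rightarrow> ((nat \<Rightarrow> real) \<Rightarrow> 'a)
      \<Rightarrow> ((nat \<Rightarrow> real) \<Rightarrow> 'g) set" where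
  "coeff_lifts X (Constant M) j \<sigma> =
     {\<lambda>t\<in>standard_simplex (nat j). m | m. m \<in> carrier M}"
| "coeff_lifts X (Local_System G T) j \<sigma> =
     {s \<in> \<Pi>\<^sub>E t\<in>coeff_dom X (Local_System G T) j \<sigma>. carrier (G (\<sigma> t)).
        continuous_map
          (subtopology (powertop_real UNIV) (coeff_dom X (Local_System G T) j \<sigma>)) T
          (\<lambda>t. (\<sigma> t, s t))}"

definition coeff_module ::
    "'a filtered \<Rightarrow> ('a, 'r, 'g) coefficients \<Rightarrow> int \<Rightarrow> ((nat \<Rightarrow> real) \<Rightarrow> 'a)
      \<Rightarrow> ('r, (nat \<Rightarrow> real) \<Rightarrow> 'g) module" where
  "coeff_module X \<G> j \<sigma> =
     (prod_module (coeff_dom X \<G> j \<sigma>) (\<lambda>t. fibre \<G> (\<sigma> t)))\<lparr>carrier := coeff_lifts X \<G> j \<sigma>\<rparr>"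


section \<open>Intersection chains\<close>

type_synonym ('a, 'g) schain = "((nat \<Rightarrow> real) \<Rightarrow> 'a) \<Rightarrow> (nat \<Rightarrow> real) \<Rightarrow> 'g"

text \<open>All formal combinations of singular simplices, without any finiteness condition.\<close>

definition chain_module ::
    "'a filtered \<Rightarrow> ('a, 'r, 'g) coefficients \<Rightarrow> int \<Rightarrow> ('r, ('a, 'g) schain) module" where
  "chain_module X \<G> j = prod_module (simplices X j) (coeff_module X \<G> j)"

definition simplices_of ::
    "'a filtered \<Rightarrow> ('a, 'r, 'g) coefficients \<Rightarrow> int \<Rightarrow> ('a, 'g) schain
      \<Rightarrow> ((nat \<Rightarrow> real) \<Rightarrow> 'a) set" where
  "simplices_of X \<G> j \<xi> = {\<sigma> \<in> simplices X j. \<xi> \<sigma> \<noteq> \<zero>\<^bsub>coeff_module X \<G> j \<sigma>\<^esub>}"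

definition chain_support ::
    "'a filtered \<Rightarrow> ('a, 'r, 'g) coefficients \<Rightarrow> int \<Rightarrow> ('a, 'g) schain \<Rightarrow> 'a set" where
  "chain_support X \<G> j \<xi> = (\<Union>\<sigma>\<in>simplices_of X \<G> j \<xi>. \<sigma> ` standard_simplex (nat j))"

definition locally_finite_chain ::
    "'a filtered \<Rightarrow> ('a, 'r, 'g) coefficients \<Rightarrow> int \<Rightarrow> ('a, 'g) schain \<Rightarrow> bool" where
  "locally_finite_chain X \<G> j \<xi> \<longleftrightarrow>
     (\<forall>x\<in>topspace (ftop X). \<exists>N. openin (ftop X) N \<and> x \<in> N \<and>
        finite {\<sigma> \<in> simplices_of X \<G> j \<xi>. \<sigma> ` standard_simplex (nat j) \<inter> N \<noteq> {}})"

text \<open>The coefficient of \<open>\<tau>\<close> in the boundary is the sum of \<open>(-1)\<^sup>k\<close> times the restriction to the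
  \<open>k\<close>th face of the coefficient of \<open>\<sigma>\<close>, over all \<open>\<sigma>\<close> with \<open>k\<close>th face \<open>\<tau>\<close>. The sum is finite when
  \<open>\<xi>\<close> is locally finite.\<close>

definition boundary ::
    "'a filtered \<Rightarrow> ('a, 'r, 'g) coefficients \<Rightarrow> int \<Rightarrow> ('a, 'g) schain
      \<Rightarrow> ('a, 'g) schain" where
  "boundary X \<G> j \<xi> =
     (\<lambda>\<tau>\<in>simplices X (j - 1). \<lambda>t\<in>coeff_dom X \<G> (j - 1) \<tau>.
        finsum (fibre \<G> (\<tau> t))
          (\<lambda>(k, \<sigma>). if even k then \<xi> \<sigma> (simplical_face k t)
                    else \<ominus>\<^bsub>fibre \<G> (\<tau> t)\<^esub> \<xi> \<sigma> (simplical_face k t))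
          {(k, \<sigma>). k \<le> nat j \<and> \<sigma> \<in> simplices_of X \<G> j \<xi> \<and> singular_face (nat j) k \<sigma> = \<tau>})"

definition perversity :: "(nat \<Rightarrow> int) \<Rightarrow> bool" where
  "perversity pv \<longleftrightarrow> (\<forall>k\<ge>1. pv k \<le> pv (k + 1) \<and> pv (k + 1) \<le> pv k + 1)"

text \<open>A point is in the \<open>m\<close>-skeleton iff at most \<open>m + 1\<close> of its barycentric coordinates are
  nonzero; the skeleton is empty for \<open>m < 0\<close>.\<close>

definition simplex_skeleton :: "int \<Rightarrow> int \<Rightarrow> (nat \<Rightarrow> real) set" where
  "simplex_skeleton j m = {t \<in> standard_simplex (nat j). int (card {l. t l \<noteq> 0}) \<le> m + 1}"

definition allowable_simplex ::
    "'a filtered \<Rightarrow> (nat \<Rightarrow> int) \<Rightarrow> int \<Rightarrow> ((nat \<Rightarrow> real) \<Rightarrow> 'a) \<Rightarrow> bool" where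
  "allowable_simplex X pv j \<sigma> \<longleftrightarrow>
     (\<forall>k\<ge>1. {t \<in> standard_simplex (nat j). \<sigma> t \<in> stratum X (int (fdim X) - int k)}
              \<subseteq> simplex_skeleton j (j - int k + pv k))"

definition allowable_chain ::
    "'a filtered \<Rightarrow> (nat \<Rightarrow> int) \<Rightarrow> ('a, 'r, 'g) coefficients \<Rightarrow> int \<Rightarrow> ('a, 'g) schain
      \<Rightarrow> bool" where
  "allowable_chain X pv \<G> j \<xi> \<longleftrightarrow>
     (\<forall>\<sigma>\<in>simplices_of X \<G> j \<xi>. allowable_simplex X pv j \<sigma>) \<and>
     (\<forall>\<tau>\<in>simplices_of X \<G> (j - 1) (boundary X \<G> j \<xi>). allowable_simplex X pv (j - 1) \<tau>)"

definition IC_inf ::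
    "'a filtered \<Rightarrow> (nat \<Rightarrow> int) \<Rightarrow> ('a, 'r, 'g) coefficients \<Rightarrow> int
      \<Rightarrow> ('r, ('a, 'g) schain) module" where
  "IC_inf X pv \<G> j = (chain_module X \<G> j)
     \<lparr>carrier := {\<xi> \<in> carrier (chain_module X \<G> j).
        locally_finite_chain X \<G> j \<xi> \<and> allowable_chain X pv \<G> j \<xi>}\<rparr>"

definition IC_c ::
    "'a filtered \<Rightarrow> (nat \<Rightarrow> int) \<Rightarrow> ('a, 'r, 'g) coefficients \<Rightarrow> int
      \<Rightarrow> ('r, ('a, 'g) schain) module" where
  "IC_c X pv \<G> j = (chain_module X \<G> j)
     \<lparr>carrier := {\<xi> \<in> carrier (chain_module X \<G> j).
        finite (simplices_of X \<G> j \<xi>) \<and> allowable_chain X pv \<G> j \<xi>}\<rparr>"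

text \<open>Chains of a subspace \<open>B\<close>, with the restricted filtration, are identified with the chains of
  \<open>X\<close> that are supported in \<open>B\<close>.\<close>

definition IC_c_in ::
    "'a filtered \<Rightarrow> (nat \<Rightarrow> int) \<Rightarrow> ('a, 'r, 'g) coefficients \<Rightarrow> 'a set \<Rightarrow> int
      \<Rightarrow> ('a, 'g) schain set" where
  "IC_c_in X pv \<G> B j = {\<xi> \<in> carrier (IC_c X pv \<G> j). chain_support X \<G> j \<xi> \<subseteq> B}"

definition IC_c_rel ::
    "'a filtered \<Rightarrow> (nat \<Rightarrow> int) \<Rightarrow> ('a, 'r, 'g) coefficients \<Rightarrow> 'a set \<Rightarrow> int
      \<Rightarrow> ('r, ('a, 'g) schain set) module" where
  "IC_c_rel X pv \<G> B j = quot_module (IC_c X pv \<G> j) (IC_c_in X pv \<G> B j)"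

definition IC_c_rel_boundary ::
    "'a filtered \<Rightarrow> (nat \<Rightarrow> int) \<Rightarrow> ('a, 'r, 'g) coefficients \<Rightarrow> 'a set \<Rightarrow> int
      \<Rightarrow> ('a, 'g) schain set \<Rightarrow> ('a, 'g) schain set" where
  "IC_c_rel_boundary X pv \<G> B j =
     coset_map (IC_c X pv \<G> (j - 1)) (IC_c_in X pv \<G> B (j - 1)) (boundary X \<G> j)"

definition IH_c_rel ::
    "'a filtered \<Rightarrow> (nat \<Rightarrow> int) \<Rightarrow> ('a, 'r, 'g) coefficients \<Rightarrow> 'a set \<Rightarrow> int
      \<Rightarrow> ('r, ('a, 'g) schain set set) module" where
  "IH_c_rel X pv \<G> B j =
     homology_at (IC_c_rel X pv \<G> B (j + 1)) (IC_c_rel_boundary X pv \<G> B (j + 1))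
       (IC_c_rel X pv \<G> B j) (IC_c_rel_boundary X pv \<G> B j) (IC_c_rel X pv \<G> B (j - 1))"


section \<open>The sheaf complex of chains with fibrewise compact support\<close>

definition IC_fc ::
    "'a filtered \<Rightarrow> 'b filtered \<Rightarrow> ('a \<Rightarrow> 'b) \<Rightarrow> (nat \<Rightarrow> int) \<Rightarrow> ('a, 'r, 'g) coefficients \<Rightarrow> int
      \<Rightarrow> ('r, ('a, 'g) schain) module" where
  "IC_fc E Y p pv \<G> j = (chain_module E \<G> j)
     \<lparr>carrier := {\<xi> \<in> carrier (IC_inf E pv \<G> j).
        \<forall>y\<in>topspace (ftop Y). \<exists>N K. openin (ftop Y) N \<and> y \<in> N \<and> compactin (ftop E) K \<and>
          chain_support E \<G> j \<xi> \<inter> p -` N = K \<inter> p -` N}\<rparr>"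

definition IC_fc_away ::
    "'a filtered \<Rightarrow> 'b filtered \<Rightarrow> ('a \<Rightarrow> 'b) \<Rightarrow> (nat \<Rightarrow> int) \<Rightarrow> ('a, 'r, 'g) coefficients \<Rightarrow> int
      \<Rightarrow> 'b set \<Rightarrow> ('a, 'g) schain set" where
  "IC_fc_away E Y p pv \<G> j U =
     {\<xi> \<in> carrier (IC_fc E Y p pv \<G> j).
        chain_support E \<G> j \<xi> \<subseteq>
          topspace (ftop E) - ftop E closure_of (topspace (ftop E) \<inter> p -` U)}"

definition fc_presheaf ::
    "'a filtered \<Rightarrow> 'b filtered \<Rightarrow> ('a \<Rightarrow> 'b) \<Rightarrow> (nat \<Rightarrow> int) \<Rightarrow> ('a, 'r, 'g) coefficients \<Rightarrow> int
      \<Rightarrow> ('b, 'r, ('a, 'g) schain set) presheaf" where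
  "fc_presheaf E Y p pv \<G> j =
     \<lparr>sections = (\<lambda>U. quot_module (IC_fc E Y p pv \<G> j) (IC_fc_away E Y p pv \<G> j U)),
      restr = (\<lambda>U V. coset_map (IC_fc E Y p pv \<G> j) (IC_fc_away E Y p pv \<G> j V) id)\<rparr>"

definition fc_presheaf_boundary ::
    "'a filtered \<Rightarrow> 'b filtered \<Rightarrow> ('a \<Rightarrow> 'b) \<Rightarrow> (nat \<Rightarrow> int) \<Rightarrow> ('a, 'r, 'g) coefficients \<Rightarrow> int
      \<Rightarrow> 'b set \<Rightarrow> ('a, 'g) schain set \<Rightarrow> ('a, 'g) schain set" where
  "fc_presheaf_boundary E Y p pv \<G> j U =
     coset_map (IC_fc E Y p pv \<G> (j - 1)) (IC_fc_away E Y p pv \<G> (j - 1) U) (boundary E \<G> j)"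

text \<open>Cohomological degree \<open>i\<close> is chain degree \<open>n - i\<close>.\<close>

definition fc_sheaf ::
    "'a filtered \<Rightarrow> 'b filtered \<Rightarrow> ('a \<Rightarrow> 'b) \<Rightarrow> (nat \<Rightarrow> int) \<Rightarrow> ('a, 'r, 'g) coefficients \<Rightarrow> int
      \<Rightarrow> ('b, 'r, 'b \<Rightarrow> ('b set \<times> ('a, 'g) schain set) set) presheaf" where
  "fc_sheaf E Y p pv \<G> i = sheafify (ftop Y) (fc_presheaf E Y p pv \<G> (int (fdim E) - i))"

definition fc_coboundary ::
    "'a filtered \<Rightarrow> 'b filtered \<Rightarrow> ('a \<Rightarrow> 'b) \<Rightarrow> (nat \<Rightarrow> int) \<Rightarrow> ('a, 'r, 'g) coefficients \<Rightarrow> int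
      \<Rightarrow> 'b set \<Rightarrow> ('b \<Rightarrow> ('b set \<times> ('a, 'g) schain set) set)
      \<Rightarrow> ('b \<Rightarrow> ('b set \<times> ('a, 'g) schain set) set)" where
  "fc_coboundary E Y p pv \<G> i =
     sheafify_map (ftop Y) (fc_presheaf E Y p pv \<G> (int (fdim E) - (i + 1)))
       (fc_presheaf_boundary E Y p pv \<G> (int (fdim E) - i))"

end

theory Submission
  imports Defs
begin

text \<open>
  A stalk of the derived sheaf is the homology of the complex of stalks, because homology commutes
  with direct limits and sheafification does not change stalks (\<open>stalk_homology_sheafify\<close>). Since a
  section over \<open>U\<close> is a class of chains on all of \<open>E\<close>, every germ at \<open>y\<close> is the class of a chain
  with fibrewise compact support. Near the fibre over \<open>y\<close> such a chain has a compact support, whose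
  image in the base is closed. A paracompact base is regular, so that the germ of the chain vanishes if
  and only if the support misses the fibre (\<open>away_iff\<close>). Hence the stalk of the derived sheaf is the
  homology of the chains with fibrewise compact support modulo those that miss the fibre, and it remains
  to see that it makes no difference to admit only finite chains.

  Only finitely many simplices of a chain with fibrewise compact support meet the fibre. Discarding the
  other simplices would destroy allowability: faces that cancel in the boundary of the chain could
  reappear, and they need not be allowable. Instead, the chain is subdivided, and of the subdivision
  only the stars of the vertices of those finitely many simplices are kept. The new faces that
  appear in the boundary then belong to links of vertices in a barycentric subdivision. These are in
  general position with respect to the skeleta (\<open>in_position_star_link\<close>), so that the
  truncated chain is allowable (\<open>allow_star\<close>). It is finite, and it differs from the
  subdivided chain only by a chain that misses the fibre (\<open>truncation\<close>). The
  homotopy between subdivision and identity preserves allowability as well (\<open>allow_hty\<close>).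
  Therefore truncation of cycles shows that relative homology of finite chains maps onto the homology of the
  stalks (\<open>relative_cycle_truncation\<close>), and truncation of bounding chains
  shows that the map is injective (\<open>relative_boundary_truncation\<close>).

  Boundary, subdivision, stars, links and the homotopy all replace a simplex by its images of an
  integral chain in the standard simplex, and pull back its coefficient. The operator \<open>push\<close> does this
  for arbitrary such chains. It turns composition into composition of
  integral chains (\<open>push_push\<close>), which reduces the identities between the
  operators to those for singular chains in standard simplices.
\<close>

section \<open>Left modules\<close>

lemma left_moduleD:
  assumes "left_module R M"
  shows left_module_ring: "ring R"
    and left_module_abelian_group: "abelian_group M"
    and left_module_smult_closed:
      "\<And>r x. r \<in> carrier R \<Longrightarrow> x \<in> carrier M \<Longrightarrow> r \<odot>\<^bsub>M\<^esub> x \<in> carrier M"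
    and left_module_smult_l_distr:
      "\<And>r s x. r \<in> carrier R \<Longrightarrow> s \<in> carrier R \<Longrightarrow> x \<in> carrier M \<Longrightarrow>
         (r \<oplus>\<^bsub>R\<^esub> s) \<odot>\<^bsub>M\<^esub> x = r \<odot>\<^bsub>M\<^esub> x \<oplus>\<^bsub>M\<^esub> s \<odot>\<^bsub>M\<^esub> x"
    and left_module_smult_r_distr:
      "\<And>r x y. r \<in> carrier R \<Longrightarrow> x \<in> carrier M \<Longrightarrow> y \<in> carrier M \<Longrightarrow>
         r \<odot>\<^bsub>M\<^esub> (x \<oplus>\<^bsub>M\<^esub> y) = r \<odot>\<^bsub>M\<^esub> x \<oplus>\<^bsub>M\<^esub> r \<odot>\<^bsub>M\<^esub> y"
    and left_module_smult_assoc: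
      "\<And>r s x. r \<in> carrier R \<Longrightarrow> s \<in> carrier R \<Longrightarrow> x \<in> carrier M \<Longrightarrow>
         (r \<otimes>\<^bsub>R\<^esub> s) \<odot>\<^bsub>M\<^esub> x = r \<odot>\<^bsub>M\<^esub> (s \<odot>\<^bsub>M\<^esub> x)"
    and left_module_smult_one: "\<And>x. x \<in> carrier M \<Longrightarrow> \<one>\<^bsub>R\<^esub> \<odot>\<^bsub>M\<^esub> x = x"
  using assms unfolding left_module_def module_axioms_def by simp_all

lemma left_moduleI:
  fixes M (structure)
  assumes "ring R"
    and "\<And>x y. x \<in> carrier M \<Longrightarrow> y \<in> carrier M \<Longrightarrow> x \<oplus> y \<in> carrier M"
    and "\<zero> \<in> carrier M"
    and "\<And>x y z. x \<in> carrier M \<Longrightarrow> y \<in> carrier M \<Longrightarrow> z \<in> carrier M \<Longrightarrow>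
           (x \<oplus> y) \<oplus> z = x \<oplus> (y \<oplus> z)"
    and "\<And>x y. x \<in> carrier M \<Longrightarrow> y \<in> carrier M \<Longrightarrow> x \<oplus> y = y \<oplus> x"
    and "\<And>x. x \<in> carrier M \<Longrightarrow> \<zero> \<oplus> x = x"
    and "\<And>x. x \<in> carrier M \<Longrightarrow> \<exists>y\<in>carrier M. y \<oplus> x = \<zero>"
    and "\<And>r x. r \<in> carrier R \<Longrightarrow> x \<in> carrier M \<Longrightarrow> r \<odot> x \<in> carrier M"
    and "\<And>r s x. r \<in> carrier R \<Longrightarrow> s \<in> carrier R \<Longrightarrow> x \<in> carrier M \<Longrightarrow>
           (r \<oplus>\<^bsub>R\<^esub> s) \<odot> x = r \<odot> x \<oplus> s \<odot> x"
    and "\<And>r x y. r \<in> carrier R \<Longrightarrow> x \<in> carrier M \<Longrightarrow> y \<in> carrier M \<Longrightarrow>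
           r \<odot> (x \<oplus> y) = r \<odot> x \<oplus> r \<odot> y"
    and "\<And>r s x. r \<in> carrier R \<Longrightarrow> s \<in> carrier R \<Longrightarrow> x \<in> carrier M \<Longrightarrow>
           (r \<otimes>\<^bsub>R\<^esub> s) \<odot> x = r \<odot> (s \<odot> x)"
    and "\<And>x. x \<in> carrier M \<Longrightarrow> \<one>\<^bsub>R\<^esub> \<odot> x = x"
  shows "left_module R M"
proof -
  have "abelian_group M"
    using assms(2-7) by (rule abelian_groupI)
  moreover have "module_axioms R M"
    using assms(8-12) by (rule module_axioms.intro)
  ultimately show ?thesis unfolding left_module_def using assms(1) by blast
qed

lemma left_module_smult_minus_one:
  assumes "left_module R M" "x \<in> carrier M"
  shows "(\<ominus>\<^bsub>R\<^esub> \<one>\<^bsub>R\<^esub>) \<odot>\<^bsub>M\<^esub> x = \<ominus>\<^bsub>M\<^esub> x"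
proof -
  interpret R: ring R by (rule left_module_ring[OF assms(1)])
  interpret M: abelian_group M by (rule left_module_abelian_group[OF assms(1)])
  let ?m = "\<ominus>\<^bsub>R\<^esub> \<one>\<^bsub>R\<^esub>"
  have m: "?m \<in> carrier R" by simp
  have cl: "\<And>r. r \<in> carrier R \<Longrightarrow> r \<odot>\<^bsub>M\<^esub> x \<in> carrier M"
    using left_module_smult_closed[OF assms(1) _ assms(2)] .
  have "\<zero>\<^bsub>R\<^esub> \<odot>\<^bsub>M\<^esub> x \<oplus>\<^bsub>M\<^esub> \<zero>\<^bsub>R\<^esub> \<odot>\<^bsub>M\<^esub> x = \<zero>\<^bsub>R\<^esub> \<odot>\<^bsub>M\<^esub> x"
    using left_module_smult_l_distr[OF assms(1), of "\<zero>\<^bsub>R\<^esub>" "\<zero>\<^bsub>R\<^esub>" x] assms(2) by simp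
  then have "\<zero>\<^bsub>R\<^esub> \<odot>\<^bsub>M\<^esub> x = \<zero>\<^bsub>M\<^esub>"
    using cl[OF R.zero_closed] by simp
  moreover have "?m \<odot>\<^bsub>M\<^esub> x \<oplus>\<^bsub>M\<^esub> x = \<zero>\<^bsub>R\<^esub> \<odot>\<^bsub>M\<^esub> x"
    using left_module_smult_l_distr[OF assms(1) m R.one_closed assms(2)]
      left_module_smult_one[OF assms] by (simp add: R.l_neg)
  ultimately show ?thesis
    by (metis M.minus_equality assms(2) cl m)
qed

text \<open>The carrier is a set and the operations are those of \<open>M\<close>, so that one set can be a submodule of
  \<open>M\<close> and of a smaller module of the form \<open>M\<lparr>carrier := S\<rparr>\<close>.\<close>

definition submodule_of :: "('r, 'm) ring_scheme \<Rightarrow> ('r, 'x, 'n) module_scheme \<Rightarrow> 'x set \<Rightarrow> bool" where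
  "submodule_of R M N \<longleftrightarrow> N \<subseteq> carrier M \<and> \<zero>\<^bsub>M\<^esub> \<in> N \<and>
     (\<forall>x\<in>N. \<forall>y\<in>N. x \<oplus>\<^bsub>M\<^esub> y \<in> N) \<and> (\<forall>r\<in>carrier R. \<forall>x\<in>N. r \<odot>\<^bsub>M\<^esub> x \<in> N)"

lemma submodule_of_a_inv:
  assumes "left_module R M" "submodule_of R M N" "x \<in> N"
  shows "\<ominus>\<^bsub>M\<^esub> x \<in> N"
proof -
  interpret R: ring R by (rule left_module_ring[OF assms(1)])
  have "\<ominus>\<^bsub>R\<^esub> \<one>\<^bsub>R\<^esub> \<in> carrier R" by simp
  moreover have "x \<in> carrier M" using assms unfolding submodule_of_def by blast
  ultimately show ?thesis
    using left_module_smult_minus_one[OF assms(1)] assms unfolding submodule_of_def by metis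
qed

lemma submodule_of_abelian_subgroup:
  assumes "left_module R M" "submodule_of R M N"
  shows "abelian_subgroup N M"
proof -
  interpret M: abelian_group M by (rule left_module_abelian_group[OF assms(1)])
  have "subgroup N (add_monoid M)"
    by (rule M.add.subgroupI)
       (use assms submodule_of_a_inv[OF assms] in \<open>auto simp: submodule_of_def a_inv_def\<close>)
  then show ?thesis
    by (intro abelian_subgroupI3 additive_subgroup.intro) (auto simp: M.abelian_group_axioms)
qed

lemma left_module_submodule:
  assumes M: "left_module R M" and N: "submodule_of R M N"
  shows "left_module R (M\<lparr>carrier := N\<rparr>)"
proof -
  interpret M: abelian_group M by (rule left_module_abelian_group[OF M])
  have sub: "x \<in> carrier M" if "x \<in> N" for x using N that unfolding submodule_of_def by auto
  show ?thesis
  proof (rule left_moduleI)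
    fix x assume "x \<in> carrier (M\<lparr>carrier := N\<rparr>)"
    then show "\<exists>y\<in>carrier (M\<lparr>carrier := N\<rparr>). y \<oplus>\<^bsub>M\<lparr>carrier := N\<rparr>\<^esub> x = \<zero>\<^bsub>M\<lparr>carrier := N\<rparr>\<^esub>"
      using submodule_of_a_inv[OF M N] by (auto intro!: bexI[of _ "\<ominus>\<^bsub>M\<^esub> x"] M.l_neg sub)
  qed (use N sub in \<open>auto simp: submodule_of_def left_moduleD[OF M] M.a_ac\<close>)
qed

definition linear_map ::
    "('r, 'm) ring_scheme \<Rightarrow> ('r, 'x, 'n) module_scheme \<Rightarrow> ('r, 'y, 'k) module_scheme \<Rightarrow> ('x \<Rightarrow> 'y) \<Rightarrow> bool" where
  "linear_map R M N f \<longleftrightarrow> (\<forall>x\<in>carrier M. f x \<in> carrier N) \<and>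
     (\<forall>x\<in>carrier M. \<forall>y\<in>carrier M. f (x \<oplus>\<^bsub>M\<^esub> y) = f x \<oplus>\<^bsub>N\<^esub> f y) \<and>
     (\<forall>r\<in>carrier R. \<forall>x\<in>carrier M. f (r \<odot>\<^bsub>M\<^esub> x) = r \<odot>\<^bsub>N\<^esub> f x)"

lemma linear_mapD:
  assumes "linear_map R M N f"
  shows linear_map_closed: "\<And>x. x \<in> carrier M \<Longrightarrow> f x \<in> carrier N"
    and linear_map_add: "\<And>x y. x \<in> carrier M \<Longrightarrow> y \<in> carrier M \<Longrightarrow> f (x \<oplus>\<^bsub>M\<^esub> y) = f x \<oplus>\<^bsub>N\<^esub> f y"
    and linear_map_smult: "\<And>r x. r \<in> carrier R \<Longrightarrow> x \<in> carrier M \<Longrightarrow> f (r \<odot>\<^bsub>M\<^esub> x) = r \<odot>\<^bsub>N\<^esub> f x"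
  using assms unfolding linear_map_def by blast+

lemma linear_map_zero:
  assumes "left_module R M" "left_module R N" "linear_map R M N f"
  shows "f \<zero>\<^bsub>M\<^esub> = \<zero>\<^bsub>N\<^esub>"
proof -
  interpret M: abelian_group M by (rule left_module_abelian_group[OF assms(1)])
  interpret N: abelian_group N by (rule left_module_abelian_group[OF assms(2)])
  have "f \<zero>\<^bsub>M\<^esub> \<oplus>\<^bsub>N\<^esub> f \<zero>\<^bsub>M\<^esub> = f \<zero>\<^bsub>M\<^esub>"
    using linear_map_add[OF assms(3) M.zero_closed M.zero_closed] by simp
  then show ?thesis
    using linear_map_closed[OF assms(3) M.zero_closed] by simp
qed

lemma linear_map_ker_submodule:
  assumes "left_module R M" "left_module R N" "linear_map R M N f"
  shows "submodule_of R M {x \<in> carrier M. f x = \<zero>\<^bsub>N\<^esub>}"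
proof -
  interpret M: abelian_group M by (rule left_module_abelian_group[OF assms(1)])
  interpret N: abelian_group N by (rule left_module_abelian_group[OF assms(2)])
  have "r \<odot>\<^bsub>N\<^esub> \<zero>\<^bsub>N\<^esub> = \<zero>\<^bsub>N\<^esub>" if "r \<in> carrier R" for r
  proof -
    have "r \<odot>\<^bsub>N\<^esub> \<zero>\<^bsub>N\<^esub> \<oplus>\<^bsub>N\<^esub> r \<odot>\<^bsub>N\<^esub> \<zero>\<^bsub>N\<^esub> = r \<odot>\<^bsub>N\<^esub> \<zero>\<^bsub>N\<^esub>"
      using left_module_smult_r_distr[OF assms(2) that N.zero_closed N.zero_closed] by simp
    then show ?thesis using left_module_smult_closed[OF assms(2) that N.zero_closed] by simp
  qed
  then show ?thesis
    unfolding submodule_of_def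
    by (auto simp: linear_map_zero[OF assms] linear_mapD[OF assms(3)] left_moduleD[OF assms(1)])
qed

lemma linear_map_image_submodule:
  assumes "left_module R A" "left_module R M" "linear_map R A M f"
  shows "submodule_of R M (f ` carrier A)"
proof -
  interpret A: abelian_group A by (rule left_module_abelian_group[OF assms(1)])
  show ?thesis
    unfolding submodule_of_def
  proof (intro conjI ballI)
    show "\<zero>\<^bsub>M\<^esub> \<in> f ` carrier A" using linear_map_zero[OF assms] A.zero_closed by (metis imageI)
    show "x \<oplus>\<^bsub>M\<^esub> y \<in> f ` carrier A" if "x \<in> f ` carrier A" "y \<in> f ` carrier A" for x y
      using that linear_map_add[OF assms(3)] by (metis (no_types, lifting) A.a_closed image_iff)
    show "r \<odot>\<^bsub>M\<^esub> x \<in> f ` carrier A" if "r \<in> carrier R" "x \<in> f ` carrier A" for r x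
      using that linear_map_smult[OF assms(3)] left_module_smult_closed[OF assms(1)]
      by (metis (no_types, lifting) image_iff)
  qed (use linear_map_closed[OF assms(3)] in auto)
qed

text \<open>The axioms of a module are equations, hence they pass to images. This covers quotient modules.\<close>

lemma left_module_surj_image:
  assumes M: "left_module R M" and f: "linear_map R M N f"
    and onto: "f ` carrier M = carrier N" and zero: "\<zero>\<^bsub>N\<^esub> = f \<zero>\<^bsub>M\<^esub>"
  shows "left_module R N"
proof -
  interpret M: abelian_group M by (rule left_module_abelian_group[OF M])
  interpret R: ring R by (rule left_module_ring[OF M])
  note f' = linear_map_add[OF f, symmetric] linear_map_smult[OF f, symmetric]
  show ?thesis
  proof (rule left_moduleI)
    fix x assume "x \<in> carrier N"
    then obtain a where a: "a \<in> carrier M" "x = f a" using onto by blast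
    show "\<exists>y\<in>carrier N. y \<oplus>\<^bsub>N\<^esub> x = \<zero>\<^bsub>N\<^esub>"
      using a by (intro bexI[of _ "f (\<ominus>\<^bsub>M\<^esub> a)"]) (auto simp: f' M.l_neg zero onto[symmetric])
  qed (auto simp: onto[symmetric] f' zero left_moduleD[OF M] M.a_ac)
qed

lemma left_module_prod_module:
  assumes R: "ring R" and M: "\<And>i. i \<in> I \<Longrightarrow> left_module R (M i)"
  shows "left_module R (prod_module I M)"
proof (rule left_moduleI)
  note ab = left_module_abelian_group[OF M]
  note am = abelian_group.axioms(1)[OF ab]
  show "ring R" by fact
  show "\<zero>\<^bsub>prod_module I M\<^esub> \<in> carrier (prod_module I M)"
    by (auto simp: prod_module_def abelian_monoid.zero_closed[OF am])
  fix x assume x: "x \<in> carrier (prod_module I M)"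
  have xi: "x i \<in> carrier (M i)" if "i \<in> I" for i using x that by (auto simp: prod_module_def)
  have xe: "x \<in> extensional I" using x by (auto simp: prod_module_def PiE_def)
  show "\<zero>\<^bsub>prod_module I M\<^esub> \<oplus>\<^bsub>prod_module I M\<^esub> x = x"
    using xe xi by (auto simp: prod_module_def fun_eq_iff extensional_def abelian_monoid.l_zero[OF am])
  show "\<one>\<^bsub>R\<^esub> \<odot>\<^bsub>prod_module I M\<^esub> x = x"
    using xe xi by (auto simp: prod_module_def fun_eq_iff extensional_def left_module_smult_one[OF M])
  show "\<exists>y\<in>carrier (prod_module I M). y \<oplus>\<^bsub>prod_module I M\<^esub> x = \<zero>\<^bsub>prod_module I M\<^esub>"
    using xi by (intro bexI[of _ "\<lambda>i\<in>I. \<ominus>\<^bsub>M i\<^esub> x i"])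
      (auto simp: prod_module_def fun_eq_iff abelian_group.l_neg[OF ab] abelian_group.a_inv_closed[OF ab])
  fix r assume r: "r \<in> carrier R"
  show "r \<odot>\<^bsub>prod_module I M\<^esub> x \<in> carrier (prod_module I M)"
    using r xi by (auto simp: prod_module_def left_module_smult_closed[OF M])
  {
    fix s assume s: "s \<in> carrier R"
    show "(r \<oplus>\<^bsub>R\<^esub> s) \<odot>\<^bsub>prod_module I M\<^esub> x
        = r \<odot>\<^bsub>prod_module I M\<^esub> x \<oplus>\<^bsub>prod_module I M\<^esub> s \<odot>\<^bsub>prod_module I M\<^esub> x"
      using r s xi by (auto simp: prod_module_def fun_eq_iff left_module_smult_l_distr[OF M])
    show "(r \<otimes>\<^bsub>R\<^esub> s) \<odot>\<^bsub>prod_module I M\<^esub> x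
        = r \<odot>\<^bsub>prod_module I M\<^esub> (s \<odot>\<^bsub>prod_module I M\<^esub> x)"
      using r s xi by (auto simp: prod_module_def fun_eq_iff left_module_smult_assoc[OF M])
  }
  {
    fix y assume y: "y \<in> carrier (prod_module I M)"
    have yi: "y i \<in> carrier (M i)" if "i \<in> I" for i using y that by (auto simp: prod_module_def)
    show "r \<odot>\<^bsub>prod_module I M\<^esub> (x \<oplus>\<^bsub>prod_module I M\<^esub> y)
        = r \<odot>\<^bsub>prod_module I M\<^esub> x \<oplus>\<^bsub>prod_module I M\<^esub> r \<odot>\<^bsub>prod_module I M\<^esub> y"
      using r xi yi by (auto simp: prod_module_def fun_eq_iff left_module_smult_r_distr[OF M])
  }
next
  note ab = left_module_abelian_group[OF M]
  note am = abelian_group.axioms(1)[OF ab]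
  fix x y assume "x \<in> carrier (prod_module I M)" "y \<in> carrier (prod_module I M)"
  then have xi: "\<And>i. i \<in> I \<Longrightarrow> x i \<in> carrier (M i)" "\<And>i. i \<in> I \<Longrightarrow> y i \<in> carrier (M i)"
    by (auto simp: prod_module_def)
  show "x \<oplus>\<^bsub>prod_module I M\<^esub> y \<in> carrier (prod_module I M)"
    using xi by (auto simp: prod_module_def abelian_monoid.a_closed[OF am])
  show "x \<oplus>\<^bsub>prod_module I M\<^esub> y = y \<oplus>\<^bsub>prod_module I M\<^esub> x"
    using xi by (auto simp: prod_module_def fun_eq_iff abelian_monoid.a_comm[OF am])
  fix z assume "z \<in> carrier (prod_module I M)"
  then have "\<And>i. i \<in> I \<Longrightarrow> z i \<in> carrier (M i)" by (auto simp: prod_module_def)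
  then show "x \<oplus>\<^bsub>prod_module I M\<^esub> y \<oplus>\<^bsub>prod_module I M\<^esub> z
      = x \<oplus>\<^bsub>prod_module I M\<^esub> (y \<oplus>\<^bsub>prod_module I M\<^esub> z)"
    using xi by (auto simp: prod_module_def fun_eq_iff abelian_monoid.a_assoc[OF am])
qed

subsection \<open>Quotients and homology\<close>

lemma mem_a_r_coset: "x \<in> N +>\<^bsub>M\<^esub> y \<longleftrightarrow> (\<exists>n\<in>N. x = n \<oplus>\<^bsub>M\<^esub> y)"
  by (auto simp: a_r_coset_def r_coset_def)

lemma coset_carrier_update: "N +>\<^bsub>M\<lparr>carrier := S\<rparr>\<^esub> x = N +>\<^bsub>M\<^esub> x"
  by (auto simp: mem_a_r_coset)

lemma coset_eq_iff:
  assumes M: "left_module R M" and N: "submodule_of R M N"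
    and x: "x \<in> carrier M" and y: "y \<in> carrier M"
  shows "N +>\<^bsub>M\<^esub> x = N +>\<^bsub>M\<^esub> y \<longleftrightarrow> x \<ominus>\<^bsub>M\<^esub> y \<in> N"
proof -
  interpret abelian_subgroup N M by (rule submodule_of_abelian_subgroup[OF M N])
  show ?thesis
    using x y by (metis a_repr_independence' a_repr_independenceD a_rcos_module minus_eq)
qed

lemma linear_map_coset:
  assumes M: "left_module R M" and N: "submodule_of R M N"
  shows "linear_map R M (quot_module M N) (\<lambda>x. N +>\<^bsub>M\<^esub> x)"
proof -
  interpret abelian_subgroup N M by (rule submodule_of_abelian_subgroup[OF M N])
  have smult: "(\<Union>c\<in>N +>\<^bsub>M\<^esub> x. N +>\<^bsub>M\<^esub> (r \<odot>\<^bsub>M\<^esub> c)) = N +>\<^bsub>M\<^esub> (r \<odot>\<^bsub>M\<^esub> x)"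
    if r: "r \<in> carrier R" and x: "x \<in> carrier M" for r x
  proof -
    have "N +>\<^bsub>M\<^esub> (r \<odot>\<^bsub>M\<^esub> c) = N +>\<^bsub>M\<^esub> (r \<odot>\<^bsub>M\<^esub> x)" if c: "c \<in> N +>\<^bsub>M\<^esub> x" for c
    proof -
      obtain n where n: "n \<in> N" "c = n \<oplus>\<^bsub>M\<^esub> x" using c by (auto simp: mem_a_r_coset)
      then have "r \<odot>\<^bsub>M\<^esub> c = r \<odot>\<^bsub>M\<^esub> n \<oplus>\<^bsub>M\<^esub> r \<odot>\<^bsub>M\<^esub> x"
        using left_module_smult_r_distr[OF M r _ x] by simp
      moreover have "r \<odot>\<^bsub>M\<^esub> n \<in> N" using N r n(1) unfolding submodule_of_def by blast
      ultimately have "r \<odot>\<^bsub>M\<^esub> c \<in> N +>\<^bsub>M\<^esub> (r \<odot>\<^bsub>M\<^esub> x)" by (auto simp: mem_a_r_coset)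
      then show ?thesis using a_repr_independence' left_module_smult_closed[OF M r x] by simp
    qed
    moreover have "x \<in> N +>\<^bsub>M\<^esub> x" using a_rcos_self x by simp
    ultimately show ?thesis by blast
  qed
  show ?thesis
    unfolding linear_map_def quot_module_def
    using smult by (auto simp: a_rcos_sum A_RCOSETS_def' )
qed

lemma carrier_quot_module: "carrier (quot_module M N) = (\<lambda>x. N +>\<^bsub>M\<^esub> x) ` carrier M"
  by (auto simp: quot_module_def A_RCOSETS_def')

lemma zero_quot_module:
  assumes M: "left_module R M" and N: "submodule_of R M N"
  shows "\<zero>\<^bsub>quot_module M N\<^esub> = N +>\<^bsub>M\<^esub> \<zero>\<^bsub>M\<^esub>"
proof -
  interpret M: abelian_group M by (rule left_module_abelian_group[OF M])
  have sub: "N \<subseteq> carrier M" using N unfolding submodule_of_def by blast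
  then show ?thesis
    by (auto simp: quot_module_def mem_a_r_coset)
qed

lemma left_module_quot_module:
  assumes M: "left_module R M" and N: "submodule_of R M N"
  shows "left_module R (quot_module M N)"
  by (rule left_module_surj_image[OF M linear_map_coset[OF M N]])
     (simp_all add: carrier_quot_module zero_quot_module[OF M N])

text \<open>The union that defines the induced map on cosets is taken over equal sets.\<close>

lemma coset_map_coset:
  assumes M: "left_module R M" and N: "submodule_of R M N" and M': "left_module R M'"
    and N': "submodule_of R M' N'" and f: "linear_map R M M' f"
    and fN: "f ` N \<subseteq> N'" and x: "x \<in> carrier M"
  shows "coset_map M' N' f (N +>\<^bsub>M\<^esub> x) = N' +>\<^bsub>M'\<^esub> f x"
proof -
  interpret abelian_subgroup N M by (rule submodule_of_abelian_subgroup[OF M N])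
  interpret N': abelian_subgroup N' M' by (rule submodule_of_abelian_subgroup[OF M' N'])
  have "N' +>\<^bsub>M'\<^esub> f c = N' +>\<^bsub>M'\<^esub> f x" if c: "c \<in> N +>\<^bsub>M\<^esub> x" for c
  proof -
    obtain n where n: "n \<in> N" "c = n \<oplus>\<^bsub>M\<^esub> x" using c by (auto simp: mem_a_r_coset)
    then have "f c = f n \<oplus>\<^bsub>M'\<^esub> f x" using linear_map_add[OF f] x by simp
    then have "f c \<in> N' +>\<^bsub>M'\<^esub> f x" using fN n(1) by (auto simp: mem_a_r_coset)
    then show ?thesis using N'.a_repr_independence' linear_map_closed[OF f x] by simp
  qed
  moreover have "x \<in> N +>\<^bsub>M\<^esub> x" using a_rcos_self x by simp
  ultimately show ?thesis unfolding coset_map_def by blast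
qed

lemma linear_map_coset_map:
  assumes M: "left_module R M" and N: "submodule_of R M N" and M': "left_module R M'"
    and N': "submodule_of R M' N'" and f: "linear_map R M M' f" and fN: "f ` N \<subseteq> N'"
  shows "linear_map R (quot_module M N) (quot_module M' N') (coset_map M' N' f)"
proof -
  interpret M: abelian_group M by (rule left_module_abelian_group[OF M])
  note q = linear_mapD[OF linear_map_coset[OF M N]]
  note q' = linear_mapD[OF linear_map_coset[OF M' N']]
  note c = coset_map_coset[OF M N M' N' f fN]
  show ?thesis
    unfolding linear_map_def carrier_quot_module
    using q(2,3)[symmetric] q'(2,3)[symmetric]
    by (auto simp: c linear_mapD[OF f] left_module_smult_closed[OF M])
qed

abbreviation homology_class :: "('r, 'x) module \<Rightarrow> ('x \<Rightarrow> 'y) \<Rightarrow> ('r, 'y) module \<Rightarrow> 'y \<Rightarrow> 'y set" where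
  "homology_class A f M x \<equiv> (f ` carrier A) +>\<^bsub>M\<^esub> x"

locale three_term_complex =
  fixes R :: "('r, 'm) ring_scheme" and A :: "('r, 'x) module" and f and M :: "('r, 'y) module"
    and g :: "'y \<Rightarrow> 'z" and B :: "('r, 'z) module"
  assumes A: "left_module R A" and M: "left_module R M" and B: "left_module R B"
    and f: "linear_map R A M f" and g: "linear_map R M B g"
    and gf: "\<And>a. a \<in> carrier A \<Longrightarrow> g (f a) = \<zero>\<^bsub>B\<^esub>"
begin

definition "cycles = {x \<in> carrier M. g x = \<zero>\<^bsub>B\<^esub>}"

lemma cycles_submodule: "submodule_of R M cycles"
  unfolding cycles_def by (rule linear_map_ker_submodule[OF M B g])

lemma boundaries_submodule: "submodule_of R (M\<lparr>carrier := cycles\<rparr>) (f ` carrier A)"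
  using linear_map_image_submodule[OF A M f] gf linear_map_closed[OF f]
  unfolding submodule_of_def cycles_def by auto

lemma left_module_cycles: "left_module R (M\<lparr>carrier := cycles\<rparr>)"
  by (rule left_module_submodule[OF M cycles_submodule])

lemma homology_at_eq: "homology_at A f M g B = quot_module (M\<lparr>carrier := cycles\<rparr>) (f ` carrier A)"
  unfolding homology_at_def cycles_def ..

lemma left_module_homology: "left_module R (homology_at A f M g B)"
  unfolding homology_at_eq by (rule left_module_quot_module[OF left_module_cycles boundaries_submodule])

lemma carrier_homology: "carrier (homology_at A f M g B) = homology_class A f M ` cycles"
  unfolding homology_at_eq carrier_quot_module by (simp add: coset_carrier_update)

lemma linear_map_homology_class:
  "linear_map R (M\<lparr>carrier := cycles\<rparr>) (homology_at A f M g B) (homology_class A f M)"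
  using linear_map_coset[OF left_module_cycles boundaries_submodule]
  unfolding homology_at_eq by (simp add: coset_carrier_update)

lemma homology_class_add:
  assumes "x \<in> cycles" "y \<in> cycles"
  shows "homology_class A f M x \<oplus>\<^bsub>homology_at A f M g B\<^esub> homology_class A f M y =
         homology_class A f M (x \<oplus>\<^bsub>M\<^esub> y)"
  using linear_map_add[OF linear_map_homology_class] assms by simp

lemma homology_class_smult:
  assumes "r \<in> carrier R" "x \<in> cycles"
  shows "r \<odot>\<^bsub>homology_at A f M g B\<^esub> homology_class A f M x = homology_class A f M (r \<odot>\<^bsub>M\<^esub> x)"
  using linear_map_smult[OF linear_map_homology_class] assms by simp

lemma homology_class_eq_iff:
  assumes "x \<in> cycles" "y \<in> cycles"
  shows "homology_class A f M x = homology_class A f M y \<longleftrightarrow> (\<exists>a\<in>carrier A. x = y \<oplus>\<^bsub>M\<^esub> f a)"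
proof -
  interpret M: abelian_group M by (rule left_module_abelian_group[OF M])
  have xy: "x \<in> carrier M" "y \<in> carrier M" using assms by (auto simp: cycles_def)
  have "homology_class A f M x = homology_class A f M y \<longleftrightarrow> x \<ominus>\<^bsub>M\<^esub> y \<in> f ` carrier A"
    by (rule coset_eq_iff[OF M linear_map_image_submodule[OF A M f] xy])
  also have "\<dots> \<longleftrightarrow> (\<exists>a\<in>carrier A. x = y \<oplus>\<^bsub>M\<^esub> f a)"
  proof -
    have "x \<ominus>\<^bsub>M\<^esub> y = b \<longleftrightarrow> x = y \<oplus>\<^bsub>M\<^esub> b" if "b \<in> carrier M" for b
      using xy that M.a_comm M.a_assoc M.r_neg2 M.r_neg1 unfolding a_minus_def
      by (metis M.a_inv_closed M.a_closed)
    then show ?thesis using linear_map_closed[OF f] by (auto simp: image_iff)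
  qed
  finally show ?thesis .
qed

end

text \<open>Two modules are isomorphic if both are images of one index set under maps with the same fibres
  that transport both structures in the same way. The index set may be any set of representatives;
  it need not carry a module structure.\<close>

lemma modules_isomorphicI:
  fixes M :: "('r, 'x) module" and N :: "('r, 'y) module"
  assumes f: "f ` Z = carrier M" and g: "g ` Z = carrier N"
    and eq: "\<And>z w. z \<in> Z \<Longrightarrow> w \<in> Z \<Longrightarrow> f z = f w \<longleftrightarrow> g z = g w"
    and add: "\<And>z w. z \<in> Z \<Longrightarrow> w \<in> Z \<Longrightarrow>
                \<exists>v\<in>Z. f v = f z \<oplus>\<^bsub>M\<^esub> f w \<and> g v = g z \<oplus>\<^bsub>N\<^esub> g w"
    and smult: "\<And>r z. r \<in> carrier R \<Longrightarrow> z \<in> Z \<Longrightarrow>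
                \<exists>v\<in>Z. f v = r \<odot>\<^bsub>M\<^esub> f z \<and> g v = r \<odot>\<^bsub>N\<^esub> g z"
  shows "modules_isomorphic R M N"
proof -
  define h where "h x = g (SOME z. z \<in> Z \<and> f z = x)" for x
  have h: "h (f z) = g z" if "z \<in> Z" for z
  proof -
    have "(SOME w. w \<in> Z \<and> f w = f z) \<in> Z \<and> f (SOME w. w \<in> Z \<and> f w = f z) = f z"
      by (rule someI[of _ z]) (simp add: that)
    then show ?thesis unfolding h_def using eq that by auto
  qed
  have "bij_betw h (carrier M) (carrier N)"
    unfolding bij_betw_def f[symmetric] g[symmetric] inj_on_def
    using h eq by (auto simp: image_iff)
  moreover have "h (x \<oplus>\<^bsub>M\<^esub> y) = h x \<oplus>\<^bsub>N\<^esub> h y" if "x \<in> carrier M" "y \<in> carrier M" for x y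
    using that add h unfolding f[symmetric] by (metis (no_types, lifting) imageE)
  moreover have "h (r \<odot>\<^bsub>M\<^esub> x) = r \<odot>\<^bsub>N\<^esub> h x" if "r \<in> carrier R" "x \<in> carrier M" for r x
    using that smult h unfolding f[symmetric] by (metis (no_types, lifting) imageE)
  ultimately have "h \<in> module_isos R M N"
    unfolding module_isos_def iso_def hom_def bij_betw_def by auto
  then show ?thesis unfolding modules_isomorphic_def by blast
qed

lemma modules_isomorphic_trans:
  assumes "modules_isomorphic R L M" "modules_isomorphic R M N"
  shows "modules_isomorphic R L N"
proof -
  obtain f g where fg: "f \<in> module_isos R L M" "g \<in> module_isos R M N"
    using assms unfolding modules_isomorphic_def by blast
  have "g \<circ> f \<in> iso (add_monoid L) (add_monoid N)"
    using fg iso_set_trans unfolding module_isos_def by blast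
  moreover have "f x \<in> carrier M" if "x \<in> carrier L" for x
    using fg that unfolding module_isos_def iso_def hom_def by auto
  ultimately have "g \<circ> f \<in> module_isos R L N"
    using fg unfolding module_isos_def by auto
  then show ?thesis unfolding modules_isomorphic_def by blast
qed

section \<open>Presheaves of modules and their stalks\<close>

locale module_presheaf =
  fixes R :: "('r, 'm) ring_scheme" and Y :: "'b topology" and P :: "('b, 'r, 'x) presheaf"
  assumes base_ring: "ring R"
    and sections_module: "openin Y U \<Longrightarrow> left_module R (sections P U)"
    and restr_linear: "openin Y U \<Longrightarrow> openin Y V \<Longrightarrow> V \<subseteq> U \<Longrightarrow>
          linear_map R (sections P U) (sections P V) (restr P U V)"
    and restr_id: "openin Y U \<Longrightarrow> s \<in> carrier (sections P U) \<Longrightarrow> restr P U U s = s"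
    and restr_comp: "openin Y U \<Longrightarrow> openin Y V \<Longrightarrow> openin Y W \<Longrightarrow> W \<subseteq> V \<Longrightarrow> V \<subseteq> U \<Longrightarrow>
          s \<in> carrier (sections P U) \<Longrightarrow> restr P V W (restr P U V s) = restr P U W s"
begin

lemma restr_closed:
  "openin Y U \<Longrightarrow> openin Y V \<Longrightarrow> V \<subseteq> U \<Longrightarrow> s \<in> carrier (sections P U) \<Longrightarrow>
     restr P U V s \<in> carrier (sections P V)"
  using linear_map_closed[OF restr_linear] by blast

lemma sections_closed:
  assumes "openin Y U"
  shows sections_add_closed: "s \<in> carrier (sections P U) \<Longrightarrow> t \<in> carrier (sections P U) \<Longrightarrow>
           s \<oplus>\<^bsub>sections P U\<^esub> t \<in> carrier (sections P U)"
    and sections_zero_closed: "\<zero>\<^bsub>sections P U\<^esub> \<in> carrier (sections P U)"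
    and sections_smult_closed: "r \<in> carrier R \<Longrightarrow> s \<in> carrier (sections P U) \<Longrightarrow>
           r \<odot>\<^bsub>sections P U\<^esub> s \<in> carrier (sections P U)"
proof -
  interpret abelian_group "sections P U"
    by (rule left_module_abelian_group[OF sections_module[OF assms]])
  show "s \<in> carrier (sections P U) \<Longrightarrow> t \<in> carrier (sections P U) \<Longrightarrow>
           s \<oplus>\<^bsub>sections P U\<^esub> t \<in> carrier (sections P U)" by simp
  show "\<zero>\<^bsub>sections P U\<^esub> \<in> carrier (sections P U)" by simp
  show "r \<in> carrier R \<Longrightarrow> s \<in> carrier (sections P U) \<Longrightarrow>
           r \<odot>\<^bsub>sections P U\<^esub> s \<in> carrier (sections P U)"
    by (rule left_module_smult_closed[OF sections_module[OF assms]])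
qed

text \<open>Germs are sets of pairs, so this says that agreement near \<open>y\<close> is an equivalence relation:
  two neighbourhoods of agreement are intersected for transitivity.\<close>

lemma germ_eq_iff:
  assumes U: "openin Y U" "y \<in> U" "s \<in> carrier (sections P U)"
    and V: "openin Y V" "y \<in> V" "t \<in> carrier (sections P V)"
  shows "germ Y P y U s = germ Y P y V t \<longleftrightarrow>
    (\<exists>W. openin Y W \<and> y \<in> W \<and> W \<subseteq> U \<inter> V \<and> restr P U W s = restr P V W t)"
proof
  assume "germ Y P y U s = germ Y P y V t"
  moreover have "(V, t) \<in> germ Y P y V t" using V unfolding germ_def by auto
  ultimately have "(V, t) \<in> germ Y P y U s" by simp
  then show "\<exists>W. openin Y W \<and> y \<in> W \<and> W \<subseteq> U \<inter> V \<and> restr P U W s = restr P V W t"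
    unfolding germ_def by auto
next
  assume "\<exists>W. openin Y W \<and> y \<in> W \<and> W \<subseteq> U \<inter> V \<and> restr P U W s = restr P V W t"
  then obtain W where W: "openin Y W" "y \<in> W" "W \<subseteq> U" "W \<subseteq> V" "restr P U W s = restr P V W t"
    by auto
  have *: "germ Y P y V0 t0 \<subseteq> germ Y P y V1 t1"
    if V1: "openin Y V1" "W \<subseteq> V1" "t1 \<in> carrier (sections P V1)"
      and V0: "openin Y V0" "W \<subseteq> V0" "t0 \<in> carrier (sections P V0)"
      and eq: "restr P V0 W t0 = restr P V1 W t1"
    for V0 V1 t0 t1
  proof clarify
    fix V2 t2 assume "(V2, t2) \<in> germ Y P y V0 t0"
    then obtain W2 where V2: "openin Y V2" "y \<in> V2" "t2 \<in> carrier (sections P V2)"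
      and W2: "openin Y W2" "y \<in> W2" "W2 \<subseteq> V0" "W2 \<subseteq> V2" "restr P V0 W2 t0 = restr P V2 W2 t2"
      unfolding germ_def by auto
    have o: "openin Y (W \<inter> W2)" using W W2 by auto
    have "restr P V1 (W \<inter> W2) t1 = restr P W (W \<inter> W2) (restr P V1 W t1)"
      using restr_comp[OF V1(1) W(1) o _ V1(2,3)] by simp
    also have "\<dots> = restr P V0 (W \<inter> W2) t0"
      using restr_comp[OF V0(1) W(1) o _ V0(2,3)] eq by simp
    also have "\<dots> = restr P W2 (W \<inter> W2) (restr P V0 W2 t0)"
      using restr_comp[OF V0(1) W2(1) o _ W2(3) V0(3)] by simp
    also have "\<dots> = restr P V2 (W \<inter> W2) t2"
      using restr_comp[OF V2(1) W2(1) o _ W2(4) V2(3)] W2(5) by simp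
    finally have "\<exists>W'. openin Y W' \<and> y \<in> W' \<and> W' \<subseteq> V1 \<inter> V2 \<and> restr P V1 W' t1 = restr P V2 W' t2"
      using o W(2) W2(2,4) V1(2) by (intro exI[of _ "W \<inter> W2"]) auto
    with V2 show "(V2, t2) \<in> germ Y P y V1 t1" unfolding germ_def by simp
  qed
  show "germ Y P y U s = germ Y P y V t"
    using *[OF V(1) W(4) V(3) U(1) W(3) U(3) W(5)] *[OF U(1) W(3) U(3) V(1) W(4) V(3) W(5)[symmetric]]
    by (rule subset_antisym)
qed

lemma germ_eqI:
  assumes "openin Y U" "s \<in> carrier (sections P U)" "openin Y V" "t \<in> carrier (sections P V)"
    and "openin Y W" "y \<in> W" "W \<subseteq> U" "W \<subseteq> V" "restr P U W s = restr P V W t"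
  shows "germ Y P y U s = germ Y P y V t"
  by (subst germ_eq_iff) (use assms in auto)

lemma germ_restr:
  assumes "openin Y U" "s \<in> carrier (sections P U)" "openin Y V" "y \<in> V" "V \<subseteq> U"
  shows "germ Y P y V (restr P U V s) = germ Y P y U s"
  by (rule germ_eqI[of _ _ _ _ V])
     (use assms restr_closed restr_comp[of U V V] in auto)

lemma germ_mem:
  "(V, t) \<in> germ Y P y U s \<Longrightarrow> openin Y U \<Longrightarrow> y \<in> U \<Longrightarrow> s \<in> carrier (sections P U) \<Longrightarrow>
     openin Y V \<and> y \<in> V \<and> t \<in> carrier (sections P V) \<and> germ Y P y V t = germ Y P y U s"
  using germ_eq_iff[of U y s V t] unfolding germ_def by auto

lemma germ_self:
  "openin Y U \<Longrightarrow> y \<in> U \<Longrightarrow> s \<in> carrier (sections P U) \<Longrightarrow> (U, s) \<in> germ Y P y U s"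
  unfolding germ_def by auto

lemma stalk_carrierE:
  assumes "A \<in> carrier (stalk Y P y)"
  obtains U s where "openin Y U" "y \<in> U" "s \<in> carrier (sections P U)" "A = germ Y P y U s"
  using assms unfolding stalk_def by auto

lemma germ_in_stalk:
  "openin Y U \<Longrightarrow> y \<in> U \<Longrightarrow> s \<in> carrier (sections P U) \<Longrightarrow> germ Y P y U s \<in> carrier (stalk Y P y)"
  unfolding stalk_def by auto

lemma stalk_zero:
  assumes "openin Y U" "y \<in> U"
  shows "\<zero>\<^bsub>stalk Y P y\<^esub> = germ Y P y U \<zero>\<^bsub>sections P U\<^esub>"
proof -
  have U: "openin Y (topspace Y)" "U \<subseteq> topspace Y"
    using assms openin_subset by auto
  have "restr P (topspace Y) U \<zero>\<^bsub>sections P (topspace Y)\<^esub> = restr P U U \<zero>\<^bsub>sections P U\<^esub>"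
    using linear_map_zero[OF sections_module sections_module restr_linear] U assms
    by (simp add: restr_id sections_zero_closed)
  then have "germ Y P y (topspace Y) \<zero>\<^bsub>sections P (topspace Y)\<^esub> = germ Y P y U \<zero>\<^bsub>sections P U\<^esub>"
    by (intro germ_eqI[of _ _ _ _ U]) (use assms U sections_zero_closed in auto)
  then show ?thesis by (simp add: stalk_def)
qed

text \<open>The union in the definition of addition is over all representatives of both summands; their
  sums all have the same germ, because they agree on a common smaller neighbourhood.\<close>

lemma stalk_add_gen:
  assumes U: "openin Y U" "y \<in> U" "s \<in> carrier (sections P U)"
    and V: "openin Y V" "y \<in> V" "t \<in> carrier (sections P V)"
  shows "germ Y P y U s \<oplus>\<^bsub>stalk Y P y\<^esub> germ Y P y V t =
    germ Y P y (U \<inter> V) (restr P U (U \<inter> V) s \<oplus>\<^bsub>sections P (U \<inter> V)\<^esub> restr P V (U \<inter> V) t)"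
proof -
  let ?G = "\<lambda>U V s t. germ Y P y (U \<inter> V)
    (restr P U (U \<inter> V) s \<oplus>\<^bsub>sections P (U \<inter> V)\<^esub> restr P V (U \<inter> V) t)"
  have "?G U' V' s' t' = ?G U V s t"
    if m: "(U', s') \<in> germ Y P y U s" "(V', t') \<in> germ Y P y V t" for U' s' V' t'
  proof -
    have U': "openin Y U'" "y \<in> U'" "s' \<in> carrier (sections P U')" using germ_mem[OF m(1) U] by auto
    have V': "openin Y V'" "y \<in> V'" "t' \<in> carrier (sections P V')" using germ_mem[OF m(2) V] by auto
    obtain W1 where W1: "openin Y W1" "y \<in> W1" "W1 \<subseteq> U \<inter> U'" "restr P U W1 s = restr P U' W1 s'"
      using m(1) unfolding germ_def by blast
    obtain W2 where W2: "openin Y W2" "y \<in> W2" "W2 \<subseteq> V \<inter> V'" "restr P V W2 t = restr P V' W2 t'"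
      using m(2) unfolding germ_def by blast
    let ?W = "W1 \<inter> W2"
    have o: "openin Y ?W" "openin Y (U \<inter> V)" "openin Y (U' \<inter> V')"
      using W1 W2 U V U' V' by auto
    have r: "restr P (A \<inter> B) ?W (restr P A (A \<inter> B) a \<oplus>\<^bsub>sections P (A \<inter> B)\<^esub> restr P B (A \<inter> B) b)
        = restr P W1 ?W (restr P A W1 a) \<oplus>\<^bsub>sections P ?W\<^esub> restr P W2 ?W (restr P B W2 b)"
      if "openin Y A" "openin Y B" "W1 \<subseteq> A" "W2 \<subseteq> B" "a \<in> carrier (sections P A)"
        "b \<in> carrier (sections P B)" for A B a b
    proof -
      have oAB: "openin Y (A \<inter> B)" using that by auto
      have sub: "?W \<subseteq> A \<inter> B" using that by auto
      have "restr P (A \<inter> B) ?W (restr P A (A \<inter> B) a \<oplus>\<^bsub>sections P (A \<inter> B)\<^esub> restr P B (A \<inter> B) b)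
        = restr P (A \<inter> B) ?W (restr P A (A \<inter> B) a) \<oplus>\<^bsub>sections P ?W\<^esub>
          restr P (A \<inter> B) ?W (restr P B (A \<inter> B) b)"
        using linear_map_add[OF restr_linear[OF oAB o(1) sub]] restr_closed that oAB by simp
      also have "restr P (A \<inter> B) ?W (restr P A (A \<inter> B) a) = restr P W1 ?W (restr P A W1 a)"
        using restr_comp[of A "A \<inter> B" ?W a] restr_comp[of A W1 ?W a] that oAB o W1(1) sub by auto
      also have "restr P (A \<inter> B) ?W (restr P B (A \<inter> B) b) = restr P W2 ?W (restr P B W2 b)"
        using restr_comp[of B "A \<inter> B" ?W b] restr_comp[of B W2 ?W b] that oAB o W2(1) sub by auto
      finally show ?thesis .
    qed
    have cl: "restr P A (A \<inter> B) a \<oplus>\<^bsub>sections P (A \<inter> B)\<^esub> restr P B (A \<inter> B) b \<in> carrier (sections P (A \<inter> B))"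
      if "openin Y A" "openin Y B" "a \<in> carrier (sections P A)" "b \<in> carrier (sections P B)" for A B a b
      using that by (intro sections_add_closed restr_closed) auto
    show ?thesis
      by (rule germ_eqI[where W = ?W])
         (use r[of U V s t] r[of U' V' s' t'] W1 W2 U V U' V' o cl in auto)
  qed
  moreover have "(U, s) \<in> germ Y P y U s" "(V, t) \<in> germ Y P y V t"
    using germ_self U V by auto
  ultimately have "(\<Union>(U', s')\<in>germ Y P y U s. \<Union>(V', t')\<in>germ Y P y V t. ?G U' V' s' t') = ?G U V s t"
    by blast
  then show ?thesis by (simp add: stalk_def)
qed

lemma stalk_add:
  assumes "openin Y U" "y \<in> U" "s \<in> carrier (sections P U)" "t \<in> carrier (sections P U)"
  shows "germ Y P y U s \<oplus>\<^bsub>stalk Y P y\<^esub> germ Y P y U t = germ Y P y U (s \<oplus>\<^bsub>sections P U\<^esub> t)"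
  using stalk_add_gen[of U y s U t] assms by (simp add: restr_id)

lemma stalk_smult:
  assumes r: "r \<in> carrier R" and U: "openin Y U" "y \<in> U" "s \<in> carrier (sections P U)"
  shows "r \<odot>\<^bsub>stalk Y P y\<^esub> germ Y P y U s = germ Y P y U (r \<odot>\<^bsub>sections P U\<^esub> s)"
proof -
  have "germ Y P y U' (r \<odot>\<^bsub>sections P U'\<^esub> s') = germ Y P y U (r \<odot>\<^bsub>sections P U\<^esub> s)"
    if m: "(U', s') \<in> germ Y P y U s" for U' s'
  proof -
    have U': "openin Y U'" "y \<in> U'" "s' \<in> carrier (sections P U')" using germ_mem[OF m U] by auto
    obtain W where W: "openin Y W" "y \<in> W" "W \<subseteq> U" "W \<subseteq> U'" "restr P U W s = restr P U' W s'"
      using m unfolding germ_def by blast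
    show ?thesis
      by (rule germ_eqI[OF U'(1) sections_smult_closed[OF U'(1) r U'(3)] U(1)
              sections_smult_closed[OF U(1) r U(3)] W(1,2,4,3)])
         (simp add: linear_map_smult[OF restr_linear[OF U(1) W(1,3)] r U(3)]
            linear_map_smult[OF restr_linear[OF U'(1) W(1,4)] r U'(3)] W(5))
  qed
  moreover have "(U, s) \<in> germ Y P y U s" using germ_self U by auto
  ultimately have "(\<Union>(U', s')\<in>germ Y P y U s. germ Y P y U' (r \<odot>\<^bsub>sections P U'\<^esub> s'))
      = germ Y P y U (r \<odot>\<^bsub>sections P U\<^esub> s)"
    by blast
  then show ?thesis by (simp add: stalk_def)
qed

text \<open>Finitely many germs are represented over a common neighbourhood, where the module axioms hold.\<close>

lemma stalk_common_domain:
  assumes "A \<in> carrier (stalk Y P y)" "openin Y U" "y \<in> U"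
  obtains V s where "openin Y V" "y \<in> V" "V \<subseteq> U" "s \<in> carrier (sections P V)" "A = germ Y P y V s"
proof -
  obtain V s where V: "openin Y V" "y \<in> V" "s \<in> carrier (sections P V)" "A = germ Y P y V s"
    using stalk_carrierE[OF assms(1)] by blast
  have o: "openin Y (U \<inter> V)" using V assms by auto
  show ?thesis
    by (rule that[of "U \<inter> V" "restr P V (U \<inter> V) s"])
       (use V assms o germ_restr[OF V(1,3) o] restr_closed[OF V(1) o] in auto)
qed

lemma stalk_common_domain3:
  assumes "A \<in> carrier (stalk Y P y)" "B \<in> carrier (stalk Y P y)" "C \<in> carrier (stalk Y P y)"
  obtains U s t u where "openin Y U" "y \<in> U" "s \<in> carrier (sections P U)" "t \<in> carrier (sections P U)"
    "u \<in> carrier (sections P U)" "A = germ Y P y U s" "B = germ Y P y U t" "C = germ Y P y U u"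
proof -
  obtain U1 s where 1: "openin Y U1" "y \<in> U1" "s \<in> carrier (sections P U1)" "A = germ Y P y U1 s"
    using stalk_carrierE[OF assms(1)] by blast
  obtain U2 t where 2: "openin Y U2" "y \<in> U2" "U2 \<subseteq> U1" "t \<in> carrier (sections P U2)" "B = germ Y P y U2 t"
    using stalk_common_domain[OF assms(2) 1(1,2)] by blast
  obtain U3 u where 3: "openin Y U3" "y \<in> U3" "U3 \<subseteq> U2" "u \<in> carrier (sections P U3)" "C = germ Y P y U3 u"
    using stalk_common_domain[OF assms(3) 2(1,2)] by blast
  have "U3 \<subseteq> U1" using 2 3 by auto
  show ?thesis
    by (rule that[OF 3(1,2) restr_closed[OF 1(1) 3(1) \<open>U3 \<subseteq> U1\<close> 1(3)] restr_closed[OF 2(1) 3(1,3) 2(4)] 3(4)])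
       (use 1 2 3 germ_restr[OF 1(1,3) 3(1,2) \<open>U3 \<subseteq> U1\<close>] germ_restr[OF 2(1,4) 3(1,2,3)] in auto)
qed

lemma left_module_stalk:
  assumes y: "y \<in> topspace Y"
  shows "left_module R (stalk Y P y)"
proof (rule left_moduleI)
  show "ring R" by (rule base_ring)
  show "\<zero>\<^bsub>stalk Y P y\<^esub> \<in> carrier (stalk Y P y)"
    using stalk_zero[of "topspace Y" y] y by (auto intro: germ_in_stalk sections_zero_closed)
next
  fix A B C assume "A \<in> carrier (stalk Y P y)" "B \<in> carrier (stalk Y P y)" "C \<in> carrier (stalk Y P y)"
  then obtain U s t u where U: "openin Y U" "y \<in> U" and s: "s \<in> carrier (sections P U)"
    "t \<in> carrier (sections P U)" "u \<in> carrier (sections P U)"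
    and e: "A = germ Y P y U s" "B = germ Y P y U t" "C = germ Y P y U u"
    by (rule stalk_common_domain3)
  interpret S: abelian_group "sections P U"
    by (rule left_module_abelian_group[OF sections_module[OF U(1)]])
  show "A \<oplus>\<^bsub>stalk Y P y\<^esub> B \<oplus>\<^bsub>stalk Y P y\<^esub> C = A \<oplus>\<^bsub>stalk Y P y\<^esub> (B \<oplus>\<^bsub>stalk Y P y\<^esub> C)"
    using U s by (simp add: e stalk_add S.a_assoc)
next
  fix A B assume "A \<in> carrier (stalk Y P y)" "B \<in> carrier (stalk Y P y)"
  then obtain U s t where U: "openin Y U" "y \<in> U" and s: "s \<in> carrier (sections P U)"
    "t \<in> carrier (sections P U)"
    and e: "A = germ Y P y U s" "B = germ Y P y U t"
    by (metis stalk_common_domain3)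
  interpret S: abelian_group "sections P U"
    by (rule left_module_abelian_group[OF sections_module[OF U(1)]])
  show "A \<oplus>\<^bsub>stalk Y P y\<^esub> B \<in> carrier (stalk Y P y)"
    using U s by (simp add: e stalk_add germ_in_stalk)
  show "A \<oplus>\<^bsub>stalk Y P y\<^esub> B = B \<oplus>\<^bsub>stalk Y P y\<^esub> A"
    using U s by (simp add: e stalk_add S.a_comm)
  fix r assume r: "r \<in> carrier R"
  show "r \<odot>\<^bsub>stalk Y P y\<^esub> (A \<oplus>\<^bsub>stalk Y P y\<^esub> B) = r \<odot>\<^bsub>stalk Y P y\<^esub> A \<oplus>\<^bsub>stalk Y P y\<^esub> r \<odot>\<^bsub>stalk Y P y\<^esub> B"
    using U s r by (simp add: e stalk_add stalk_smult sections_smult_closed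
        left_module_smult_r_distr[OF sections_module])
next
  fix A assume "A \<in> carrier (stalk Y P y)"
  then obtain U s where U: "openin Y U" "y \<in> U" and s: "s \<in> carrier (sections P U)"
    and e: "A = germ Y P y U s"
    by (rule stalk_carrierE)
  interpret S: abelian_group "sections P U"
    by (rule left_module_abelian_group[OF sections_module[OF U(1)]])
  show "\<zero>\<^bsub>stalk Y P y\<^esub> \<oplus>\<^bsub>stalk Y P y\<^esub> A = A"
    using U s by (simp add: e stalk_add stalk_zero[OF U])
  show "\<one>\<^bsub>R\<^esub> \<odot>\<^bsub>stalk Y P y\<^esub> A = A"
    using U s ring.ring_simprules(6)[OF base_ring]
    by (simp add: e stalk_smult left_module_smult_one[OF sections_module])
  show "\<exists>B\<in>carrier (stalk Y P y). B \<oplus>\<^bsub>stalk Y P y\<^esub> A = \<zero>\<^bsub>stalk Y P y\<^esub>"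
    using U s by (intro bexI[of _ "germ Y P y U (\<ominus>\<^bsub>sections P U\<^esub> s)"])
      (auto simp: e stalk_add stalk_zero[OF U] S.l_neg intro: germ_in_stalk)
  fix r assume r: "r \<in> carrier R"
  show "r \<odot>\<^bsub>stalk Y P y\<^esub> A \<in> carrier (stalk Y P y)"
    using U s r by (simp add: e stalk_smult sections_smult_closed germ_in_stalk)
  fix q assume q: "q \<in> carrier R"
  show "(r \<oplus>\<^bsub>R\<^esub> q) \<odot>\<^bsub>stalk Y P y\<^esub> A = r \<odot>\<^bsub>stalk Y P y\<^esub> A \<oplus>\<^bsub>stalk Y P y\<^esub> q \<odot>\<^bsub>stalk Y P y\<^esub> A"
    using U s r q ring.ring_simprules(1)[OF base_ring r q]
    by (simp add: e stalk_add stalk_smult sections_smult_closed left_module_smult_l_distr[OF sections_module])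
  show "(r \<otimes>\<^bsub>R\<^esub> q) \<odot>\<^bsub>stalk Y P y\<^esub> A = r \<odot>\<^bsub>stalk Y P y\<^esub> (q \<odot>\<^bsub>stalk Y P y\<^esub> A)"
    using U s r q ring.ring_simprules(5)[OF base_ring r q]
    by (simp add: e stalk_smult sections_smult_closed left_module_smult_assoc[OF sections_module])
qed

end

section \<open>Stalks of sheafifications and of derived sheaves\<close>

context module_presheaf
begin

definition "local_sections U =
  {g \<in> \<Pi>\<^sub>E y\<in>U. carrier (stalk Y P y). \<forall>y\<in>U. \<exists>V s. openin Y V \<and> y \<in> V \<and> V \<subseteq> U \<and>
     s \<in> carrier (sections P V) \<and> (\<forall>z\<in>V. g z = germ Y P z V s)}"

lemma sections_sheafify:
  "sections (sheafify Y P) U = (prod_module U (stalk Y P))\<lparr>carrier := local_sections U\<rparr>"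
  by (simp add: sheafify_def local_sections_def)

lemma sheafify_simps [simp]:
  "carrier (sections (sheafify Y P) U) = local_sections U"
  "\<zero>\<^bsub>sections (sheafify Y P) U\<^esub> = (\<lambda>z\<in>U. \<zero>\<^bsub>stalk Y P z\<^esub>)"
  "g \<oplus>\<^bsub>sections (sheafify Y P) U\<^esub> h = (\<lambda>z\<in>U. g z \<oplus>\<^bsub>stalk Y P z\<^esub> h z)"
  "r \<odot>\<^bsub>sections (sheafify Y P) U\<^esub> g = (\<lambda>z\<in>U. r \<odot>\<^bsub>stalk Y P z\<^esub> g z)"
  "restr (sheafify Y P) U V g = restrict g V"
  by (simp_all add: sheafify_def prod_module_def local_sections_def)

text \<open>The neighbourhoods may leave \<open>U\<close>; they are intersected with \<open>U\<close> here once and for all.\<close>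

lemma local_sectionsI:
  assumes "g \<in> extensional U" and U: "openin Y U"
    and "\<And>y. y \<in> U \<Longrightarrow> \<exists>V s. openin Y V \<and> y \<in> V \<and> s \<in> carrier (sections P V) \<and>
                         (\<forall>z\<in>V \<inter> U. g z = germ Y P z V s)"
  shows "g \<in> local_sections U"
proof -
  have loc: "\<exists>V s. openin Y V \<and> y \<in> V \<and> V \<subseteq> U \<and> s \<in> carrier (sections P V) \<and>
      (\<forall>z\<in>V. g z = germ Y P z V s)" if y: "y \<in> U" for y
  proof -
    obtain V s where V: "openin Y V" "y \<in> V" "s \<in> carrier (sections P V)"
      "\<forall>z\<in>V \<inter> U. g z = germ Y P z V s"
      using assms(3)[OF y] by blast
    have o: "openin Y (V \<inter> U)" using U V by auto
    show ?thesis
      by (rule exI[of _ "V \<inter> U"], rule exI[of _ "restr P V (V \<inter> U) s"])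
         (use o V y restr_closed[OF V(1) o] germ_restr[OF V(1,3) o] in auto)
  qed
  moreover have "g y \<in> carrier (stalk Y P y)" if y: "y \<in> U" for y
    using loc[OF y] germ_in_stalk by fastforce
  ultimately show ?thesis using assms(1) by (auto simp: PiE_def local_sections_def)
qed

lemma local_sectionsE:
  assumes "g \<in> local_sections U" "y \<in> U"
  obtains V s where "openin Y V" "y \<in> V" "V \<subseteq> U" "s \<in> carrier (sections P V)"
    "\<And>z. z \<in> V \<Longrightarrow> g z = germ Y P z V s"
  using assms(1)[unfolded local_sections_def mem_Collect_eq, THEN conjunct2, rule_format, OF assms(2)] that by metis

lemma local_sections_stalk: "g \<in> local_sections U \<Longrightarrow> y \<in> U \<Longrightarrow> g y \<in> carrier (stalk Y P y)"
  by (auto simp: local_sections_def)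

lemma local_sections_extensional: "g \<in> local_sections U \<Longrightarrow> g \<in> extensional U"
  by (auto simp: PiE_def local_sections_def)

lemma germ_section:
  assumes "openin Y V" "s \<in> carrier (sections P V)"
  shows "(\<lambda>z\<in>V. germ Y P z V s) \<in> local_sections V"
  by (rule local_sectionsI) (use assms in auto)

lemma local_sections_submodule:
  assumes U: "openin Y U"
  shows "submodule_of R (prod_module U (stalk Y P)) (local_sections U)"
proof -
  let ?M = "prod_module U (stalk Y P)"
  have add: "x \<oplus>\<^bsub>?M\<^esub> y \<in> local_sections U" if x: "x \<in> local_sections U" and y: "y \<in> local_sections U" for x y
  proof (rule local_sectionsI)
    show "x \<oplus>\<^bsub>?M\<^esub> y \<in> extensional U" by (simp add: prod_module_def)
    fix u assume u: "u \<in> U"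
    obtain V s where V: "openin Y V" "u \<in> V" "V \<subseteq> U" "s \<in> carrier (sections P V)"
      "\<And>z. z \<in> V \<Longrightarrow> x z = germ Y P z V s" using local_sectionsE[OF x u] by metis
    obtain W t where W: "openin Y W" "u \<in> W" "W \<subseteq> U" "t \<in> carrier (sections P W)"
      "\<And>z. z \<in> W \<Longrightarrow> y z = germ Y P z W t" using local_sectionsE[OF y u] by metis
    let ?s = "restr P V (V \<inter> W) s \<oplus>\<^bsub>sections P (V \<inter> W)\<^esub> restr P W (V \<inter> W) t"
    have o: "openin Y (V \<inter> W)" using V W by auto
    have "?s \<in> carrier (sections P (V \<inter> W))"
      using V W o by (intro sections_add_closed restr_closed) auto
    moreover have "(x \<oplus>\<^bsub>?M\<^esub> y) z = germ Y P z (V \<inter> W) ?s" if "z \<in> V \<inter> W" for z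
      using that V W stalk_add_gen[of V z s W t] by (auto simp: prod_module_def)
    ultimately show "\<exists>V s. openin Y V \<and> u \<in> V \<and> s \<in> carrier (sections P V) \<and>
        (\<forall>z\<in>V \<inter> U. (x \<oplus>\<^bsub>?M\<^esub> y) z = germ Y P z V s)"
      using V W o by (intro exI[of _ "V \<inter> W"] exI[of _ ?s]) auto
  qed (rule U)
  have smult: "r \<odot>\<^bsub>?M\<^esub> x \<in> local_sections U" if r: "r \<in> carrier R" and x: "x \<in> local_sections U" for r x
  proof (rule local_sectionsI)
    show "r \<odot>\<^bsub>?M\<^esub> x \<in> extensional U" by (simp add: prod_module_def)
    fix u assume u: "u \<in> U"
    obtain V s where V: "openin Y V" "u \<in> V" "V \<subseteq> U" "s \<in> carrier (sections P V)"
      "\<And>z. z \<in> V \<Longrightarrow> x z = germ Y P z V s" using local_sectionsE[OF x u] by metis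
    then show "\<exists>V s. openin Y V \<and> u \<in> V \<and> s \<in> carrier (sections P V) \<and>
        (\<forall>z\<in>V \<inter> U. (r \<odot>\<^bsub>?M\<^esub> x) z = germ Y P z V s)"
      by (intro exI[of _ V] exI[of _ "r \<odot>\<^bsub>sections P V\<^esub> s"])
         (auto simp: prod_module_def stalk_smult r sections_smult_closed)
  qed (rule U)
  have zero: "\<zero>\<^bsub>?M\<^esub> \<in> local_sections U"
  proof (rule local_sectionsI)
    fix u assume u: "u \<in> U"
    then show "\<exists>V s. openin Y V \<and> u \<in> V \<and> s \<in> carrier (sections P V) \<and>
        (\<forall>z\<in>V \<inter> U. \<zero>\<^bsub>?M\<^esub> z = germ Y P z V s)"
      using U stalk_zero[OF U]
      by (intro exI[of _ U] exI[of _ "\<zero>\<^bsub>sections P U\<^esub>"]) (auto simp: prod_module_def sections_zero_closed)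
  qed (auto simp: prod_module_def U)
  have sub: "local_sections U \<subseteq> carrier ?M" by (auto simp: prod_module_def local_sections_def)
  show ?thesis unfolding submodule_of_def by (intro conjI ballI add smult zero sub)
qed

lemma restrict_local_sections:
  assumes "openin Y V" "V \<subseteq> U" "g \<in> local_sections U"
  shows "restrict g V \<in> local_sections V"
proof (rule local_sectionsI)
  fix y assume "y \<in> V"
  then have "y \<in> U" using assms by auto
  obtain W s where "openin Y W" "y \<in> W" "s \<in> carrier (sections P W)" "\<And>z. z \<in> W \<Longrightarrow> g z = germ Y P z W s"
    using local_sectionsE[OF assms(3) \<open>y \<in> U\<close>] by metis
  then show "\<exists>W s. openin Y W \<and> y \<in> W \<and> s \<in> carrier (sections P W) \<and>
        (\<forall>z\<in>W \<inter> V. restrict g V z = germ Y P z W s)"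
    by (intro exI[of _ W] exI[of _ s]) auto
qed (use assms in auto)

lemma module_presheaf_sheafify: "module_presheaf R Y (sheafify Y P)"
proof (intro module_presheaf.intro)
  show "ring R" by (rule base_ring)
  fix U assume U: "openin Y U"
  have Us: "U \<subseteq> topspace Y" using U openin_subset by auto
  have "left_module R (prod_module U (stalk Y P))"
    using left_module_prod_module[OF base_ring] left_module_stalk Us by blast
  then show "left_module R (sections (sheafify Y P) U)"
    unfolding sections_sheafify by (rule left_module_submodule[OF _ local_sections_submodule[OF U]])
  show "restr (sheafify Y P) U U s = s" if "s \<in> carrier (sections (sheafify Y P) U)" for s
    using that local_sections_extensional[of s U] by (simp add: extensional_restrict)
  fix V assume V: "openin Y V" "V \<subseteq> U"
  show "linear_map R (sections (sheafify Y P) U) (sections (sheafify Y P) V) (restr (sheafify Y P) U V)"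
    unfolding linear_map_def sheafify_simps
  proof (intro conjI ballI)
    fix x assume "x \<in> local_sections U"
    then show "restrict x V \<in> local_sections V" by (rule restrict_local_sections[OF V])
  qed (use V in \<open>auto simp: fun_eq_iff\<close>)
next
  fix U V W :: "'b set" and s assume "W \<subseteq> V"
  then show "restr (sheafify Y P) V W (restr (sheafify Y P) U V s) = restr (sheafify Y P) U W s"
    by (auto simp: fun_eq_iff)
qed

text \<open>Near \<open>y\<close> both sections consist of the germs of sections of the presheaf, and these agree near
  \<open>y\<close> when their germs at \<open>y\<close> do.\<close>

lemma germ_sheafify_eq_iff:
  assumes U: "openin Y U" "y \<in> U" "g \<in> local_sections U"
    and V: "openin Y V" "y \<in> V" "h \<in> local_sections V"
  shows "germ Y (sheafify Y P) y U g = germ Y (sheafify Y P) y V h \<longleftrightarrow> g y = h y"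
proof -
  interpret S: module_presheaf R Y "sheafify Y P" by (rule module_presheaf_sheafify)
  have "germ Y (sheafify Y P) y U g = germ Y (sheafify Y P) y V h \<longleftrightarrow>
      (\<exists>W. openin Y W \<and> y \<in> W \<and> W \<subseteq> U \<inter> V \<and> restrict g W = restrict h W)"
    by (subst S.germ_eq_iff) (use U V in auto)
  also have "\<dots> \<longleftrightarrow> g y = h y"
  proof
    show "g y = h y" if "\<exists>W. openin Y W \<and> y \<in> W \<and> W \<subseteq> U \<inter> V \<and> restrict g W = restrict h W"
      using that by (metis restrict_apply')
  next
    assume eq: "g y = h y"
    obtain A s where A: "openin Y A" "y \<in> A" "A \<subseteq> U" "s \<in> carrier (sections P A)"
      "\<And>z. z \<in> A \<Longrightarrow> g z = germ Y P z A s" using local_sectionsE[OF U(3,2)] by metis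
    obtain B t where B: "openin Y B" "y \<in> B" "B \<subseteq> V" "t \<in> carrier (sections P B)"
      "\<And>z. z \<in> B \<Longrightarrow> h z = germ Y P z B t" using local_sectionsE[OF V(3,2)] by metis
    have "germ Y P y A s = germ Y P y B t" using A B eq by simp
    then obtain W where W: "openin Y W" "y \<in> W" "W \<subseteq> A" "W \<subseteq> B" "restr P A W s = restr P B W t"
      using germ_eq_iff[OF A(1,2,4) B(1,2,4)] by auto
    have "g z = h z" if z: "z \<in> W" for z
    proof -
      have "germ Y P z A s = germ Y P z B t"
        by (rule germ_eqI[OF A(1,4) B(1,4) W(1) z W(3,4,5)])
      then show ?thesis using A(5)[of z] B(5)[of z] W z by (simp add: subset_iff)
    qed
    then have eqW: "restrict g W = restrict h W" by (simp add: fun_eq_iff restrict_def)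
    have "W \<subseteq> U \<inter> V" using W A(3) B(3) by auto
    with W(1,2) eqW show "\<exists>W. openin Y W \<and> y \<in> W \<and> W \<subseteq> U \<inter> V \<and> restrict g W = restrict h W"
      by metis
  qed
  finally show ?thesis .
qed

lemma local_section_through:
  assumes "A \<in> carrier (stalk Y P y)"
  obtains U g where "openin Y U" "y \<in> U" "g \<in> local_sections U" "g y = A"
proof -
  obtain U s where U: "openin Y U" "y \<in> U" "s \<in> carrier (sections P U)" "A = germ Y P y U s"
    using stalk_carrierE[OF assms] by blast
  show ?thesis by (rule that[OF U(1,2) germ_section[OF U(1,3)]]) (use U in auto)
qed

text \<open>Evaluation at \<open>y\<close> identifies the stalks.\<close>

theorem stalk_sheafify:
  "modules_isomorphic R (stalk Y (sheafify Y P) y) (stalk Y P y)"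
proof (rule modules_isomorphicI)
  interpret S: module_presheaf R Y "sheafify Y P" by (rule module_presheaf_sheafify)
  let ?Z = "{(U, g). openin Y U \<and> y \<in> U \<and> g \<in> local_sections U}"
  let ?f = "\<lambda>(U, g). germ Y (sheafify Y P) y U g" and ?g = "\<lambda>(U :: 'b set, g). g y"
  show "?f ` ?Z = carrier (stalk Y (sheafify Y P) y)"
    unfolding stalk_def[of Y "sheafify Y P"] by (auto simp: image_iff)
  show "?g ` ?Z = carrier (stalk Y P y)"
  proof
    show "?g ` ?Z \<subseteq> carrier (stalk Y P y)" using local_sections_stalk by auto
    show "carrier (stalk Y P y) \<subseteq> ?g ` ?Z"
    proof
      fix A assume "A \<in> carrier (stalk Y P y)"
      then obtain U g where U: "openin Y U" "y \<in> U" "g \<in> local_sections U" "g y = A"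
        by (rule local_section_through)
      show "A \<in> ?g ` ?Z" by (rule image_eqI[of _ _ "(U, g)"]) (use U in auto)
    qed
  qed
  show "?f z = ?f w \<longleftrightarrow> ?g z = ?g w" if "z \<in> ?Z" "w \<in> ?Z" for z w
    using that germ_sheafify_eq_iff by (cases z, cases w) auto
  show "\<exists>v\<in>?Z. ?f v = ?f z \<oplus>\<^bsub>stalk Y (sheafify Y P) y\<^esub> ?f w \<and> ?g v = ?g z \<oplus>\<^bsub>stalk Y P y\<^esub> ?g w"
    if z: "z \<in> ?Z" and w: "w \<in> ?Z" for z w
  proof -
    obtain U g where U: "z = (U, g)" "openin Y U" "y \<in> U" "g \<in> local_sections U" using z by auto
    obtain V h where V: "w = (V, h)" "openin Y V" "y \<in> V" "h \<in> local_sections V" using w by auto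
    let ?W = "U \<inter> V"
    let ?s = "restr (sheafify Y P) U ?W g \<oplus>\<^bsub>sections (sheafify Y P) ?W\<^esub> restr (sheafify Y P) V ?W h"
    have o: "openin Y ?W" using U V by auto
    have "?s \<in> carrier (sections (sheafify Y P) ?W)"
      using U V o by (intro S.sections_add_closed S.restr_closed) (simp_all)
    then have m: "?s \<in> local_sections ?W" by simp
    have "?f (?W, ?s) = ?f z \<oplus>\<^bsub>stalk Y (sheafify Y P) y\<^esub> ?f w"
      using S.stalk_add_gen[OF U(2,3) _ V(2,3), of g h] U V by simp
    moreover have "?g (?W, ?s) = ?g z \<oplus>\<^bsub>stalk Y P y\<^esub> ?g w" using U V by simp
    ultimately show ?thesis using m o U V by (intro bexI[of _ "(?W, ?s)"]) blast+
  qed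
  show "\<exists>v\<in>?Z. ?f v = r \<odot>\<^bsub>stalk Y (sheafify Y P) y\<^esub> ?f z \<and> ?g v = r \<odot>\<^bsub>stalk Y P y\<^esub> ?g z"
    if r: "r \<in> carrier R" and z: "z \<in> ?Z" for r z
  proof -
    obtain U g where U: "z = (U, g)" "openin Y U" "y \<in> U" "g \<in> local_sections U" using z by auto
    let ?s = "r \<odot>\<^bsub>sections (sheafify Y P) U\<^esub> g"
    have "?s \<in> carrier (sections (sheafify Y P) U)" using U r by (intro S.sections_smult_closed) simp_all
    then have m: "?s \<in> local_sections U" by simp
    have "?f (U, ?s) = r \<odot>\<^bsub>stalk Y (sheafify Y P) y\<^esub> ?f z"
      using S.stalk_smult[OF r U(2,3), of g] U by simp
    moreover have "?g (U, ?s) = r \<odot>\<^bsub>stalk Y P y\<^esub> ?g z" using U by simp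
    ultimately show ?thesis using m U by (intro bexI[of _ "(U, ?s)"]) blast+
  qed
qed

end

definition stalk_map ::
    "'b topology \<Rightarrow> ('b, 'r, 'z) presheaf \<Rightarrow> ('b set \<Rightarrow> 'x \<Rightarrow> 'z) \<Rightarrow> 'b
      \<Rightarrow> ('b set \<times> 'x) set \<Rightarrow> ('b set \<times> 'z) set" where
  "stalk_map Y Q \<phi> y A = (\<Union>(V, s)\<in>A. germ Y Q y V (\<phi> V s))"

locale presheaf_map = P: module_presheaf R Y P + Q: module_presheaf R Y Q
  for R :: "('r, 'm) ring_scheme" and Y :: "'b topology"
    and P :: "('b, 'r, 'x) presheaf" and Q :: "('b, 'r, 'z) presheaf" +
  fixes \<phi> :: "'b set \<Rightarrow> 'x \<Rightarrow> 'z"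
  assumes map_linear: "openin Y U \<Longrightarrow> linear_map R (sections P U) (sections Q U) (\<phi> U)"
    and map_restr: "openin Y U \<Longrightarrow> openin Y V \<Longrightarrow> V \<subseteq> U \<Longrightarrow> s \<in> carrier (sections P U) \<Longrightarrow>
          \<phi> V (restr P U V s) = restr Q U V (\<phi> U s)"
begin

lemma map_closed: "openin Y U \<Longrightarrow> s \<in> carrier (sections P U) \<Longrightarrow> \<phi> U s \<in> carrier (sections Q U)"
  using linear_map_closed[OF map_linear] .

lemma stalk_map_germ:
  assumes U: "openin Y U" "y \<in> U" "s \<in> carrier (sections P U)"
  shows "stalk_map Y Q \<phi> y (germ Y P y U s) = germ Y Q y U (\<phi> U s)"
proof -
  have "germ Y Q y V (\<phi> V t) = germ Y Q y U (\<phi> U s)" if m: "(V, t) \<in> germ Y P y U s" for V t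
  proof -
    have V: "openin Y V" "y \<in> V" "t \<in> carrier (sections P V)" using P.germ_mem[OF m U] by auto
    obtain W where W: "openin Y W" "y \<in> W" "W \<subseteq> U" "W \<subseteq> V" "restr P U W s = restr P V W t"
      using m unfolding germ_def by blast
    have "restr Q V W (\<phi> V t) = restr Q U W (\<phi> U s)"
      using map_restr[OF V(1) W(1,4) V(3)] map_restr[OF U(1) W(1,3) U(3)] W(5) by simp
    then show ?thesis
      by (intro Q.germ_eqI[OF V(1) map_closed[OF V(1,3)] U(1) map_closed[OF U(1,3)] W(1,2,4,3)])
  qed
  then show ?thesis unfolding stalk_map_def using P.germ_self[OF U] by blast
qed

lemma stalk_map_linear:
  "linear_map R (stalk Y P y) (stalk Y Q y) (stalk_map Y Q \<phi> y)"
  unfolding linear_map_def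
proof (intro conjI ballI)
  fix A assume A: "A \<in> carrier (stalk Y P y)"
  then obtain U s where U: "openin Y U" "y \<in> U" "s \<in> carrier (sections P U)" "A = germ Y P y U s"
    by (rule P.stalk_carrierE)
  show "stalk_map Y Q \<phi> y A \<in> carrier (stalk Y Q y)"
    using U map_closed by (auto simp: stalk_map_germ intro: Q.germ_in_stalk)
  show "stalk_map Y Q \<phi> y (r \<odot>\<^bsub>stalk Y P y\<^esub> A) = r \<odot>\<^bsub>stalk Y Q y\<^esub> stalk_map Y Q \<phi> y A"
    if "r \<in> carrier R" for r
    using U that map_closed[OF U(1)] linear_map_smult[OF map_linear[OF U(1)]]
    by (simp add: stalk_map_germ P.stalk_smult Q.stalk_smult P.sections_smult_closed)
  fix B assume "B \<in> carrier (stalk Y P y)"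
  with A obtain U s t where U: "openin Y U" "y \<in> U" "s \<in> carrier (sections P U)" "t \<in> carrier (sections P U)"
    and e: "A = germ Y P y U s" "B = germ Y P y U t"
    by (metis P.stalk_common_domain3)
  show "stalk_map Y Q \<phi> y (A \<oplus>\<^bsub>stalk Y P y\<^esub> B)
      = stalk_map Y Q \<phi> y A \<oplus>\<^bsub>stalk Y Q y\<^esub> stalk_map Y Q \<phi> y B"
    using U map_closed[OF U(1)] linear_map_add[OF map_linear[OF U(1)]]
    by (simp add: e stalk_map_germ P.stalk_add Q.stalk_add P.sections_add_closed)
qed

lemma sheafify_map_eq: "sheafify_map Y Q \<phi> U g = (\<lambda>z\<in>U. stalk_map Y Q \<phi> z (g z))"
  by (simp add: sheafify_map_def stalk_map_def)

lemma presheaf_map_sheafify: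
  "presheaf_map R Y (sheafify Y P) (sheafify Y Q) (sheafify_map Y Q \<phi>)"
proof (intro presheaf_map.intro presheaf_map_axioms.intro)
  show "module_presheaf R Y (sheafify Y P)" "module_presheaf R Y (sheafify Y Q)"
    by (rule P.module_presheaf_sheafify Q.module_presheaf_sheafify)+
  fix U assume U: "openin Y U"
  show "linear_map R (sections (sheafify Y P) U) (sections (sheafify Y Q) U) (sheafify_map Y Q \<phi> U)"
    unfolding linear_map_def P.sheafify_simps Q.sheafify_simps sheafify_map_eq
  proof (intro conjI ballI)
    fix g assume g: "g \<in> P.local_sections U"
    show "(\<lambda>z\<in>U. stalk_map Y Q \<phi> z (g z)) \<in> Q.local_sections U"
    proof (rule Q.local_sectionsI)
      fix y assume "y \<in> U"
      then obtain V s where V: "openin Y V" "y \<in> V" "V \<subseteq> U" "s \<in> carrier (sections P V)"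
        "\<And>z. z \<in> V \<Longrightarrow> g z = germ Y P z V s" using P.local_sectionsE[OF g] by metis
      then show "\<exists>V s. openin Y V \<and> y \<in> V \<and> s \<in> carrier (sections Q V) \<and>
          (\<forall>z\<in>V \<inter> U. (\<lambda>z\<in>U. stalk_map Y Q \<phi> z (g z)) z = germ Y Q z V s)"
        by (intro exI[of _ V] exI[of _ "\<phi> V s"]) (auto simp: stalk_map_germ map_closed)
    qed (use U in auto)
    show "(\<lambda>z\<in>U. stalk_map Y Q \<phi> z ((\<lambda>z\<in>U. r \<odot>\<^bsub>stalk Y P z\<^esub> g z) z))
        = (\<lambda>z\<in>U. r \<odot>\<^bsub>stalk Y Q z\<^esub> (\<lambda>z\<in>U. stalk_map Y Q \<phi> z (g z)) z)"
      if r: "r \<in> carrier R" for r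
      using P.local_sections_stalk[OF g] linear_map_smult[OF stalk_map_linear r] by (auto simp: fun_eq_iff)
    fix h assume h: "h \<in> P.local_sections U"
    show "(\<lambda>z\<in>U. stalk_map Y Q \<phi> z ((\<lambda>z\<in>U. g z \<oplus>\<^bsub>stalk Y P z\<^esub> h z) z))
        = (\<lambda>z\<in>U. (\<lambda>z\<in>U. stalk_map Y Q \<phi> z (g z)) z \<oplus>\<^bsub>stalk Y Q z\<^esub> (\<lambda>z\<in>U. stalk_map Y Q \<phi> z (h z)) z)"
      using P.local_sections_stalk[OF g] P.local_sections_stalk[OF h] linear_map_add[OF stalk_map_linear]
      by (auto simp: fun_eq_iff)
  qed
  fix V g assume "V \<subseteq> U"
  then show "sheafify_map Y Q \<phi> V (restr (sheafify Y P) U V g) = restr (sheafify Y Q) U V (sheafify_map Y Q \<phi> U g)"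
    by (auto simp: sheafify_map_eq fun_eq_iff)
qed

end

text \<open>The presheaf \<open>cohomology_presheaf\<close> for three consecutive terms, whose sections may have three
  different types.\<close>

definition homology_presheaf ::
    "('b, 'r, 'x) presheaf \<Rightarrow> ('b set \<Rightarrow> 'x \<Rightarrow> 'y) \<Rightarrow> ('b, 'r, 'y) presheaf
      \<Rightarrow> ('b set \<Rightarrow> 'y \<Rightarrow> 'z) \<Rightarrow> ('b, 'r, 'z) presheaf \<Rightarrow> ('b, 'r, 'y set) presheaf" where
  "homology_presheaf A f B g C =
     \<lparr>sections = (\<lambda>U. homology_at (sections A U) (f U) (sections B U) (g U) (sections C U)),
      restr = (\<lambda>U V. coset_map (sections B V) (f V ` carrier (sections A V)) (restr B U V))\<rparr>"

lemma cohomology_presheaf_eq: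
  "cohomology_presheaf F d i = homology_presheaf (F (i - 1)) (d (i - 1)) (F i) (d i) (F (i + 1))"
  by (simp add: cohomology_presheaf_def homology_presheaf_def)

locale three_term_presheaves = f: presheaf_map R Y A B f + g: presheaf_map R Y B C g
  for R :: "('r, 'm) ring_scheme" and Y :: "'b topology" and A :: "('b, 'r, 'x) presheaf"
    and f and B :: "('b, 'r, 'y) presheaf" and g and C :: "('b, 'r, 'z) presheaf" +
  assumes gf: "openin Y U \<Longrightarrow> s \<in> carrier (sections A U) \<Longrightarrow> g U (f U s) = \<zero>\<^bsub>sections C U\<^esub>"
begin

abbreviation "H \<equiv> homology_presheaf A f B g C"
abbreviation "hclass U \<equiv> homology_class (sections A U) (f U) (sections B U)"
definition "cocycles U = {s \<in> carrier (sections B U). g U s = \<zero>\<^bsub>sections C U\<^esub>}"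

lemma complex_at:
  "openin Y U \<Longrightarrow> three_term_complex R (sections A U) (f U) (sections B U) (g U) (sections C U)"
  by (intro three_term_complex.intro)
     (auto simp: gf f.P.sections_module f.Q.sections_module g.Q.sections_module f.map_linear g.map_linear)

lemma cycles_at: "openin Y U \<Longrightarrow> three_term_complex.cycles (sections B U) (g U) (sections C U) = cocycles U"
  using three_term_complex.cycles_def[OF complex_at] by (simp add: cocycles_def)

lemma restr_cocycles:
  assumes "openin Y U" "openin Y V" "V \<subseteq> U" "s \<in> cocycles U"
  shows "restr B U V s \<in> cocycles V"
  using assms f.Q.restr_closed g.map_restr
    linear_map_zero[OF g.Q.sections_module g.Q.sections_module g.Q.restr_linear]
  by (simp add: cocycles_def)

lemma linear_restr_cocycles:
  assumes "openin Y U" "openin Y V" "V \<subseteq> U"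
  shows "linear_map R (sections B U\<lparr>carrier := cocycles U\<rparr>) (sections B V\<lparr>carrier := cocycles V\<rparr>) (restr B U V)"
  using linear_mapD[OF f.Q.restr_linear[OF assms]] restr_cocycles[OF assms]
  unfolding linear_map_def by (auto simp: cocycles_def)

lemma restr_boundaries:
  assumes "openin Y U" "openin Y V" "V \<subseteq> U"
  shows "restr B U V ` f U ` carrier (sections A U) \<subseteq> f V ` carrier (sections A V)"
  using f.map_restr[OF assms, symmetric] f.P.restr_closed[OF assms] by auto

lemma coset_map_cocycles:
  "coset_map (sections B V) N \<phi> = coset_map (sections B V\<lparr>carrier := cocycles V\<rparr>) N \<phi>"
  unfolding coset_map_def by (auto simp: fun_eq_iff mem_a_r_coset)

lemma restr_hclass:
  assumes "openin Y U" "openin Y V" "V \<subseteq> U" "s \<in> cocycles U"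
  shows "restr H U V (hclass U s) = hclass V (restr B U V s)"
proof -
  interpret u: three_term_complex R "sections A U" "f U" "sections B U" "g U" "sections C U"
    by (rule complex_at) fact
  interpret v: three_term_complex R "sections A V" "f V" "sections B V" "g V" "sections C V"
    by (rule complex_at) fact
  show ?thesis
    using coset_map_coset[OF u.left_module_cycles u.boundaries_submodule v.left_module_cycles
        v.boundaries_submodule, unfolded cycles_at[OF assms(1)] cycles_at[OF assms(2)],
        OF linear_restr_cocycles[OF assms(1-3)] restr_boundaries[OF assms(1-3)]] assms(4)
    by (simp add: homology_presheaf_def coset_map_cocycles coset_carrier_update)
qed

lemma carrier_H: "openin Y U \<Longrightarrow> carrier (sections H U) = hclass U ` cocycles U"
  using three_term_complex.carrier_homology[OF complex_at] cycles_at
  by (simp add: homology_presheaf_def)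

lemma module_presheaf_H: "module_presheaf R Y H"
proof (intro module_presheaf.intro)
  show "ring R" by (rule f.P.base_ring)
  fix U assume U: "openin Y U"
  interpret u: three_term_complex R "sections A U" "f U" "sections B U" "g U" "sections C U"
    by (rule complex_at) fact
  show "left_module R (sections H U)"
    using u.left_module_homology by (simp add: homology_presheaf_def)
  show "restr H U U c = c" if c: "c \<in> carrier (sections H U)" for c
    using c U restr_hclass[OF U U order_refl] f.Q.restr_id[OF U]
    by (auto simp: carrier_H cocycles_def)
  {
    fix V assume V: "openin Y V" "V \<subseteq> U"
    interpret v: three_term_complex R "sections A V" "f V" "sections B V" "g V" "sections C V"
      by (rule complex_at) fact
    show "linear_map R (sections H U) (sections H V) (restr H U V)"
      using linear_map_coset_map[OF u.left_module_cycles u.boundaries_submodule v.left_module_cycles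
        v.boundaries_submodule, unfolded cycles_at[OF U] cycles_at[OF V(1)],
        OF linear_restr_cocycles[OF U V] restr_boundaries[OF U V]]
        u.homology_at_eq[unfolded cycles_at[OF U]] v.homology_at_eq[unfolded cycles_at[OF V(1)]]
      by (simp add: homology_presheaf_def coset_map_cocycles)
  }
next
  fix U V W :: "'b set" and c
  assume o: "openin Y U" "openin Y V" "openin Y W" "W \<subseteq> V" "V \<subseteq> U" and "c \<in> carrier (sections H U)"
  then obtain s where s: "s \<in> cocycles U" "c = hclass U s" using carrier_H by auto
  have "s \<in> carrier (sections B U)" using s by (simp add: cocycles_def)
  then show "restr H V W (restr H U V c) = restr H U W c"
    using o s restr_cocycles[OF o(1,2,5)] f.Q.restr_comp[OF o] by (simp add: restr_hclass)
qed

lemma stalk_complex: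
  assumes y: "y \<in> topspace Y"
  shows "three_term_complex R (stalk Y A y) (stalk_map Y B f y) (stalk Y B y) (stalk_map Y C g y) (stalk Y C y)"
proof (intro three_term_complex.intro)
  fix a assume "a \<in> carrier (stalk Y A y)"
  then obtain U s where U: "openin Y U" "y \<in> U" "s \<in> carrier (sections A U)" "a = germ Y A y U s"
    by (rule f.P.stalk_carrierE)
  then show "stalk_map Y C g y (stalk_map Y B f y a) = \<zero>\<^bsub>stalk Y C y\<^esub>"
    using g.Q.stalk_zero[OF U(1,2)] by (simp add: f.stalk_map_germ g.stalk_map_germ f.map_closed gf)
qed (use y in \<open>auto simp: f.P.left_module_stalk f.Q.left_module_stalk g.Q.left_module_stalk
        f.stalk_map_linear g.stalk_map_linear\<close>)

lemma three_term_presheaves_sheafify: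
  "three_term_presheaves R Y (sheafify Y A) (sheafify_map Y B f) (sheafify Y B)
     (sheafify_map Y C g) (sheafify Y C)"
proof (intro three_term_presheaves.intro three_term_presheaves_axioms.intro
        f.presheaf_map_sheafify g.presheaf_map_sheafify)
  fix U h assume U: "openin Y U" and h: "h \<in> carrier (sections (sheafify Y A) U)"
  have "stalk_map Y C g z (stalk_map Y B f z (h z)) = \<zero>\<^bsub>stalk Y C z\<^esub>" if "z \<in> U" for z
  proof -
    have z: "z \<in> topspace Y" using U that openin_subset by blast
    show ?thesis
      using three_term_complex.gf[OF stalk_complex[OF z]] h that f.P.local_sections_stalk by simp
  qed
  then show "sheafify_map Y C g U (sheafify_map Y B f U h) = \<zero>\<^bsub>sections (sheafify Y C) U\<^esub>"
    by (auto simp: f.sheafify_map_eq g.sheafify_map_eq fun_eq_iff)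
qed

text \<open>Germs determine both sides. A section of the sheaf of cocycles has a value at \<open>y\<close>, which is a
  cycle in the complex of stalks, and every such cycle extends to a section near \<open>y\<close>. If the values at \<open>y\<close>
  of two sections differ by a boundary in the complex of stalks, then this boundary also extends, so
  that the sections differ by a coboundary near \<open>y\<close>.\<close>

theorem stalk_homology_sheafify:
  assumes y: "y \<in> topspace Y"
  shows "modules_isomorphic R
    (stalk Y (homology_presheaf (sheafify Y A) (sheafify_map Y B f) (sheafify Y B)
                (sheafify_map Y C g) (sheafify Y C)) y)
    (homology_at (stalk Y A y) (stalk_map Y B f y) (stalk Y B y) (stalk_map Y C g y) (stalk Y C y))"
proof -
  interpret S: three_term_presheaves R Y "sheafify Y A" "sheafify_map Y B f" "sheafify Y B"
    "sheafify_map Y C g" "sheafify Y C" by (rule three_term_presheaves_sheafify)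
  interpret H: module_presheaf R Y S.H by (rule S.module_presheaf_H)
  interpret T: three_term_complex R "stalk Y A y" "stalk_map Y B f y" "stalk Y B y"
    "stalk_map Y C g y" "stalk Y C y" by (rule stalk_complex[OF y])
  let ?T = "homology_at (stalk Y A y) (stalk_map Y B f y) (stalk Y B y) (stalk_map Y C g y) (stalk Y C y)"
  define Z where "Z = {(U, h). openin Y U \<and> y \<in> U \<and> h \<in> S.cocycles U}"
  define F where "F = (\<lambda>(U, h). germ Y S.H y U (S.hclass U h))"
  define G where "G = (\<lambda>(U :: 'b set, h). homology_class (stalk Y A y) (stalk_map Y B f y) (stalk Y B y) (h y))"
  have cocyc: "h \<in> f.Q.local_sections U" "h y \<in> T.cycles" if "openin Y U" "y \<in> U" "h \<in> S.cocycles U" for U h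
  proof -
    show h: "h \<in> f.Q.local_sections U" using that by (simp add: S.cocycles_def)
    have "sheafify_map Y C g U h y = \<zero>\<^bsub>sections (sheafify Y C) U\<^esub> y" using that by (simp add: S.cocycles_def)
    then show "h y \<in> T.cycles"
      using that f.Q.local_sections_stalk[OF h] by (simp add: g.sheafify_map_eq T.cycles_def)
  qed
  have Hin: "S.hclass U h \<in> carrier (sections S.H U)" if "openin Y U" "h \<in> S.cocycles U" for U h
    using that by (simp add: S.carrier_H)
  show ?thesis
  proof (rule modules_isomorphicI[of F Z _ G])
    show "F ` Z = carrier (stalk Y S.H y)"
    proof
      show "F ` Z \<subseteq> carrier (stalk Y S.H y)"
        by (auto simp: F_def Z_def simp del: f.P.sheafify_simps intro!: H.germ_in_stalk Hin)
      show "carrier (stalk Y S.H y) \<subseteq> F ` Z"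
      proof
        fix c assume "c \<in> carrier (stalk Y S.H y)"
        then obtain U k where U: "openin Y U" "y \<in> U" "k \<in> carrier (sections S.H U)" "c = germ Y S.H y U k"
          by (rule H.stalk_carrierE)
        then obtain h where "h \<in> S.cocycles U" "k = S.hclass U h" by (auto simp: S.carrier_H)
        with U show "c \<in> F ` Z" by (auto simp: F_def Z_def intro!: image_eqI[of _ _ "(U, h)"])
      qed
    qed
    show "G ` Z = carrier ?T"
    proof
      show "G ` Z \<subseteq> carrier ?T"
        using cocyc by (auto simp: G_def Z_def T.carrier_homology)
      show "carrier ?T \<subseteq> G ` Z"
      proof
        fix c assume "c \<in> carrier ?T"
        then obtain b where b: "b \<in> T.cycles" "c = homology_class (stalk Y A y) (stalk_map Y B f y) (stalk Y B y) b"
          by (auto simp: T.carrier_homology)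
        then have "b \<in> carrier (stalk Y B y)" "stalk_map Y C g y b = \<zero>\<^bsub>stalk Y C y\<^esub>"
          by (auto simp: T.cycles_def)
        then obtain U s where U: "openin Y U" "y \<in> U" "s \<in> carrier (sections B U)" "b = germ Y B y U s"
          by (metis f.Q.stalk_carrierE)
        have "germ Y C y U (g U s) = germ Y C y U \<zero>\<^bsub>sections C U\<^esub>"
          using \<open>stalk_map Y C g y b = \<zero>\<^bsub>stalk Y C y\<^esub>\<close> U g.Q.stalk_zero[OF U(1,2)]
          by (simp add: g.stalk_map_germ)
        then obtain W where W: "openin Y W" "y \<in> W" "W \<subseteq> U"
          and eq: "restr C U W (g U s) = restr C U W \<zero>\<^bsub>sections C U\<^esub>"
          using g.Q.germ_eq_iff[of U y "g U s" U "\<zero>\<^bsub>sections C U\<^esub>"] U g.map_closed g.Q.sections_zero_closed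
          by auto
        define t where "t = restr B U W s"
        have t: "t \<in> carrier (sections B W)"
          unfolding t_def by (rule f.Q.restr_closed[OF U(1) W(1,3) U(3)])
        have gt: "g W t = \<zero>\<^bsub>sections C W\<^esub>"
          using g.map_restr[OF U(1) W(1,3) U(3)] eq
            linear_map_zero[OF g.Q.sections_module g.Q.sections_module g.Q.restr_linear] U W
          by (simp add: t_def)
        define h where "h = (\<lambda>z\<in>W. germ Y B z W t)"
        have "h \<in> f.Q.local_sections W" unfolding h_def by (rule f.Q.germ_section[OF W(1) t])
        moreover have "sheafify_map Y C g W h = \<zero>\<^bsub>sections (sheafify Y C) W\<^esub>"
          using W(1) t gt g.Q.stalk_zero[OF W(1)]
          by (auto simp: g.sheafify_map_eq h_def fun_eq_iff g.stalk_map_germ)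
        ultimately have "h \<in> S.cocycles W" by (simp add: S.cocycles_def)
        moreover have "h y = b"
          using f.Q.germ_restr[OF U(1,3) W(1,2,3)] W U by (simp add: h_def t_def)
        ultimately show "c \<in> G ` Z"
          using W b by (auto simp: G_def Z_def intro!: image_eqI[of _ _ "(W, h)"])
      qed
    qed
    show "F z = F w \<longleftrightarrow> G z = G w" if z: "z \<in> Z" and w: "w \<in> Z" for z w
    proof -
      obtain U h where U: "z = (U, h)" "openin Y U" "y \<in> U" "h \<in> S.cocycles U" using z by (auto simp: Z_def)
      obtain V k where V: "w = (V, k)" "openin Y V" "y \<in> V" "k \<in> S.cocycles V" using w by (auto simp: Z_def)
      note hc = cocyc[OF U(2-4)] and kc = cocyc[OF V(2-4)]
      have restr: "restr S.H X W (S.hclass X x) = S.hclass W (restrict x W)" "restrict x W \<in> S.cocycles W"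
        if "openin Y X" "openin Y W" "W \<subseteq> X" "x \<in> S.cocycles X" for X W x
        using S.restr_hclass[OF that] S.restr_cocycles[OF that] by simp_all
      have "F z = F w \<longleftrightarrow> (\<exists>W. openin Y W \<and> y \<in> W \<and> W \<subseteq> U \<inter> V \<and>
              restr S.H U W (S.hclass U h) = restr S.H V W (S.hclass V k))"
        unfolding F_def U V prod.case
        by (rule H.germ_eq_iff) (use U V Hin in auto)
      also have "\<dots> \<longleftrightarrow> (\<exists>W. openin Y W \<and> y \<in> W \<and> W \<subseteq> U \<inter> V \<and>
              S.hclass W (restrict h W) = S.hclass W (restrict k W))"
        using restr U V by (auto cong: conj_cong)
      also have "\<dots> \<longleftrightarrow> (\<exists>W. openin Y W \<and> y \<in> W \<and> W \<subseteq> U \<inter> V \<and> (\<exists>a\<in>f.P.local_sections W.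
              restrict h W = restrict k W \<oplus>\<^bsub>sections (sheafify Y B) W\<^esub> sheafify_map Y B f W a))"
        using three_term_complex.homology_class_eq_iff[OF S.complex_at, unfolded S.cycles_at] restr(2) U V
        by (auto cong: conj_cong simp: S.cycles_at)
      also have "\<dots> \<longleftrightarrow> (\<exists>a\<in>carrier (stalk Y A y). h y = k y \<oplus>\<^bsub>stalk Y B y\<^esub> stalk_map Y B f y a)"
      proof
        assume "\<exists>W. openin Y W \<and> y \<in> W \<and> W \<subseteq> U \<inter> V \<and> (\<exists>a\<in>f.P.local_sections W.
              restrict h W = restrict k W \<oplus>\<^bsub>sections (sheafify Y B) W\<^esub> sheafify_map Y B f W a)"
        then obtain W a where W: "y \<in> W" "a \<in> f.P.local_sections W"
          and eq: "restrict h W = restrict k W \<oplus>\<^bsub>sections (sheafify Y B) W\<^esub> sheafify_map Y B f W a"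
          by auto
        from fun_cong[OF eq, of y] W show "\<exists>a\<in>carrier (stalk Y A y). h y = k y \<oplus>\<^bsub>stalk Y B y\<^esub> stalk_map Y B f y a"
          using f.P.local_sections_stalk[OF W(2,1)]
          by (intro bexI[of _ "a y"]) (simp_all add: f.sheafify_map_eq)
      next
        assume "\<exists>a\<in>carrier (stalk Y A y). h y = k y \<oplus>\<^bsub>stalk Y B y\<^esub> stalk_map Y B f y a"
        then obtain a where a: "a \<in> carrier (stalk Y A y)" "h y = k y \<oplus>\<^bsub>stalk Y B y\<^esub> stalk_map Y B f y a"
          by blast
        obtain X l where X: "openin Y X" "y \<in> X" "l \<in> f.P.local_sections X" "l y = a"
          using f.P.local_section_through[OF a(1)] by metis
        let ?W = "X \<inter> (U \<inter> V)"
        let ?k = "restrict k ?W \<oplus>\<^bsub>sections (sheafify Y B) ?W\<^esub> sheafify_map Y B f ?W (restrict l ?W)"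
        have o: "openin Y ?W" "y \<in> ?W" using X U V by auto
        have lW: "restrict l ?W \<in> f.P.local_sections ?W" by (rule f.P.restrict_local_sections[OF o(1) _ X(3)]) auto
        have hW: "restrict h ?W \<in> f.Q.local_sections ?W" by (rule f.Q.restrict_local_sections[OF o(1) _ hc(1)]) auto
        have kW: "restrict k ?W \<in> f.Q.local_sections ?W" by (rule f.Q.restrict_local_sections[OF o(1) _ kc(1)]) auto
        have "sheafify_map Y B f ?W (restrict l ?W) \<in> carrier (sections (sheafify Y B) ?W)"
          by (rule S.f.map_closed[OF o(1)]) (simp only: f.P.sheafify_simps(1) lW)
        moreover have "restrict k ?W \<in> carrier (sections (sheafify Y B) ?W)"
          by (simp only: f.Q.sheafify_simps(1) kW)
        ultimately have kk: "?k \<in> f.Q.local_sections ?W"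
          using S.f.Q.sections_add_closed[OF o(1)] unfolding f.Q.sheafify_simps(1) by blast
        have "restrict h ?W y = ?k y" using o(2) a X by (simp add: f.sheafify_map_eq)
        then have "germ Y (sheafify Y B) y ?W (restrict h ?W) = germ Y (sheafify Y B) y ?W ?k"
          using f.Q.germ_sheafify_eq_iff[OF o hW o kk] by blast
        then obtain W where W: "openin Y W" "y \<in> W" "W \<subseteq> ?W" "restrict (restrict h ?W) W = restrict ?k W"
          using S.f.Q.germ_eq_iff[of ?W y "restrict h ?W" ?W ?k] o hW kk by auto
        have "restrict h W = restrict k W \<oplus>\<^bsub>sections (sheafify Y B) W\<^esub> sheafify_map Y B f W (restrict l W)"
        proof
          fix z show "restrict h W z = (restrict k W \<oplus>\<^bsub>sections (sheafify Y B) W\<^esub> sheafify_map Y B f W (restrict l W)) z"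
          proof (cases "z \<in> W")
            case True
            then have "z \<in> X" "z \<in> U" "z \<in> V" using W(3) by auto
            with True show ?thesis using fun_cong[OF W(4), of z] by (simp add: f.sheafify_map_eq)
          qed (simp add: f.sheafify_map_eq)
        qed
        moreover have "restrict l W \<in> f.P.local_sections W"
          by (rule f.P.restrict_local_sections[OF W(1) _ X(3)]) (use W in auto)
        moreover have "W \<subseteq> U \<inter> V" using W by auto
        ultimately show "\<exists>W. openin Y W \<and> y \<in> W \<and> W \<subseteq> U \<inter> V \<and> (\<exists>a\<in>f.P.local_sections W.
              restrict h W = restrict k W \<oplus>\<^bsub>sections (sheafify Y B) W\<^esub> sheafify_map Y B f W a)"
          using W(1,2) by (intro exI[of _ W] conjI bexI[of _ "restrict l W"])
      qed
      also have "\<dots> \<longleftrightarrow> G z = G w"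
        using T.homology_class_eq_iff[OF hc(2) kc(2)] by (simp add: G_def U V)
      finally show ?thesis .
    qed
    show "\<exists>v\<in>Z. F v = F z \<oplus>\<^bsub>stalk Y S.H y\<^esub> F w \<and> G v = G z \<oplus>\<^bsub>?T\<^esub> G w"
      if z: "z \<in> Z" and w: "w \<in> Z" for z w
    proof -
      obtain U h where U: "z = (U, h)" "openin Y U" "y \<in> U" "h \<in> S.cocycles U" using z by (auto simp: Z_def)
      obtain V k where V: "w = (V, k)" "openin Y V" "y \<in> V" "k \<in> S.cocycles V" using w by (auto simp: Z_def)
      let ?W = "U \<inter> V"
      have o: "openin Y ?W" "y \<in> ?W" "?W \<subseteq> U" "?W \<subseteq> V" using U V by auto
      interpret c: three_term_complex R "sections (sheafify Y A) ?W" "sheafify_map Y B f ?W"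
        "sections (sheafify Y B) ?W" "sheafify_map Y C g ?W" "sections (sheafify Y C) ?W"
        by (rule S.complex_at[OF o(1)])
      have hW: "restrict h ?W \<in> S.cocycles ?W" using S.restr_cocycles[OF U(2) o(1,3) U(4)] by simp
      have kW: "restrict k ?W \<in> S.cocycles ?W" using S.restr_cocycles[OF V(2) o(1,4) V(4)] by simp
      define s where "s = restrict h ?W \<oplus>\<^bsub>sections (sheafify Y B) ?W\<^esub> restrict k ?W"
      have s: "s \<in> S.cocycles ?W"
        using c.cycles_submodule hW kW unfolding S.cycles_at[OF o(1)] submodule_of_def s_def by blast
      have "S.hclass ?W s = S.hclass ?W (restrict h ?W) \<oplus>\<^bsub>sections S.H ?W\<^esub> S.hclass ?W (restrict k ?W)"
        using c.homology_class_add[unfolded S.cycles_at[OF o(1)], OF hW kW]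
        by (simp add: homology_presheaf_def s_def)
      then have "F (?W, s) = F z \<oplus>\<^bsub>stalk Y S.H y\<^esub> F w"
        using H.stalk_add_gen[OF U(2,3) Hin[OF U(2,4)] V(2,3) Hin[OF V(2,4)]]
          S.restr_hclass[OF U(2) o(1,3) U(4)] S.restr_hclass[OF V(2) o(1,4) V(4)]
        by (simp add: F_def U V)
      moreover have "G (?W, s) = G z \<oplus>\<^bsub>?T\<^esub> G w"
        using T.homology_class_add[OF cocyc(2)[OF U(2-4)] cocyc(2)[OF V(2-4)]] o(2)
        by (simp add: G_def U V s_def)
      ultimately show ?thesis using o s by (intro bexI[of _ "(?W, s)"]) (auto simp: Z_def)
    qed
    show "\<exists>v\<in>Z. F v = r \<odot>\<^bsub>stalk Y S.H y\<^esub> F z \<and> G v = r \<odot>\<^bsub>?T\<^esub> G z"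
      if r: "r \<in> carrier R" and z: "z \<in> Z" for r z
    proof -
      obtain U h where U: "z = (U, h)" "openin Y U" "y \<in> U" "h \<in> S.cocycles U" using z by (auto simp: Z_def)
      interpret c: three_term_complex R "sections (sheafify Y A) U" "sheafify_map Y B f U"
        "sections (sheafify Y B) U" "sheafify_map Y C g U" "sections (sheafify Y C) U"
        by (rule S.complex_at[OF U(2)])
      define s where "s = r \<odot>\<^bsub>sections (sheafify Y B) U\<^esub> h"
      have s: "s \<in> S.cocycles U"
        using c.cycles_submodule U r unfolding S.cycles_at[OF U(2)] submodule_of_def s_def by blast
      have "S.hclass U s = r \<odot>\<^bsub>sections S.H U\<^esub> S.hclass U h"
        using c.homology_class_smult[unfolded S.cycles_at[OF U(2)], OF r U(4)]
        by (simp add: homology_presheaf_def s_def)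
      then have "F (U, s) = r \<odot>\<^bsub>stalk Y S.H y\<^esub> F z"
        using H.stalk_smult[OF r U(2,3) Hin[OF U(2,4)]] by (simp add: F_def U)
      moreover have "G (U, s) = r \<odot>\<^bsub>?T\<^esub> G z"
        using T.homology_class_smult[OF r cocyc(2)[OF U(2-4)]] U(3) by (simp add: G_def U s_def)
      ultimately show ?thesis using U s by (intro bexI[of _ "(U, s)"]) (auto simp: Z_def)
    qed
  qed
qed

end

section \<open>Subdividing into stars of vertices\<close>

definition support :: "(nat \<Rightarrow> real) \<Rightarrow> nat set" where
  "support t = {l. t l \<noteq> 0}"

abbreviation identity_simplex :: "nat \<Rightarrow> (nat \<Rightarrow> real) \<Rightarrow> nat \<Rightarrow> real" where
  "identity_simplex p \<equiv> restrict id (standard_simplex p)"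

abbreviation std_simplex :: "nat \<Rightarrow> (nat \<Rightarrow> real) topology" where
  "std_simplex p \<equiv> subtopology (powertop_real UNIV) (standard_simplex p)"

definition center :: "nat \<Rightarrow> nat \<Rightarrow> real" where
  "center p = (\<lambda>i. if i \<le> p then 1 / real (Suc p) else 0)"

lemma center_in: "center p \<in> standard_simplex p"
  by (simp add: center_def standard_simplex_def del: of_nat_Suc)

text \<open>The coning point in the recursion of \<open>simplicial_subdivision\<close>.\<close>

definition barycentre :: "nat \<Rightarrow> ((nat \<Rightarrow> real) \<Rightarrow> nat \<Rightarrow> real) \<Rightarrow> nat \<Rightarrow> real" where
  "barycentre p f = (\<lambda>i. (\<Sum>j\<le>p. simplicial_vertex j f i) / real (Suc p))"

lemma barycentre_eq:
  assumes "simplicial_simplex p S f"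
  shows "barycentre p f = f (center p)"
proof -
  obtain l where l: "f = oriented_simplex p l" using assms by (auto simp: simplicial_simplex)
  have "barycentre p f = (\<lambda>i. (\<Sum>j\<le>p. l j i) / real (Suc p))"
    by (simp add: barycentre_def l simplicial_vertex_oriented_simplex)
  also have "\<dots> = (\<lambda>i. \<Sum>j\<le>p. l j i * center p j)"
    by (simp add: sum_divide_distrib center_def)
  also have "\<dots> = f (center p)" using center_in by (simp add: l oriented_simplex_def)
  finally show ?thesis .
qed

lemma barycentre_in: "simplicial_simplex p S f \<Longrightarrow> barycentre p f \<in> S"
  using barycentre_eq[of p S f] center_in[of p] by (auto simp: simplicial_simplex)

text \<open>The part of the barycentric subdivision that consists of the stars of the vertices satisfying
  \<open>P\<close>. The recursion is the one of \<open>simplicial_subdivision\<close>, with the test at the bottom: each simplex of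
  the subdivision has exactly one original vertex, its last one.\<close>

primrec star_subdivision ::
    "((nat \<Rightarrow> real) \<Rightarrow> bool) \<Rightarrow> nat \<Rightarrow> (nat \<Rightarrow> real) chain \<Rightarrow> (nat \<Rightarrow> real) chain" where
  "star_subdivision P 0 = frag_extend (\<lambda>f. if P (simplicial_vertex 0 f) then frag_of f else 0)"
| "star_subdivision P (Suc p) =
     frag_extend (\<lambda>f. simplicial_cone p (barycentre (Suc p) f)
                        (star_subdivision P p (chain_boundary (Suc p) (frag_of f))))"

lemma star_subdivision_0 [simp]: "star_subdivision P p 0 = 0"
  by (cases p) auto

lemma star_subdivision_diff:
  "star_subdivision P p (a - b) = star_subdivision P p a - star_subdivision P p b"
  by (cases p) (auto simp: frag_extend_diff)

lemma star_subdivision_extend: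
  "star_subdivision P p c = frag_extend (\<lambda>f. star_subdivision P p (frag_of f)) c"
  by (cases p) simp_all

lemma simplicial_cone_add: "simplicial_cone p v (a + b) = simplicial_cone p v a + simplicial_cone p v b"
  by (simp add: simplicial_cone_def frag_extend_add)

lemma simplicial_cone_0 [simp]: "simplicial_cone p v 0 = 0"
  by (simp add: simplicial_cone_def)

lemma frag_extend_plus: "frag_extend f c + frag_extend g c = frag_extend (\<lambda>x. f x + g x) c"
proof -
  have "Poly_Mapping.keys c \<subseteq> UNIV" by simp
  then show ?thesis
    by (induction rule: frag_induction) (auto simp: frag_extend_diff algebra_simps)
qed

lemma star_subdivision_compl:
  "star_subdivision P p c + star_subdivision (\<lambda>t. \<not> P t) p c = simplicial_subdivision p c"
proof (induction p arbitrary: c)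
  case 0
  have "frag_extend (\<lambda>f. (if P (simplicial_vertex 0 f) then frag_of f else 0) +
      (if \<not> P (simplicial_vertex 0 f) then frag_of f else 0)) c = frag_extend frag_of c"
    by (rule frag_extend_eq) simp
  then show ?case
    using frag_expansion[of c]
    by (simp only: frag_extend_plus star_subdivision.simps simplicial_subdivision.simps id_apply)
next
  case (Suc p)
  have b: "barycentre (Suc p) f = (\<lambda>i. (\<Sum>j\<le>Suc p. simplicial_vertex j f i) / (p + 2))" for f
    by (simp add: barycentre_def add.commute)
  show ?case
    by (simp add: frag_extend_plus simplicial_cone_add[symmetric] Suc b add.commute del: sum.atMost_Suc)
qed

lemma star_subdivision_True: "star_subdivision (\<lambda>t. True) p c = simplicial_subdivision p c"
proof -
  have "star_subdivision (\<lambda>t. False) p c = 0"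
  proof (induction p arbitrary: c)
    case (Suc p)
    then show ?case by (simp add: frag_extend_eq_0)
  qed (simp add: frag_extend_eq_0)
  then show ?thesis using star_subdivision_compl[of "\<lambda>t. True" p c] by simp
qed

lemma keys_chain_boundary_of:
  "Poly_Mapping.keys (chain_boundary p (frag_of f)) \<subseteq> {singular_face p k f | k. k \<le> p \<and> 0 < p}"
proof (cases "p = 0")
  case False
  then have "Poly_Mapping.keys (chain_boundary p (frag_of f))
      \<subseteq> (\<Union>k\<in>{..p}. Poly_Mapping.keys (frag_cmul ((-1) ^ k) (frag_of (singular_face p k f))))"
    by (simp add: chain_boundary_of keys_sum)
  also have "\<dots> \<subseteq> {singular_face p k f | k. k \<le> p \<and> 0 < p}"
    using False by (auto simp: keys_frag_of)
  finally show ?thesis .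
qed (simp add: chain_boundary_def)

lemma simplicial_chain_star_subdivision:
  "simplicial_chain p (standard_simplex s) c \<Longrightarrow>
     simplicial_chain p (standard_simplex s) (star_subdivision P p c)"
proof (induction p arbitrary: c)
  case 0
  then have "Poly_Mapping.keys (star_subdivision P 0 c) \<subseteq> Poly_Mapping.keys c"
    using keys_frag_extend[of "\<lambda>f. if P (simplicial_vertex 0 f) then frag_of f else 0" c]
    by (fastforce simp: keys_frag_of split: if_splits)
  then show ?case using 0 by (auto simp: simplicial_chain_def)
next
  case (Suc p)
  show ?case
    using Suc.prems[unfolded simplicial_chain_def]
  proof (induction rule: frag_induction)
    case (one f)
    then have f: "simplicial_simplex (Suc p) (standard_simplex s) f" by simp
    then have "simplicial_chain p (standard_simplex s) (chain_boundary (Suc p) (frag_of f))"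
      using simplicial_chain_boundary[of "Suc p" "standard_simplex s" "frag_of f"] by simp
    then have "simplicial_chain p (standard_simplex s) (star_subdivision P p (chain_boundary (Suc p) (frag_of f)))"
      by (rule Suc.IH)
    then show ?case
      by (auto intro!: simplicial_chain_simplicial_cone convex_standard_simplex barycentre_in[OF f])
  next
    case (diff a b)
    then show ?case by (metis simplicial_chain_diff star_subdivision_diff)
  qed simp
qed

lemma star_subdivision_cong:
  assumes "simplicial_chain p S c" and PQ: "\<And>t. t \<in> S \<Longrightarrow> P t = Q t"
  shows "star_subdivision P p c = star_subdivision Q p c"
  using assms(1)
proof (induction p arbitrary: c)
  case 0
  have "P (simplicial_vertex 0 f) = Q (simplicial_vertex 0 f)" if "f \<in> Poly_Mapping.keys c" for f
  proof (rule PQ)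
    have "simplicial_simplex 0 S f" using 0 that by (auto simp: simplicial_chain_def)
    then have "f ` standard_simplex 0 \<subseteq> S" by (simp add: simplicial_simplex)
    then show "simplicial_vertex 0 f \<in> S" by (simp add: simplicial_vertex_def image_subset_iff)
  qed
  then show ?case by (auto intro: frag_extend_eq)
next
  case (Suc p)
  have "star_subdivision P p (chain_boundary (Suc p) (frag_of f)) = star_subdivision Q p (chain_boundary (Suc p) (frag_of f))"
    if "f \<in> Poly_Mapping.keys c" for f
  proof (rule Suc.IH)
    have "simplicial_chain (Suc p) S (frag_of f)" using Suc.prems that by (auto simp: simplicial_chain_def)
    then show "simplicial_chain p S (chain_boundary (Suc p) (frag_of f))"
      using simplicial_chain_boundary[of "Suc p" S "frag_of f"] by simp
  qed
  then show ?case by (auto intro: frag_extend_eq)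
qed

lemma simplicial_vertex_face:
  assumes f: "simplicial_simplex p S f" and k: "1 \<le> p" "k \<le> p" and i: "i \<le> p - 1"
  shows "simplicial_vertex i (singular_face p k f) = simplicial_vertex (if i < k then i else Suc i) f"
proof -
  obtain l where l: "f = oriented_simplex p l" using f by (auto simp: simplicial_simplex)
  moreover have "Suc i \<le> p" using k i by linarith
  ultimately show ?thesis
    using k i by (simp add: singular_face_oriented_simplex simplicial_vertex_oriented_simplex)
qed

lemma star_subdivision_eq_0:
  assumes "simplicial_simplex p S f" "\<And>i. i \<le> p \<Longrightarrow> \<not> P (simplicial_vertex i f)"
  shows "star_subdivision P p (frag_of f) = 0"
  using assms
proof (induction p arbitrary: f)
  case (Suc p)
  have "star_subdivision P p (frag_of g) = 0" if "g \<in> Poly_Mapping.keys (chain_boundary (Suc p) (frag_of f))" for g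
  proof -
    obtain k where k: "k \<le> Suc p" "g = singular_face (Suc p) k f"
      using \<open>g \<in> _\<close> keys_chain_boundary_of[of "Suc p" f] by auto
    show ?thesis
      unfolding k
    proof (rule Suc.IH)
      show "simplicial_simplex p S (singular_face (Suc p) k f)"
        using simplicial_simplex_singular_face[OF Suc.prems(1), of k] k by simp
      show "\<not> P (simplicial_vertex i (singular_face (Suc p) k f))" if "i \<le> p" for i
        using simplicial_vertex_face[OF Suc.prems(1) _ k(1), of i] Suc.prems(2) that by simp
    qed
  qed
  then have "star_subdivision P p (chain_boundary (Suc p) (frag_of f)) = 0"
    by (subst star_subdivision_extend) (rule frag_extend_eq_0)
  then show ?case by simp
qed simp

text \<open>Affine maps preserve barycentres. Hence the stars in a face of a singular simplex can be computed
  in the face or in the whole simplex, which makes them compatible with the boundary.\<close>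

lemma star_subdivision_natural:
  assumes "simplicial_chain p (standard_simplex q) c" and g: "simplicial_simplex q (standard_simplex r) g"
  shows "chain_map p g (star_subdivision (\<lambda>t. P (g t)) p c) = star_subdivision P p (chain_map p g c)"
  using assms(1)
proof (induction p arbitrary: c)
  case 0
  show ?case
    using 0[unfolded simplicial_chain_def]
  proof (induction rule: frag_induction)
    case (one f)
    then show ?case by (simp add: simplicial_vertex_def simplex_map_def)
  qed (auto simp: chain_map_diff frag_extend_diff)
next
  case (Suc p)
  show ?case
    using Suc.prems[unfolded simplicial_chain_def]
  proof (induction rule: frag_induction)
    case (one f)
    then have f: "simplicial_simplex (Suc p) (standard_simplex q) f" by simp
    have fc: "simplicial_chain (Suc p) (standard_simplex q) (frag_of f)" using f by simp
    have bf: "simplicial_chain p (standard_simplex q) (chain_boundary (Suc p) (frag_of f))"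
      using simplicial_chain_boundary[OF fc] by simp
    have gf: "simplicial_simplex (Suc p) (standard_simplex r) (simplex_map (Suc p) g f)"
      using simplicial_chain_chain_map[OF g fc] by simp
    have b: "g (barycentre (Suc p) f) = barycentre (Suc p) (simplex_map (Suc p) g f)"
      using barycentre_eq[OF f] barycentre_eq[OF gf] center_in[of "Suc p"] by (simp add: simplex_map_def)
    have "chain_map p g (star_subdivision (\<lambda>t. P (g t)) p (chain_boundary (Suc p) (frag_of f)))
        = star_subdivision P p (chain_map p g (chain_boundary (Suc p) (frag_of f)))"
      by (rule Suc.IH[OF bf])
    also have "chain_map p g (chain_boundary (Suc p) (frag_of f))
        = chain_boundary (Suc p) (frag_of (simplex_map (Suc p) g f))"
      using chain_boundary_chain_map[OF simplicial_imp_singular_chain[OF fc], of g] by simp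
    finally have "chain_map p g (star_subdivision (\<lambda>t. P (g t)) p (chain_boundary (Suc p) (frag_of f)))
        = star_subdivision P p (chain_boundary (Suc p) (frag_of (simplex_map (Suc p) g f)))" .
    then show ?case
      using chain_map_simplicial_cone[OF g simplicial_chain_star_subdivision[OF bf] barycentre_in[OF f] order_refl]
      by (simp add: b)
  qed (auto simp: chain_map_diff star_subdivision_diff simp del: star_subdivision.simps)
qed

text \<open>The boundary of the star of a vertex consists of the stars of the vertex in the faces that
  contain it, and of the link of the vertex. The link is defined as this difference.\<close>

definition star_link :: "((nat \<Rightarrow> real) \<Rightarrow> bool) \<Rightarrow> nat \<Rightarrow> (nat \<Rightarrow> real) chain \<Rightarrow> (nat \<Rightarrow> real) chain" where
  "star_link P p c = chain_boundary p (star_subdivision P p c) - star_subdivision P (p - 1) (chain_boundary p c)"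

lemma star_link_diff: "star_link P p (a - b) = star_link P p a - star_link P p b"
  by (simp add: star_link_def chain_boundary_diff star_subdivision_diff)

lemma star_link_extend: "star_link P p c = frag_extend (\<lambda>f. star_link P p (frag_of f)) c"
proof -
  have "Poly_Mapping.keys c \<subseteq> UNIV" by simp
  then show ?thesis
    by (induction rule: frag_induction)
       (auto simp: star_link_diff frag_extend_diff, simp add: star_link_def)
qed

lemma star_link_0: "star_link P 0 c = 0"
  by (simp add: star_link_def chain_boundary_def)

text \<open>The link in a simplex is the cone over the links in its faces, with the barycentre as apex, because
  the boundary of a cone is its base minus the cone over the boundary of the base. For an edge the cone
  over the boundary of a point has to be replaced by the apex itself.\<close>

lemma star_link_Suc:
  assumes f: "simplicial_simplex (Suc p) (standard_simplex s) f"
  shows "star_link P (Suc p) (frag_of f) =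
    - (if p = 0 then frag_extend (\<lambda>g. frag_of (\<lambda>u\<in>standard_simplex p. barycentre (Suc p) f))
                       (star_subdivision P p (chain_boundary (Suc p) (frag_of f)))
       else simplicial_cone (p - 1) (barycentre (Suc p) f) (star_link P p (chain_boundary (Suc p) (frag_of f))))"
proof -
  let ?X = "star_subdivision P p (chain_boundary (Suc p) (frag_of f))"
  have fc: "simplicial_chain (Suc p) (standard_simplex s) (frag_of f)" using f by simp
  have bf: "simplicial_chain p (standard_simplex s) (chain_boundary (Suc p) (frag_of f))"
    using simplicial_chain_boundary[OF fc] by simp
  have "chain_boundary p ?X = star_link P p (chain_boundary (Suc p) (frag_of f))"
    using chain_boundary_boundary_alt[OF simplicial_imp_singular_chain[OF fc]]
    by (simp add: star_link_def)
  moreover have "star_link P (Suc p) (frag_of f)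
      = - (if p = 0 then frag_extend (\<lambda>g. frag_of (\<lambda>u\<in>standard_simplex p. barycentre (Suc p) f)) ?X
           else simplicial_cone (p - 1) (barycentre (Suc p) f) (chain_boundary p ?X))"
    using chain_boundary_simplicial_cone[OF simplicial_chain_star_subdivision[OF bf]]
    by (simp add: star_link_def)
  ultimately show ?thesis by simp
qed

subsection \<open>Position with respect to skeleta\<close>

text \<open>\<open>in_position s V d q \<theta>\<close> says that the preimage under \<open>\<theta>\<close> of the \<open>m\<close>-skeleton of the standard
  simplex is contained in the \<open>(m + d)\<close>-skeleton, for all \<open>m\<close>. Composition with such a map preserves
  allowability of simplices if \<open>d\<close> is the difference of the dimensions. The face spanned by the
  vertices in \<open>V\<close> contains the image.\<close>

definition in_position :: "nat \<Rightarrow> nat set \<Rightarrow> int \<Rightarrow> nat \<Rightarrow> ((nat \<Rightarrow> real) \<Rightarrow> nat \<Rightarrow> real) \<Rightarrow> bool" where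
  "in_position s V d q \<theta> \<longleftrightarrow> simplicial_simplex q (standard_simplex s) \<theta> \<and>
     (\<forall>t\<in>standard_simplex q. support (\<theta> t) \<subseteq> V \<and> int (card (support t)) \<le> int (card (support (\<theta> t))) + d)"

text \<open>The affine simplices that enumerate the vertices of a face of the standard simplex.\<close>

definition face_simplex :: "nat \<Rightarrow> nat \<Rightarrow> nat set \<Rightarrow> ((nat \<Rightarrow> real) \<Rightarrow> nat \<Rightarrow> real) \<Rightarrow> bool" where
  "face_simplex s p V f \<longleftrightarrow> (\<exists>v. inj_on v {..p} \<and> v ` {..p} = V \<and> V \<subseteq> {..s} \<and>
     f = oriented_simplex p (\<lambda>i j. if j = v i then 1 else 0))"

lemma card_support_le: "t \<in> standard_simplex p \<Longrightarrow> card (support t) \<le> Suc p"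
proof -
  assume "t \<in> standard_simplex p"
  then have "support t \<subseteq> {..p}" by (auto simp: support_def standard_simplex_def not_less)
  then show ?thesis using card_mono[of "{..p}" "support t"] by simp
qed

text \<open>A point of the cone is on the base, where the claim is the hypothesis on \<open>\<theta>\<close>, or it has a positive
  coordinate at the apex. Then its image has full support \<open>V\<close>, like the apex, and the claim
  follows from a comparison of \<open>card V\<close> with the number of vertices of the cone.\<close>

lemma in_position_cone:
  assumes \<theta>: "in_position s V' d' q \<theta>" and V': "V' \<subseteq> V" and d: "d' \<le> d"
    and b: "b \<in> standard_simplex s" "support b = V" and q: "int q + 2 \<le> int (card V) + d"
  shows "in_position s V d (Suc q) (simplex_cone q b \<theta>)"
proof -
  have \<theta>s: "simplicial_simplex q (standard_simplex s) \<theta>" using \<theta> by (simp add: in_position_def)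
  obtain l where l: "\<theta> = oriented_simplex q l" using \<theta>s by (auto simp: simplicial_simplex)
  have "simplex_cone q b \<theta> = oriented_simplex (Suc q) (\<lambda>i. if i = 0 then b else l (i - 1))"
    by (simp add: l simplex_cone)
  then have cone: "simplex_cone q b \<theta> t = (\<lambda>i. b i * t 0 + (\<Sum>j\<le>q. l j i * t (Suc j)))"
    if "t \<in> standard_simplex (Suc q)" for t
    using that by (simp add: oriented_simplex_def sum.atMost_Suc_shift del: sum.atMost_Suc)
  have lj: "l j \<in> standard_simplex s" "support (l j) \<subseteq> V'" if "j \<le> q" for j
  proof -
    let ?e = "\<lambda>i. if i = j then 1 else 0 :: real"
    have "?e \<in> standard_simplex q" using that by simp
    moreover have "\<theta> ?e = l j"
      using that by (simp add: l oriented_simplex_def if_distrib cong: if_cong)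
    ultimately show "l j \<in> standard_simplex s" "support (l j) \<subseteq> V'"
      using \<theta> \<theta>s unfolding in_position_def simplicial_simplex by (metis image_subset_iff, metis)
  qed
  have "support (simplex_cone q b \<theta> t) \<subseteq> V \<and>
      int (card (support t)) \<le> int (card (support (simplex_cone q b \<theta> t))) + d"
    if t: "t \<in> standard_simplex (Suc q)" for t
  proof (cases "t 0 = 0")
    case True
    define t' where "t' j = t (Suc j)" for j
    have "t' \<in> standard_simplex q"
      using t True by (auto simp: t'_def standard_simplex_def sum.atMost_Suc_shift simp del: sum.atMost_Suc)
    moreover have "simplex_cone q b \<theta> t = \<theta> t'"
      using cone[OF t] True \<open>t' \<in> _\<close> by (simp add: l oriented_simplex_def t'_def)
    moreover have "support t = Suc ` support t'"
    proof
      show "support t \<subseteq> Suc ` support t'"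
      proof
        fix x assume "x \<in> support t"
        then show "x \<in> Suc ` support t'" using True by (cases x) (auto simp: support_def t'_def)
      qed
    qed (auto simp: support_def t'_def)
    then have "card (support t) = card (support t')" by (simp add: card_image)
    ultimately show ?thesis using \<theta> V' d unfolding in_position_def by fastforce
  next
    case False
    have t0: "t 0 > 0" using t False by (auto simp: standard_simplex_def less_le)
    have bn: "\<And>i. 0 \<le> b i" using b by (auto simp: standard_simplex_def)
    have ln: "\<And>i j. j \<le> q \<Longrightarrow> 0 \<le> l j i" using lj by (auto simp: standard_simplex_def)
    have tn: "\<And>j. 0 \<le> t j" using t by (auto simp: standard_simplex_def)
    have sn: "0 \<le> (\<Sum>j\<le>q. l j i * t (Suc j))" for i
      by (rule sum_nonneg) (use ln tn in auto)
    have "support (simplex_cone q b \<theta> t) = V"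
    proof
      show "V \<subseteq> support (simplex_cone q b \<theta> t)"
      proof
        fix i assume "i \<in> V"
        then have "0 < b i" using b(2) bn[of i] by (auto simp: support_def less_le)
        then have "0 < b i * t 0" using t0 by simp
        then have "0 < simplex_cone q b \<theta> t i" unfolding cone[OF t] using sn[of i] by linarith
        then show "i \<in> support (simplex_cone q b \<theta> t)" by (simp add: support_def)
      qed
      show "support (simplex_cone q b \<theta> t) \<subseteq> V"
      proof
        fix i assume i: "i \<in> support (simplex_cone q b \<theta> t)"
        show "i \<in> V"
        proof (rule ccontr)
          assume "i \<notin> V"
          then have "b i = 0" "\<And>j. j \<le> q \<Longrightarrow> l j i = 0"
            using b(2) lj(2) V' by (auto simp: support_def)
          then show False using i by (simp add: support_def cone[OF t])
        qed
      qed
    qed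
    moreover have "card (support t) \<le> Suc (Suc q)" by (rule card_support_le[OF t])
    ultimately show ?thesis using q by auto
  qed
  moreover have "simplicial_simplex (Suc q) (standard_simplex s) (simplex_cone q b \<theta>)"
    by (rule simplicial_simplex_simplex_cone[OF \<theta>s]) (rule convex_standard_simplex[OF b(1)])
  ultimately show ?thesis unfolding in_position_def by blast
qed

lemma in_position_mono:
  "in_position s V' d' q \<theta> \<Longrightarrow> V' \<subseteq> V \<Longrightarrow> d' \<le> d \<Longrightarrow> in_position s V d q \<theta>"
  unfolding in_position_def by fastforce

lemma keys_simplicial_cone:
  "\<theta> \<in> Poly_Mapping.keys (simplicial_cone p v c) \<Longrightarrow> \<exists>\<theta>'\<in>Poly_Mapping.keys c. \<theta> = simplex_cone p v \<theta>'"
  using keys_frag_extend[of "frag_of \<circ> simplex_cone p v" c]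
  by (auto simp: simplicial_cone_def keys_frag_of)

lemma face_simplex_in_position:
  assumes "face_simplex s p V f"
  shows "in_position s V 0 p f" and "card V = Suc p" and "support (barycentre p f) = V"
proof -
  obtain v where v: "inj_on v {..p}" "v ` {..p} = V" "V \<subseteq> {..s}"
    and f: "f = oriented_simplex p (\<lambda>i j. if j = v i then 1 else 0)"
    using assms unfolding face_simplex_def by blast
  show "card V = Suc p" using v card_image[OF v(1)] by simp
  have ft: "f t (v i) = t i" if "t \<in> standard_simplex p" "i \<le> p" for t i
  proof -
    have "f t (v i) = (\<Sum>j\<le>p. (if j = i then 1 else 0) * t j)"
      unfolding f oriented_simplex_def using that v(1)
      by (auto intro!: sum.cong simp: inj_on_def)
    then show ?thesis using that by (simp add: if_distrib[of "\<lambda>x. x * _"] cong: if_cong)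
  qed
  have f0: "f t k = 0" if "t \<in> standard_simplex p" "k \<notin> V" for t k
    unfolding f oriented_simplex_def using that v(2) by (auto intro!: sum.neutral)
  have supp: "support (f t) = v ` support t" if t: "t \<in> standard_simplex p" for t
  proof -
    have sub: "support t \<subseteq> {..p}" using t by (auto simp: support_def standard_simplex_def not_less)
    show ?thesis
    proof (intro subset_antisym subsetI)
      fix k assume k: "k \<in> support (f t)"
      then have "k \<in> V" using f0[OF t, of k] by (auto simp: support_def)
      then obtain i where "i \<le> p" "k = v i" using v(2) by auto
      then show "k \<in> v ` support t" using k ft[OF t, of i] by (simp add: support_def)
    next
      fix k assume "k \<in> v ` support t"
      then obtain i where "i \<in> support t" "k = v i" by blast
      then show "k \<in> support (f t)" using sub ft[OF t, of i] by (auto simp: support_def)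
    qed
  qed
  have "f t \<in> standard_simplex s" if t: "t \<in> standard_simplex p" for t
  proof -
    have "sum (f t) {..s} = sum (f t) V"
      by (rule sum.mono_neutral_right) (use v(3) f0[OF t] in auto)
    also have "\<dots> = (\<Sum>i\<le>p. f t (v i))" using v sum.reindex[OF v(1), of "f t"] by simp
    also have "\<dots> = 1" using t ft[OF t] by (simp add: standard_simplex_def)
    finally have "sum (f t) {..s} = 1" .
    moreover have "0 \<le> f t k \<and> f t k \<le> 1" for k
      using ft[OF t] f0[OF t] t v(2) by (cases "k \<in> V") (auto simp: standard_simplex_def)
    moreover have "f t k = 0" if "k > s" for k
      by (rule f0[OF t]) (use v(3) that in auto)
    ultimately show ?thesis by (simp add: standard_simplex_def)
  qed
  then have sim: "simplicial_simplex p (standard_simplex s) f"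
    by (auto simp: simplicial_simplex f)
  moreover have "card (support t) \<le> card (support (f t))" if "t \<in> standard_simplex p" for t
  proof -
    have "support t \<subseteq> {..p}" using that by (auto simp: support_def standard_simplex_def not_less)
    then show ?thesis using supp[OF that] card_image inj_on_subset[OF v(1)] by (metis order_refl)
  qed
  moreover have "support (f t) \<subseteq> V" if "t \<in> standard_simplex p" for t
    using f0[OF that] by (auto simp: support_def)
  ultimately show "in_position s V 0 p f" unfolding in_position_def by simp
  have "support (center p) = {..p}" by (auto simp: support_def center_def)
  then show "support (barycentre p f) = V"
    using barycentre_eq[OF sim] supp[OF center_in] v(2) by simp
qed

lemma face_simplex_simplicial: "face_simplex s p V f \<Longrightarrow> simplicial_simplex p (standard_simplex s) f"
  using face_simplex_in_position(1) by (auto simp: in_position_def)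

lemma face_simplex_face:
  assumes "face_simplex s (Suc p) V f" "g \<in> Poly_Mapping.keys (chain_boundary (Suc p) (frag_of f))"
  shows "\<exists>V'\<subseteq>V. face_simplex s p V' g"
proof -
  obtain v where v: "inj_on v {..Suc p}" "v ` {..Suc p} = V" "V \<subseteq> {..s}"
    and f: "f = oriented_simplex (Suc p) (\<lambda>i j. if j = v i then 1 else 0)"
    using assms(1) unfolding face_simplex_def by blast
  obtain k where k: "k \<le> Suc p" "g = singular_face (Suc p) k f"
    using assms(2) keys_chain_boundary_of[of "Suc p" f] by auto
  define w where "w i = v (if i < k then i else Suc i)" for i
  have "inj_on (\<lambda>i. if i < k then i else Suc i) {..p}" by (auto simp: inj_on_def split: if_splits)
  moreover have "inj_on v ((\<lambda>i. if i < k then i else Suc i) ` {..p})"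
    by (rule inj_on_subset[OF v(1)]) auto
  ultimately have "inj_on w {..p}" using comp_inj_on unfolding w_def o_def by blast
  moreover have sub: "w ` {..p} \<subseteq> V" using v(2) unfolding w_def by auto
  moreover have "g = oriented_simplex p (\<lambda>i j. if j = w i then 1 else 0)"
    unfolding k f using k(1) by (auto simp: singular_face_oriented_simplex w_def oriented_simplex_eq)
  ultimately have "face_simplex s p (w ` {..p}) g" using v(3) unfolding face_simplex_def by blast
  then show ?thesis using sub by blast
qed

lemma face_simplex_identity: "face_simplex p p {..p} (identity_simplex p)"
proof -
  have "identity_simplex p = oriented_simplex p (\<lambda>i j. if j = i then 1 else 0)"
    by (force simp: oriented_simplex_def standard_simplex_def if_distrib [of "\<lambda>u. u * _"] cong: if_cong)
  then show ?thesis unfolding face_simplex_def by (intro exI[of _ id]) auto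
qed

text \<open>A simplex of the subdivision is a cone with the barycentre of a face as apex over a simplex in a
  proper face. By induction, a point of it has at most as many nonzero coordinates as its image.\<close>

lemma in_position_star:
  "face_simplex s p V f \<Longrightarrow> \<theta> \<in> Poly_Mapping.keys (star_subdivision P p (frag_of f)) \<Longrightarrow> in_position s V 0 p \<theta>"
proof (induction p arbitrary: V f \<theta>)
  case 0
  then show ?case using face_simplex_in_position(1) by (auto simp: keys_frag_of split: if_splits)
next
  case (Suc p)
  let ?c = "chain_boundary (Suc p) (frag_of f)"
  have "\<theta> \<in> Poly_Mapping.keys (simplicial_cone p (barycentre (Suc p) f) (star_subdivision P p ?c))"
    using Suc.prems by simp
  then obtain \<theta>' where \<theta>': "\<theta>' \<in> Poly_Mapping.keys (star_subdivision P p ?c)"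
    "\<theta> = simplex_cone p (barycentre (Suc p) f) \<theta>'"
    using keys_simplicial_cone by blast
  have "\<theta>' \<in> Poly_Mapping.keys (frag_extend (\<lambda>f. star_subdivision P p (frag_of f)) ?c)"
    using \<theta>'(1) star_subdivision_extend[of P p ?c] by simp
  then obtain g where g: "g \<in> Poly_Mapping.keys ?c" "\<theta>' \<in> Poly_Mapping.keys (star_subdivision P p (frag_of g))"
    using keys_frag_extend by fastforce
  obtain V' where V': "V' \<subseteq> V" "face_simplex s p V' g" using face_simplex_face[OF Suc.prems(1) g(1)] by blast
  note F = face_simplex_in_position[OF Suc.prems(1)] face_simplex_simplicial[OF Suc.prems(1)]
  show ?case unfolding \<theta>'(2)
    by (rule in_position_cone[OF Suc.IH[OF V'(2) g(2)] V'(1) _ barycentre_in[OF F(4)] F(3)])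
       (use F in auto)
qed

text \<open>The vertices of a simplex of the link are the barycentres of a flag of faces of the dimensions
  \<open>1, \<dots>, p\<close>; the original vertex is omitted. So the image of a point with \<open>k\<close> nonzero coordinates is
  in the interior of a face of dimension at least \<open>k\<close>, and has more than \<open>k\<close> nonzero coordinates. This gain
  makes the link allowable.\<close>

lemma in_position_star_link:
  "face_simplex s p V f \<Longrightarrow> \<theta> \<in> Poly_Mapping.keys (star_link P p (frag_of f)) \<Longrightarrow>
     in_position s V (-1) (p - 1) \<theta>"
proof (induction p arbitrary: V f \<theta>)
  case 0
  then show ?case by (simp add: star_link_0)
next
  case (Suc p)
  let ?c = "chain_boundary (Suc p) (frag_of f)" and ?b = "barycentre (Suc p) f"
  note F = face_simplex_in_position[OF Suc.prems(1)] face_simplex_simplicial[OF Suc.prems(1)]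
  have b: "?b \<in> standard_simplex s" by (rule barycentre_in[OF F(4)])
  show ?case
  proof (cases "p = 0")
    case True
    have "\<theta> \<in> Poly_Mapping.keys (frag_extend (\<lambda>g. frag_of (\<lambda>u\<in>standard_simplex p. ?b)) (star_subdivision P p ?c))"
      using Suc.prems(2) True unfolding star_link_Suc[OF F(4)] by simp
    then have \<theta>: "\<theta> = (\<lambda>u\<in>standard_simplex 0. ?b)"
      using keys_frag_extend True by (fastforce simp: keys_frag_of)
    have "\<theta> = oriented_simplex 0 (\<lambda>i. ?b)"
      by (auto simp: \<theta> oriented_simplex_def standard_simplex_def fun_eq_iff)
    moreover have "\<theta> ` standard_simplex 0 \<subseteq> standard_simplex s" using b by (auto simp: \<theta>)
    ultimately have "simplicial_simplex 0 (standard_simplex s) \<theta>"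
      unfolding simplicial_simplex by blast
    moreover have "card V = 2" using F(2) True by simp
    moreover have "card (support t) \<le> 1" if "t \<in> standard_simplex 0" for t
      using card_support_le[OF that] by simp
    ultimately show ?thesis using True \<theta> F(3) unfolding in_position_def by fastforce
  next
    case False
    then obtain q where q: "p = Suc q" by (cases p) auto
    have "\<theta> \<in> Poly_Mapping.keys (simplicial_cone (p - 1) ?b (star_link P p ?c))"
      using Suc.prems(2) False unfolding star_link_Suc[OF F(4)] by simp
    then obtain \<theta>' where \<theta>': "\<theta>' \<in> Poly_Mapping.keys (star_link P p ?c)" "\<theta> = simplex_cone (p - 1) ?b \<theta>'"
      using keys_simplicial_cone by blast
    have "\<theta>' \<in> Poly_Mapping.keys (frag_extend (\<lambda>f. star_link P p (frag_of f)) ?c)"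
      using \<theta>'(1) star_link_extend[of P p ?c] by simp
    then obtain g where g: "g \<in> Poly_Mapping.keys ?c" "\<theta>' \<in> Poly_Mapping.keys (star_link P p (frag_of g))"
      using keys_frag_extend by fastforce
    obtain V' where V': "V' \<subseteq> V" "face_simplex s p V' g" using face_simplex_face[OF Suc.prems(1) g(1)] by blast
    have "in_position s V (-1) (Suc (p - 1)) (simplex_cone (p - 1) ?b \<theta>')"
      by (rule in_position_cone[OF Suc.IH[OF V'(2) g(2)] V'(1) _ b F(3)]) (use F q in auto)
    then show ?thesis using \<theta>'(2) q by simp
  qed
qed

lemma in_position_subd:
  "face_simplex s p V f \<Longrightarrow> \<theta> \<in> Poly_Mapping.keys (subd p (frag_of f)) \<Longrightarrow> in_position s V 1 (Suc p) \<theta>"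
proof (induction p arbitrary: V f \<theta>)
  case 0
  then show ?case by simp
next
  case (Suc p)
  let ?c = "chain_boundary (Suc p) (frag_of f)" and ?b = "barycentre (Suc p) f"
  note F = face_simplex_in_position[OF Suc.prems(1)] face_simplex_simplicial[OF Suc.prems(1)]
  have b: "?b \<in> standard_simplex s" by (rule barycentre_in[OF F(4)])
  have "\<theta> \<in> Poly_Mapping.keys (simplicial_cone (Suc p) ?b
          (simplicial_subdivision (Suc p) (frag_of f) - frag_of f - subd p ?c))"
    using Suc.prems(2) by (simp add: barycentre_def add.commute del: sum.atMost_Suc simplicial_subdivision.simps)
  then obtain \<theta>' where \<theta>': "\<theta>' \<in> Poly_Mapping.keys (simplicial_subdivision (Suc p) (frag_of f) - frag_of f - subd p ?c)"
    "\<theta> = simplex_cone (Suc p) ?b \<theta>'"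
    using keys_simplicial_cone by blast
  have "Poly_Mapping.keys (A - B - C) \<subseteq> Poly_Mapping.keys A \<union> Poly_Mapping.keys B \<union> Poly_Mapping.keys C"
    for A B C :: "(nat \<Rightarrow> real) chain"
    by (rule order_trans[OF keys_diff]) (use keys_diff[of A B] in auto)
  then have "\<theta>' \<in> Poly_Mapping.keys (simplicial_subdivision (Suc p) (frag_of f)) \<union> Poly_Mapping.keys (frag_of f)
      \<union> Poly_Mapping.keys (subd p ?c)"
    using \<theta>'(1) by (rule subsetD)
  then have "\<theta>' \<in> Poly_Mapping.keys (simplicial_subdivision (Suc p) (frag_of f)) \<or> \<theta>' = f \<or> \<theta>' \<in> Poly_Mapping.keys (subd p ?c)"
    by (simp only: keys_frag_of Un_iff singleton_iff disj_assoc)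
  then have "in_position s V 1 (Suc p) \<theta>'"
  proof (elim disjE)
    assume "\<theta>' \<in> Poly_Mapping.keys (simplicial_subdivision (Suc p) (frag_of f))"
    then have "in_position s V 0 (Suc p) \<theta>'"
      using in_position_star[OF Suc.prems(1), of _ "\<lambda>t. True"] by (simp only: star_subdivision_True)
    then show ?thesis by (rule in_position_mono) auto
  next
    assume "\<theta>' = f"
    then show ?thesis using F(1) in_position_mono by fastforce
  next
    assume "\<theta>' \<in> Poly_Mapping.keys (subd p ?c)"
    moreover have "subd p ?c = frag_extend (\<lambda>f. subd p (frag_of f)) ?c"
      by (cases p) (simp_all add: frag_extend_eq_0)
    ultimately have "\<theta>' \<in> Poly_Mapping.keys (frag_extend (\<lambda>f. subd p (frag_of f)) ?c)" by simp
    then obtain g where g: "g \<in> Poly_Mapping.keys ?c" "\<theta>' \<in> Poly_Mapping.keys (subd p (frag_of g))"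
      using keys_frag_extend by fastforce
    obtain V' where V': "V' \<subseteq> V" "face_simplex s p V' g" using face_simplex_face[OF Suc.prems(1) g(1)] by blast
    show ?thesis by (rule in_position_mono[OF Suc.IH[OF V'(2) g(2)] V'(1)]) simp
  qed
  then show ?case unfolding \<theta>'(2)
    by (rule in_position_cone[OF _ order_refl order_refl b F(3)]) (use F in auto)
qed

section \<open>Integral combinations in an abelian group\<close>

text \<open>The value at \<open>c\<close> of the homomorphism from integral chains to \<open>M\<close> that extends \<open>w\<close>.\<close>

definition zsum :: "('g, 'k) ring_scheme \<Rightarrow> ('i \<Rightarrow> 'g) \<Rightarrow> ('i \<Rightarrow>\<^sub>0 int) \<Rightarrow> 'g" where
  "zsum M w c = finsum M (\<lambda>k. add_pow M (Poly_Mapping.lookup c k) (w k)) (Poly_Mapping.keys c)"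

lemma frag_induction_keys [consumes 1, case_names zero one diff]:
  assumes "Poly_Mapping.keys c \<subseteq> S" and "P 0" and "\<And>x. x \<in> S \<Longrightarrow> P (frag_of x)"
    and "\<And>a b. Poly_Mapping.keys a \<subseteq> S \<Longrightarrow> Poly_Mapping.keys b \<subseteq> S \<Longrightarrow> P a \<Longrightarrow> P b \<Longrightarrow> P (a - b)"
  shows "P c"
proof -
  have "Poly_Mapping.keys c \<subseteq> S \<and> P c"
    using assms(1)
  proof (induction rule: frag_induction)
    case (diff a b)
    then show ?case using assms(4)[of a b] keys_diff[of a b] by auto
  qed (use assms in \<open>auto simp: keys_frag_of\<close>)
  then show ?thesis ..
qed

context abelian_group
begin

lemma add_pow_0: "add_pow G (0 :: int) x = \<zero>"
  by (simp add: add_pow_def)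

lemma zsum_superset:
  assumes "finite S" "Poly_Mapping.keys c \<subseteq> S" "\<And>k. k \<in> S \<Longrightarrow> w k \<in> carrier G"
  shows "zsum G w c = finsum G (\<lambda>k. add_pow G (Poly_Mapping.lookup c k) (w k)) S"
  unfolding zsum_def
  by (rule add.finprod_mono_neutral_cong_left)
     (use assms in \<open>auto simp: in_keys_iff add_pow_0 add.int_pow_closed\<close>)

lemma zsum_closed:
  "(\<And>k. k \<in> Poly_Mapping.keys c \<Longrightarrow> w k \<in> carrier G) \<Longrightarrow> zsum G w c \<in> carrier G"
  unfolding zsum_def by (rule finsum_closed) (auto simp: add.int_pow_closed)

lemma zsum_0 [simp]: "zsum G w 0 = \<zero>"
  by (simp add: zsum_def)

lemma zsum_of [simp]: "w k \<in> carrier G \<Longrightarrow> zsum G w (frag_of k) = w k"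
  by (simp add: zsum_def keys_frag_of add.int_pow_1)

lemma zsum_add:
  assumes w: "\<And>k. k \<in> S \<Longrightarrow> w k \<in> carrier G" and "Poly_Mapping.keys a \<subseteq> S" "Poly_Mapping.keys b \<subseteq> S"
  shows "zsum G w (a + b) = zsum G w a \<oplus> zsum G w b"
proof -
  let ?S = "Poly_Mapping.keys a \<union> Poly_Mapping.keys b"
  have wS: "w k \<in> carrier G" if "k \<in> ?S" for k using assms that by auto
  have "zsum G w (a + b) = finsum G (\<lambda>k. add_pow G (Poly_Mapping.lookup (a + b) k) (w k)) ?S"
    by (rule zsum_superset) (use keys_add[of a b] wS in auto)
  also have "\<dots> = finsum G (\<lambda>k. add_pow G (Poly_Mapping.lookup a k) (w k) \<oplus> add_pow G (Poly_Mapping.lookup b k) (w k)) ?S"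
    by (rule finsum_cong') (use wS in \<open>auto simp: lookup_add add.int_pow_mult add.int_pow_closed\<close>)
  also have "\<dots> = finsum G (\<lambda>k. add_pow G (Poly_Mapping.lookup a k) (w k)) ?S
       \<oplus> finsum G (\<lambda>k. add_pow G (Poly_Mapping.lookup b k) (w k)) ?S"
    by (rule finsum_addf) (use wS in \<open>auto simp: add.int_pow_closed\<close>)
  also have "\<dots> = zsum G w a \<oplus> zsum G w b"
    using zsum_superset[of ?S a w] zsum_superset[of ?S b w] wS by simp
  finally show ?thesis .
qed

lemma zsum_diff:
  assumes w: "\<And>k. k \<in> S \<Longrightarrow> w k \<in> carrier G" and a: "Poly_Mapping.keys a \<subseteq> S" and b: "Poly_Mapping.keys b \<subseteq> S"
  shows "zsum G w (a - b) = zsum G w a \<ominus> zsum G w b"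
proof -
  have "Poly_Mapping.keys (a - b) \<subseteq> S" using keys_diff[of a b] a b by auto
  then have "zsum G w a = zsum G w (a - b) \<oplus> zsum G w b"
    using zsum_add[of S w "a - b" b] w b by simp
  moreover have "zsum G w (a - b) \<in> carrier G" "zsum G w b \<in> carrier G"
    using w b \<open>Poly_Mapping.keys (a - b) \<subseteq> S\<close> by (auto intro!: zsum_closed)
  ultimately show ?thesis by (simp add: a_minus_def a_assoc r_neg)
qed

lemma zsum_cong:
  "(\<And>k. k \<in> Poly_Mapping.keys c \<Longrightarrow> w k = w' k \<and> w' k \<in> carrier G) \<Longrightarrow> zsum G w c = zsum G w' c"
  unfolding zsum_def by (rule finsum_cong') (auto simp: add.int_pow_closed)

lemma zsum_zero: "zsum G (\<lambda>k. \<zero>) c = \<zero>"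
  unfolding zsum_def by (rule add.finprod_one_eqI) (simp add: add.int_pow_one)

lemma zsum_frag_extend:
  assumes "Poly_Mapping.keys c \<subseteq> A" "\<And>a. a \<in> A \<Longrightarrow> Poly_Mapping.keys (f a) \<subseteq> S"
    and w: "\<And>k. k \<in> S \<Longrightarrow> w k \<in> carrier G"
  shows "zsum G w (frag_extend f c) = zsum G (\<lambda>a. zsum G w (f a)) c"
proof -
  have cl: "zsum G w (f a) \<in> carrier G" if "a \<in> A" for a
    using w assms(2)[OF that] by (auto intro!: zsum_closed)
  have sub: "Poly_Mapping.keys (frag_extend f c) \<subseteq> S" if "Poly_Mapping.keys c \<subseteq> A" for c
    using that keys_frag_extend[of f c] assms(2) by blast
  show ?thesis
    using assms(1)
  proof (induction "c" rule: frag_induction_keys)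
    case (diff a b)
    have k: "Poly_Mapping.keys a \<subseteq> A" "Poly_Mapping.keys b \<subseteq> A" by fact+
    show ?case
      using zsum_diff[OF w sub[OF k(1)] sub[OF k(2)]] zsum_diff[of A, OF cl k] diff.IH
      by (simp add: frag_extend_diff)
  qed (simp_all add: cl)
qed

lemma zsum_add_fun:
  assumes "\<And>k. k \<in> Poly_Mapping.keys c \<Longrightarrow> v k \<in> carrier G"
    "\<And>k. k \<in> Poly_Mapping.keys c \<Longrightarrow> w k \<in> carrier G"
  shows "zsum G (\<lambda>k. v k \<oplus> w k) c = zsum G v c \<oplus> zsum G w c"
proof -
  have "zsum G (\<lambda>k. v k \<oplus> w k) c = finsum G (\<lambda>k. add_pow G (Poly_Mapping.lookup c k) (v k)
      \<oplus> add_pow G (Poly_Mapping.lookup c k) (w k)) (Poly_Mapping.keys c)"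
    unfolding zsum_def
    by (rule finsum_cong') (use assms in \<open>auto simp: add.int_pow_closed add.int_pow_distrib\<close>)
  also have "\<dots> = zsum G v c \<oplus> zsum G w c"
    unfolding zsum_def by (rule finsum_addf) (use assms in \<open>auto simp: add.int_pow_closed\<close>)
  finally show ?thesis .
qed

lemma zsum_finsum:
  assumes "finite A" "\<And>i k. i \<in> A \<Longrightarrow> k \<in> Poly_Mapping.keys c \<Longrightarrow> w i k \<in> carrier G"
  shows "zsum G (\<lambda>k. finsum G (\<lambda>i. w i k) A) c = finsum G (\<lambda>i. zsum G (w i) c) A"
  using assms
proof (induction A rule: finite_induct)
  case empty
  then show ?case by (simp add: zsum_zero)
next
  case (insert x A)
  have "zsum G (\<lambda>k. finsum G (\<lambda>i. w i k) (insert x A)) c = zsum G (\<lambda>k. w x k \<oplus> finsum G (\<lambda>i. w i k) A) c"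
    by (rule zsum_cong) (use insert.hyps insert.prems in \<open>auto intro!: finsum_insert a_closed finsum_closed\<close>)
  also have "\<dots> = zsum G (w x) c \<oplus> zsum G (\<lambda>k. finsum G (\<lambda>i. w i k) A) c"
    by (rule zsum_add_fun) (use insert.prems in \<open>auto intro!: finsum_closed\<close>)
  also have "\<dots> = finsum G (\<lambda>i. zsum G (w i) c) (insert x A)"
    using insert.IH insert.hyps insert.prems by (simp add: finsum_insert zsum_closed Pi_iff)
  finally show ?case .
qed

lemma zsum_zsum:
  assumes c: "Poly_Mapping.keys c \<subseteq> A"
    and w: "\<And>a b. a \<in> A \<Longrightarrow> b \<in> Poly_Mapping.keys d \<Longrightarrow> w a b \<in> carrier G"
  shows "zsum G (\<lambda>a. zsum G (w a) d) c = zsum G (\<lambda>b. zsum G (\<lambda>a. w a b) c) d"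
  using c
proof (induction c rule: frag_induction_keys)
  case zero
  then show ?case by (simp add: zsum_zero)
next
  case (one a)
  then show ?case by (auto simp: zsum_closed w intro!: zsum_cong)
next
  case (diff a b)
  have k: "Poly_Mapping.keys a \<subseteq> A" "Poly_Mapping.keys b \<subseteq> A" by fact+
  have "Poly_Mapping.keys (a - b) \<subseteq> A" using k keys_diff[of a b] by auto
  have cl: "zsum G (\<lambda>x. w x y) e \<in> carrier G" if "Poly_Mapping.keys e \<subseteq> A" "y \<in> Poly_Mapping.keys d" for e y
    using that w by (auto intro!: zsum_closed)
  have "zsum G (\<lambda>y. zsum G (\<lambda>x. w x y) a) d
      = zsum G (\<lambda>y. zsum G (\<lambda>x. w x y) (a - b) \<oplus> zsum G (\<lambda>x. w x y) b) d"
  proof (rule zsum_cong)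
    fix y assume y: "y \<in> Poly_Mapping.keys d"
    have "zsum G (\<lambda>x. w x y) ((a - b) + b) = zsum G (\<lambda>x. w x y) (a - b) \<oplus> zsum G (\<lambda>x. w x y) b"
      by (rule zsum_add[of A]) (use y w k \<open>Poly_Mapping.keys (a - b) \<subseteq> A\<close> in auto)
    then show "zsum G (\<lambda>x. w x y) a = zsum G (\<lambda>x. w x y) (a - b) \<oplus> zsum G (\<lambda>x. w x y) b \<and>
        zsum G (\<lambda>x. w x y) (a - b) \<oplus> zsum G (\<lambda>x. w x y) b \<in> carrier G"
      using cl[OF \<open>Poly_Mapping.keys (a - b) \<subseteq> A\<close> y] cl[OF k(2) y] by simp
  qed
  also have "\<dots> = zsum G (\<lambda>y. zsum G (\<lambda>x. w x y) (a - b)) d \<oplus> zsum G (\<lambda>y. zsum G (\<lambda>x. w x y) b) d"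
    by (rule zsum_add_fun) (use cl k \<open>Poly_Mapping.keys (a - b) \<subseteq> A\<close> in auto)
  finally have "zsum G (\<lambda>y. zsum G (\<lambda>x. w x y) (a - b)) d
      = zsum G (\<lambda>y. zsum G (\<lambda>x. w x y) a) d \<ominus> zsum G (\<lambda>y. zsum G (\<lambda>x. w x y) b) d"
    using cl[OF \<open>Poly_Mapping.keys (a - b) \<subseteq> A\<close>] cl[OF k(2)]
    by (simp add: zsum_closed a_minus_def a_assoc r_neg)
  then show ?case
    using zsum_diff[of A "\<lambda>a. zsum G (w a) d" a b] k w diff.IH by (simp add: zsum_closed)
qed

end

section \<open>Coefficients of singular simplices\<close>

lemma continuous_map_locally:
  assumes "\<And>x. x \<in> topspace X \<Longrightarrow> \<exists>U. openin X U \<and> x \<in> U \<and> continuous_map (subtopology X U) Z f"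
  shows "continuous_map X Z f"
  unfolding continuous_map_def
proof (intro conjI allI impI)
  show "f \<in> topspace X \<rightarrow> topspace Z"
  proof
    fix x assume x: "x \<in> topspace X"
    then obtain U where "x \<in> U" "continuous_map (subtopology X U) Z f" using assms by blast
    then show "f x \<in> topspace Z" using x by (auto simp: continuous_map_def)
  qed
  fix V assume V: "openin Z V"
  show "openin X {x \<in> topspace X. f x \<in> V}"
  proof (subst openin_subopen, intro ballI)
    fix x assume "x \<in> {x \<in> topspace X. f x \<in> V}"
    then obtain U where U: "openin X U" "x \<in> U" "continuous_map (subtopology X U) Z f" "f x \<in> V"
      using assms by blast
    then have "openin (subtopology X U) {z \<in> topspace X \<inter> U. f z \<in> V}"
      using V by (auto simp: continuous_map_def)
    then have "openin X {z \<in> topspace X \<inter> U. f z \<in> V}"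
      by (rule openin_trans_full[OF _ U(1)])
    then show "\<exists>T. openin X T \<and> x \<in> T \<and> T \<subseteq> {x \<in> topspace X. f x \<in> V}"
      using U openin_subset[OF U(1)] by (intro exI[of _ "{z \<in> topspace X \<inter> U. f z \<in> V}"]) auto
  qed
qed

text \<open>The chart turns the lift into a continuous map to a discrete space.\<close>

lemma local_system_lift_locally_constant:
  assumes L: "local_system R X G T" and u: "continuous_map W X u"
    and s: "continuous_map W T (\<lambda>w. (u w, s w))" and w0: "w0 \<in> topspace W"
    and U: "openin X U" "u w0 \<in> U"
    and hom: "homeomorphic_map (prod_topology (subtopology X U) (discrete_topology (carrier (G x))))
          (subtopology T (fst -` U)) (\<lambda>(u, m). (u, \<phi> u m))"
  obtains N m where "openin W N" "w0 \<in> N" "m \<in> carrier (G x)"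
    "\<And>w. w \<in> N \<Longrightarrow> u w \<in> U \<and> s w = \<phi> (u w) m"
proof -
  let ?P = "prod_topology (subtopology X U) (discrete_topology (carrier (G x)))"
  obtain k where k: "homeomorphic_maps ?P (subtopology T (fst -` U)) (\<lambda>(u, m). (u, \<phi> u m)) k"
    using hom homeomorphic_map_maps by blast
  define N1 where "N1 = {w \<in> topspace W. u w \<in> U}"
  have N1: "openin W N1" unfolding N1_def by (rule openin_continuous_map_preimage[OF u U(1)])
  have c1: "continuous_map (subtopology W N1) (subtopology T (fst -` U)) (\<lambda>w. (u w, s w))"
    using continuous_map_from_subtopology[OF s, of N1]
    by (auto simp: continuous_map_in_subtopology N1_def)
  have "continuous_map (subtopology W N1) ?P (k \<circ> (\<lambda>w. (u w, s w)))"
    using continuous_map_compose[OF c1] k by (auto simp: homeomorphic_maps_def)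
  then have c2: "continuous_map (subtopology W N1) (discrete_topology (carrier (G x))) (\<lambda>w. snd (k (u w, s w)))"
    using continuous_map_compose[OF _ continuous_map_snd] by (fastforce simp: o_def)
  have w0N: "w0 \<in> N1" using w0 U by (simp add: N1_def)
  define m where "m = snd (k (u w0, s w0))"
  define N where "N = {w \<in> topspace (subtopology W N1). snd (k (u w, s w)) \<in> {m}}"
  have sN: "topspace (subtopology W N1) = N1" using openin_subset[OF N1] by auto
  have m: "m \<in> carrier (G x)"
    using c2 w0N sN unfolding m_def by (auto simp: continuous_map_def)
  have "openin (subtopology W N1) N"
    unfolding N_def by (rule openin_continuous_map_preimage[OF c2]) (use m in auto)
  then have "openin W N" by (rule openin_trans_full[OF _ N1])
  moreover have "w0 \<in> N" using w0N sN by (simp add: N_def m_def)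
  moreover have "u w \<in> U \<and> s w = \<phi> (u w) m" if "w \<in> N" for w
  proof -
    have wN: "w \<in> N1" "snd (k (u w, s w)) = m" using that sN by (auto simp: N_def)
    have "(u w, s w) \<in> topspace (subtopology T (fst -` U))"
      using c1 wN(1) sN by (auto simp: continuous_map_def)
    then have "(\<lambda>(u, m). (u, \<phi> u m)) (k (u w, s w)) = (u w, s w)"
      using k by (simp add: homeomorphic_maps_def)
    then show ?thesis using wN by (auto simp: N1_def case_prod_unfold)
  qed
  ultimately show ?thesis using m by (rule_tac that[of N m]) auto
qed

lemma local_system_lift_continuous:
  assumes L: "local_system R X G T" and u: "continuous_map W X u"
    and loc: "\<And>w0. w0 \<in> topspace W \<Longrightarrow> \<exists>N U \<phi> x m. openin W N \<and> w0 \<in> N \<and> openin X U \<and> m \<in> carrier (G x) \<and>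
       homeomorphic_map (prod_topology (subtopology X U) (discrete_topology (carrier (G x))))
          (subtopology T (fst -` U)) (\<lambda>(u, m). (u, \<phi> u m)) \<and>
       (\<forall>w\<in>N. u w \<in> U \<and> s w = \<phi> (u w) m)"
  shows "continuous_map W T (\<lambda>w. (u w, s w))"
proof (rule continuous_map_locally)
  fix w0 assume w0: "w0 \<in> topspace W"
  obtain N U \<phi> x m where *: "openin W N \<and> w0 \<in> N \<and> openin X U \<and> m \<in> carrier (G x) \<and>
       homeomorphic_map (prod_topology (subtopology X U) (discrete_topology (carrier (G x))))
          (subtopology T (fst -` U)) (\<lambda>(u, m). (u, \<phi> u m)) \<and>
       (\<forall>w\<in>N. u w \<in> U \<and> s w = \<phi> (u w) m)"
    using loc[OF w0] by (elim exE) (rule that)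
  then have N: "openin W N" "w0 \<in> N" and U: "openin X U" and m: "m \<in> carrier (G x)"
    and hom: "homeomorphic_map (prod_topology (subtopology X U) (discrete_topology (carrier (G x))))
          (subtopology T (fst -` U)) (\<lambda>(u, m). (u, \<phi> u m))"
    and s: "\<And>w. w \<in> N \<Longrightarrow> u w \<in> U \<and> s w = \<phi> (u w) m"
    by simp_all
  have "continuous_map (subtopology W N) (subtopology X U) u"
    using continuous_map_from_subtopology[OF u] s by (auto simp: continuous_map_in_subtopology)
  then have "continuous_map (subtopology W N)
      (prod_topology (subtopology X U) (discrete_topology (carrier (G x)))) (\<lambda>w. (u w, m))"
    using m by (intro continuous_map_pairedI) auto
  then have "continuous_map (subtopology W N) (subtopology T (fst -` U)) ((\<lambda>(u, m). (u, \<phi> u m)) \<circ> (\<lambda>w. (u w, m)))"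
    by (rule continuous_map_compose) (use hom homeomorphic_imp_continuous_map in blast)
  then have "continuous_map (subtopology W N) T (\<lambda>w. (u w, \<phi> (u w) m))"
    by (simp add: o_def continuous_map_in_subtopology)
  then have "continuous_map (subtopology W N) T (\<lambda>w. (u w, s w))"
    by (rule continuous_map_eq) (use s in auto)
  then show "\<exists>U. openin W U \<and> w0 \<in> U \<and> continuous_map (subtopology W U) T (\<lambda>w. (u w, s w))"
    using N by blast
qed

text \<open>In a chart a lift is locally constant, and the chart is linear in the fibre. So the operations of
  the fibres can be carried out on constants.\<close>

lemma local_system_lifts:
  assumes L: "local_system R X G T" and u: "continuous_map W X u"
  shows local_system_lift_zero: "continuous_map W T (\<lambda>w. (u w, \<zero>\<^bsub>G (u w)\<^esub>))"
    and local_system_lift_add: "continuous_map W T (\<lambda>w. (u w, s w)) \<Longrightarrow> continuous_map W T (\<lambda>w. (u w, s' w)) \<Longrightarrow>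
       continuous_map W T (\<lambda>w. (u w, s w \<oplus>\<^bsub>G (u w)\<^esub> s' w))"
    and local_system_lift_smult: "r \<in> carrier R \<Longrightarrow> continuous_map W T (\<lambda>w. (u w, s w)) \<Longrightarrow>
       continuous_map W T (\<lambda>w. (u w, r \<odot>\<^bsub>G (u w)\<^esub> s w))"
proof -
  have chart: "\<exists>U \<phi>. openin X U \<and> u w0 \<in> U \<and> (\<forall>v\<in>U. linear_map R (G (u w0)) (G v) (\<phi> v)) \<and>
      homeomorphic_map (prod_topology (subtopology X U) (discrete_topology (carrier (G (u w0)))))
          (subtopology T (fst -` U)) (\<lambda>(u, m). (u, \<phi> u m))" if "w0 \<in> topspace W" for w0
  proof -
    have "u w0 \<in> topspace X" using u that by (auto simp: continuous_map_def)
    then have "\<exists>U \<phi>. openin X U \<and> u w0 \<in> U \<and> (\<forall>v\<in>U. \<phi> v \<in> module_isos R (G (u w0)) (G v)) \<and>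
      homeomorphic_map (prod_topology (subtopology X U) (discrete_topology (carrier (G (u w0)))))
          (subtopology T (fst -` U)) (\<lambda>(u, m). (u, \<phi> u m))"
      using L unfolding local_system_def by (elim conjE) (rule bspec)
    then obtain U \<phi> where U: "openin X U \<and> u w0 \<in> U \<and> (\<forall>v\<in>U. \<phi> v \<in> module_isos R (G (u w0)) (G v)) \<and>
      homeomorphic_map (prod_topology (subtopology X U) (discrete_topology (carrier (G (u w0)))))
          (subtopology T (fst -` U)) (\<lambda>(u, m). (u, \<phi> u m))"
      by (elim exE)
    have "linear_map R (G (u w0)) (G v) (\<phi> v)" if "v \<in> U" for v
      using U that by (auto simp: module_isos_def iso_def hom_def linear_map_def)
    with U show ?thesis by (intro exI[of _ U] exI[of _ \<phi>]) simp
  qed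
  have mod: "left_module R (G v)" if "v \<in> topspace X" for v using L that unfolding local_system_def by blast
  have uX: "u w \<in> topspace X" if "w \<in> topspace W" for w using u that by (auto simp: continuous_map_def)
  show "continuous_map W T (\<lambda>w. (u w, \<zero>\<^bsub>G (u w)\<^esub>))"
  proof (rule local_system_lift_continuous[OF L u])
    fix w0 assume w0: "w0 \<in> topspace W"
    obtain U \<phi> where U: "openin X U" "u w0 \<in> U" "\<And>v. v \<in> U \<Longrightarrow> linear_map R (G (u w0)) (G v) (\<phi> v)"
      and hom: "homeomorphic_map (prod_topology (subtopology X U) (discrete_topology (carrier (G (u w0)))))
          (subtopology T (fst -` U)) (\<lambda>(u, m). (u, \<phi> u m))" using chart[OF w0] by blast
    have m: "\<zero>\<^bsub>G (u w0)\<^esub> \<in> carrier (G (u w0))"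
      using abelian_group.axioms(1)[OF left_module_abelian_group[OF mod[OF uX[OF w0]]]]
      by (rule abelian_monoid.zero_closed)
    have "\<phi> v \<zero>\<^bsub>G (u w0)\<^esub> = \<zero>\<^bsub>G v\<^esub>" if "v \<in> U" for v
      using linear_map_zero[OF mod[OF uX[OF w0]] mod U(3)[OF that]] openin_subset[OF U(1)] that by auto
    then show "\<exists>N U \<phi> x m. openin W N \<and> w0 \<in> N \<and> openin X U \<and> m \<in> carrier (G x) \<and>
       homeomorphic_map (prod_topology (subtopology X U) (discrete_topology (carrier (G x))))
          (subtopology T (fst -` U)) (\<lambda>(u, m). (u, \<phi> u m)) \<and>
       (\<forall>w\<in>N. u w \<in> U \<and> \<zero>\<^bsub>G (u w)\<^esub> = \<phi> (u w) m)"
      using hom m U w0 openin_continuous_map_preimage[OF u U(1)]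
      by (intro exI[of _ "{w \<in> topspace W. u w \<in> U}"] exI[of _ U] exI[of _ \<phi>] exI[of _ "u w0"]
            exI[of _ "\<zero>\<^bsub>G (u w0)\<^esub>"]) auto
  qed
  {
    assume s: "continuous_map W T (\<lambda>w. (u w, s w))" and s': "continuous_map W T (\<lambda>w. (u w, s' w))"
    show "continuous_map W T (\<lambda>w. (u w, s w \<oplus>\<^bsub>G (u w)\<^esub> s' w))"
    proof (rule local_system_lift_continuous[OF L u])
      fix w0 assume w0: "w0 \<in> topspace W"
      obtain U \<phi> where U: "openin X U" "u w0 \<in> U" "\<And>v. v \<in> U \<Longrightarrow> linear_map R (G (u w0)) (G v) (\<phi> v)"
        and hom: "homeomorphic_map (prod_topology (subtopology X U) (discrete_topology (carrier (G (u w0)))))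
          (subtopology T (fst -` U)) (\<lambda>(u, m). (u, \<phi> u m))" using chart[OF w0] by blast
      obtain N m where N: "openin W N" "w0 \<in> N" "m \<in> carrier (G (u w0))"
        "\<And>w. w \<in> N \<Longrightarrow> u w \<in> U \<and> s w = \<phi> (u w) m"
        using local_system_lift_locally_constant[OF L u s w0 U(1,2) hom] by metis
      obtain N' m' where N': "openin W N'" "w0 \<in> N'" "m' \<in> carrier (G (u w0))"
        "\<And>w. w \<in> N' \<Longrightarrow> u w \<in> U \<and> s' w = \<phi> (u w) m'"
        using local_system_lift_locally_constant[OF L u s' w0 U(1,2) hom] by metis
      have m: "m \<oplus>\<^bsub>G (u w0)\<^esub> m' \<in> carrier (G (u w0))"
        using abelian_group.axioms(1)[OF left_module_abelian_group[OF mod[OF uX[OF w0]]]] N(3) N'(3)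
        by (rule abelian_monoid.a_closed)
      have "\<forall>w\<in>N \<inter> N'. u w \<in> U \<and> s w \<oplus>\<^bsub>G (u w)\<^esub> s' w = \<phi> (u w) (m \<oplus>\<^bsub>G (u w0)\<^esub> m')"
        using N N' linear_map_add[OF U(3)] by auto
      then show "\<exists>N U \<phi> x m. openin W N \<and> w0 \<in> N \<and> openin X U \<and> m \<in> carrier (G x) \<and>
         homeomorphic_map (prod_topology (subtopology X U) (discrete_topology (carrier (G x))))
            (subtopology T (fst -` U)) (\<lambda>(u, m). (u, \<phi> u m)) \<and>
         (\<forall>w\<in>N. u w \<in> U \<and> s w \<oplus>\<^bsub>G (u w)\<^esub> s' w = \<phi> (u w) m)"
        using hom m U(1) N(1,2) N'(1,2)
        by (intro exI[of _ "N \<inter> N'"] exI[of _ U] exI[of _ \<phi>] exI[of _ "u w0"]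
              exI[of _ "m \<oplus>\<^bsub>G (u w0)\<^esub> m'"]) auto
    qed
  }
  {
    assume r: "r \<in> carrier R" and s: "continuous_map W T (\<lambda>w. (u w, s w))"
    show "continuous_map W T (\<lambda>w. (u w, r \<odot>\<^bsub>G (u w)\<^esub> s w))"
    proof (rule local_system_lift_continuous[OF L u])
      fix w0 assume w0: "w0 \<in> topspace W"
      obtain U \<phi> where U: "openin X U" "u w0 \<in> U" "\<And>v. v \<in> U \<Longrightarrow> linear_map R (G (u w0)) (G v) (\<phi> v)"
        and hom: "homeomorphic_map (prod_topology (subtopology X U) (discrete_topology (carrier (G (u w0)))))
          (subtopology T (fst -` U)) (\<lambda>(u, m). (u, \<phi> u m))" using chart[OF w0] by blast
      obtain N m where N: "openin W N" "w0 \<in> N" "m \<in> carrier (G (u w0))"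
        "\<And>w. w \<in> N \<Longrightarrow> u w \<in> U \<and> s w = \<phi> (u w) m"
        using local_system_lift_locally_constant[OF L u s w0 U(1,2) hom] by metis
      have m: "r \<odot>\<^bsub>G (u w0)\<^esub> m \<in> carrier (G (u w0))"
        using mod[OF uX[OF w0]] r N(3) by (rule left_module_smult_closed)
      have "\<forall>w\<in>N. u w \<in> U \<and> r \<odot>\<^bsub>G (u w)\<^esub> s w = \<phi> (u w) (r \<odot>\<^bsub>G (u w0)\<^esub> m)"
        using N linear_map_smult[OF U(3) r] by auto
      then show "\<exists>N U \<phi> x m. openin W N \<and> w0 \<in> N \<and> openin X U \<and> m \<in> carrier (G x) \<and>
         homeomorphic_map (prod_topology (subtopology X U) (discrete_topology (carrier (G x))))
            (subtopology T (fst -` U)) (\<lambda>(u, m). (u, \<phi> u m)) \<and>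
         (\<forall>w\<in>N. u w \<in> U \<and> r \<odot>\<^bsub>G (u w)\<^esub> s w = \<phi> (u w) m)"
        using hom m U(1) N(1,2)
        by (intro exI[of _ N] exI[of _ U] exI[of _ \<phi>] exI[of _ "u w0"]
              exI[of _ "r \<odot>\<^bsub>G (u w0)\<^esub> m"]) auto
    qed
  }
qed

lemma (in abelian_group) finsum_swap:
  assumes "finite A" "finite B" "\<And>a b. a \<in> A \<Longrightarrow> b \<in> B \<Longrightarrow> f a b \<in> carrier G"
  shows "finsum G (\<lambda>a. finsum G (f a) B) A = finsum G (\<lambda>b. finsum G (\<lambda>a. f a b) A) B"
  using assms(1,3)
proof (induction A rule: finite_induct)
  case empty
  then show ?case by (simp add: finsum_zero)
next
  case (insert x A)
  have "finsum G (\<lambda>b. finsum G (\<lambda>a. f a b) (insert x A)) B = finsum G (\<lambda>b. f x b \<oplus> finsum G (\<lambda>a. f a b) A) B"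
    by (rule finsum_cong') (use insert.hyps insert.prems in \<open>auto intro!: finsum_insert a_closed finsum_closed\<close>)
  also have "\<dots> = finsum G (f x) B \<oplus> finsum G (\<lambda>b. finsum G (\<lambda>a. f a b) A) B"
    by (rule finsum_addf) (use insert.prems in \<open>auto intro!: finsum_closed\<close>)
  also have "\<dots> = finsum G (\<lambda>a. finsum G (f a) B) (insert x A)"
    using insert.IH insert.hyps insert.prems by (simp add: finsum_insert Pi_iff)
  finally show ?case by simp
qed

lemma submodule_prod_finsum:
  assumes M: "\<And>i. i \<in> I \<Longrightarrow> left_module R (M i)" and N: "submodule_of R (prod_module I M) N"
    and "finite A" and "\<And>a. a \<in> A \<Longrightarrow> f a \<in> N"
  shows "(\<lambda>i\<in>I. finsum (M i) (\<lambda>a. f a i) A) \<in> N"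
  using assms(3,4)
proof (induction A rule: finite_induct)
  case empty
  have "(\<lambda>i\<in>I. finsum (M i) (\<lambda>a. f a i) {}) = \<zero>\<^bsub>prod_module I M\<^esub>"
    unfolding prod_module_def
    using abelian_monoid.finsum_empty[OF abelian_group.axioms(1)[OF left_module_abelian_group[OF M]]]
    by (auto simp: fun_eq_iff)
  then show ?case using N unfolding submodule_of_def by simp
next
  case (insert x A)
  have fi: "f a i \<in> carrier (M i)" if "a \<in> insert x A" "i \<in> I" for a i
  proof -
    have "f a \<in> carrier (prod_module I M)" using insert.prems[OF that(1)] N unfolding submodule_of_def by blast
    then show ?thesis using that(2) by (auto simp: prod_module_def)
  qed
  have "(\<lambda>i\<in>I. finsum (M i) (\<lambda>a. f a i) (insert x A)) = f x \<oplus>\<^bsub>prod_module I M\<^esub> (\<lambda>i\<in>I. finsum (M i) (\<lambda>a. f a i) A)"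
    unfolding prod_module_def
  proof (simp, rule ext)
    fix i
    show "(\<lambda>i\<in>I. finsum (M i) (\<lambda>a. f a i) (insert x A)) i
        = (\<lambda>i\<in>I. f x i \<oplus>\<^bsub>M i\<^esub> (if i \<in> I then finsum (M i) (\<lambda>a. f a i) A else undefined)) i"
      using abelian_monoid.finsum_insert[OF abelian_group.axioms(1)[OF left_module_abelian_group[OF M]], of i A x "\<lambda>a. f a i"]
        insert.hyps fi by (auto simp: Pi_iff)
  qed
  moreover have "(\<lambda>i\<in>I. finsum (M i) (\<lambda>a. f a i) A) \<in> N"
    by (rule insert.IH) (use insert.prems in auto)
  ultimately show ?case using N insert.prems unfolding submodule_of_def by simp
qed

text \<open>Continuous lifts form a submodule of all families of fibre elements. The lemma transfers closure
  under finite integral combinations to sums that are computed pointwise.\<close>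

lemma submodule_prod_zsum:
  assumes M: "\<And>i. i \<in> I \<Longrightarrow> left_module R (M i)" and R: "ring R" and N: "submodule_of R (prod_module I M) N"
    and "Poly_Mapping.keys c \<subseteq> S" and f: "\<And>a. a \<in> S \<Longrightarrow> f a \<in> N"
  shows "(\<lambda>i\<in>I. zsum (M i) (\<lambda>a. f a i) c) \<in> N"
proof -
  have P: "left_module R (prod_module I M)" by (rule left_module_prod_module[OF R M])
  have fi: "f a i \<in> carrier (M i)" if "a \<in> S" "i \<in> I" for a i
  proof -
    have "f a \<in> carrier (prod_module I M)" using f[OF that(1)] N unfolding submodule_of_def by blast
    then show ?thesis using that(2) by (auto simp: prod_module_def)
  qed
  note ab = left_module_abelian_group[OF M]
  show ?thesis
    using assms(4)
  proof (induction c rule: frag_induction_keys)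
    case zero
    have "(\<lambda>i\<in>I. zsum (M i) (\<lambda>a. f a i) 0) = \<zero>\<^bsub>prod_module I M\<^esub>"
      unfolding prod_module_def using abelian_group.zsum_0[OF ab] by (auto simp: fun_eq_iff)
    then show ?case using N unfolding submodule_of_def by simp
  next
    case (one a)
    have "f a \<in> carrier (prod_module I M)" using f[OF one] N unfolding submodule_of_def by blast
    then have "f a \<in> extensional I" by (auto simp: prod_module_def PiE_def)
    moreover have "zsum (M i) (\<lambda>a. f a i) (frag_of a) = f a i" if "i \<in> I" for i
      by (rule abelian_group.zsum_of[OF ab[OF that], of "\<lambda>a. f a i" a, OF fi[OF one that]])
    ultimately have "(\<lambda>i\<in>I. zsum (M i) (\<lambda>a. f a i) (frag_of a)) = f a"
      by (auto simp: fun_eq_iff extensional_def)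
    then show ?case using f[OF one] by simp
  next
    case (diff a b)
    let ?z = "\<lambda>c. (\<lambda>i\<in>I. zsum (M i) (\<lambda>a. f a i) c)"
    have b: "?z b \<in> carrier (prod_module I M)" using diff(4) N unfolding submodule_of_def by blast
    have "\<ominus>\<^bsub>prod_module I M\<^esub> ?z b \<in> N" by (rule submodule_of_a_inv[OF P N diff(4)])
    then have d: "?z a \<ominus>\<^bsub>prod_module I M\<^esub> ?z b \<in> N"
      using diff(3) N unfolding submodule_of_def a_minus_def by blast
    have e: "?z (a - b) \<oplus>\<^bsub>prod_module I M\<^esub> ?z b = ?z a"
    proof
      fix i
      show "(?z (a - b) \<oplus>\<^bsub>prod_module I M\<^esub> ?z b) i = ?z a i"
      proof (cases "i \<in> I")
        case True
        interpret Mi: abelian_group "M i" by (rule ab[OF True])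
        have "zsum (M i) (\<lambda>a. f a i) ((a - b) + b) = zsum (M i) (\<lambda>a. f a i) (a - b) \<oplus>\<^bsub>M i\<^esub> zsum (M i) (\<lambda>a. f a i) b"
          by (rule Mi.zsum_add[of S]) (use fi True diff(1,2) keys_diff[of a b] in auto)
        then show ?thesis using True by (simp add: prod_module_def)
      qed (simp add: prod_module_def)
    qed
    have c: "?z (a - b) \<in> carrier (prod_module I M)"
    proof -
      have "Poly_Mapping.keys (a - b) \<subseteq> S" using keys_diff[of a b] diff(1,2) by auto
      then have "zsum (M i) (\<lambda>a. f a i) (a - b) \<in> carrier (M i)" if "i \<in> I" for i
        by (intro abelian_group.zsum_closed[OF ab[OF that]]) (use fi that in auto)
      then show ?thesis by (auto simp: prod_module_def)
    qed
    have "x = z \<ominus>\<^bsub>prod_module I M\<^esub> y" if "x \<oplus>\<^bsub>prod_module I M\<^esub> y = z"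
      "x \<in> carrier (prod_module I M)" "y \<in> carrier (prod_module I M)" for x y z
    proof -
      interpret Q: abelian_group "prod_module I M" by (rule left_module_abelian_group[OF P])
      show ?thesis using that by (auto simp: a_minus_def Q.a_assoc Q.r_neg)
    qed
    then have eq: "?z (a - b) = ?z a \<ominus>\<^bsub>prod_module I M\<^esub> ?z b" using e c b by blast
    show ?case unfolding eq by (rule d)
  qed
qed

lemma simplices_nonneg: "\<sigma> \<in> simplices E j \<Longrightarrow> 0 \<le> j"
  by (simp add: simplices_def)

lemma simplices_singular: "\<sigma> \<in> simplices E j \<Longrightarrow> singular_simplex (nat j) (ftop E) \<sigma>"
  by (simp add: simplices_def)

lemma simplices_extensional: "\<sigma> \<in> simplices E j \<Longrightarrow> \<sigma> \<in> extensional (standard_simplex (nat j))"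
  by (simp add: simplices_def singular_simplex_def)

lemma simplices_topspace: "\<sigma> \<in> simplices E j \<Longrightarrow> t \<in> standard_simplex (nat j) \<Longrightarrow> \<sigma> t \<in> topspace (ftop E)"
  by (auto simp: simplices_def singular_simplex_def continuous_map_def)

lemma simplex_map_simplices:
  "\<sigma> \<in> simplices E j \<Longrightarrow> 0 \<le> m \<Longrightarrow> singular_simplex (nat m) (std_simplex (nat j)) \<theta> \<Longrightarrow>
     simplex_map (nat m) \<sigma> \<theta> \<in> simplices E m"
  unfolding simplices_def using singular_simplex_simplex_map[of "nat m" "std_simplex (nat j)" \<theta> "ftop E" \<sigma>]
  by (auto simp: singular_simplex_def)

lemma singular_std_simplex:
  "singular_simplex m (std_simplex j) \<theta> \<Longrightarrow> t \<in> standard_simplex m \<Longrightarrow> \<theta> t \<in> standard_simplex j"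
  by (auto simp: singular_simplex_def continuous_map_def)

lemma coeff_dom_subset: "coeff_dom E \<G> j \<sigma> \<subseteq> standard_simplex (nat j)"
  by (cases \<G>) auto

lemma coeff_dom_simplex_map:
  assumes "singular_simplex (nat m) (std_simplex (nat j)) \<theta>"
  shows "coeff_dom E \<G> m (simplex_map (nat m) \<sigma> \<theta>) = {t \<in> standard_simplex (nat m). \<theta> t \<in> coeff_dom E \<G> j \<sigma>}"
  using singular_std_simplex[OF assms] by (cases \<G>) (auto simp: simplex_map_def)

lemma coeff_lifts_extensional: "s \<in> coeff_lifts E \<G> j \<sigma> \<Longrightarrow> s \<in> extensional (coeff_dom E \<G> j \<sigma>)"
  by (cases \<G>) (auto simp: PiE_def)

lemma coeff_lifts_closed:
  "s \<in> coeff_lifts E \<G> j \<sigma> \<Longrightarrow> t \<in> coeff_dom E \<G> j \<sigma> \<Longrightarrow> s t \<in> carrier (fibre \<G> (\<sigma> t))"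
  by (cases \<G>) auto

lemma coeff_lifts_pullback:
  assumes \<sigma>: "\<sigma> \<in> simplices E j" and s: "s \<in> coeff_lifts E \<G> j \<sigma>"
    and \<theta>: "singular_simplex (nat m) (std_simplex (nat j)) \<theta>"
  shows "(\<lambda>t\<in>coeff_dom E \<G> m (simplex_map (nat m) \<sigma> \<theta>). s (\<theta> t)) \<in> coeff_lifts E \<G> m (simplex_map (nat m) \<sigma> \<theta>)"
proof (cases \<G>)
  case (Constant M)
  then show ?thesis using s singular_std_simplex[OF \<theta>] by (auto simp: fun_eq_iff restrict_def)
next
  case (Local_System G T)
  let ?\<tau> = "simplex_map (nat m) \<sigma> \<theta>"
  let ?D = "coeff_dom E \<G> m ?\<tau>" and ?C = "coeff_dom E \<G> j \<sigma>"
  note D = coeff_dom_simplex_map[OF \<theta>, of E \<G> \<sigma>]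
  have mem: "t \<in> standard_simplex (nat m) \<and> \<theta> t \<in> ?C \<and> ?\<tau> t = \<sigma> (\<theta> t)" if "t \<in> ?D" for t
    using that unfolding D by (auto simp: simplex_map_def)
  have c: "continuous_map (subtopology (powertop_real UNIV) ?C) T (\<lambda>t. (\<sigma> t, s t))"
    using s Local_System by simp
  have "continuous_map (subtopology (std_simplex (nat m)) ?D) (subtopology (powertop_real UNIV) ?C) \<theta>"
    using \<theta> continuous_map_from_subtopology[of "std_simplex (nat m)" "std_simplex (nat j)" \<theta> ?D]
    by (auto simp: singular_simplex_def continuous_map_in_subtopology D)
  moreover have "subtopology (std_simplex (nat m)) ?D = subtopology (powertop_real UNIV) ?D"
    using coeff_dom_subset[of E \<G> m ?\<tau>] by (simp add: subtopology_subtopology Int_absorb1)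
  ultimately have "continuous_map (subtopology (powertop_real UNIV) ?D) T ((\<lambda>t. (\<sigma> t, s t)) \<circ> \<theta>)"
    using continuous_map_compose[OF _ c] by simp
  then have "continuous_map (subtopology (powertop_real UNIV) ?D) T (\<lambda>t. (?\<tau> t, (\<lambda>t\<in>?D. s (\<theta> t)) t))"
    by (rule continuous_map_eq) (auto simp: mem)
  moreover have "(\<lambda>t\<in>?D. s (\<theta> t)) \<in> (\<Pi>\<^sub>E t\<in>?D. carrier (G (?\<tau> t)))"
  proof (rule PiE_I)
    fix t assume t: "t \<in> ?D"
    have "s (\<theta> t) \<in> carrier (fibre \<G> (\<sigma> (\<theta> t)))" using coeff_lifts_closed[OF s] mem[OF t] by blast
    then show "(\<lambda>t\<in>?D. s (\<theta> t)) t \<in> carrier (G (?\<tau> t))" using t mem[OF t] by (simp add: Local_System)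
  qed auto
  ultimately show ?thesis by (simp add: Local_System)
qed

section \<open>Operators on singular chains\<close>

locale chain_coefficients =
  fixes R :: "('r, 'm) ring_scheme" and E :: "'a filtered" and \<G> :: "('a, 'r, 'g) coefficients"
  assumes base_ring: "ring R" and coeffs: "coefficient_system R E \<G>"
begin

lemma fibre_module:
  assumes "\<sigma> \<in> simplices E j" "t \<in> coeff_dom E \<G> j \<sigma>"
  shows "left_module R (fibre \<G> (\<sigma> t))"
proof (cases \<G>)
  case (Local_System G T)
  then have "\<sigma> t \<in> topspace (subtopology (ftop E) (regular_part E))"
    using assms by (auto simp: regular_part_def)
  then show ?thesis using coeffs Local_System by (auto simp: local_system_def)
qed (use coeffs in simp)

lemma coeff_lifts_submodule:
  assumes \<sigma>: "\<sigma> \<in> simplices E j"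
  shows "submodule_of R (prod_module (coeff_dom E \<G> j \<sigma>) (\<lambda>t. fibre \<G> (\<sigma> t))) (coeff_lifts E \<G> j \<sigma>)"
proof (cases \<G>)
  case (Constant M)
  have M: "left_module R M" using coeffs Constant by simp
  interpret M: abelian_group M by (rule left_module_abelian_group[OF M])
  show ?thesis
    using left_module_smult_closed[OF M]
    by (auto simp: submodule_of_def Constant prod_module_def fun_eq_iff restrict_def
        intro: exI[of _ "\<zero>\<^bsub>M\<^esub>"])
next
  case (Local_System G T)
  let ?D = "coeff_dom E \<G> j \<sigma>"
  let ?W = "subtopology (powertop_real UNIV) ?D"
  let ?P = "prod_module ?D (\<lambda>t. fibre \<G> (\<sigma> t))"
  have L: "local_system R (subtopology (ftop E) (regular_part E)) G T" using coeffs Local_System by simp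
  have W: "?W = subtopology (std_simplex (nat j)) ?D"
    using coeff_dom_subset[of E \<G> j \<sigma>] by (simp add: subtopology_subtopology Int_absorb1)
  have u: "continuous_map ?W (subtopology (ftop E) (regular_part E)) \<sigma>"
    using simplices_singular[OF \<sigma>] continuous_map_from_subtopology[of "std_simplex (nat j)" "ftop E" \<sigma> ?D]
    unfolding W by (auto simp: singular_simplex_def continuous_map_in_subtopology Local_System)
  have lift: "s \<in> coeff_lifts E \<G> j \<sigma> \<longleftrightarrow> s \<in> carrier ?P \<and> continuous_map ?W T (\<lambda>t. (\<sigma> t, s t))" for s
    by (simp add: Local_System prod_module_def)
  have P: "left_module R ?P"
    by (rule left_module_prod_module[OF base_ring]) (rule fibre_module[OF \<sigma>])
  interpret P: abelian_group ?P by (rule left_module_abelian_group[OF P])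
  have eq: "continuous_map ?W T (\<lambda>t. (\<sigma> t, s t))"
    if "continuous_map ?W T (\<lambda>t. (\<sigma> t, s' t))" "\<And>t. t \<in> ?D \<Longrightarrow> s t = s' t" for s s'
    by (rule continuous_map_eq[OF that(1)]) (use that(2) in auto)
  show ?thesis
    unfolding submodule_of_def
  proof (intro conjI ballI)
    show "coeff_lifts E \<G> j \<sigma> \<subseteq> carrier ?P" using lift by blast
    have "continuous_map ?W T (\<lambda>t. (\<sigma> t, \<zero>\<^bsub>?P\<^esub> t))"
      by (rule eq[OF local_system_lift_zero[OF L u]]) (simp add: prod_module_def Local_System)
    then show "\<zero>\<^bsub>?P\<^esub> \<in> coeff_lifts E \<G> j \<sigma>" using lift by simp
    fix x assume x: "x \<in> coeff_lifts E \<G> j \<sigma>"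
    {
      fix y assume y: "y \<in> coeff_lifts E \<G> j \<sigma>"
      have "continuous_map ?W T (\<lambda>t. (\<sigma> t, (x \<oplus>\<^bsub>?P\<^esub> y) t))"
        by (rule eq[OF local_system_lift_add[OF L u, of x y]])
           (use x y lift in \<open>auto simp: prod_module_def Local_System\<close>)
      then show "x \<oplus>\<^bsub>?P\<^esub> y \<in> coeff_lifts E \<G> j \<sigma>" using lift x y by simp
    }
    fix r assume r: "r \<in> carrier R"
    have "continuous_map ?W T (\<lambda>t. (\<sigma> t, (r \<odot>\<^bsub>?P\<^esub> x) t))"
      by (rule eq[OF local_system_lift_smult[OF L u r, of x]])
         (use x lift in \<open>auto simp: prod_module_def Local_System\<close>)
    then show "r \<odot>\<^bsub>?P\<^esub> x \<in> coeff_lifts E \<G> j \<sigma>"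
      using lift x left_module_smult_closed[OF P r] by simp
  qed
qed

lemma left_module_coeff:
  assumes \<sigma>: "\<sigma> \<in> simplices E j"
  shows "left_module R (coeff_module E \<G> j \<sigma>)"
  unfolding coeff_module_def
  by (rule left_module_submodule[OF left_module_prod_module[OF base_ring fibre_module[OF \<sigma>]] coeff_lifts_submodule[OF \<sigma>]])

abbreviation "C \<equiv> chain_module E \<G>"

lemma left_module_chain: "left_module R (C j)"
  unfolding chain_module_def by (rule left_module_prod_module[OF base_ring left_module_coeff])

lemma chain_lift: "\<xi> \<in> carrier (C j) \<Longrightarrow> \<sigma> \<in> simplices E j \<Longrightarrow> \<xi> \<sigma> \<in> coeff_lifts E \<G> j \<sigma>"
  by (auto simp: chain_module_def prod_module_def coeff_module_def)

lemma chain_closed: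
  "\<xi> \<in> carrier (C j) \<Longrightarrow> \<sigma> \<in> simplices E j \<Longrightarrow> t \<in> coeff_dom E \<G> j \<sigma> \<Longrightarrow> \<xi> \<sigma> t \<in> carrier (fibre \<G> (\<sigma> t))"
  by (rule coeff_lifts_closed[OF chain_lift])

lemma chain_eval:
  assumes "\<sigma> \<in> simplices E j" "t \<in> coeff_dom E \<G> j \<sigma>"
  shows chain_add_eval: "(\<xi> \<oplus>\<^bsub>C j\<^esub> \<eta>) \<sigma> t = \<xi> \<sigma> t \<oplus>\<^bsub>fibre \<G> (\<sigma> t)\<^esub> \<eta> \<sigma> t"
    and chain_zero_eval: "\<zero>\<^bsub>C j\<^esub> \<sigma> t = \<zero>\<^bsub>fibre \<G> (\<sigma> t)\<^esub>"
    and chain_smult_eval: "(r \<odot>\<^bsub>C j\<^esub> \<xi>) \<sigma> t = r \<odot>\<^bsub>fibre \<G> (\<sigma> t)\<^esub> \<xi> \<sigma> t"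
    and coeff_zero_eval: "\<zero>\<^bsub>coeff_module E \<G> j \<sigma>\<^esub> t = \<zero>\<^bsub>fibre \<G> (\<sigma> t)\<^esub>"
  using assms by (simp_all add: chain_module_def prod_module_def coeff_module_def)

lemma coeff_eqI:
  assumes "s \<in> coeff_lifts E \<G> j \<sigma>" "s' \<in> coeff_lifts E \<G> j \<sigma>" "\<And>t. t \<in> coeff_dom E \<G> j \<sigma> \<Longrightarrow> s t = s' t"
  shows "s = s'"
  by (rule extensionalityI[OF coeff_lifts_extensional[OF assms(1)] coeff_lifts_extensional[OF assms(2)] assms(3)])

lemma chain_eqI:
  assumes \<xi>: "\<xi> \<in> carrier (C j)" and \<eta>: "\<eta> \<in> carrier (C j)"
    and "\<And>\<sigma> t. \<sigma> \<in> simplices E j \<Longrightarrow> t \<in> coeff_dom E \<G> j \<sigma> \<Longrightarrow> \<xi> \<sigma> t = \<eta> \<sigma> t"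
  shows "\<xi> = \<eta>"
proof (rule extensionalityI)
  show "\<xi> \<in> extensional (simplices E j)" "\<eta> \<in> extensional (simplices E j)"
    using \<xi> \<eta> by (auto simp: chain_module_def prod_module_def PiE_def)
  show "\<xi> \<sigma> = \<eta> \<sigma>" if "\<sigma> \<in> simplices E j" for \<sigma>
    by (rule coeff_eqI[OF chain_lift[OF \<xi> that] chain_lift[OF \<eta> that]]) (rule assms(3)[OF that])
qed

lemma coeff_zero_lift: "\<sigma> \<in> simplices E j \<Longrightarrow> \<zero>\<^bsub>coeff_module E \<G> j \<sigma>\<^esub> \<in> coeff_lifts E \<G> j \<sigma>"
  using coeff_lifts_submodule by (simp add: submodule_of_def coeff_module_def)

abbreviation "spx j \<xi> \<equiv> simplices_of E \<G> j \<xi>"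

lemma spx_simplices: "\<sigma> \<in> spx j \<xi> \<Longrightarrow> \<sigma> \<in> simplices E j"
  by (simp add: simplices_of_def)

lemma not_spx_eval:
  "\<sigma> \<in> simplices E j \<Longrightarrow> \<sigma> \<notin> spx j \<xi> \<Longrightarrow> t \<in> coeff_dom E \<G> j \<sigma> \<Longrightarrow> \<xi> \<sigma> t = \<zero>\<^bsub>fibre \<G> (\<sigma> t)\<^esub>"
  using coeff_zero_eval by (auto simp: simplices_of_def)

text \<open>This is the finiteness that makes the sums in \<open>push\<close> finite at each point. It does not refer to the
  topology, and it covers finite chains and chains with fibrewise compact support alike.\<close>

definition point_finite :: "int \<Rightarrow> ('a, 'g) schain \<Rightarrow> bool" where
  "point_finite j \<xi> \<longleftrightarrow> (\<forall>x. finite {\<sigma> \<in> spx j \<xi>. x \<in> \<sigma> ` standard_simplex (nat j)})"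

text \<open>A rule that assigns an integral chain of \<open>m\<close>-simplices in the standard \<open>j\<close>-simplex to each singular
  \<open>j\<close>-simplex. The chain may depend on the singular simplex: a star depends on which of its
  vertices are selected. For \<open>m < 0\<close> only the zero chain is possible, although \<open>nat m\<close> is \<open>0\<close>.\<close>

definition simplex_operator ::
    "int \<Rightarrow> int \<Rightarrow> (((nat \<Rightarrow> real) \<Rightarrow> 'a) \<Rightarrow> (nat \<Rightarrow> real) chain) \<Rightarrow> bool" where
  "simplex_operator j m \<Theta> \<longleftrightarrow> (\<forall>\<sigma>\<in>simplices E j. \<forall>\<theta>\<in>Poly_Mapping.keys (\<Theta> \<sigma>).
     0 \<le> m \<and> singular_simplex (nat m) (std_simplex (nat j)) \<theta>)"

text \<open>The contribution of \<open>\<sigma>\<close> and \<open>\<theta>\<close> to the coefficient of \<open>\<tau>\<close> at the point \<open>t\<close>. Outside of the case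
  \<open>\<sigma> \<circ> \<theta> = \<tau>\<close> it is zero, so that sums may run over more simplices than necessary.\<close>

definition pulled ::
    "int \<Rightarrow> ((nat \<Rightarrow> real) \<Rightarrow> 'a) \<Rightarrow> ('a, 'g) schain \<Rightarrow> ((nat \<Rightarrow> real) \<Rightarrow> 'a)
      \<Rightarrow> ((nat \<Rightarrow> real) \<Rightarrow> nat \<Rightarrow> real) \<Rightarrow> (nat \<Rightarrow> real) \<Rightarrow> 'g" where
  "pulled m \<tau> \<xi> \<sigma> \<theta> t = (if simplex_map (nat m) \<sigma> \<theta> = \<tau> then \<xi> \<sigma> (\<theta> t) else \<zero>\<^bsub>fibre \<G> (\<tau> t)\<^esub>)"

text \<open>The chain obtained from \<open>\<xi>\<close> by replacing each simplex \<open>\<sigma>\<close>, with coefficient \<open>s\<close>, by the image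
  under \<open>\<sigma>\<close> of the chain \<open>\<Theta> \<sigma>\<close> of the standard simplex, where the coefficient of a simplex \<open>\<theta>\<close> of
  \<open>\<Theta> \<sigma>\<close> is multiplied by the pullback of \<open>s\<close> along \<open>\<theta>\<close>.\<close>

definition push ::
    "int \<Rightarrow> int \<Rightarrow> (((nat \<Rightarrow> real) \<Rightarrow> 'a) \<Rightarrow> (nat \<Rightarrow> real) chain) \<Rightarrow> ('a, 'g) schain \<Rightarrow> ('a, 'g) schain" where
  "push j m \<Theta> \<xi> = (\<lambda>\<tau>\<in>simplices E m. \<lambda>t\<in>coeff_dom E \<G> m \<tau>.
     finsum (fibre \<G> (\<tau> t)) (\<lambda>\<sigma>. zsum (fibre \<G> (\<tau> t)) (\<lambda>\<theta>. pulled m \<tau> \<xi> \<sigma> \<theta> t) (\<Theta> \<sigma>))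
       {\<sigma> \<in> spx j \<xi>. \<exists>\<theta>\<in>Poly_Mapping.keys (\<Theta> \<sigma>). simplex_map (nat m) \<sigma> \<theta> = \<tau>})"

lemma simplex_operatorD:
  assumes "simplex_operator j m \<Theta>" "\<sigma> \<in> simplices E j" "\<theta> \<in> Poly_Mapping.keys (\<Theta> \<sigma>)"
  shows "0 \<le> m" "singular_simplex (nat m) (std_simplex (nat j)) \<theta>" "simplex_map (nat m) \<sigma> \<theta> \<in> simplices E m"
proof -
  show *: "0 \<le> m" "singular_simplex (nat m) (std_simplex (nat j)) \<theta>"
    using assms unfolding simplex_operator_def by auto
  show "simplex_map (nat m) \<sigma> \<theta> \<in> simplices E m" by (rule simplex_map_simplices[OF assms(2) *])
qed

lemma push_index_finite:
  assumes \<xi>: "point_finite j \<xi>" and \<Theta>: "simplex_operator j m \<Theta>" and t: "t \<in> standard_simplex (nat m)"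
  shows "{\<sigma> \<in> spx j \<xi>. \<exists>\<theta>\<in>Poly_Mapping.keys (\<Theta> \<sigma>). simplex_map (nat m) \<sigma> \<theta> = \<tau>}
      \<subseteq> {\<sigma> \<in> spx j \<xi>. \<tau> t \<in> \<sigma> ` standard_simplex (nat j)}"
proof clarify
  fix \<sigma> \<theta> assume \<sigma>: "\<sigma> \<in> spx j \<xi>" and \<theta>: "\<theta> \<in> Poly_Mapping.keys (\<Theta> \<sigma>)"
  have "\<theta> t \<in> standard_simplex (nat j)"
    using simplex_operatorD(2)[OF \<Theta> spx_simplices[OF \<sigma>] \<theta>] t by (rule singular_std_simplex)
  then show "simplex_map (nat m) \<sigma> \<theta> t \<in> \<sigma> ` standard_simplex (nat j)"
    using t by (simp add: simplex_map_def)
qed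

lemma pulled_closed:
  assumes \<xi>: "\<xi> \<in> carrier (C j)" and \<sigma>: "\<sigma> \<in> simplices E j"
    and \<theta>: "singular_simplex (nat m) (std_simplex (nat j)) \<theta>"
    and \<tau>: "\<tau> \<in> simplices E m" and t: "t \<in> coeff_dom E \<G> m \<tau>"
  shows "pulled m \<tau> \<xi> \<sigma> \<theta> t \<in> carrier (fibre \<G> (\<tau> t))"
proof (cases "simplex_map (nat m) \<sigma> \<theta> = \<tau>")
  case True
  then have "\<theta> t \<in> coeff_dom E \<G> j \<sigma>" "t \<in> standard_simplex (nat m)"
    using t coeff_dom_simplex_map[OF \<theta>, of E \<G> \<sigma>] by auto
  then have "\<xi> \<sigma> (\<theta> t) \<in> carrier (fibre \<G> (\<sigma> (\<theta> t)))" "\<tau> t = \<sigma> (\<theta> t)"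
    using chain_closed[OF \<xi> \<sigma>] True by (auto simp: simplex_map_def)
  then show ?thesis using True by (simp add: pulled_def)
next
  case False
  interpret abelian_group "fibre \<G> (\<tau> t)"
    by (rule left_module_abelian_group[OF fibre_module[OF \<tau> t]])
  show ?thesis using False by (simp add: pulled_def)
qed

text \<open>The index set in the definition depends on \<open>\<xi>\<close> and \<open>\<tau>\<close>; sums of two chains and compositions
  require a common larger one.\<close>

lemma push_eval:
  assumes \<xi>: "\<xi> \<in> carrier (C j)" and \<Theta>: "simplex_operator j m \<Theta>"
    and \<tau>: "\<tau> \<in> simplices E m" and t: "t \<in> coeff_dom E \<G> m \<tau>"
    and S: "finite S" "S \<subseteq> simplices E j"
      "{\<sigma> \<in> spx j \<xi>. \<exists>\<theta>\<in>Poly_Mapping.keys (\<Theta> \<sigma>). simplex_map (nat m) \<sigma> \<theta> = \<tau>} \<subseteq> S"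
  shows "push j m \<Theta> \<xi> \<tau> t =
    finsum (fibre \<G> (\<tau> t)) (\<lambda>\<sigma>. zsum (fibre \<G> (\<tau> t)) (\<lambda>\<theta>. pulled m \<tau> \<xi> \<sigma> \<theta> t) (\<Theta> \<sigma>)) S"
proof -
  interpret M: abelian_group "fibre \<G> (\<tau> t)"
    by (rule left_module_abelian_group[OF fibre_module[OF \<tau> t]])
  have cl: "zsum (fibre \<G> (\<tau> t)) (\<lambda>\<theta>. pulled m \<tau> \<xi> \<sigma> \<theta> t) (\<Theta> \<sigma>) \<in> carrier (fibre \<G> (\<tau> t))"
    if "\<sigma> \<in> simplices E j" for \<sigma>
    using pulled_closed[OF \<xi> that _ \<tau> t] simplex_operatorD(2)[OF \<Theta> that] by (intro M.zsum_closed) auto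
  have zero: "zsum (fibre \<G> (\<tau> t)) (\<lambda>\<theta>. pulled m \<tau> \<xi> \<sigma> \<theta> t) (\<Theta> \<sigma>) = \<zero>\<^bsub>fibre \<G> (\<tau> t)\<^esub>"
    if \<sigma>: "\<sigma> \<in> S" "\<not> (\<sigma> \<in> spx j \<xi> \<and> (\<exists>\<theta>\<in>Poly_Mapping.keys (\<Theta> \<sigma>). simplex_map (nat m) \<sigma> \<theta> = \<tau>))" for \<sigma>
  proof -
    have "pulled m \<tau> \<xi> \<sigma> \<theta> t = \<zero>\<^bsub>fibre \<G> (\<tau> t)\<^esub>" if \<theta>: "\<theta> \<in> Poly_Mapping.keys (\<Theta> \<sigma>)" for \<theta>
    proof (cases "simplex_map (nat m) \<sigma> \<theta> = \<tau>")
      case True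
      have \<sigma>s: "\<sigma> \<in> simplices E j" using \<sigma> S by auto
      have "\<theta> t \<in> coeff_dom E \<G> j \<sigma>" "t \<in> standard_simplex (nat m)"
        using True t coeff_dom_simplex_map[OF simplex_operatorD(2)[OF \<Theta> \<sigma>s \<theta>], of E \<G> \<sigma>] by auto
      moreover have "\<sigma> \<notin> spx j \<xi>" using \<sigma> True \<theta> by auto
      ultimately have "\<xi> \<sigma> (\<theta> t) = \<zero>\<^bsub>fibre \<G> (\<sigma> (\<theta> t))\<^esub>" "\<tau> t = \<sigma> (\<theta> t)"
        using not_spx_eval[OF \<sigma>s] True by (auto simp: simplex_map_def)
      then show ?thesis by (simp add: pulled_def)
    qed (simp add: pulled_def)
    then have "zsum (fibre \<G> (\<tau> t)) (\<lambda>\<theta>. pulled m \<tau> \<xi> \<sigma> \<theta> t) (\<Theta> \<sigma>) = zsum (fibre \<G> (\<tau> t)) (\<lambda>\<theta>. \<zero>\<^bsub>fibre \<G> (\<tau> t)\<^esub>) (\<Theta> \<sigma>)"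
      by (intro M.zsum_cong) simp
    then show ?thesis by (simp add: M.zsum_zero)
  qed
  show ?thesis
    unfolding push_def using \<tau> t
    by simp (rule M.add.finprod_mono_neutral_cong_left[OF S(1,3)], use zero cl S in auto)
qed

lemma push_eval_point:
  assumes \<xi>: "\<xi> \<in> carrier (C j)" "point_finite j \<xi>" and \<Theta>: "simplex_operator j m \<Theta>"
    and \<tau>: "\<tau> \<in> simplices E m" and t: "t \<in> coeff_dom E \<G> m \<tau>"
  shows "push j m \<Theta> \<xi> \<tau> t =
    finsum (fibre \<G> (\<tau> t)) (\<lambda>\<sigma>. zsum (fibre \<G> (\<tau> t)) (\<lambda>\<theta>. pulled m \<tau> \<xi> \<sigma> \<theta> t) (\<Theta> \<sigma>))
      {\<sigma> \<in> spx j \<xi>. \<tau> t \<in> \<sigma> ` standard_simplex (nat j)}"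
proof (rule push_eval[OF \<xi>(1) \<Theta> \<tau> t])
  show "finite {\<sigma> \<in> spx j \<xi>. \<tau> t \<in> \<sigma> ` standard_simplex (nat j)}"
    using \<xi>(2) by (simp add: point_finite_def)
  show "{\<sigma> \<in> spx j \<xi>. \<exists>\<theta>\<in>Poly_Mapping.keys (\<Theta> \<sigma>). simplex_map (nat m) \<sigma> \<theta> = \<tau>}
      \<subseteq> {\<sigma> \<in> spx j \<xi>. \<tau> t \<in> \<sigma> ` standard_simplex (nat j)}"
    by (rule push_index_finite[OF \<xi>(2) \<Theta>]) (use t coeff_dom_subset in blast)
qed (auto simp: simplices_of_def)

lemma pulled_lift:
  assumes \<xi>: "\<xi> \<in> carrier (C j)" and \<sigma>: "\<sigma> \<in> simplices E j"
    and \<theta>: "singular_simplex (nat m) (std_simplex (nat j)) \<theta>" and \<tau>: "\<tau> \<in> simplices E m"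
  shows "(\<lambda>t\<in>coeff_dom E \<G> m \<tau>. pulled m \<tau> \<xi> \<sigma> \<theta> t) \<in> coeff_lifts E \<G> m \<tau>"
proof (cases "simplex_map (nat m) \<sigma> \<theta> = \<tau>")
  case True
  then show ?thesis using coeff_lifts_pullback[OF \<sigma> chain_lift[OF \<xi> \<sigma>] \<theta>] by (simp add: pulled_def)
next
  case False
  then have "(\<lambda>t\<in>coeff_dom E \<G> m \<tau>. pulled m \<tau> \<xi> \<sigma> \<theta> t) = \<zero>\<^bsub>coeff_module E \<G> m \<tau>\<^esub>"
    by (simp add: pulled_def coeff_module_def prod_module_def)
  then show ?thesis using coeff_zero_lift[OF \<tau>] by simp
qed

lemma push_closed:
  assumes \<xi>: "\<xi> \<in> carrier (C j)" "point_finite j \<xi>" and \<Theta>: "simplex_operator j m \<Theta>"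
  shows "push j m \<Theta> \<xi> \<in> carrier (C m)"
proof -
  have "push j m \<Theta> \<xi> \<tau> \<in> coeff_lifts E \<G> m \<tau>" if \<tau>: "\<tau> \<in> simplices E m" for \<tau>
  proof -
    let ?D = "coeff_dom E \<G> m \<tau>"
    let ?S = "{\<sigma> \<in> spx j \<xi>. \<exists>\<theta>\<in>Poly_Mapping.keys (\<Theta> \<sigma>). simplex_map (nat m) \<sigma> \<theta> = \<tau>}"
    let ?Z = "\<lambda>\<sigma>. \<lambda>t\<in>?D. zsum (fibre \<G> (\<tau> t)) (\<lambda>\<theta>. (\<lambda>t\<in>?D. pulled m \<tau> \<xi> \<sigma> \<theta> t) t) (\<Theta> \<sigma>)"
    obtain t where "t \<in> standard_simplex (nat m)" using nonempty_standard_simplex by blast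
    then have "?S \<subseteq> {\<sigma> \<in> spx j \<xi>. \<tau> t \<in> \<sigma> ` standard_simplex (nat j)}"
      by (rule push_index_finite[OF \<xi>(2) \<Theta>])
    then have fin: "finite ?S" using \<xi>(2) finite_subset unfolding point_finite_def by blast
    have Z: "?Z \<sigma> \<in> coeff_lifts E \<G> m \<tau>" if "\<sigma> \<in> ?S" for \<sigma>
    proof (rule submodule_prod_zsum[OF fibre_module[OF \<tau>] base_ring coeff_lifts_submodule[OF \<tau>]])
      show "Poly_Mapping.keys (\<Theta> \<sigma>) \<subseteq> Poly_Mapping.keys (\<Theta> \<sigma>)" by simp
      have "\<sigma> \<in> simplices E j" using that spx_simplices by auto
      then show "(\<lambda>t\<in>?D. pulled m \<tau> \<xi> \<sigma> \<theta> t) \<in> coeff_lifts E \<G> m \<tau>" if "\<theta> \<in> Poly_Mapping.keys (\<Theta> \<sigma>)" for \<theta>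
        using pulled_lift[OF \<xi>(1) _ simplex_operatorD(2)[OF \<Theta> _ that] \<tau>] by blast
    qed
    have "(\<lambda>t\<in>?D. finsum (fibre \<G> (\<tau> t)) (\<lambda>\<sigma>. ?Z \<sigma> t) ?S) \<in> coeff_lifts E \<G> m \<tau>"
      by (rule submodule_prod_finsum[OF fibre_module[OF \<tau>] coeff_lifts_submodule[OF \<tau>] fin Z])
    moreover have "(\<lambda>t\<in>?D. finsum (fibre \<G> (\<tau> t)) (\<lambda>\<sigma>. ?Z \<sigma> t) ?S) = push j m \<Theta> \<xi> \<tau>"
      using \<tau> by (auto simp: push_def fun_eq_iff)
    ultimately show ?thesis by simp
  qed
  then show ?thesis
    by (auto simp: chain_module_def prod_module_def coeff_module_def push_def)
qed

lemma spx_push: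
  assumes \<Theta>: "simplex_operator j m \<Theta>" and \<tau>: "\<tau> \<in> spx m (push j m \<Theta> \<xi>)"
  obtains \<sigma> \<theta> where "\<sigma> \<in> spx j \<xi>" "\<theta> \<in> Poly_Mapping.keys (\<Theta> \<sigma>)" "\<tau> = simplex_map (nat m) \<sigma> \<theta>"
proof -
  have \<tau>s: "\<tau> \<in> simplices E m" using \<tau> by (rule spx_simplices)
  have "\<exists>\<sigma>\<in>spx j \<xi>. \<exists>\<theta>\<in>Poly_Mapping.keys (\<Theta> \<sigma>). simplex_map (nat m) \<sigma> \<theta> = \<tau>"
  proof (rule ccontr)
    assume "\<not> ?thesis"
    then have e: "{\<sigma> \<in> spx j \<xi>. \<exists>\<theta>\<in>Poly_Mapping.keys (\<Theta> \<sigma>). simplex_map (nat m) \<sigma> \<theta> = \<tau>} = {}" by blast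
    have "push j m \<Theta> \<xi> \<tau> = (\<lambda>t\<in>coeff_dom E \<G> m \<tau>. finsum (fibre \<G> (\<tau> t))
        (\<lambda>\<sigma>. zsum (fibre \<G> (\<tau> t)) (\<lambda>\<theta>. pulled m \<tau> \<xi> \<sigma> \<theta> t) (\<Theta> \<sigma>)) {})"
      unfolding push_def restrict_apply'[OF \<tau>s] e ..
    also have "\<dots> = \<zero>\<^bsub>coeff_module E \<G> m \<tau>\<^esub>"
      unfolding coeff_module_def prod_module_def
      using abelian_monoid.finsum_empty[OF abelian_group.axioms(1)[OF left_module_abelian_group[OF fibre_module[OF \<tau>s]]]]
      by (auto simp: fun_eq_iff)
    finally have "push j m \<Theta> \<xi> \<tau> = \<zero>\<^bsub>coeff_module E \<G> m \<tau>\<^esub>" .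
    then show False using \<tau> by (simp add: simplices_of_def)
  qed
  then show ?thesis using that by blast
qed

text \<open>Operators compose like the chains that define them. This reduces identities between operators to
  identities between integral chains of standard simplices.\<close>

lemma push_push:
  assumes \<xi>: "\<xi> \<in> carrier (C j)" "point_finite j \<xi>"
    and \<Theta>: "simplex_operator j m \<Theta>" and \<Psi>: "simplex_operator m l \<Psi>"
    and pf: "point_finite m (push j m \<Theta> \<xi>)"
  shows "push m l \<Psi> (push j m \<Theta> \<xi>) =
    push j l (\<lambda>\<sigma>. frag_extend (\<lambda>\<theta>. chain_map (nat l) \<theta> (\<Psi> (simplex_map (nat m) \<sigma> \<theta>))) (\<Theta> \<sigma>)) \<xi>"
    (is "_ = push j l ?\<Phi> \<xi>")
proof -
  (* At a point t, both sides are sums of the terms P over sigma, sigma', theta and theta1. On the right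
     the middle simplex sigma' is determined by sigma and theta, on the left it runs over K. *)
  let ?\<eta> = "push j m \<Theta> \<xi>"
  have comp: "singular_simplex (nat l) (std_simplex (nat j)) (simplex_map (nat l) \<theta> \<theta>1)"
    if "singular_simplex (nat m) (std_simplex (nat j)) \<theta>" "singular_simplex (nat l) (std_simplex (nat m)) \<theta>1" for \<theta> \<theta>1
    using singular_simplex_simplex_map[OF that(2)] that(1) by (auto simp: singular_simplex_def)
  have keys\<Phi>: "\<exists>\<theta>\<in>Poly_Mapping.keys (\<Theta> \<sigma>). \<exists>\<theta>1\<in>Poly_Mapping.keys (\<Psi> (simplex_map (nat m) \<sigma> \<theta>)).
      \<kappa> = simplex_map (nat l) \<theta> \<theta>1" if "\<kappa> \<in> Poly_Mapping.keys (?\<Phi> \<sigma>)" for \<sigma> \<kappa>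
  proof -
    obtain \<theta> where \<theta>: "\<theta> \<in> Poly_Mapping.keys (\<Theta> \<sigma>)"
      "\<kappa> \<in> Poly_Mapping.keys (chain_map (nat l) \<theta> (\<Psi> (simplex_map (nat m) \<sigma> \<theta>)))"
      using \<open>\<kappa> \<in> _\<close> keys_frag_extend by fastforce
    then show ?thesis
      unfolding chain_map_def using keys_frag_extend[of "frag_of \<circ> simplex_map (nat l) \<theta>"]
      by (fastforce simp: keys_frag_of)
  qed
  have \<Phi>: "simplex_operator j l ?\<Phi>"
    unfolding simplex_operator_def
  proof (intro ballI)
    fix \<sigma> \<kappa> assume \<sigma>: "\<sigma> \<in> simplices E j" and "\<kappa> \<in> Poly_Mapping.keys (?\<Phi> \<sigma>)"
    then obtain \<theta> \<theta>1 where \<theta>: "\<theta> \<in> Poly_Mapping.keys (\<Theta> \<sigma>)"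
      and \<theta>1: "\<theta>1 \<in> Poly_Mapping.keys (\<Psi> (simplex_map (nat m) \<sigma> \<theta>))" "\<kappa> = simplex_map (nat l) \<theta> \<theta>1"
      using keys\<Phi>[of \<kappa> \<sigma>] by auto
    note a = simplex_operatorD[OF \<Theta> \<sigma> \<theta>]
    note b = simplex_operatorD[OF \<Psi> a(3) \<theta>1(1)]
    show "0 \<le> l \<and> singular_simplex (nat l) (std_simplex (nat j)) \<kappa>"
      using b(1) comp[OF a(2) b(2)] \<theta>1(2) by simp
  qed
  have \<eta>: "?\<eta> \<in> carrier (C m)" by (rule push_closed[OF \<xi> \<Theta>])
  show ?thesis
  proof (rule chain_eqI)
    show "push m l \<Psi> ?\<eta> \<in> carrier (C l)" by (rule push_closed[OF \<eta> pf \<Psi>])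
    show "push j l ?\<Phi> \<xi> \<in> carrier (C l)" by (rule push_closed[OF \<xi> \<Phi>])
    fix \<tau> t assume \<tau>: "\<tau> \<in> simplices E l" and t: "t \<in> coeff_dom E \<G> l \<tau>"
    define M where "M = fibre \<G> (\<tau> t)"
    interpret M: abelian_group M
      unfolding M_def by (rule left_module_abelian_group[OF fibre_module[OF \<tau> t]])
    have tl: "t \<in> standard_simplex (nat l)" using t coeff_dom_subset by blast
    define I where "I = {\<sigma> \<in> spx j \<xi>. \<tau> t \<in> \<sigma> ` standard_simplex (nat j)}"
    have I: "finite I" "I \<subseteq> simplices E j" "I \<subseteq> spx j \<xi>"
      using \<xi>(2) by (auto simp: I_def point_finite_def simplices_of_def)
    define K where "K = (\<Union>\<sigma>\<in>I. simplex_map (nat m) \<sigma> ` Poly_Mapping.keys (\<Theta> \<sigma>))"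
    have K: "finite K" "K \<subseteq> simplices E m"
      using I simplex_operatorD(3)[OF \<Theta>] by (auto simp: K_def)
    define P where "P \<sigma> \<sigma>' \<theta> \<theta>1 = (if simplex_map (nat m) \<sigma> \<theta> = \<sigma>' \<and> simplex_map (nat l) \<sigma>' \<theta>1 = \<tau>
        then \<xi> \<sigma> (\<theta> (\<theta>1 t)) else \<zero>\<^bsub>M\<^esub>)" for \<sigma> \<sigma>' \<theta> \<theta>1
    have inner: "simplex_map (nat l) \<sigma>' \<theta>1 = \<tau> \<Longrightarrow>
        \<theta>1 t \<in> coeff_dom E \<G> m \<sigma>' \<and> \<sigma>' (\<theta>1 t) = \<tau> t"
      if "\<sigma>' \<in> simplices E m" "\<theta>1 \<in> Poly_Mapping.keys (\<Psi> \<sigma>')" for \<sigma>' \<theta>1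
      using coeff_dom_simplex_map[OF simplex_operatorD(2)[OF \<Psi> that], of E \<G> \<sigma>'] t tl
      by (auto simp: simplex_map_def)
    have Pcl: "P \<sigma> \<sigma>' \<theta> \<theta>1 \<in> carrier M"
      if "\<sigma> \<in> simplices E j" "\<theta> \<in> Poly_Mapping.keys (\<Theta> \<sigma>)" "\<sigma>' \<in> simplices E m" "\<theta>1 \<in> Poly_Mapping.keys (\<Psi> \<sigma>')"
      for \<sigma> \<sigma>' \<theta> \<theta>1
    proof (cases "simplex_map (nat m) \<sigma> \<theta> = \<sigma>' \<and> simplex_map (nat l) \<sigma>' \<theta>1 = \<tau>")
      case True
      then have "pulled m \<sigma>' \<xi> \<sigma> \<theta> (\<theta>1 t) \<in> carrier (fibre \<G> (\<sigma>' (\<theta>1 t)))"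
        using pulled_closed[OF \<xi>(1) that(1) simplex_operatorD(2)[OF \<Theta> that(1,2)] that(3)] inner[OF that(3,4)]
        by blast
      then show ?thesis using True inner[OF that(3,4)] by (simp add: P_def pulled_def M_def)
    qed (auto simp: P_def)
    have pulled\<eta>: "pulled l \<tau> ?\<eta> \<sigma>' \<theta>1 t = finsum M (\<lambda>\<sigma>. zsum M (\<lambda>\<theta>. P \<sigma> \<sigma>' \<theta> \<theta>1) (\<Theta> \<sigma>)) I"
      if \<sigma>': "\<sigma>' \<in> simplices E m" and \<theta>1: "\<theta>1 \<in> Poly_Mapping.keys (\<Psi> \<sigma>')" for \<sigma>' \<theta>1
    proof (cases "simplex_map (nat l) \<sigma>' \<theta>1 = \<tau>")
      case True
      note in1 = inner[OF \<sigma>' \<theta>1 True]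
      have "?\<eta> \<sigma>' (\<theta>1 t) = finsum (fibre \<G> (\<sigma>' (\<theta>1 t)))
          (\<lambda>\<sigma>. zsum (fibre \<G> (\<sigma>' (\<theta>1 t))) (\<lambda>\<theta>. pulled m \<sigma>' \<xi> \<sigma> \<theta> (\<theta>1 t)) (\<Theta> \<sigma>))
          {\<sigma> \<in> spx j \<xi>. \<sigma>' (\<theta>1 t) \<in> \<sigma> ` standard_simplex (nat j)}"
        by (rule push_eval_point[OF \<xi> \<Theta> \<sigma>']) (use in1 in simp)
      also have "\<dots> = finsum M (\<lambda>\<sigma>. zsum M (\<lambda>\<theta>. P \<sigma> \<sigma>' \<theta> \<theta>1) (\<Theta> \<sigma>)) I"
        unfolding pulled_def P_def I_def M_def conjunct2[OF in1] using True by simp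
      finally show ?thesis using True by (simp add: pulled_def)
    next
      case False
      then have "P \<sigma> \<sigma>' \<theta> \<theta>1 = \<zero>\<^bsub>M\<^esub>" for \<sigma> \<theta> by (simp add: P_def)
      then show ?thesis using False by (simp add: pulled_def M.zsum_zero M.finsum_zero flip: M_def)
    qed
    have zcl: "zsum M (\<lambda>\<theta>. P \<sigma> \<sigma>' \<theta> \<theta>1) (\<Theta> \<sigma>) \<in> carrier M"
      if "\<sigma> \<in> I" "\<sigma>' \<in> K" "\<theta>1 \<in> Poly_Mapping.keys (\<Psi> \<sigma>')" for \<sigma> \<sigma>' \<theta>1
      using that Pcl I K by (intro M.zsum_closed) blast
    have zcl1: "zsum M (P \<sigma> \<sigma>' \<theta>) (\<Psi> \<sigma>') \<in> carrier M"
      if "\<sigma> \<in> I" "\<sigma>' \<in> K" "\<theta> \<in> Poly_Mapping.keys (\<Theta> \<sigma>)" for \<sigma> \<sigma>' \<theta>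
      using that Pcl I K by (intro M.zsum_closed) blast
    have zcl2: "zsum M (\<lambda>\<theta>. zsum M (P \<sigma> \<sigma>' \<theta>) (\<Psi> \<sigma>')) (\<Theta> \<sigma>) \<in> carrier M"
      if "\<sigma> \<in> I" "\<sigma>' \<in> K" for \<sigma> \<sigma>'
      by (rule M.zsum_closed) (rule zcl1[OF that])
    have "push m l \<Psi> ?\<eta> \<tau> t = finsum M (\<lambda>\<sigma>'. zsum M (\<lambda>\<theta>1. pulled l \<tau> ?\<eta> \<sigma>' \<theta>1 t) (\<Psi> \<sigma>')) K"
      unfolding M_def
    proof (rule push_eval[OF \<eta> \<Psi> \<tau> t K])
      show "{\<sigma>' \<in> spx m ?\<eta>. \<exists>\<theta>1\<in>Poly_Mapping.keys (\<Psi> \<sigma>'). simplex_map (nat l) \<sigma>' \<theta>1 = \<tau>} \<subseteq> K"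
      proof clarify
        fix \<sigma>' \<theta>1 assume \<sigma>': "\<sigma>' \<in> spx m ?\<eta>" and \<theta>1: "\<theta>1 \<in> Poly_Mapping.keys (\<Psi> \<sigma>')" "\<tau> = simplex_map (nat l) \<sigma>' \<theta>1"
        obtain \<sigma> \<theta> where \<sigma>: "\<sigma> \<in> spx j \<xi>" "\<theta> \<in> Poly_Mapping.keys (\<Theta> \<sigma>)" "\<sigma>' = simplex_map (nat m) \<sigma> \<theta>"
          using spx_push[OF \<Theta> \<sigma>'] by metis
        have th: "\<theta>1 t \<in> standard_simplex (nat m)"
          using simplex_operatorD(2)[OF \<Psi> spx_simplices[OF \<sigma>'] \<theta>1(1)] tl by (rule singular_std_simplex)
        then have "\<theta> (\<theta>1 t) \<in> standard_simplex (nat j)"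
          using simplex_operatorD(2)[OF \<Theta> spx_simplices[OF \<sigma>(1)] \<sigma>(2)] by (auto intro: singular_std_simplex)
        moreover have "\<tau> t = \<sigma> (\<theta> (\<theta>1 t))" using \<theta>1 \<sigma> tl th by (simp add: simplex_map_def)
        ultimately have "\<sigma> \<in> I" using \<sigma> by (simp add: I_def)
        then show "\<sigma>' \<in> K" using \<sigma> by (auto simp: K_def)
      qed
    qed
    also have "\<dots> = finsum M (\<lambda>\<sigma>'. finsum M (\<lambda>\<sigma>. zsum M (\<lambda>\<theta>. zsum M (P \<sigma> \<sigma>' \<theta>) (\<Psi> \<sigma>')) (\<Theta> \<sigma>)) I) K"
    proof (rule M.finsum_cong'[OF refl])
      show "(\<lambda>\<sigma>'. finsum M (\<lambda>\<sigma>. zsum M (\<lambda>\<theta>. zsum M (P \<sigma> \<sigma>' \<theta>) (\<Psi> \<sigma>')) (\<Theta> \<sigma>)) I) \<in> K \<rightarrow> carrier M"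
        using zcl2 by (auto intro!: M.finsum_closed)
      fix \<sigma>' assume \<sigma>': "\<sigma>' \<in> K"
      then have \<sigma>'s: "\<sigma>' \<in> simplices E m" using K by blast
      have "zsum M (\<lambda>\<theta>1. pulled l \<tau> ?\<eta> \<sigma>' \<theta>1 t) (\<Psi> \<sigma>')
          = zsum M (\<lambda>\<theta>1. finsum M (\<lambda>\<sigma>. zsum M (\<lambda>\<theta>. P \<sigma> \<sigma>' \<theta> \<theta>1) (\<Theta> \<sigma>)) I) (\<Psi> \<sigma>')"
        by (rule M.zsum_cong) (use pulled\<eta>[OF \<sigma>'s] zcl[OF _ \<sigma>'] in \<open>auto intro!: M.finsum_closed\<close>)
      also have "\<dots> = finsum M (\<lambda>\<sigma>. zsum M (\<lambda>\<theta>1. zsum M (\<lambda>\<theta>. P \<sigma> \<sigma>' \<theta> \<theta>1) (\<Theta> \<sigma>)) (\<Psi> \<sigma>')) I"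
        by (rule M.zsum_finsum[OF I(1)]) (rule zcl[OF _ \<sigma>'])
      also have "\<dots> = finsum M (\<lambda>\<sigma>. zsum M (\<lambda>\<theta>. zsum M (P \<sigma> \<sigma>' \<theta>) (\<Psi> \<sigma>')) (\<Theta> \<sigma>)) I"
      proof (rule M.finsum_cong'[OF refl])
        show "(\<lambda>\<sigma>. zsum M (\<lambda>\<theta>. zsum M (P \<sigma> \<sigma>' \<theta>) (\<Psi> \<sigma>')) (\<Theta> \<sigma>)) \<in> I \<rightarrow> carrier M"
          using zcl2 \<sigma>' by auto
        fix \<sigma> assume "\<sigma> \<in> I"
        then show "zsum M (\<lambda>\<theta>1. zsum M (\<lambda>\<theta>. P \<sigma> \<sigma>' \<theta> \<theta>1) (\<Theta> \<sigma>)) (\<Psi> \<sigma>')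
            = zsum M (\<lambda>\<theta>. zsum M (P \<sigma> \<sigma>' \<theta>) (\<Psi> \<sigma>')) (\<Theta> \<sigma>)"
          by (intro M.zsum_zsum[of _ "Poly_Mapping.keys (\<Psi> \<sigma>')"]) (use I(2) \<sigma>'s Pcl in auto)
      qed
      finally show "zsum M (\<lambda>\<theta>1. pulled l \<tau> ?\<eta> \<sigma>' \<theta>1 t) (\<Psi> \<sigma>')
          = finsum M (\<lambda>\<sigma>. zsum M (\<lambda>\<theta>. zsum M (P \<sigma> \<sigma>' \<theta>) (\<Psi> \<sigma>')) (\<Theta> \<sigma>)) I" .
    qed
    also have "\<dots> = finsum M (\<lambda>\<sigma>. finsum M (\<lambda>\<sigma>'. zsum M (\<lambda>\<theta>. zsum M (P \<sigma> \<sigma>' \<theta>) (\<Psi> \<sigma>')) (\<Theta> \<sigma>)) K) I"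
      by (rule M.finsum_swap[OF K(1) I(1)]) (use zcl2 in auto)
    also have "\<dots> = finsum M (\<lambda>\<sigma>. zsum M (\<lambda>\<kappa>. pulled l \<tau> \<xi> \<sigma> \<kappa> t) (?\<Phi> \<sigma>)) I"
    proof (rule M.finsum_cong'[OF refl])
      show "(\<lambda>\<sigma>. zsum M (\<lambda>\<kappa>. pulled l \<tau> \<xi> \<sigma> \<kappa> t) (?\<Phi> \<sigma>)) \<in> I \<rightarrow> carrier M"
      proof
        fix \<sigma> assume "\<sigma> \<in> I"
        then have \<sigma>s: "\<sigma> \<in> simplices E j" using I by blast
        show "zsum M (\<lambda>\<kappa>. pulled l \<tau> \<xi> \<sigma> \<kappa> t) (?\<Phi> \<sigma>) \<in> carrier M"
        proof (rule M.zsum_closed)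
          fix \<kappa> assume "\<kappa> \<in> Poly_Mapping.keys (?\<Phi> \<sigma>)"
          then show "pulled l \<tau> \<xi> \<sigma> \<kappa> t \<in> carrier M"
            unfolding M_def by (intro pulled_closed[OF \<xi>(1) \<sigma>s _ \<tau> t] simplex_operatorD(2)[OF \<Phi> \<sigma>s])
        qed
      qed
      fix \<sigma> assume \<sigma>: "\<sigma> \<in> I"
      then have \<sigma>s: "\<sigma> \<in> simplices E j" using I by blast
      let ?A = "{\<kappa>. singular_simplex (nat l) (std_simplex (nat j)) \<kappa>}"
      have pc: "pulled l \<tau> \<xi> \<sigma> \<kappa> t \<in> carrier M" if "\<kappa> \<in> ?A" for \<kappa>
        unfolding M_def using pulled_closed[OF \<xi>(1) \<sigma>s _ \<tau> t] that by blast
      have zs: "zsum M (\<lambda>\<kappa>. pulled l \<tau> \<xi> \<sigma> \<kappa> t) (chain_map (nat l) \<theta> (\<Psi> (simplex_map (nat m) \<sigma> \<theta>)))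
          = zsum M (P \<sigma> (simplex_map (nat m) \<sigma> \<theta>) \<theta>) (\<Psi> (simplex_map (nat m) \<sigma> \<theta>))"
        if \<theta>: "\<theta> \<in> Poly_Mapping.keys (\<Theta> \<sigma>)" for \<theta>
      proof -
        let ?s = "simplex_map (nat m) \<sigma> \<theta>"
        have s: "?s \<in> simplices E m" by (rule simplex_operatorD(3)[OF \<Theta> \<sigma>s \<theta>])
        have "zsum M (\<lambda>\<kappa>. pulled l \<tau> \<xi> \<sigma> \<kappa> t) (chain_map (nat l) \<theta> (\<Psi> ?s))
            = zsum M (\<lambda>\<theta>1. zsum M (\<lambda>\<kappa>. pulled l \<tau> \<xi> \<sigma> \<kappa> t) (frag_of (simplex_map (nat l) \<theta> \<theta>1))) (\<Psi> ?s)"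
          unfolding chain_map_def
          by (subst M.zsum_frag_extend[OF order_refl, of _ _ ?A])
             (use comp[OF simplex_operatorD(2)[OF \<Theta> \<sigma>s \<theta>] simplex_operatorD(2)[OF \<Psi> s]] pc in \<open>auto simp: keys_frag_of\<close>)
        also have "\<dots> = zsum M (P \<sigma> ?s \<theta>) (\<Psi> ?s)"
        proof (rule M.zsum_cong)
          fix \<theta>1 assume \<theta>1: "\<theta>1 \<in> Poly_Mapping.keys (\<Psi> ?s)"
          have "simplex_map (nat l) \<sigma> (simplex_map (nat l) \<theta> \<theta>1) = simplex_map (nat l) ?s \<theta>1"
            using singular_std_simplex[OF simplex_operatorD(2)[OF \<Psi> s \<theta>1]]
            by (auto simp: simplex_map_def fun_eq_iff)
          moreover have "simplex_map (nat l) \<theta> \<theta>1 t = \<theta> (\<theta>1 t)" using tl by (simp add: simplex_map_def)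
          ultimately have "pulled l \<tau> \<xi> \<sigma> (simplex_map (nat l) \<theta> \<theta>1) t = P \<sigma> ?s \<theta> \<theta>1"
            by (simp add: pulled_def P_def M_def)
          then show "zsum M (\<lambda>\<kappa>. pulled l \<tau> \<xi> \<sigma> \<kappa> t) (frag_of (simplex_map (nat l) \<theta> \<theta>1)) = P \<sigma> ?s \<theta> \<theta>1
              \<and> P \<sigma> ?s \<theta> \<theta>1 \<in> carrier M"
            using Pcl[OF \<sigma>s \<theta> s \<theta>1] by simp
        qed
        finally show ?thesis .
      qed
      have keysA: "Poly_Mapping.keys (chain_map (nat l) \<theta> (\<Psi> (simplex_map (nat m) \<sigma> \<theta>))) \<subseteq> ?A"
        if \<theta>: "\<theta> \<in> Poly_Mapping.keys (\<Theta> \<sigma>)" for \<theta>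
        unfolding chain_map_def
        using keys_frag_extend[of "frag_of \<circ> simplex_map (nat l) \<theta>" "\<Psi> (simplex_map (nat m) \<sigma> \<theta>)"]
          comp[OF simplex_operatorD(2)[OF \<Theta> \<sigma>s \<theta>] simplex_operatorD(2)[OF \<Psi> simplex_operatorD(3)[OF \<Theta> \<sigma>s \<theta>]]]
        by (fastforce simp: keys_frag_of)
      have "finsum M (\<lambda>\<sigma>'. zsum M (\<lambda>\<theta>. zsum M (P \<sigma> \<sigma>' \<theta>) (\<Psi> \<sigma>')) (\<Theta> \<sigma>)) K
          = zsum M (\<lambda>\<theta>. finsum M (\<lambda>\<sigma>'. zsum M (P \<sigma> \<sigma>' \<theta>) (\<Psi> \<sigma>')) K) (\<Theta> \<sigma>)"
        by (rule M.zsum_finsum[symmetric, OF K(1)]) (use zcl1[OF \<sigma>] in auto)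
      also have "\<dots> = zsum M (\<lambda>\<theta>. zsum M (\<lambda>\<kappa>. pulled l \<tau> \<xi> \<sigma> \<kappa> t)
            (chain_map (nat l) \<theta> (\<Psi> (simplex_map (nat m) \<sigma> \<theta>)))) (\<Theta> \<sigma>)"
      proof (rule M.zsum_cong)
        fix \<theta> assume \<theta>: "\<theta> \<in> Poly_Mapping.keys (\<Theta> \<sigma>)"
        let ?s = "simplex_map (nat m) \<sigma> \<theta>"
        have sK: "?s \<in> K" using \<sigma> \<theta> by (auto simp: K_def)
        have zero: "zsum M (P \<sigma> \<sigma>' \<theta>) (\<Psi> \<sigma>') = \<zero>\<^bsub>M\<^esub>" if "\<sigma>' \<noteq> ?s" for \<sigma>'
        proof -
          have "P \<sigma> \<sigma>' \<theta> = (\<lambda>\<theta>1. \<zero>\<^bsub>M\<^esub>)" using that by (auto simp: P_def fun_eq_iff)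
          then show ?thesis by (simp add: M.zsum_zero)
        qed
        have "finsum M (\<lambda>\<sigma>'. zsum M (P \<sigma> \<sigma>' \<theta>) (\<Psi> \<sigma>')) K
            = finsum M (\<lambda>\<sigma>'. if ?s = \<sigma>' then zsum M (P \<sigma> \<sigma>' \<theta>) (\<Psi> \<sigma>') else \<zero>\<^bsub>M\<^esub>) K"
          by (rule M.finsum_cong'[OF refl]) (use zero zcl1[OF \<sigma> _ \<theta>] in auto)
        also have "\<dots> = zsum M (P \<sigma> ?s \<theta>) (\<Psi> ?s)"
          by (rule M.finsum_singleton[OF sK K(1)]) (use zcl1[OF \<sigma> _ \<theta>] in auto)
        also have "\<dots> = zsum M (\<lambda>\<kappa>. pulled l \<tau> \<xi> \<sigma> \<kappa> t) (chain_map (nat l) \<theta> (\<Psi> ?s))"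
          using zs[OF \<theta>] by simp
        finally show "finsum M (\<lambda>\<sigma>'. zsum M (P \<sigma> \<sigma>' \<theta>) (\<Psi> \<sigma>')) K
            = zsum M (\<lambda>\<kappa>. pulled l \<tau> \<xi> \<sigma> \<kappa> t) (chain_map (nat l) \<theta> (\<Psi> ?s))
          \<and> zsum M (\<lambda>\<kappa>. pulled l \<tau> \<xi> \<sigma> \<kappa> t) (chain_map (nat l) \<theta> (\<Psi> ?s)) \<in> carrier M"
          using zs[OF \<theta>] zcl1[OF \<sigma> sK \<theta>] by simp
      qed
      also have "\<dots> = zsum M (\<lambda>\<kappa>. pulled l \<tau> \<xi> \<sigma> \<kappa> t) (?\<Phi> \<sigma>)"
        by (rule M.zsum_frag_extend[symmetric, OF order_refl, of _ _ ?A]) (use keysA pc in auto)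
      finally show "finsum M (\<lambda>\<sigma>'. zsum M (\<lambda>\<theta>. zsum M (P \<sigma> \<sigma>' \<theta>) (\<Psi> \<sigma>')) (\<Theta> \<sigma>)) K
          = zsum M (\<lambda>\<kappa>. pulled l \<tau> \<xi> \<sigma> \<kappa> t) (?\<Phi> \<sigma>)" .
    qed
    also have "\<dots> = push j l ?\<Phi> \<xi> \<tau> t"
      unfolding I_def M_def by (rule push_eval_point[symmetric, OF \<xi> \<Phi> \<tau> t])
    finally show "push m l \<Psi> ?\<eta> \<tau> t = push j l ?\<Phi> \<xi> \<tau> t" .
  qed
qed

end

context abelian_group
begin

lemma zsum_sum:
  assumes "finite A" "\<And>i. i \<in> A \<Longrightarrow> Poly_Mapping.keys (c i) \<subseteq> S" "\<And>k. k \<in> S \<Longrightarrow> w k \<in> carrier G"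
  shows "zsum G w (\<Sum>i\<in>A. c i) = finsum G (\<lambda>i. zsum G w (c i)) A"
  using assms(1,2)
proof (induction A rule: finite_induct)
  case (insert x A)
  have "Poly_Mapping.keys (\<Sum>i\<in>A. c i) \<subseteq> S" using keys_sum[of c A] insert.prems by auto
  then have "zsum G w (\<Sum>i\<in>insert x A. c i) = zsum G w (c x) \<oplus> zsum G w (\<Sum>i\<in>A. c i)"
    using insert zsum_add[of S w "c x" "\<Sum>i\<in>A. c i"] assms(3) by simp
  moreover have "zsum G w (c i) \<in> carrier G" if "i \<in> insert x A" for i
    using insert.prems[OF that] assms(3) by (intro zsum_closed) auto
  ultimately show ?case using insert by (simp add: finsum_insert Pi_iff)
qed simp

lemma zsum_signed:
  assumes "w a \<in> carrier G"
  shows "zsum G w (frag_cmul ((-1) ^ k) (frag_of a)) = (if even k then w a else \<ominus> w a)"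
proof (cases "even k")
  case False
  have "zsum G w (0 - frag_of a) = zsum G w 0 \<ominus> zsum G w (frag_of a)"
    by (rule zsum_diff[of "{a}"]) (use assms in \<open>auto simp: keys_frag_of\<close>)
  then show ?thesis using False assms by (simp add: a_minus_def)
qed (use assms in simp)

lemma finsum_product:
  assumes "finite A" "finite B" "\<And>a b. a \<in> A \<Longrightarrow> b \<in> B \<Longrightarrow> f b a \<in> carrier G"
  shows "finsum G (\<lambda>a. finsum G (\<lambda>b. f b a) B) A = finsum G (\<lambda>(b, a). f b a) (B \<times> A)"
  using assms(1,3)
proof (induction A rule: finite_induct)
  case (insert x A)
  have eq: "B \<times> insert x A = (\<lambda>b. (b, x)) ` B \<union> B \<times> A" by auto
  have "finsum G (\<lambda>(b, a). f b a) (B \<times> insert x A)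
      = finsum G (\<lambda>(b, a). f b a) ((\<lambda>b. (b, x)) ` B) \<oplus> finsum G (\<lambda>(b, a). f b a) (B \<times> A)"
    unfolding eq
    by (rule finsum_Un_disjoint) (use insert.hyps insert.prems assms(2) in auto)
  also have "finsum G (\<lambda>(b, a). f b a) ((\<lambda>b. (b, x)) ` B) = finsum G (\<lambda>b. f b x) B"
    using insert.prems by (subst finsum_reindex) (auto simp: inj_on_def)
  finally show ?case
    using insert by (simp add: finsum_insert finsum_closed Pi_iff)
qed simp

end

context chain_coefficients
begin

lemma push_term_closed:
  assumes \<xi>: "\<xi> \<in> carrier (C j)" and \<Theta>: "simplex_operator j m \<Theta>"
    and \<tau>: "\<tau> \<in> simplices E m" and t: "t \<in> coeff_dom E \<G> m \<tau>" and \<sigma>: "\<sigma> \<in> simplices E j"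
  shows "zsum (fibre \<G> (\<tau> t)) (\<lambda>\<theta>. pulled m \<tau> \<xi> \<sigma> \<theta> t) (\<Theta> \<sigma>) \<in> carrier (fibre \<G> (\<tau> t))"
proof -
  interpret M: abelian_group "fibre \<G> (\<tau> t)"
    by (rule left_module_abelian_group[OF fibre_module[OF \<tau> t]])
  show ?thesis
    by (rule M.zsum_closed) (rule pulled_closed[OF \<xi> \<sigma> simplex_operatorD(2)[OF \<Theta> \<sigma>] \<tau> t])
qed

lemma push_eqI:
  assumes \<xi>: "\<xi> \<in> carrier (C j)" "point_finite j \<xi>" and \<Theta>: "simplex_operator j m \<Theta>"
    and \<eta>: "\<eta> \<in> carrier (C m)"
    and eq: "\<And>\<tau> t. \<tau> \<in> simplices E m \<Longrightarrow> t \<in> coeff_dom E \<G> m \<tau> \<Longrightarrow>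
      finsum (fibre \<G> (\<tau> t)) (\<lambda>\<sigma>. zsum (fibre \<G> (\<tau> t)) (\<lambda>\<theta>. pulled m \<tau> \<xi> \<sigma> \<theta> t) (\<Theta> \<sigma>))
        {\<sigma> \<in> spx j \<xi>. \<tau> t \<in> \<sigma> ` standard_simplex (nat j)} = \<eta> \<tau> t"
  shows "push j m \<Theta> \<xi> = \<eta>"
  by (rule chain_eqI[OF push_closed[OF \<xi> \<Theta>] \<eta>]) (simp add: push_eval_point[OF \<xi> \<Theta>] eq)

lemma push_cong:
  assumes \<xi>: "\<xi> \<in> carrier (C j)" "point_finite j \<xi>" and \<Theta>: "simplex_operator j m \<Theta>"
    and eq: "\<And>\<sigma>. \<sigma> \<in> simplices E j \<Longrightarrow> \<Theta> \<sigma> = \<Theta>' \<sigma>"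
  shows "push j m \<Theta> \<xi> = push j m \<Theta>' \<xi>"
proof (rule push_eqI[OF \<xi> \<Theta>])
  have \<Theta>': "simplex_operator j m \<Theta>'" using \<Theta> eq unfolding simplex_operator_def by simp
  then show "push j m \<Theta>' \<xi> \<in> carrier (C m)" by (rule push_closed[OF \<xi>])
  fix \<tau> t assume \<tau>: "\<tau> \<in> simplices E m" and t: "t \<in> coeff_dom E \<G> m \<tau>"
  interpret M: abelian_group "fibre \<G> (\<tau> t)"
    by (rule left_module_abelian_group[OF fibre_module[OF \<tau> t]])
  show "finsum (fibre \<G> (\<tau> t)) (\<lambda>\<sigma>. zsum (fibre \<G> (\<tau> t)) (\<lambda>\<theta>. pulled m \<tau> \<xi> \<sigma> \<theta> t) (\<Theta> \<sigma>))
        {\<sigma> \<in> spx j \<xi>. \<tau> t \<in> \<sigma> ` standard_simplex (nat j)} = push j m \<Theta>' \<xi> \<tau> t"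
    unfolding push_eval_point[OF \<xi> \<Theta>' \<tau> t]
    by (rule M.finsum_cong'[OF refl])
       (use push_term_closed[OF \<xi>(1) \<Theta>' \<tau> t] eq in \<open>auto simp: simplices_of_def\<close>)
qed

lemma simplex_operator_add:
  assumes "simplex_operator j m \<Theta>" "simplex_operator j m \<Theta>'"
  shows "simplex_operator j m (\<lambda>\<sigma>. \<Theta> \<sigma> + \<Theta>' \<sigma>)"
  unfolding simplex_operator_def
proof (intro ballI)
  fix \<sigma> \<theta> assume "\<sigma> \<in> simplices E j" "\<theta> \<in> Poly_Mapping.keys (\<Theta> \<sigma> + \<Theta>' \<sigma>)"
  then show "0 \<le> m \<and> singular_simplex (nat m) (std_simplex (nat j)) \<theta>"
    using keys_add[of "\<Theta> \<sigma>" "\<Theta>' \<sigma>"] assms unfolding simplex_operator_def by blast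
qed

lemma chain_add_closed: "\<xi> \<in> carrier (C j) \<Longrightarrow> \<eta> \<in> carrier (C j) \<Longrightarrow> \<xi> \<oplus>\<^bsub>C j\<^esub> \<eta> \<in> carrier (C j)"
  using abelian_monoid.a_closed[OF abelian_group.axioms(1)[OF left_module_abelian_group[OF left_module_chain]]] .

lemma push_add_operator:
  assumes \<xi>: "\<xi> \<in> carrier (C j)" "point_finite j \<xi>"
    and \<Theta>: "simplex_operator j m \<Theta>" and \<Theta>': "simplex_operator j m \<Theta>'"
  shows "push j m (\<lambda>\<sigma>. \<Theta> \<sigma> + \<Theta>' \<sigma>) \<xi> = push j m \<Theta> \<xi> \<oplus>\<^bsub>C m\<^esub> push j m \<Theta>' \<xi>"
proof (rule push_eqI[OF \<xi> simplex_operator_add[OF \<Theta> \<Theta>']])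
  show "push j m \<Theta> \<xi> \<oplus>\<^bsub>C m\<^esub> push j m \<Theta>' \<xi> \<in> carrier (C m)"
    using push_closed[OF \<xi> \<Theta>] push_closed[OF \<xi> \<Theta>'] by (rule chain_add_closed)
  fix \<tau> t assume \<tau>: "\<tau> \<in> simplices E m" and t: "t \<in> coeff_dom E \<G> m \<tau>"
  interpret M: abelian_group "fibre \<G> (\<tau> t)"
    by (rule left_module_abelian_group[OF fibre_module[OF \<tau> t]])
  let ?I = "{\<sigma> \<in> spx j \<xi>. \<tau> t \<in> \<sigma> ` standard_simplex (nat j)}"
  let ?z = "\<lambda>\<Theta> \<sigma>. zsum (fibre \<G> (\<tau> t)) (\<lambda>\<theta>. pulled m \<tau> \<xi> \<sigma> \<theta> t) (\<Theta> \<sigma>)"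
  have "?z (\<lambda>\<sigma>. \<Theta> \<sigma> + \<Theta>' \<sigma>) \<sigma> = ?z \<Theta> \<sigma> \<oplus>\<^bsub>fibre \<G> (\<tau> t)\<^esub> ?z \<Theta>' \<sigma>" if "\<sigma> \<in> ?I" for \<sigma>
  proof -
    have \<sigma>: "\<sigma> \<in> simplices E j" using that spx_simplices by auto
    show ?thesis
      by (rule M.zsum_add[of "{\<theta>. singular_simplex (nat m) (std_simplex (nat j)) \<theta>}"])
         (use pulled_closed[OF \<xi>(1) \<sigma> _ \<tau> t] simplex_operatorD(2)[OF \<Theta> \<sigma>] simplex_operatorD(2)[OF \<Theta>' \<sigma>] in auto)
  qed
  then have "finsum (fibre \<G> (\<tau> t)) (?z (\<lambda>\<sigma>. \<Theta> \<sigma> + \<Theta>' \<sigma>)) ?I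
      = finsum (fibre \<G> (\<tau> t)) (\<lambda>\<sigma>. ?z \<Theta> \<sigma> \<oplus>\<^bsub>fibre \<G> (\<tau> t)\<^esub> ?z \<Theta>' \<sigma>) ?I"
    by (intro M.finsum_cong'[OF refl])
       (use push_term_closed[OF \<xi>(1) \<Theta> \<tau> t] push_term_closed[OF \<xi>(1) \<Theta>' \<tau> t] in \<open>auto simp: simplices_of_def\<close>)
  also have "\<dots> = finsum (fibre \<G> (\<tau> t)) (?z \<Theta>) ?I \<oplus>\<^bsub>fibre \<G> (\<tau> t)\<^esub> finsum (fibre \<G> (\<tau> t)) (?z \<Theta>') ?I"
    by (rule M.finsum_addf)
       (use push_term_closed[OF \<xi>(1) \<Theta> \<tau> t] push_term_closed[OF \<xi>(1) \<Theta>' \<tau> t] in \<open>auto simp: simplices_of_def\<close>)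
  finally show "finsum (fibre \<G> (\<tau> t)) (?z (\<lambda>\<sigma>. \<Theta> \<sigma> + \<Theta>' \<sigma>)) ?I = (push j m \<Theta> \<xi> \<oplus>\<^bsub>C m\<^esub> push j m \<Theta>' \<xi>) \<tau> t"
    unfolding chain_add_eval[OF \<tau> t] push_eval_point[OF \<xi> \<Theta> \<tau> t] push_eval_point[OF \<xi> \<Theta>' \<tau> t] .
qed

lemma push_zero_operator:
  assumes \<xi>: "\<xi> \<in> carrier (C j)" "point_finite j \<xi>"
  shows "push j m (\<lambda>\<sigma>. 0) \<xi> = \<zero>\<^bsub>C m\<^esub>"
proof (rule push_eqI[OF \<xi>])
  show "simplex_operator j m (\<lambda>\<sigma>. 0)" by (simp add: simplex_operator_def)
  show "\<zero>\<^bsub>C m\<^esub> \<in> carrier (C m)"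
    using abelian_monoid.zero_closed[OF abelian_group.axioms(1)[OF left_module_abelian_group[OF left_module_chain]]] .
  fix \<tau> t assume \<tau>: "\<tau> \<in> simplices E m" and t: "t \<in> coeff_dom E \<G> m \<tau>"
  interpret M: abelian_group "fibre \<G> (\<tau> t)"
    by (rule left_module_abelian_group[OF fibre_module[OF \<tau> t]])
  show "finsum (fibre \<G> (\<tau> t)) (\<lambda>\<sigma>. zsum (fibre \<G> (\<tau> t)) (\<lambda>\<theta>. pulled m \<tau> \<xi> \<sigma> \<theta> t) 0)
        {\<sigma> \<in> spx j \<xi>. \<tau> t \<in> \<sigma> ` standard_simplex (nat j)} = \<zero>\<^bsub>C m\<^esub> \<tau> t"
    by (simp add: M.finsum_zero chain_zero_eval[OF \<tau> t])
qed

lemma simplex_map_identity: "\<sigma> \<in> simplices E j \<Longrightarrow> simplex_map (nat j) \<sigma> (identity_simplex (nat j)) = \<sigma>"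
  using simplices_extensional[of \<sigma> E j] by (auto simp: simplex_map_def fun_eq_iff extensional_def)

lemma singular_identity: "singular_simplex p (std_simplex p) (identity_simplex p)"
  using simplicial_simplex_id[of p "standard_simplex p"] simplicial_imp_singular_simplex by blast

lemma push_identity:
  assumes \<xi>: "\<xi> \<in> carrier (C j)"
  shows "push j j (\<lambda>\<sigma>. frag_of (identity_simplex (nat j))) \<xi> = \<xi>"
proof -
  let ?\<Theta> = "\<lambda>\<sigma> :: (nat \<Rightarrow> real) \<Rightarrow> 'a. frag_of (identity_simplex (nat j))"
  have \<Theta>: "simplex_operator j j ?\<Theta>"
    unfolding simplex_operator_def using singular_identity simplices_nonneg by (auto simp: keys_frag_of)
  have ev: "push j j ?\<Theta> \<xi> \<tau> t = \<xi> \<tau> t" if \<tau>: "\<tau> \<in> simplices E j" and t: "t \<in> coeff_dom E \<G> j \<tau>" for \<tau> t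
  proof -
    interpret M: abelian_group "fibre \<G> (\<tau> t)"
      by (rule left_module_abelian_group[OF fibre_module[OF \<tau> t]])
    have td: "t \<in> standard_simplex (nat j)" using t coeff_dom_subset by blast
    have p: "pulled j \<tau> \<xi> \<tau> (identity_simplex (nat j)) t = \<xi> \<tau> t"
      using td by (simp add: pulled_def simplex_map_identity[OF \<tau>])
    have "push j j ?\<Theta> \<xi> \<tau> t = finsum (fibre \<G> (\<tau> t))
        (\<lambda>\<sigma>. zsum (fibre \<G> (\<tau> t)) (\<lambda>\<theta>. pulled j \<tau> \<xi> \<sigma> \<theta> t) (?\<Theta> \<sigma>)) {\<tau>}"
      by (rule push_eval[OF \<xi> \<Theta> \<tau> t])
         (use \<tau> simplex_map_identity spx_simplices in \<open>auto simp: keys_frag_of\<close>)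
    also have "\<dots> = zsum (fibre \<G> (\<tau> t)) (\<lambda>\<theta>. pulled j \<tau> \<xi> \<tau> \<theta> t) (?\<Theta> \<tau>)"
      using push_term_closed[OF \<xi> \<Theta> \<tau> t \<tau>] by (simp add: M.finsum_insert M.finsum_empty)
    also have "\<dots> = \<xi> \<tau> t"
      using p chain_closed[OF \<xi> \<tau> t]
        M.zsum_of[of "\<lambda>\<theta>. pulled j \<tau> \<xi> \<tau> \<theta> t" "identity_simplex (nat j)"] by simp
    finally show ?thesis .
  qed
  have "push j j ?\<Theta> \<xi> \<tau> \<in> coeff_lifts E \<G> j \<tau> \<and> push j j ?\<Theta> \<xi> \<tau> = \<xi> \<tau>" if \<tau>: "\<tau> \<in> simplices E j" for \<tau>
  proof -
    have "push j j ?\<Theta> \<xi> \<tau> = \<xi> \<tau>"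
      by (rule extensionalityI[of _ "coeff_dom E \<G> j \<tau>"])
         (use \<tau> ev coeff_lifts_extensional[OF chain_lift[OF \<xi> \<tau>]] in \<open>auto simp: push_def\<close>)
    then show ?thesis using chain_lift[OF \<xi> \<tau>] by simp
  qed
  moreover have "\<xi> \<in> extensional (simplices E j)"
    using \<xi> by (auto simp: chain_module_def prod_module_def PiE_def)
  ultimately show ?thesis
    by (intro extensionalityI[of _ "simplices E j"]) (auto simp: push_def)
qed

subsection \<open>Linearity in the chain\<close>

lemma spx_add: "spx j (\<xi> \<oplus>\<^bsub>C j\<^esub> \<eta>) \<subseteq> spx j \<xi> \<union> spx j \<eta>"
proof
  fix \<sigma> assume \<sigma>: "\<sigma> \<in> spx j (\<xi> \<oplus>\<^bsub>C j\<^esub> \<eta>)"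
  have \<sigma>s: "\<sigma> \<in> simplices E j" using \<sigma> by (rule spx_simplices)
  interpret M: abelian_group "coeff_module E \<G> j \<sigma>"
    by (rule left_module_abelian_group[OF left_module_coeff[OF \<sigma>s]])
  have "(\<xi> \<oplus>\<^bsub>C j\<^esub> \<eta>) \<sigma> = \<xi> \<sigma> \<oplus>\<^bsub>coeff_module E \<G> j \<sigma>\<^esub> \<eta> \<sigma>"
    using \<sigma>s by (simp add: chain_module_def prod_module_def)
  then show "\<sigma> \<in> spx j \<xi> \<union> spx j \<eta>" using \<sigma> \<sigma>s by (auto simp: simplices_of_def)
qed

lemma spx_smult:
  assumes r: "r \<in> carrier R"
  shows "spx j (r \<odot>\<^bsub>C j\<^esub> \<xi>) \<subseteq> spx j \<xi>"
proof
  fix \<sigma> assume \<sigma>: "\<sigma> \<in> spx j (r \<odot>\<^bsub>C j\<^esub> \<xi>)"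
  have \<sigma>s: "\<sigma> \<in> simplices E j" using \<sigma> by (rule spx_simplices)
  have M: "left_module R (coeff_module E \<G> j \<sigma>)" by (rule left_module_coeff[OF \<sigma>s])
  interpret M: abelian_group "coeff_module E \<G> j \<sigma>" by (rule left_module_abelian_group[OF M])
  have "r \<odot>\<^bsub>coeff_module E \<G> j \<sigma>\<^esub> \<zero>\<^bsub>coeff_module E \<G> j \<sigma>\<^esub> \<oplus>\<^bsub>coeff_module E \<G> j \<sigma>\<^esub>
      r \<odot>\<^bsub>coeff_module E \<G> j \<sigma>\<^esub> \<zero>\<^bsub>coeff_module E \<G> j \<sigma>\<^esub>
    = r \<odot>\<^bsub>coeff_module E \<G> j \<sigma>\<^esub> \<zero>\<^bsub>coeff_module E \<G> j \<sigma>\<^esub>"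
    using left_module_smult_r_distr[OF M r M.zero_closed M.zero_closed] by simp
  then have z: "r \<odot>\<^bsub>coeff_module E \<G> j \<sigma>\<^esub> \<zero>\<^bsub>coeff_module E \<G> j \<sigma>\<^esub> = \<zero>\<^bsub>coeff_module E \<G> j \<sigma>\<^esub>"
    using left_module_smult_closed[OF M r M.zero_closed] by simp
  have "(r \<odot>\<^bsub>C j\<^esub> \<xi>) \<sigma> = r \<odot>\<^bsub>coeff_module E \<G> j \<sigma>\<^esub> \<xi> \<sigma>"
    using \<sigma>s by (simp add: chain_module_def prod_module_def)
  then show "\<sigma> \<in> spx j \<xi>" using \<sigma> \<sigma>s z by (auto simp: simplices_of_def)
qed

lemma spx_zero: "spx j \<zero>\<^bsub>C j\<^esub> = {}"
  by (auto simp: simplices_of_def chain_module_def prod_module_def)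

lemma point_finite_subset:
  assumes "spx j \<xi> \<subseteq> spx j \<eta> \<union> spx j \<zeta>" "point_finite j \<eta>" "point_finite j \<zeta>"
  shows "point_finite j \<xi>"
  unfolding point_finite_def
proof
  fix x
  have "{\<sigma> \<in> spx j \<xi>. x \<in> \<sigma> ` standard_simplex (nat j)}
      \<subseteq> {\<sigma> \<in> spx j \<eta>. x \<in> \<sigma> ` standard_simplex (nat j)} \<union> {\<sigma> \<in> spx j \<zeta>. x \<in> \<sigma> ` standard_simplex (nat j)}"
    using assms(1) by auto
  then show "finite {\<sigma> \<in> spx j \<xi>. x \<in> \<sigma> ` standard_simplex (nat j)}"
    using assms(2,3) unfolding point_finite_def by (meson finite_UnI finite_subset)
qed

lemma push_add:
  assumes \<xi>: "\<xi> \<in> carrier (C j)" "point_finite j \<xi>" and \<eta>: "\<eta> \<in> carrier (C j)" "point_finite j \<eta>"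
    and \<Theta>: "simplex_operator j m \<Theta>"
  shows "push j m \<Theta> (\<xi> \<oplus>\<^bsub>C j\<^esub> \<eta>) = push j m \<Theta> \<xi> \<oplus>\<^bsub>C m\<^esub> push j m \<Theta> \<eta>"
proof (rule chain_eqI)
  have s: "\<xi> \<oplus>\<^bsub>C j\<^esub> \<eta> \<in> carrier (C j)" "point_finite j (\<xi> \<oplus>\<^bsub>C j\<^esub> \<eta>)"
    using chain_add_closed[OF \<xi>(1) \<eta>(1)] point_finite_subset[OF spx_add \<xi>(2) \<eta>(2)] by auto
  show "push j m \<Theta> (\<xi> \<oplus>\<^bsub>C j\<^esub> \<eta>) \<in> carrier (C m)" by (rule push_closed[OF s \<Theta>])
  show "push j m \<Theta> \<xi> \<oplus>\<^bsub>C m\<^esub> push j m \<Theta> \<eta> \<in> carrier (C m)"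
    using push_closed[OF \<xi> \<Theta>] push_closed[OF \<eta> \<Theta>] by (rule chain_add_closed)
  fix \<tau> t assume \<tau>: "\<tau> \<in> simplices E m" and t: "t \<in> coeff_dom E \<G> m \<tau>"
  interpret M: abelian_group "fibre \<G> (\<tau> t)"
    by (rule left_module_abelian_group[OF fibre_module[OF \<tau> t]])
  have td: "t \<in> standard_simplex (nat m)" using t coeff_dom_subset by blast
  let ?I = "\<lambda>\<xi>. {\<sigma> \<in> spx j \<xi>. \<tau> t \<in> \<sigma> ` standard_simplex (nat j)}"
  let ?S = "?I \<xi> \<union> ?I \<eta>"
  let ?z = "\<lambda>\<xi> \<sigma>. zsum (fibre \<G> (\<tau> t)) (\<lambda>\<theta>. pulled m \<tau> \<xi> \<sigma> \<theta> t) (\<Theta> \<sigma>)"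
  have S: "finite ?S" "?S \<subseteq> simplices E j"
    using \<xi>(2) \<eta>(2) by (auto simp: point_finite_def simplices_of_def)
  have sub: "?I (\<xi> \<oplus>\<^bsub>C j\<^esub> \<eta>) \<subseteq> ?S" using spx_add[of j \<xi> \<eta>] by auto
  have ev: "push j m \<Theta> \<zeta> \<tau> t = finsum (fibre \<G> (\<tau> t)) (?z \<zeta>) ?S"
    if "\<zeta> \<in> carrier (C j)" "point_finite j \<zeta>" "?I \<zeta> \<subseteq> ?S" for \<zeta>
    by (rule push_eval[OF that(1) \<Theta> \<tau> t S]) (use push_index_finite[OF that(2) \<Theta> td] that(3) in blast)
  have "?z (\<xi> \<oplus>\<^bsub>C j\<^esub> \<eta>) \<sigma> = ?z \<xi> \<sigma> \<oplus>\<^bsub>fibre \<G> (\<tau> t)\<^esub> ?z \<eta> \<sigma>" if "\<sigma> \<in> ?S" for \<sigma>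
  proof -
    have \<sigma>: "\<sigma> \<in> simplices E j" using that S by blast
    have "pulled m \<tau> (\<xi> \<oplus>\<^bsub>C j\<^esub> \<eta>) \<sigma> \<theta> t = pulled m \<tau> \<xi> \<sigma> \<theta> t \<oplus>\<^bsub>fibre \<G> (\<tau> t)\<^esub> pulled m \<tau> \<eta> \<sigma> \<theta> t"
      if \<theta>: "\<theta> \<in> Poly_Mapping.keys (\<Theta> \<sigma>)" for \<theta>
    proof (cases "simplex_map (nat m) \<sigma> \<theta> = \<tau>")
      case True
      then have "\<theta> t \<in> coeff_dom E \<G> j \<sigma>" "\<tau> t = \<sigma> (\<theta> t)"
        using t td coeff_dom_simplex_map[OF simplex_operatorD(2)[OF \<Theta> \<sigma> \<theta>], of E \<G> \<sigma>] by (auto simp: simplex_map_def)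
      then show ?thesis using True chain_add_eval[OF \<sigma>, of "\<theta> t"] by (simp add: pulled_def)
    qed (simp add: pulled_def)
    then have "?z (\<xi> \<oplus>\<^bsub>C j\<^esub> \<eta>) \<sigma> = zsum (fibre \<G> (\<tau> t))
        (\<lambda>\<theta>. pulled m \<tau> \<xi> \<sigma> \<theta> t \<oplus>\<^bsub>fibre \<G> (\<tau> t)\<^esub> pulled m \<tau> \<eta> \<sigma> \<theta> t) (\<Theta> \<sigma>)"
      using pulled_closed[OF \<xi>(1) \<sigma> simplex_operatorD(2)[OF \<Theta> \<sigma>] \<tau> t]
        pulled_closed[OF \<eta>(1) \<sigma> simplex_operatorD(2)[OF \<Theta> \<sigma>] \<tau> t]
      by (intro M.zsum_cong) simp
    also have "\<dots> = ?z \<xi> \<sigma> \<oplus>\<^bsub>fibre \<G> (\<tau> t)\<^esub> ?z \<eta> \<sigma>"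
      by (rule M.zsum_add_fun)
         (rule pulled_closed[OF \<xi>(1) \<sigma> simplex_operatorD(2)[OF \<Theta> \<sigma>] \<tau> t]
            pulled_closed[OF \<eta>(1) \<sigma> simplex_operatorD(2)[OF \<Theta> \<sigma>] \<tau> t], assumption)+
    finally show ?thesis .
  qed
  then have "finsum (fibre \<G> (\<tau> t)) (?z (\<xi> \<oplus>\<^bsub>C j\<^esub> \<eta>)) ?S
      = finsum (fibre \<G> (\<tau> t)) (\<lambda>\<sigma>. ?z \<xi> \<sigma> \<oplus>\<^bsub>fibre \<G> (\<tau> t)\<^esub> ?z \<eta> \<sigma>) ?S"
    by (intro M.finsum_cong'[OF refl])
       (use push_term_closed[OF \<xi>(1) \<Theta> \<tau> t] push_term_closed[OF \<eta>(1) \<Theta> \<tau> t] in \<open>auto simp: simplices_of_def\<close>)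
  also have "\<dots> = finsum (fibre \<G> (\<tau> t)) (?z \<xi>) ?S \<oplus>\<^bsub>fibre \<G> (\<tau> t)\<^esub> finsum (fibre \<G> (\<tau> t)) (?z \<eta>) ?S"
    by (rule M.finsum_addf)
       (use push_term_closed[OF \<xi>(1) \<Theta> \<tau> t] push_term_closed[OF \<eta>(1) \<Theta> \<tau> t] in \<open>auto simp: simplices_of_def\<close>)
  finally show "push j m \<Theta> (\<xi> \<oplus>\<^bsub>C j\<^esub> \<eta>) \<tau> t = (push j m \<Theta> \<xi> \<oplus>\<^bsub>C m\<^esub> push j m \<Theta> \<eta>) \<tau> t"
    using ev[OF s sub] ev[OF \<xi>] ev[OF \<eta>] by (simp add: chain_add_eval[OF \<tau> t])
qed

lemma push_smult:
  assumes \<xi>: "\<xi> \<in> carrier (C j)" "point_finite j \<xi>" and r: "r \<in> carrier R"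
    and \<Theta>: "simplex_operator j m \<Theta>"
  shows "push j m \<Theta> (r \<odot>\<^bsub>C j\<^esub> \<xi>) = r \<odot>\<^bsub>C m\<^esub> push j m \<Theta> \<xi>"
proof (rule chain_eqI)
  have s: "r \<odot>\<^bsub>C j\<^esub> \<xi> \<in> carrier (C j)" "point_finite j (r \<odot>\<^bsub>C j\<^esub> \<xi>)"
    using left_module_smult_closed[OF left_module_chain r \<xi>(1)]
      point_finite_subset[of j "r \<odot>\<^bsub>C j\<^esub> \<xi>" \<xi> \<xi>] spx_smult[OF r] \<xi>(2) by auto
  show "push j m \<Theta> (r \<odot>\<^bsub>C j\<^esub> \<xi>) \<in> carrier (C m)" by (rule push_closed[OF s \<Theta>])
  show "r \<odot>\<^bsub>C m\<^esub> push j m \<Theta> \<xi> \<in> carrier (C m)"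
    by (rule left_module_smult_closed[OF left_module_chain r push_closed[OF \<xi> \<Theta>]])
  fix \<tau> t assume \<tau>: "\<tau> \<in> simplices E m" and t: "t \<in> coeff_dom E \<G> m \<tau>"
  let ?M = "fibre \<G> (\<tau> t)"
  have M: "left_module R ?M" by (rule fibre_module[OF \<tau> t])
  interpret M: abelian_group ?M by (rule left_module_abelian_group[OF M])
  have td: "t \<in> standard_simplex (nat m)" using t coeff_dom_subset by blast
  have rz: "r \<odot>\<^bsub>?M\<^esub> \<zero>\<^bsub>?M\<^esub> = \<zero>\<^bsub>?M\<^esub>"
  proof -
    have "r \<odot>\<^bsub>?M\<^esub> \<zero>\<^bsub>?M\<^esub> \<oplus>\<^bsub>?M\<^esub> r \<odot>\<^bsub>?M\<^esub> \<zero>\<^bsub>?M\<^esub> = r \<odot>\<^bsub>?M\<^esub> \<zero>\<^bsub>?M\<^esub>"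
      using left_module_smult_r_distr[OF M r M.zero_closed M.zero_closed] by simp
    then show ?thesis using left_module_smult_closed[OF M r M.zero_closed] by simp
  qed
  have rfin: "r \<odot>\<^bsub>?M\<^esub> finsum ?M f A = finsum ?M (\<lambda>a. r \<odot>\<^bsub>?M\<^esub> f a) A"
    if "finite A" "\<And>a. a \<in> A \<Longrightarrow> f a \<in> carrier ?M" for f and A :: "((nat \<Rightarrow> real) \<Rightarrow> 'a) set"
    using that
  proof (induction A rule: finite_induct)
    case (insert x A)
    then show ?case
      using left_module_smult_r_distr[OF M r, of "f x" "finsum ?M f A"] left_module_smult_closed[OF M r]
      by (simp add: M.finsum_insert M.finsum_closed Pi_iff)
  qed (simp add: rz)
  have rz': "r \<odot>\<^bsub>?M\<^esub> zsum ?M w c = zsum ?M (\<lambda>k. r \<odot>\<^bsub>?M\<^esub> w k) c"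
    if c: "Poly_Mapping.keys c \<subseteq> A" and w: "\<And>k. k \<in> A \<Longrightarrow> w k \<in> carrier ?M"
    for w A and c :: "(nat \<Rightarrow> real) chain"
    using c
  proof (induction c rule: frag_induction_keys)
    case (one k)
    then show ?case using w left_module_smult_closed[OF M r] by simp
  next
    case (diff a b)
    have cl: "zsum ?M w a \<in> carrier ?M" "zsum ?M w b \<in> carrier ?M"
      using diff w by (auto intro!: M.zsum_closed)
    have "zsum ?M w (a - b) \<oplus>\<^bsub>?M\<^esub> zsum ?M w b = zsum ?M w a"
      using M.zsum_diff[of A w a b, OF w diff(1,2)] cl by (simp add: a_minus_def M.a_assoc M.l_neg)
    moreover have c3: "zsum ?M w (a - b) \<in> carrier ?M"
      using M.zsum_diff[of A w a b, OF w diff(1,2)] cl by simp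
    ultimately have "r \<odot>\<^bsub>?M\<^esub> zsum ?M w (a - b) \<oplus>\<^bsub>?M\<^esub> r \<odot>\<^bsub>?M\<^esub> zsum ?M w b = r \<odot>\<^bsub>?M\<^esub> zsum ?M w a"
      using left_module_smult_r_distr[OF M r c3 cl(2)] by simp
    then have "r \<odot>\<^bsub>?M\<^esub> zsum ?M w (a - b) = r \<odot>\<^bsub>?M\<^esub> zsum ?M w a \<ominus>\<^bsub>?M\<^esub> r \<odot>\<^bsub>?M\<^esub> zsum ?M w b"
      using left_module_smult_closed[OF M r] c3 cl by (metis M.add.inv_solve_right a_minus_def)
    also have "\<dots> = zsum ?M (\<lambda>k. r \<odot>\<^bsub>?M\<^esub> w k) (a - b)"
      using M.zsum_diff[of A "\<lambda>k. r \<odot>\<^bsub>?M\<^esub> w k" a b] diff w left_module_smult_closed[OF M r] by simp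
    finally show ?case .
  qed (simp add: rz)
  let ?I = "{\<sigma> \<in> spx j \<xi>. \<tau> t \<in> \<sigma> ` standard_simplex (nat j)}"
  let ?z = "\<lambda>\<xi> \<sigma>. zsum ?M (\<lambda>\<theta>. pulled m \<tau> \<xi> \<sigma> \<theta> t) (\<Theta> \<sigma>)"
  have I: "finite ?I" "?I \<subseteq> simplices E j"
    using \<xi>(2) by (auto simp: point_finite_def simplices_of_def)
  have z: "?z (r \<odot>\<^bsub>C j\<^esub> \<xi>) \<sigma> = r \<odot>\<^bsub>?M\<^esub> ?z \<xi> \<sigma>" if "\<sigma> \<in> ?I" for \<sigma>
  proof -
    have \<sigma>: "\<sigma> \<in> simplices E j" using that I by blast
    note cl = pulled_closed[OF \<xi>(1) \<sigma> simplex_operatorD(2)[OF \<Theta> \<sigma>] \<tau> t]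
    have "pulled m \<tau> (r \<odot>\<^bsub>C j\<^esub> \<xi>) \<sigma> \<theta> t = r \<odot>\<^bsub>?M\<^esub> pulled m \<tau> \<xi> \<sigma> \<theta> t"
      if \<theta>: "\<theta> \<in> Poly_Mapping.keys (\<Theta> \<sigma>)" for \<theta>
    proof (cases "simplex_map (nat m) \<sigma> \<theta> = \<tau>")
      case True
      then have "\<theta> t \<in> coeff_dom E \<G> j \<sigma>" "\<tau> t = \<sigma> (\<theta> t)"
        using t td coeff_dom_simplex_map[OF simplex_operatorD(2)[OF \<Theta> \<sigma> \<theta>], of E \<G> \<sigma>] by (auto simp: simplex_map_def)
      then show ?thesis using True chain_smult_eval[OF \<sigma>, of "\<theta> t"] by (simp add: pulled_def)
    qed (simp add: pulled_def rz)
    then have "?z (r \<odot>\<^bsub>C j\<^esub> \<xi>) \<sigma> = zsum ?M (\<lambda>\<theta>. r \<odot>\<^bsub>?M\<^esub> pulled m \<tau> \<xi> \<sigma> \<theta> t) (\<Theta> \<sigma>)"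
      using cl left_module_smult_closed[OF M r] by (intro M.zsum_cong) simp
    also have "\<dots> = r \<odot>\<^bsub>?M\<^esub> ?z \<xi> \<sigma>" by (rule rz'[symmetric, OF order_refl cl])
    finally show ?thesis .
  qed
  have "push j m \<Theta> (r \<odot>\<^bsub>C j\<^esub> \<xi>) \<tau> t = finsum ?M (?z (r \<odot>\<^bsub>C j\<^esub> \<xi>)) ?I"
    by (rule push_eval[OF s(1) \<Theta> \<tau> t I])
       (use push_index_finite[OF s(2) \<Theta> td, of \<tau>] spx_smult[OF r, of j \<xi>] in auto)
  also have "\<dots> = finsum ?M (\<lambda>\<sigma>. r \<odot>\<^bsub>?M\<^esub> ?z \<xi> \<sigma>) ?I"
    by (rule M.finsum_cong'[OF refl])
       (use z I push_term_closed[OF \<xi>(1) \<Theta> \<tau> t] left_module_smult_closed[OF M r] in auto)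
  also have "\<dots> = r \<odot>\<^bsub>?M\<^esub> finsum ?M (?z \<xi>) ?I"
    by (rule rfin[symmetric, OF I(1)]) (use I push_term_closed[OF \<xi>(1) \<Theta> \<tau> t] in auto)
  finally show "push j m \<Theta> (r \<odot>\<^bsub>C j\<^esub> \<xi>) \<tau> t = (r \<odot>\<^bsub>C m\<^esub> push j m \<Theta> \<xi>) \<tau> t"
    unfolding chain_smult_eval[OF \<tau> t] push_eval_point[OF \<xi> \<Theta> \<tau> t] .
qed

subsection \<open>Supports\<close>

lemma chain_support_push:
  assumes \<Theta>: "simplex_operator j m \<Theta>"
  shows "chain_support E \<G> m (push j m \<Theta> \<xi>) \<subseteq> chain_support E \<G> j \<xi>"
proof
  fix x assume "x \<in> chain_support E \<G> m (push j m \<Theta> \<xi>)"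
  then obtain \<tau> t where \<tau>: "\<tau> \<in> spx m (push j m \<Theta> \<xi>)" "t \<in> standard_simplex (nat m)" "x = \<tau> t"
    by (auto simp: chain_support_def)
  obtain \<sigma> \<theta> where \<sigma>: "\<sigma> \<in> spx j \<xi>" "\<theta> \<in> Poly_Mapping.keys (\<Theta> \<sigma>)" "\<tau> = simplex_map (nat m) \<sigma> \<theta>"
    using spx_push[OF \<Theta> \<tau>(1)] by metis
  have "\<theta> t \<in> standard_simplex (nat j)"
    using simplex_operatorD(2)[OF \<Theta> spx_simplices[OF \<sigma>(1)] \<sigma>(2)] \<tau>(2) by (rule singular_std_simplex)
  then show "x \<in> chain_support E \<G> j \<xi>"
    using \<tau> \<sigma> by (auto simp: chain_support_def simplex_map_def)
qed

lemma finite_near_push: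
  assumes \<Theta>: "simplex_operator j m \<Theta>"
    and fin: "finite {\<sigma> \<in> spx j \<xi>. \<sigma> ` standard_simplex (nat j) \<inter> N \<noteq> {}}"
  shows "finite {\<tau> \<in> spx m (push j m \<Theta> \<xi>). \<tau> ` standard_simplex (nat m) \<inter> N \<noteq> {}}"
proof (rule finite_subset)
  show "finite (\<Union>\<sigma>\<in>{\<sigma> \<in> spx j \<xi>. \<sigma> ` standard_simplex (nat j) \<inter> N \<noteq> {}}.
      simplex_map (nat m) \<sigma> ` Poly_Mapping.keys (\<Theta> \<sigma>))" using fin by auto
  show "{\<tau> \<in> spx m (push j m \<Theta> \<xi>). \<tau> ` standard_simplex (nat m) \<inter> N \<noteq> {}} \<subseteq>
    (\<Union>\<sigma>\<in>{\<sigma> \<in> spx j \<xi>. \<sigma> ` standard_simplex (nat j) \<inter> N \<noteq> {}}. simplex_map (nat m) \<sigma> ` Poly_Mapping.keys (\<Theta> \<sigma>))"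
  proof clarify
    fix \<tau> assume \<tau>: "\<tau> \<in> spx m (push j m \<Theta> \<xi>)" and ne: "\<tau> ` standard_simplex (nat m) \<inter> N \<noteq> {}"
    obtain \<sigma> \<theta> where \<sigma>: "\<sigma> \<in> spx j \<xi>" "\<theta> \<in> Poly_Mapping.keys (\<Theta> \<sigma>)" "\<tau> = simplex_map (nat m) \<sigma> \<theta>"
      using spx_push[OF \<Theta> \<tau>] by metis
    have "\<tau> ` standard_simplex (nat m) \<subseteq> \<sigma> ` standard_simplex (nat j)"
      using singular_std_simplex[OF simplex_operatorD(2)[OF \<Theta> spx_simplices[OF \<sigma>(1)] \<sigma>(2)]] \<sigma>(3)
      by (auto simp: simplex_map_def)
    then have "\<sigma> ` standard_simplex (nat j) \<inter> N \<noteq> {}" using ne by blast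
    then show "\<tau> \<in> (\<Union>\<sigma>\<in>{\<sigma> \<in> spx j \<xi>. \<sigma> ` standard_simplex (nat j) \<inter> N \<noteq> {}}.
        simplex_map (nat m) \<sigma> ` Poly_Mapping.keys (\<Theta> \<sigma>))" using \<sigma> by blast
  qed
qed

lemma point_finite_push:
  assumes "simplex_operator j m \<Theta>" "point_finite j \<xi>"
  shows "point_finite m (push j m \<Theta> \<xi>)"
  unfolding point_finite_def
  using finite_near_push[OF assms(1), of \<xi> "{x}" for x] assms(2) by (simp add: point_finite_def)

end

subsection \<open>The boundary and the subdivision operators\<close>

definition face_op :: "int \<Rightarrow> ((nat \<Rightarrow> real) \<Rightarrow> 'a) \<Rightarrow> (nat \<Rightarrow> real) chain" where
  "face_op j \<sigma> = chain_boundary (nat j) (frag_of (identity_simplex (nat j)))"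

definition star_op :: "'a set \<Rightarrow> int \<Rightarrow> ((nat \<Rightarrow> real) \<Rightarrow> 'a) \<Rightarrow> (nat \<Rightarrow> real) chain" where
  "star_op A j \<sigma> = star_subdivision (\<lambda>t. \<sigma> t \<in> A) (nat j) (frag_of (identity_simplex (nat j)))"

definition link_op :: "'a set \<Rightarrow> int \<Rightarrow> ((nat \<Rightarrow> real) \<Rightarrow> 'a) \<Rightarrow> (nat \<Rightarrow> real) chain" where
  "link_op A j \<sigma> = star_link (\<lambda>t. \<sigma> t \<in> A) (nat j) (frag_of (identity_simplex (nat j)))"

definition homotopy_op :: "int \<Rightarrow> ((nat \<Rightarrow> real) \<Rightarrow> 'a) \<Rightarrow> (nat \<Rightarrow> real) chain" where
  "homotopy_op j \<sigma> = subd (nat j) (frag_of (identity_simplex (nat j)))"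

lemma nat_pred: "nat (j - 1) = nat j - 1"
  by simp

lemma simplicial_identity: "simplicial_chain p (standard_simplex p) (frag_of (identity_simplex p))"
  by simp

lemma simplicial_faces: "simplicial_chain (p - 1) (standard_simplex p) (chain_boundary p (frag_of (identity_simplex p)))"
  by (rule simplicial_chain_boundary[OF simplicial_identity])

lemma chain_boundary_extend: "chain_boundary p c = frag_extend (\<lambda>f. chain_boundary p (frag_of f)) c"
  by (cases "p = 0") (simp_all add: chain_boundary_def frag_extend_eq_0)

lemma subd_extend: "subd p c = frag_extend (\<lambda>f. subd p (frag_of f)) c"
  by (cases p) (simp_all add: frag_extend_eq_0)

lemma chain_map_identity:
  assumes "simplicial_simplex p S f"
  shows "chain_map p f (frag_of (identity_simplex p)) = frag_of f"
  by (rule singular_simplex_chain_map_id[OF simplicial_imp_singular_simplex[OF assms]])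

context chain_coefficients
begin

lemma simplex_operatorI:
  assumes "\<And>\<sigma>. \<sigma> \<in> simplices E j \<Longrightarrow> simplicial_chain (nat m) (standard_simplex (nat j)) (\<Theta> \<sigma>)"
    and "\<And>\<sigma>. \<sigma> \<in> simplices E j \<Longrightarrow> m < 0 \<Longrightarrow> \<Theta> \<sigma> = 0"
  shows "simplex_operator j m \<Theta>"
  unfolding simplex_operator_def
proof (intro ballI conjI)
  fix \<sigma> \<theta> assume \<sigma>: "\<sigma> \<in> simplices E j" and \<theta>: "\<theta> \<in> Poly_Mapping.keys (\<Theta> \<sigma>)"
  show "0 \<le> m" using assms(2)[OF \<sigma>] \<theta> by force
  show "singular_simplex (nat m) (std_simplex (nat j)) \<theta>"
    using simplicial_imp_singular_chain[OF assms(1)[OF \<sigma>]] \<theta> by (auto simp: singular_chain_def)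
qed

lemma simplex_operator_face: "simplex_operator j (j - 1) (face_op j)"
proof (rule simplex_operatorI)
  fix \<sigma> assume \<sigma>: "\<sigma> \<in> simplices E j"
  show "simplicial_chain (nat (j - 1)) (standard_simplex (nat j)) (face_op j \<sigma>)"
    unfolding face_op_def nat_pred by (rule simplicial_faces)
  show "face_op j \<sigma> = 0" if "j - 1 < 0"
    using that simplices_nonneg[OF \<sigma>] by (simp add: face_op_def chain_boundary_def)
qed

lemma simplex_operator_star: "simplex_operator j j (star_op A j)"
proof (rule simplex_operatorI)
  show "simplicial_chain (nat j) (standard_simplex (nat j)) (star_op A j \<sigma>)" for \<sigma>
    unfolding star_op_def by (rule simplicial_chain_star_subdivision[OF simplicial_identity])
qed (use simplices_nonneg in force)

lemma simplex_operator_homotopy: "simplex_operator j (j + 1) (homotopy_op j)"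
proof (rule simplex_operatorI)
  fix \<sigma> assume "\<sigma> \<in> simplices E j"
  then have "nat (j + 1) = Suc (nat j)" using simplices_nonneg by fastforce
  then show "simplicial_chain (nat (j + 1)) (standard_simplex (nat j)) (homotopy_op j \<sigma>)"
    unfolding homotopy_op_def using subd[OF simplicial_identity, of "nat j"] by simp
qed (use simplices_nonneg in force)

lemma simplex_operator_link: "simplex_operator j (j - 1) (link_op A j)"
proof (rule simplex_operatorI)
  fix \<sigma> assume \<sigma>: "\<sigma> \<in> simplices E j"
  show "simplicial_chain (nat (j - 1)) (standard_simplex (nat j)) (link_op A j \<sigma>)"
    unfolding link_op_def star_link_def nat_pred
    by (intro simplicial_chain_diff simplicial_chain_boundary simplicial_chain_star_subdivision
          simplicial_identity simplicial_faces)
  show "link_op A j \<sigma> = 0" if "j - 1 < 0"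
    using that simplices_nonneg[OF \<sigma>] by (simp add: link_op_def star_link_0)
qed

text \<open>The boundary is defined by a sum over pairs of a face index and a simplex; it is regrouped here by
  simplices. A simplex may occur with several face indices, with signs that are collected in \<open>face_op\<close>.\<close>

lemma boundary_eq_push:
  assumes \<xi>: "\<xi> \<in> carrier (C j)" "point_finite j \<xi>"
  shows "boundary E \<G> j \<xi> = push j (j - 1) (face_op j) \<xi>"
proof -
  have eq: "boundary E \<G> j \<xi> \<tau> t = push j (j - 1) (face_op j) \<xi> \<tau> t"
    if \<tau>: "\<tau> \<in> simplices E (j - 1)" and t: "t \<in> coeff_dom E \<G> (j - 1) \<tau>" for \<tau> t
  proof -
    let ?p = "nat j" and ?M = "fibre \<G> (\<tau> t)"
    interpret M: abelian_group ?M
      by (rule left_module_abelian_group[OF fibre_module[OF \<tau> t]])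
    have j: "1 \<le> j" "0 < ?p" "nat (j - 1) = ?p - 1" using simplices_nonneg[OF \<tau>] by auto
    have td: "t \<in> standard_simplex (?p - 1)" using t coeff_dom_subset j by fastforce
    let ?I = "{\<sigma> \<in> spx j \<xi>. \<tau> t \<in> \<sigma> ` standard_simplex (nat j)}"
    have I: "finite ?I" "?I \<subseteq> simplices E j"
      using \<xi>(2) by (auto simp: point_finite_def simplices_of_def)
    define d where "d k = singular_face ?p k (identity_simplex ?p)" for k
    have dt: "d k u = simplical_face k u" if "k \<le> ?p" "u \<in> standard_simplex (?p - 1)" for k u
      using that j simplical_face_in_standard_simplex[of ?p k u] by (simp add: d_def singular_face_def)
    have face: "simplex_map (?p - 1) \<sigma> (d k) = singular_face ?p k \<sigma>" if "k \<le> ?p" for \<sigma> :: "(nat \<Rightarrow> real) \<Rightarrow> 'a" and k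
      by (rule ext) (simp add: simplex_map_def singular_face_def dt[OF that] restrict_def)
    have ds: "singular_simplex (nat (j - 1)) (std_simplex (nat j)) (d k)" if "k \<le> ?p" for k
      unfolding d_def j(3) using singular_simplex_singular_face[OF singular_identity, of ?p k] j that by simp
    define v where "v = (\<lambda>(k, \<sigma>). if even k then \<xi> \<sigma> (simplical_face k t) else \<ominus>\<^bsub>?M\<^esub> \<xi> \<sigma> (simplical_face k t))"
    define w where "w = (\<lambda>k \<sigma>. if singular_face ?p k \<sigma> = \<tau> then v (k, \<sigma>) else \<zero>\<^bsub>?M\<^esub>)"
    have pl: "pulled (j - 1) \<tau> \<xi> \<sigma> (d k) t = (if singular_face ?p k \<sigma> = \<tau> then \<xi> \<sigma> (simplical_face k t) else \<zero>\<^bsub>?M\<^esub>)"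
      if "k \<le> ?p" for \<sigma> k
      unfolding pulled_def j(3) face[OF that] dt[OF that td] ..
    have pcl: "pulled (j - 1) \<tau> \<xi> \<sigma> (d k) t \<in> carrier ?M" if "k \<le> ?p" "\<sigma> \<in> simplices E j" for \<sigma> k
      by (rule pulled_closed[OF \<xi>(1) that(2) ds[OF that(1)] \<tau> t])
    have zs: "zsum ?M (\<lambda>\<theta>. pulled (j - 1) \<tau> \<xi> \<sigma> \<theta> t) (face_op j \<sigma>) = finsum ?M (\<lambda>k. w k \<sigma>) {..?p}"
      and wcl: "\<And>k. k \<le> ?p \<Longrightarrow> w k \<sigma> \<in> carrier ?M"
      if \<sigma>: "\<sigma> \<in> simplices E j" for \<sigma>
    proof -
      have sg: "zsum ?M (\<lambda>\<theta>. pulled (j - 1) \<tau> \<xi> \<sigma> \<theta> t) (frag_cmul ((-1) ^ k) (frag_of (d k))) = w k \<sigma>"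
        if "k \<le> ?p" for k
        using M.zsum_signed[of "\<lambda>\<theta>. pulled (j - 1) \<tau> \<xi> \<sigma> \<theta> t" "d k" k, OF pcl[OF that \<sigma>]]
        unfolding pl[OF that] by (simp add: w_def v_def)
      show wcl: "w k \<sigma> \<in> carrier ?M" if "k \<le> ?p" for k
        using pcl[OF that \<sigma>] unfolding pl[OF that] by (auto simp: w_def v_def split: if_splits)
      have fe: "face_op j \<sigma> = (\<Sum>k\<le>?p. frag_cmul ((-1) ^ k) (frag_of (d k)))"
        using j by (simp add: face_op_def chain_boundary_of d_def)
      have "zsum ?M (\<lambda>\<theta>. pulled (j - 1) \<tau> \<xi> \<sigma> \<theta> t) (face_op j \<sigma>)
          = finsum ?M (\<lambda>k. zsum ?M (\<lambda>\<theta>. pulled (j - 1) \<tau> \<xi> \<sigma> \<theta> t) (frag_cmul ((-1) ^ k) (frag_of (d k)))) {..?p}"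
        unfolding fe
        by (rule M.zsum_sum[of _ _ "d ` {..?p}"]) (use pcl[OF _ \<sigma>] in \<open>auto simp: keys_frag_of\<close>)
      also have "\<dots> = finsum ?M (\<lambda>k. w k \<sigma>) {..?p}"
        by (rule M.finsum_cong'[OF refl]) (use sg wcl in auto)
      finally show "zsum ?M (\<lambda>\<theta>. pulled (j - 1) \<tau> \<xi> \<sigma> \<theta> t) (face_op j \<sigma>) = finsum ?M (\<lambda>k. w k \<sigma>) {..?p}" .
    qed
    have "push j (j - 1) (face_op j) \<xi> \<tau> t
        = finsum ?M (\<lambda>\<sigma>. zsum ?M (\<lambda>\<theta>. pulled (j - 1) \<tau> \<xi> \<sigma> \<theta> t) (face_op j \<sigma>)) ?I"
      by (rule push_eval_point[OF \<xi> simplex_operator_face \<tau> t])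
    also have "\<dots> = finsum ?M (\<lambda>\<sigma>. finsum ?M (\<lambda>k. w k \<sigma>) {..?p}) ?I"
      by (rule M.finsum_cong'[OF refl]) (use zs wcl I in \<open>auto intro!: M.finsum_closed\<close>)
    also have "\<dots> = finsum ?M (\<lambda>(k, \<sigma>). w k \<sigma>) ({..?p} \<times> ?I)"
      by (rule M.finsum_product[OF I(1)]) (use wcl I in auto)
    also have "\<dots> = finsum ?M v {(k, \<sigma>). k \<le> ?p \<and> \<sigma> \<in> spx j \<xi> \<and> singular_face ?p k \<sigma> = \<tau>}"
    proof (rule M.add.finprod_mono_neutral_cong_right)
      show "finite ({..?p} \<times> ?I)" using I by simp
      show "{(k, \<sigma>). k \<le> ?p \<and> \<sigma> \<in> spx j \<xi> \<and> singular_face ?p k \<sigma> = \<tau>} \<subseteq> {..?p} \<times> ?I"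
      proof
        fix x assume "x \<in> {(k, \<sigma>). k \<le> ?p \<and> \<sigma> \<in> spx j \<xi> \<and> singular_face ?p k \<sigma> = \<tau>}"
        then obtain k \<sigma> where k: "x = (k, \<sigma>)" "k \<le> ?p" "\<sigma> \<in> spx j \<xi>" "singular_face ?p k \<sigma> = \<tau>" by auto
        have "simplical_face k t \<in> standard_simplex ?p"
          using simplical_face_in_standard_simplex[of ?p k t] j k td by simp
        moreover have "\<tau> t = \<sigma> (simplical_face k t)"
          using td by (simp add: k(4)[symmetric] singular_face_def)
        ultimately show "x \<in> {..?p} \<times> ?I" using k by simp
      qed
      show "(\<lambda>(k, \<sigma>). w k \<sigma>) \<in> ({..?p} \<times> ?I) \<rightarrow> carrier ?M" using wcl I by auto
    qed (auto simp: w_def split: if_splits)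
    also have "\<dots> = boundary E \<G> j \<xi> \<tau> t"
      using \<tau> t by (simp add: boundary_def v_def case_prod_unfold)
    finally show ?thesis ..
  qed
  show ?thesis
  proof (rule extensionalityI[of _ "simplices E (j - 1)"])
    fix \<tau> assume \<tau>: "\<tau> \<in> simplices E (j - 1)"
    show "boundary E \<G> j \<xi> \<tau> = push j (j - 1) (face_op j) \<xi> \<tau>"
      by (rule extensionalityI[of _ "coeff_dom E \<G> (j - 1) \<tau>"])
         (use \<tau> eq in \<open>auto simp: boundary_def push_def\<close>)
  qed (auto simp: boundary_def push_def)
qed

abbreviation "bd j \<equiv> boundary E \<G> j"

lemma boundary_closed:
  assumes \<xi>: "\<xi> \<in> carrier (C j)" "point_finite j \<xi>"
  shows "bd j \<xi> \<in> carrier (C (j - 1))" "point_finite (j - 1) (bd j \<xi>)"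
  unfolding boundary_eq_push[OF \<xi>]
  by (rule push_closed[OF \<xi> simplex_operator_face] point_finite_push[OF simplex_operator_face \<xi>(2)])+

lemma boundary_add:
  assumes \<xi>: "\<xi> \<in> carrier (C j)" "point_finite j \<xi>" and \<eta>: "\<eta> \<in> carrier (C j)" "point_finite j \<eta>"
  shows "bd j (\<xi> \<oplus>\<^bsub>C j\<^esub> \<eta>) = bd j \<xi> \<oplus>\<^bsub>C (j - 1)\<^esub> bd j \<eta>"
  using push_add[OF \<xi> \<eta> simplex_operator_face] boundary_eq_push[OF \<xi>] boundary_eq_push[OF \<eta>]
    boundary_eq_push[OF chain_add_closed[OF \<xi>(1) \<eta>(1)] point_finite_subset[OF spx_add \<xi>(2) \<eta>(2)]]
  by simp

lemma boundary_smult: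
  assumes \<xi>: "\<xi> \<in> carrier (C j)" "point_finite j \<xi>" and r: "r \<in> carrier R"
  shows "bd j (r \<odot>\<^bsub>C j\<^esub> \<xi>) = r \<odot>\<^bsub>C (j - 1)\<^esub> bd j \<xi>"
proof -
  have "r \<odot>\<^bsub>C j\<^esub> \<xi> \<in> carrier (C j)" "point_finite j (r \<odot>\<^bsub>C j\<^esub> \<xi>)"
    using left_module_smult_closed[OF left_module_chain r \<xi>(1)]
      point_finite_subset[of j "r \<odot>\<^bsub>C j\<^esub> \<xi>" \<xi> \<xi>] spx_smult[OF r] \<xi>(2) by auto
  then show ?thesis
    using push_smult[OF \<xi> r simplex_operator_face] boundary_eq_push[OF \<xi>] boundary_eq_push by simp
qed

lemma simplex_operator_boundary:
  assumes \<Theta>: "simplex_operator j m \<Theta>"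
  shows "simplex_operator j (m - 1) (\<lambda>\<sigma>. chain_boundary (nat m) (\<Theta> \<sigma>))"
  unfolding simplex_operator_def
proof (intro ballI)
  fix \<sigma> \<theta> assume \<sigma>: "\<sigma> \<in> simplices E j" and \<theta>: "\<theta> \<in> Poly_Mapping.keys (chain_boundary (nat m) (\<Theta> \<sigma>))"
  have "singular_chain (nat m) (std_simplex (nat j)) (\<Theta> \<sigma>)"
    using simplex_operatorD(2)[OF \<Theta> \<sigma>] by (auto simp: singular_chain_def)
  then have "singular_chain (nat m - Suc 0) (std_simplex (nat j)) (chain_boundary (nat m) (\<Theta> \<sigma>))"
    by (rule singular_chain_boundary)
  moreover have "nat m \<noteq> 0" using \<theta> by (auto simp: chain_boundary_def)
  ultimately show "0 \<le> m - 1 \<and> singular_simplex (nat (m - 1)) (std_simplex (nat j)) \<theta>"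
    using \<theta> by (auto simp: singular_chain_def nat_pred)
qed

lemma boundary_push:
  assumes \<xi>: "\<xi> \<in> carrier (C j)" "point_finite j \<xi>" and \<Theta>: "simplex_operator j m \<Theta>"
  shows "bd m (push j m \<Theta> \<xi>) = push j (m - 1) (\<lambda>\<sigma>. chain_boundary (nat m) (\<Theta> \<sigma>)) \<xi>"
proof -
  have eq: "frag_extend (\<lambda>\<theta>. chain_map (nat (m - 1)) \<theta> (face_op m (simplex_map (nat m) \<sigma> \<theta>))) (\<Theta> \<sigma>)
      = chain_boundary (nat m) (\<Theta> \<sigma>)" if \<sigma>: "\<sigma> \<in> simplices E j" for \<sigma>
  proof -
    have "frag_extend (\<lambda>\<theta>. chain_map (nat (m - 1)) \<theta> (face_op m (simplex_map (nat m) \<sigma> \<theta>))) (\<Theta> \<sigma>)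
        = frag_extend (\<lambda>\<theta>. chain_boundary (nat m) (frag_of \<theta>)) (\<Theta> \<sigma>)"
    proof (rule frag_extend_eq)
      fix \<theta> assume "\<theta> \<in> Poly_Mapping.keys (\<Theta> \<sigma>)"
      then have \<theta>: "singular_simplex (nat m) (std_simplex (nat j)) \<theta>" by (rule simplex_operatorD(2)[OF \<Theta> \<sigma>])
      have "chain_map (nat (m - 1)) \<theta> (face_op m (simplex_map (nat m) \<sigma> \<theta>))
          = chain_boundary (nat m) (chain_map (nat m) \<theta> (frag_of (identity_simplex (nat m))))"
        unfolding face_op_def nat_pred
        using chain_boundary_chain_map[OF simplicial_imp_singular_chain[OF simplicial_identity], of "nat m" \<theta>] by simp
      then show "chain_map (nat (m - 1)) \<theta> (face_op m (simplex_map (nat m) \<sigma> \<theta>)) = chain_boundary (nat m) (frag_of \<theta>)"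
        using singular_simplex_chain_map_id[OF \<theta>] by simp
    qed
    then show ?thesis using chain_boundary_extend[of "nat m" "\<Theta> \<sigma>"] by simp
  qed
  have "bd m (push j m \<Theta> \<xi>) = push m (m - 1) (face_op m) (push j m \<Theta> \<xi>)"
    by (rule boundary_eq_push[OF push_closed[OF \<xi> \<Theta>] point_finite_push[OF \<Theta> \<xi>(2)]])
  also have "\<dots> = push j (m - 1)
      (\<lambda>\<sigma>. frag_extend (\<lambda>\<theta>. chain_map (nat (m - 1)) \<theta> (face_op m (simplex_map (nat m) \<sigma> \<theta>))) (\<Theta> \<sigma>)) \<xi>"
    by (rule push_push[OF \<xi> \<Theta> simplex_operator_face point_finite_push[OF \<Theta> \<xi>(2)]])
  also have "\<dots> = push j (m - 1) (\<lambda>\<sigma>. chain_boundary (nat m) (\<Theta> \<sigma>)) \<xi>"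
    by (rule push_cong[OF \<xi> simplex_operator_boundary[OF \<Theta>], symmetric]) (simp add: eq)
  finally show ?thesis .
qed

lemma push_boundary:
  assumes \<xi>: "\<xi> \<in> carrier (C j)" "point_finite j \<xi>" and \<Theta>: "simplex_operator (j - 1) m \<Theta>"
    and \<Phi>: "simplex_operator j m \<Phi>"
    and eq: "\<And>\<sigma>. \<sigma> \<in> simplices E j \<Longrightarrow>
      frag_extend (\<lambda>d. chain_map (nat m) d (\<Theta> (simplex_map (nat (j - 1)) \<sigma> d))) (face_op j \<sigma>) = \<Phi> \<sigma>"
  shows "push (j - 1) m \<Theta> (bd j \<xi>) = push j m \<Phi> \<xi>"
proof -
  have "push (j - 1) m \<Theta> (bd j \<xi>) = push j m
      (\<lambda>\<sigma>. frag_extend (\<lambda>d. chain_map (nat m) d (\<Theta> (simplex_map (nat (j - 1)) \<sigma> d))) (face_op j \<sigma>)) \<xi>"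
    unfolding boundary_eq_push[OF \<xi>]
    by (rule push_push[OF \<xi> simplex_operator_face \<Theta> point_finite_push[OF simplex_operator_face \<xi>(2)]])
  also have "\<dots> = push j m \<Phi> \<xi>"
    by (rule push_cong[OF \<xi> \<Phi>, symmetric]) (simp add: eq)
  finally show ?thesis .
qed

lemma boundary_boundary:
  assumes \<xi>: "\<xi> \<in> carrier (C j)" "point_finite j \<xi>"
  shows "bd (j - 1) (bd j \<xi>) = \<zero>\<^bsub>C (j - 1 - 1)\<^esub>"
proof -
  have "bd (j - 1) (bd j \<xi>) = push j (j - 1 - 1) (\<lambda>\<sigma>. chain_boundary (nat (j - 1)) (face_op j \<sigma>)) \<xi>"
    using boundary_push[OF \<xi> simplex_operator_face] boundary_eq_push[OF \<xi>] by simp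
  also have "(\<lambda>\<sigma> :: (nat \<Rightarrow> real) \<Rightarrow> 'a. chain_boundary (nat (j - 1)) (face_op j \<sigma>)) = (\<lambda>\<sigma>. 0)"
    unfolding face_op_def nat_pred
    using chain_boundary_boundary[OF simplicial_imp_singular_chain[OF simplicial_identity]] by simp
  finally show ?thesis using push_zero_operator[OF \<xi>] by simp
qed

lemma faces_simplicial:
  "d \<in> Poly_Mapping.keys (face_op j \<sigma>) \<Longrightarrow> simplicial_simplex (nat (j - 1)) (standard_simplex (nat j)) d"
  using simplicial_faces[of "nat j"] by (auto simp: face_op_def simplicial_chain_def nat_pred)

lemma star_op_faces:
  "frag_extend (\<lambda>d. chain_map (nat (j - 1)) d (star_op A (j - 1) (simplex_map (nat (j - 1)) \<sigma> d))) (face_op j \<sigma>)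
     = star_subdivision (\<lambda>t. \<sigma> t \<in> A) (nat (j - 1)) (face_op j \<sigma>)"
proof -
  let ?q = "nat (j - 1)"
  have "chain_map ?q d (star_op A (j - 1) (simplex_map ?q \<sigma> d))
      = star_subdivision (\<lambda>t. \<sigma> t \<in> A) ?q (frag_of d)" if "d \<in> Poly_Mapping.keys (face_op j \<sigma>)" for d
  proof -
    have d: "simplicial_simplex ?q (standard_simplex (nat j)) d" by (rule faces_simplicial[OF that])
    have "star_op A (j - 1) (simplex_map ?q \<sigma> d)
        = star_subdivision (\<lambda>t. \<sigma> (d t) \<in> A) ?q (frag_of (identity_simplex ?q))"
      unfolding star_op_def
      by (rule star_subdivision_cong[OF simplicial_identity]) (simp add: simplex_map_def)
    then have "chain_map ?q d (star_op A (j - 1) (simplex_map ?q \<sigma> d))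
        = star_subdivision (\<lambda>t. \<sigma> t \<in> A) ?q (chain_map ?q d (frag_of (identity_simplex ?q)))"
      using star_subdivision_natural[OF simplicial_identity d] by simp
    then show ?thesis unfolding chain_map_identity[OF d] .
  qed
  then have "frag_extend (\<lambda>d. chain_map ?q d (star_op A (j - 1) (simplex_map ?q \<sigma> d))) (face_op j \<sigma>)
      = frag_extend (\<lambda>d. star_subdivision (\<lambda>t. \<sigma> t \<in> A) ?q (frag_of d)) (face_op j \<sigma>)"
    by (rule frag_extend_eq)
  then show ?thesis using star_subdivision_extend[of "\<lambda>t. \<sigma> t \<in> A" ?q "face_op j \<sigma>"] by simp
qed

lemma simplex_operator_star_faces:
  "simplex_operator j (j - 1) (\<lambda>\<sigma>. star_subdivision (\<lambda>t. \<sigma> t \<in> A) (nat (j - 1)) (face_op j \<sigma>))"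
proof (rule simplex_operatorI)
  fix \<sigma> assume \<sigma>: "\<sigma> \<in> simplices E j"
  show "simplicial_chain (nat (j - 1)) (standard_simplex (nat j))
      (star_subdivision (\<lambda>t. \<sigma> t \<in> A) (nat (j - 1)) (face_op j \<sigma>))"
    by (rule simplicial_chain_star_subdivision) (use simplicial_faces in \<open>simp add: face_op_def nat_pred\<close>)
  show "star_subdivision (\<lambda>t. \<sigma> t \<in> A) (nat (j - 1)) (face_op j \<sigma>) = 0" if "j - 1 < 0"
    using that simplices_nonneg[OF \<sigma>] by (simp add: face_op_def chain_boundary_def)
qed

text \<open>Taking the stars does not commute with the boundary; the links are the error. The first summand
  contains only simplices of the boundary of the chain after cancellation, and not of
  the boundaries of the single simplices.\<close>

lemma boundary_star:
  assumes \<xi>: "\<xi> \<in> carrier (C j)" "point_finite j \<xi>"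
  shows "bd j (push j j (star_op A j) \<xi>) =
    push (j - 1) (j - 1) (star_op A (j - 1)) (bd j \<xi>) \<oplus>\<^bsub>C (j - 1)\<^esub> push j (j - 1) (link_op A j) \<xi>"
proof -
  have "bd j (push j j (star_op A j) \<xi>) = push j (j - 1) (\<lambda>\<sigma>. chain_boundary (nat j) (star_op A j \<sigma>)) \<xi>"
    by (rule boundary_push[OF \<xi> simplex_operator_star])
  also have "(\<lambda>\<sigma>. chain_boundary (nat j) (star_op A j \<sigma>))
      = (\<lambda>\<sigma>. star_subdivision (\<lambda>t. \<sigma> t \<in> A) (nat (j - 1)) (face_op j \<sigma>) + link_op A j \<sigma>)"
    by (simp add: link_op_def star_link_def star_op_def face_op_def nat_pred)
  also have "push j (j - 1) \<dots> \<xi> = push j (j - 1) (\<lambda>\<sigma>. star_subdivision (\<lambda>t. \<sigma> t \<in> A) (nat (j - 1)) (face_op j \<sigma>)) \<xi>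
      \<oplus>\<^bsub>C (j - 1)\<^esub> push j (j - 1) (link_op A j) \<xi>"
    by (rule push_add_operator[OF \<xi> simplex_operator_star_faces simplex_operator_link])
  also have "push j (j - 1) (\<lambda>\<sigma>. star_subdivision (\<lambda>t. \<sigma> t \<in> A) (nat (j - 1)) (face_op j \<sigma>)) \<xi>
      = push (j - 1) (j - 1) (star_op A (j - 1)) (bd j \<xi>)"
    by (rule push_boundary[symmetric, OF \<xi> simplex_operator_star simplex_operator_star_faces])
       (rule star_op_faces)
  finally show ?thesis .
qed

abbreviation "subdivide j \<equiv> push j j (star_op UNIV j)"

lemma star_op_UNIV: "star_op UNIV j \<sigma> = simplicial_subdivision (nat j) (frag_of (identity_simplex (nat j)))"
  by (simp add: star_op_def star_subdivision_True)

lemma boundary_subdivide: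
  assumes \<xi>: "\<xi> \<in> carrier (C j)" "point_finite j \<xi>"
  shows "bd j (subdivide j \<xi>) = subdivide (j - 1) (bd j \<xi>)"
proof -
  interpret Cm: abelian_group "C (j - 1)" by (rule left_module_abelian_group[OF left_module_chain])
  have "link_op UNIV j \<sigma> = 0" for \<sigma> :: "(nat \<Rightarrow> real) \<Rightarrow> 'a"
    using chain_boundary_simplicial_subdivision[OF simplicial_identity, of "nat j"]
    by (simp add: link_op_def star_link_def star_subdivision_True)
  then have "(link_op UNIV j :: ((nat \<Rightarrow> real) \<Rightarrow> 'a) \<Rightarrow> _) = (\<lambda>\<sigma>. 0)" by auto
  then have "push j (j - 1) (link_op UNIV j) \<xi> = \<zero>\<^bsub>C (j - 1)\<^esub>"
    using push_zero_operator[OF \<xi>] by simp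
  moreover have "subdivide (j - 1) (bd j \<xi>) \<in> carrier (C (j - 1))"
    by (rule push_closed[OF boundary_closed[OF \<xi>] simplex_operator_star])
  ultimately show ?thesis using boundary_star[OF \<xi>, of UNIV] by simp
qed

lemma subdivide_split:
  assumes \<xi>: "\<xi> \<in> carrier (C j)" "point_finite j \<xi>"
  shows "subdivide j \<xi> = push j j (star_op A j) \<xi> \<oplus>\<^bsub>C j\<^esub> push j j (star_op (- A) j) \<xi>"
proof -
  have "(star_op UNIV j :: ((nat \<Rightarrow> real) \<Rightarrow> 'a) \<Rightarrow> _) = (\<lambda>\<sigma>. star_op A j \<sigma> + star_op (- A) j \<sigma>)"
    by (rule ext) (unfold star_op_UNIV, unfold star_op_def Compl_iff star_subdivision_compl, rule refl)
  then show ?thesis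
    using push_add_operator[OF \<xi> simplex_operator_star[of j A] simplex_operator_star[of j "- A"]] by simp
qed

lemma homotopy_op_faces:
  assumes \<sigma>: "\<sigma> \<in> simplices E j"
  shows "frag_extend (\<lambda>d. chain_map (nat j) d (homotopy_op (j - 1) (simplex_map (nat (j - 1)) \<sigma> d))) (face_op j \<sigma>)
     = subd (nat (j - 1)) (face_op j \<sigma>)"
proof (cases "j = 0")
  case False
  let ?q = "nat (j - 1)"
  have q: "nat j = Suc ?q" using False simplices_nonneg[OF \<sigma>] by simp
  have "chain_map (nat j) d (homotopy_op (j - 1) (simplex_map ?q \<sigma> d)) = subd ?q (frag_of d)"
    if "d \<in> Poly_Mapping.keys (face_op j \<sigma>)" for d
    using chain_homotopic_simplicial_subdivision1[OF simplicial_identity faces_simplicial[OF that]]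
      chain_map_identity[OF faces_simplicial[OF that]]
    unfolding homotopy_op_def q by simp
  then have "frag_extend (\<lambda>d. chain_map (nat j) d (homotopy_op (j - 1) (simplex_map ?q \<sigma> d))) (face_op j \<sigma>)
      = frag_extend (\<lambda>d. subd ?q (frag_of d)) (face_op j \<sigma>)"
    by (rule frag_extend_eq)
  then show ?thesis using subd_extend[of ?q "face_op j \<sigma>"] by simp
qed (simp add: face_op_def chain_boundary_def)

text \<open>The chain homotopy \<open>subd\<close> from the identity to subdivision, carried over to chains with coefficients.\<close>

lemma boundary_homotopy:
  assumes \<xi>: "\<xi> \<in> carrier (C j)" "point_finite j \<xi>"
  shows "bd (j + 1) (push j (j + 1) (homotopy_op j) \<xi>) \<oplus>\<^bsub>C j\<^esub> push (j - 1) j (homotopy_op (j - 1)) (bd j \<xi>) \<oplus>\<^bsub>C j\<^esub> \<xi>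
    = subdivide j \<xi>"
proof -
  let ?i = "frag_of (identity_simplex (nat j))"
  let ?A = "\<lambda>\<sigma>. chain_boundary (nat (j + 1)) (homotopy_op j \<sigma>) :: (nat \<Rightarrow> real) chain"
  let ?B = "\<lambda>\<sigma>. subd (nat (j - 1)) (face_op j \<sigma>) :: (nat \<Rightarrow> real) chain"
  have hom: "simplex_operator (j - 1) j (homotopy_op (j - 1))"
    using simplex_operator_homotopy[of "j - 1"] by simp
  have A: "simplex_operator j j ?A" using simplex_operator_boundary[OF simplex_operator_homotopy[of j]] by simp
  have I: "simplex_operator j j (\<lambda>\<sigma>. ?i)"
    unfolding simplex_operator_def using singular_identity simplices_nonneg by (auto simp: keys_frag_of)
  have B: "simplex_operator j j ?B"
  proof (rule simplex_operatorI)
    fix \<sigma> assume \<sigma>: "\<sigma> \<in> simplices E j"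
    show "simplicial_chain (nat j) (standard_simplex (nat j)) (?B \<sigma>)"
    proof (cases "j = 0")
      case False
      then have "nat j = Suc (nat (j - 1))" using simplices_nonneg[OF \<sigma>] by simp
      then show ?thesis
        using subd[of "nat (j - 1)" "nat j" "face_op j \<sigma>"] simplicial_faces[of "nat j"] by (simp add: face_op_def)
    qed (simp add: face_op_def chain_boundary_def)
  qed (use simplices_nonneg in force)
  have sum: "(\<lambda>\<sigma>. ?A \<sigma> + ?B \<sigma> + ?i) \<sigma> = star_op UNIV j \<sigma>" if \<sigma>: "\<sigma> \<in> simplices E j" for \<sigma>
  proof -
    have "nat (j + 1) = Suc (nat j)" using simplices_nonneg[OF \<sigma>] by simp
    then show ?thesis
      using subd[OF simplicial_identity, of "nat j"]
      by (simp add: homotopy_op_def face_op_def star_op_UNIV nat_pred)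
  qed
  have "subdivide j \<xi> = push j j (\<lambda>\<sigma>. ?A \<sigma> + ?B \<sigma> + ?i) \<xi>"
    by (rule push_cong[OF \<xi> simplex_operator_star]) (simp add: sum)
  also have "\<dots> = push j j ?A \<xi> \<oplus>\<^bsub>C j\<^esub> push j j ?B \<xi> \<oplus>\<^bsub>C j\<^esub> \<xi>"
    using push_add_operator[OF \<xi> simplex_operator_add[OF A B] I] push_add_operator[OF \<xi> A B] push_identity[OF \<xi>(1)]
    by simp
  also have "push j j ?A \<xi> = bd (j + 1) (push j (j + 1) (homotopy_op j) \<xi>)"
    using boundary_push[OF \<xi> simplex_operator_homotopy] by simp
  also have "push j j ?B \<xi> = push (j - 1) j (homotopy_op (j - 1)) (bd j \<xi>)"
    by (rule push_boundary[symmetric, OF \<xi> hom B]) (rule homotopy_op_faces)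
  finally show ?thesis ..
qed

end

section \<open>Truncating allowable chains\<close>

context abelian_group
begin

lemma eq_minusI:
  assumes "x \<in> carrier G" "y \<in> carrier G" "x \<oplus> y = z"
  shows "x = z \<ominus> y"
  using assms by (auto simp: a_minus_def a_assoc r_neg)

lemma minus_add_cancel': "x \<in> carrier G \<Longrightarrow> y \<in> carrier G \<Longrightarrow> (x \<ominus> y) \<oplus> y = x"
  by (simp add: a_minus_def a_assoc l_neg)

end

text \<open>The excess of \<open>\<theta>\<close> and the change of dimension cancel, so that the condition for each stratum carries
  over with the same value of the perversity.\<close>

lemma allowable_in_position:
  assumes \<sigma>: "allowable_simplex E pv j \<sigma>" and \<theta>: "in_position (nat j) V (m - j) (nat m) \<theta>"
  shows "allowable_simplex E pv m (simplex_map (nat m) \<sigma> \<theta>)"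
  unfolding allowable_simplex_def
proof (intro allI impI subsetI)
  fix k :: nat and t
  assume k: "1 \<le> k" and "t \<in> {t \<in> standard_simplex (nat m).
      simplex_map (nat m) \<sigma> \<theta> t \<in> stratum E (int (fdim E) - int k)}"
  then have t: "t \<in> standard_simplex (nat m)" and s: "\<sigma> (\<theta> t) \<in> stratum E (int (fdim E) - int k)"
    by (auto simp: simplex_map_def)
  have "\<theta> t \<in> standard_simplex (nat j)"
    using \<theta> t by (auto simp: in_position_def simplicial_simplex)
  then have "\<theta> t \<in> simplex_skeleton j (j - int k + pv k)"
    using \<sigma> k s unfolding allowable_simplex_def by blast
  then have "int (card (support (\<theta> t))) \<le> j - int k + pv k + 1"
    by (simp add: simplex_skeleton_def support_def)
  moreover have "int (card (support t)) \<le> int (card (support (\<theta> t))) + (m - j)"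
    using \<theta> t by (simp add: in_position_def)
  ultimately show "t \<in> simplex_skeleton m (m - int k + pv k)"
    using t by (simp add: simplex_skeleton_def support_def)
qed

context chain_coefficients
begin

lemma spx_uminus:
  assumes "\<xi> \<in> carrier (C j)"
  shows "spx j (\<ominus>\<^bsub>C j\<^esub> \<xi>) \<subseteq> spx j \<xi>"
proof -
  have "\<ominus>\<^bsub>R\<^esub> \<one>\<^bsub>R\<^esub> \<in> carrier R"
    using base_ring by (simp add: ring.ring_simprules(3) ring.ring_simprules(6))
  then show ?thesis
    using spx_smult left_module_smult_minus_one[OF left_module_chain assms] by metis
qed

lemma spx_minus:
  assumes "\<eta> \<in> carrier (C j)"
  shows "spx j (\<xi> \<ominus>\<^bsub>C j\<^esub> \<eta>) \<subseteq> spx j \<xi> \<union> spx j \<eta>"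
  using spx_add[of j \<xi> "\<ominus>\<^bsub>C j\<^esub> \<eta>"] spx_uminus[OF assms] unfolding a_minus_def by blast

abbreviation "supp j \<xi> \<equiv> chain_support E \<G> j \<xi>"

lemma supp_mono: "spx j \<xi> \<subseteq> spx j \<eta> \<union> spx j \<zeta> \<Longrightarrow> supp j \<xi> \<subseteq> supp j \<eta> \<union> supp j \<zeta>"
  by (auto simp: chain_support_def)

lemma supp_topspace: "supp j \<xi> \<subseteq> topspace (ftop E)"
  using simplices_topspace spx_simplices by (fastforce simp: chain_support_def)

abbreviation "finite_near j \<xi> N \<equiv> finite {\<sigma> \<in> spx j \<xi>. \<sigma> ` standard_simplex (nat j) \<inter> N \<noteq> {}}"

lemma finite_near_mono:
  assumes "spx j \<xi> \<subseteq> spx j \<eta> \<union> spx j \<zeta>" "finite_near j \<eta> N" "finite_near j \<zeta> N'" "M \<subseteq> N" "M \<subseteq> N'"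
  shows "finite_near j \<xi> M"
proof (rule finite_subset)
  show "{\<sigma> \<in> spx j \<xi>. \<sigma> ` standard_simplex (nat j) \<inter> M \<noteq> {}}
      \<subseteq> {\<sigma> \<in> spx j \<eta>. \<sigma> ` standard_simplex (nat j) \<inter> N \<noteq> {}} \<union> {\<sigma> \<in> spx j \<zeta>. \<sigma> ` standard_simplex (nat j) \<inter> N' \<noteq> {}}"
    using assms(1,4,5) by blast
qed (use assms in simp)

lemma finite_near_UNIV: "finite_near j \<xi> UNIV \<longleftrightarrow> finite (spx j \<xi>)"
  using nonempty_standard_simplex by simp

end

locale allowable_chains = chain_coefficients R E \<G>
  for R :: "('r, 'm) ring_scheme" and E :: "'a filtered" and \<G> :: "('a, 'r, 'g) coefficients" +
  fixes pv :: "nat \<Rightarrow> int"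
begin

text \<open>Point finiteness is common to finite chains and to chains with fibrewise compact support, which can
  thus be treated together.\<close>

definition allow :: "int \<Rightarrow> ('a, 'g) schain \<Rightarrow> bool" where
  "allow j \<xi> \<longleftrightarrow> \<xi> \<in> carrier (C j) \<and> point_finite j \<xi> \<and> allowable_chain E pv \<G> j \<xi>"

lemma allowD: "allow j \<xi> \<Longrightarrow> \<xi> \<in> carrier (C j)" "allow j \<xi> \<Longrightarrow> point_finite j \<xi>"
  by (simp_all add: allow_def)

abbreviation "allow_spx j S \<equiv> \<forall>\<sigma>\<in>S. allowable_simplex E pv j \<sigma>"

lemma allowI:
  "\<xi> \<in> carrier (C j) \<Longrightarrow> point_finite j \<xi> \<Longrightarrow> allow_spx j (spx j \<xi>) \<Longrightarrow>
    allow_spx (j - 1) (spx (j - 1) (bd j \<xi>)) \<Longrightarrow> allow j \<xi>"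
  by (simp add: allow_def allowable_chain_def)

lemma allow_spxD:
  "allow j \<xi> \<Longrightarrow> allow_spx j (spx j \<xi>)" "allow j \<xi> \<Longrightarrow> allow_spx (j - 1) (spx (j - 1) (bd j \<xi>))"
  by (simp_all add: allow_def allowable_chain_def)

lemma chain_zero_closed: "\<zero>\<^bsub>C j\<^esub> \<in> carrier (C j)"
  using abelian_monoid.zero_closed[OF abelian_group.axioms(1)[OF left_module_abelian_group[OF left_module_chain]]] .

lemma boundary_zero: "bd j \<zero>\<^bsub>C j\<^esub> = \<zero>\<^bsub>C (j - 1)\<^esub>"
proof -
  interpret c: abelian_group "C j" by (rule left_module_abelian_group[OF left_module_chain])
  interpret c1: abelian_group "C (j - 1)" by (rule left_module_abelian_group[OF left_module_chain])
  have pf: "point_finite j \<zero>\<^bsub>C j\<^esub>" by (simp add: point_finite_def spx_zero)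
  have "bd j \<zero>\<^bsub>C j\<^esub> \<oplus>\<^bsub>C (j - 1)\<^esub> bd j \<zero>\<^bsub>C j\<^esub> = bd j \<zero>\<^bsub>C j\<^esub>"
    using boundary_add[OF chain_zero_closed pf chain_zero_closed pf] by simp
  then show ?thesis using boundary_closed(1)[OF chain_zero_closed pf] by simp
qed

lemma allow_zero: "allow j \<zero>\<^bsub>C j\<^esub>"
  by (rule allowI) (simp_all add: chain_zero_closed point_finite_def spx_zero boundary_zero)

lemma allow_add:
  assumes "allow j \<xi>" "allow j \<eta>"
  shows "allow j (\<xi> \<oplus>\<^bsub>C j\<^esub> \<eta>)"
proof (rule allowI)
  note x = allowD[OF assms(1)] and e = allowD[OF assms(2)]
  show "\<xi> \<oplus>\<^bsub>C j\<^esub> \<eta> \<in> carrier (C j)" by (rule chain_add_closed[OF x(1) e(1)])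
  show "point_finite j (\<xi> \<oplus>\<^bsub>C j\<^esub> \<eta>)" by (rule point_finite_subset[OF spx_add x(2) e(2)])
  show "allow_spx j (spx j (\<xi> \<oplus>\<^bsub>C j\<^esub> \<eta>))"
    using spx_add[of j \<xi> \<eta>] allow_spxD(1)[OF assms(1)] allow_spxD(1)[OF assms(2)] by blast
  show "allow_spx (j - 1) (spx (j - 1) (bd j (\<xi> \<oplus>\<^bsub>C j\<^esub> \<eta>)))"
    unfolding boundary_add[OF x e]
    using spx_add[of "j - 1" "bd j \<xi>" "bd j \<eta>"] allow_spxD(2)[OF assms(1)] allow_spxD(2)[OF assms(2)] by blast
qed

lemma allow_smult:
  assumes "allow j \<xi>" and r: "r \<in> carrier R"
  shows "allow j (r \<odot>\<^bsub>C j\<^esub> \<xi>)"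
proof (rule allowI)
  note x = allowD[OF assms(1)]
  show "r \<odot>\<^bsub>C j\<^esub> \<xi> \<in> carrier (C j)" by (rule left_module_smult_closed[OF left_module_chain r x(1)])
  show "point_finite j (r \<odot>\<^bsub>C j\<^esub> \<xi>)"
    by (rule point_finite_subset[of _ _ \<xi> \<xi>]) (use spx_smult[OF r] x in auto)
  show "allow_spx j (spx j (r \<odot>\<^bsub>C j\<^esub> \<xi>))"
    using spx_smult[OF r, of j \<xi>] allow_spxD(1)[OF assms(1)] by blast
  show "allow_spx (j - 1) (spx (j - 1) (bd j (r \<odot>\<^bsub>C j\<^esub> \<xi>)))"
    unfolding boundary_smult[OF x r]
    using spx_smult[OF r, of "j - 1" "bd j \<xi>"] allow_spxD(2)[OF assms(1)] by blast
qed

lemma allow_boundary: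
  assumes "allow j \<xi>"
  shows "allow (j - 1) (bd j \<xi>)"
proof (rule allowI)
  note x = allowD[OF assms]
  show "bd j \<xi> \<in> carrier (C (j - 1))" "point_finite (j - 1) (bd j \<xi>)" by (rule boundary_closed[OF x])+
  show "allow_spx (j - 1) (spx (j - 1) (bd j \<xi>))" by (rule allow_spxD(2)[OF assms])
  show "allow_spx (j - 1 - 1) (spx (j - 1 - 1) (bd (j - 1) (bd j \<xi>)))"
    unfolding boundary_boundary[OF x] by (simp add: spx_zero)
qed

lemma allowable_push:
  assumes \<Theta>: "simplex_operator j m \<Theta>"
    and pos: "\<And>\<sigma> \<theta>. \<sigma> \<in> simplices E j \<Longrightarrow> \<theta> \<in> Poly_Mapping.keys (\<Theta> \<sigma>) \<Longrightarrow> in_position (nat j) {..nat j} (m - j) (nat m) \<theta>"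
    and \<xi>: "allow_spx j (spx j \<xi>)"
  shows "allow_spx m (spx m (push j m \<Theta> \<xi>))"
proof
  fix \<tau> assume "\<tau> \<in> spx m (push j m \<Theta> \<xi>)"
  then obtain \<sigma> \<theta> where \<sigma>: "\<sigma> \<in> spx j \<xi>" "\<theta> \<in> Poly_Mapping.keys (\<Theta> \<sigma>)" "\<tau> = simplex_map (nat m) \<sigma> \<theta>"
    by (rule spx_push[OF \<Theta>])
  show "allowable_simplex E pv m \<tau>"
    unfolding \<sigma>(3) by (rule allowable_in_position[OF _ pos[OF spx_simplices[OF \<sigma>(1)] \<sigma>(2)]]) (use \<xi> \<sigma> in blast)
qed

lemma allowable_push_star:
  "allow_spx j (spx j \<xi>) \<Longrightarrow> allow_spx j (spx j (push j j (star_op A j) \<xi>))"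
  by (rule allowable_push[OF simplex_operator_star])
     (use in_position_star[OF face_simplex_identity] in \<open>auto simp: star_op_def\<close>)

text \<open>The boundary consists of stars in simplices of the boundary of \<open>\<xi>\<close>, which are allowable by
  hypothesis, and of links in simplices of \<open>\<xi>\<close>, which are in general position.\<close>

lemma allow_star:
  assumes "allow j \<xi>"
  shows "allow j (push j j (star_op A j) \<xi>)"
proof (rule allowI)
  note x = allowD[OF assms]
  show "push j j (star_op A j) \<xi> \<in> carrier (C j)" by (rule push_closed[OF x simplex_operator_star])
  show "point_finite j (push j j (star_op A j) \<xi>)" by (rule point_finite_push[OF simplex_operator_star x(2)])
  show "allow_spx j (spx j (push j j (star_op A j) \<xi>))"
    by (rule allowable_push_star[OF allow_spxD(1)[OF assms]])
  have "allow_spx (j - 1) (spx (j - 1) (push (j - 1) (j - 1) (star_op A (j - 1)) (bd j \<xi>)))"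
    by (rule allowable_push_star[OF allow_spxD(2)[OF assms]])
  moreover have "allow_spx (j - 1) (spx (j - 1) (push j (j - 1) (link_op A j) \<xi>))"
    by (rule allowable_push[OF simplex_operator_link _ allow_spxD(1)[OF assms]])
       (use in_position_star_link[OF face_simplex_identity] in \<open>auto simp: link_op_def nat_pred\<close>)
  ultimately show "allow_spx (j - 1) (spx (j - 1) (bd j (push j j (star_op A j) \<xi>)))"
    unfolding boundary_star[OF x]
    using spx_add[of "j - 1" "push (j - 1) (j - 1) (star_op A (j - 1)) (bd j \<xi>)" "push j (j - 1) (link_op A j) \<xi>"]
    by blast
qed

abbreviation "hty j \<equiv> push j (j + 1) (homotopy_op j)"

lemma hty_operator: "simplex_operator (j - 1) j (homotopy_op (j - 1))"
  using simplex_operator_homotopy[of "j - 1"] by simp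

lemma allowable_push_homotopy:
  assumes "allow_spx j (spx j \<xi>)"
  shows "allow_spx (j + 1) (spx (j + 1) (hty j \<xi>))"
proof (rule allowable_push[OF simplex_operator_homotopy _ assms])
  fix \<sigma> \<theta> assume \<sigma>: "\<sigma> \<in> simplices E j" and \<theta>: "\<theta> \<in> Poly_Mapping.keys (homotopy_op j \<sigma>)"
  have "nat (j + 1) = Suc (nat j)" using simplices_nonneg[OF \<sigma>] by simp
  then show "in_position (nat j) {..nat j} (j + 1 - j) (nat (j + 1)) \<theta>"
    using in_position_subd[OF face_simplex_identity] \<theta> by (simp add: homotopy_op_def)
qed

lemma boundary_hty:
  assumes x: "\<xi> \<in> carrier (C j)" "point_finite j \<xi>"
  shows "bd (j + 1) (hty j \<xi>) = subdivide j \<xi> \<ominus>\<^bsub>C j\<^esub> \<xi> \<ominus>\<^bsub>C j\<^esub> push (j - 1) j (homotopy_op (j - 1)) (bd j \<xi>)"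
proof -
  interpret c: abelian_group "C j" by (rule left_module_abelian_group[OF left_module_chain])
  let ?H = "push (j - 1) j (homotopy_op (j - 1)) (bd j \<xi>)"
  have b: "bd (j + 1) (hty j \<xi>) \<in> carrier (C j)"
    using boundary_closed(1)[OF push_closed[OF x simplex_operator_homotopy] point_finite_push[OF simplex_operator_homotopy x(2)]]
    by simp
  have h: "?H \<in> carrier (C j)" by (rule push_closed[OF boundary_closed[OF x] hty_operator])
  have "bd (j + 1) (hty j \<xi>) \<oplus>\<^bsub>C j\<^esub> ?H = subdivide j \<xi> \<ominus>\<^bsub>C j\<^esub> \<xi>"
    by (rule c.eq_minusI) (use b h x boundary_homotopy[OF x] in auto)
  then show ?thesis by (rule c.eq_minusI[OF b h])
qed

text \<open>The boundary is expressed by the homotopy formula through chains that are known to be allowable.\<close>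

lemma allow_hty:
  assumes "allow j \<xi>"
  shows "allow (j + 1) (hty j \<xi>)"
proof (rule allowI)
  note x = allowD[OF assms]
  show "hty j \<xi> \<in> carrier (C (j + 1))" by (rule push_closed[OF x simplex_operator_homotopy])
  show "point_finite (j + 1) (hty j \<xi>)" by (rule point_finite_push[OF simplex_operator_homotopy x(2)])
  show "allow_spx (j + 1) (spx (j + 1) (hty j \<xi>))" by (rule allowable_push_homotopy[OF allow_spxD(1)[OF assms]])
  let ?H = "push (j - 1) j (homotopy_op (j - 1)) (bd j \<xi>)"
  have h: "?H \<in> carrier (C j)" by (rule push_closed[OF boundary_closed[OF x] hty_operator])
  have "allow_spx j (spx j (subdivide j \<xi>))" by (rule allowable_push_star[OF allow_spxD(1)[OF assms]])
  moreover have "allow_spx j (spx j ?H)"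
    using allowable_push_homotopy[OF allow_spxD(2)[OF assms]] by simp
  moreover have "spx j (bd (j + 1) (hty j \<xi>)) \<subseteq> spx j (subdivide j \<xi>) \<union> spx j \<xi> \<union> spx j ?H"
    unfolding boundary_hty[OF x]
    using spx_minus[OF h, of "subdivide j \<xi> \<ominus>\<^bsub>C j\<^esub> \<xi>"] spx_minus[OF x(1), of "subdivide j \<xi>"] by blast
  ultimately show "allow_spx (j + 1 - 1) (spx (j + 1 - 1) (bd (j + 1) (hty j \<xi>)))"
    using allow_spxD(1)[OF assms] by auto
qed

text \<open>Let \<open>A\<close> consist of the vertices, as points of the space, of the finitely many simplices that meet
  \<open>F\<close>. Only finitely many simplices contain a point of the finite set \<open>A\<close>. A simplex with a
  vertex outside \<open>A\<close> does not meet \<open>F\<close>, and the stars of the vertices outside \<open>A\<close> lie in such simplices.\<close>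

lemma truncation:
  assumes \<xi>: "\<xi> \<in> carrier (C j)" "point_finite j \<xi>" and fin: "finite_near j \<xi> F"
  obtains A where "finite (spx j (push j j (star_op A j) \<xi>))" "supp j (push j j (star_op (- A) j) \<xi>) \<inter> F = {}"
proof -
  let ?p = "nat j"
  let ?v = "\<lambda>(\<sigma> :: (nat \<Rightarrow> real) \<Rightarrow> 'a) i. \<sigma> (\<lambda>k. if k = i then 1 else 0)"
  define B where "B = {\<sigma> \<in> spx j \<xi>. \<sigma> ` standard_simplex ?p \<inter> F \<noteq> {}}"
  define A where "A = (\<Union>\<sigma>\<in>B. ?v \<sigma> ` {..?p})"
  have A: "finite A" using fin by (simp add: A_def B_def)
  have vertex: "\<exists>i\<le>?p. ?v \<sigma> i \<in> X" if ne: "Poly_Mapping.keys (star_op X j \<sigma>) \<noteq> {}" for \<sigma> X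
  proof (rule ccontr)
    assume "\<not> ?thesis"
    then have no: "?v \<sigma> i \<notin> X" if "i \<le> ?p" for i using that by blast
    have "star_op X j \<sigma> = 0"
      unfolding star_op_def
    proof (rule star_subdivision_eq_0)
      show "simplicial_simplex ?p (standard_simplex ?p) (identity_simplex ?p)" by simp
      show "\<not> \<sigma> (simplicial_vertex i (identity_simplex ?p)) \<in> X" if "i \<le> ?p" for i
        using no[OF that] that by (simp add: simplicial_vertex_def)
    qed
    then show False using ne by simp
  qed
  have "finite (spx j (push j j (star_op A j) \<xi>))"
  proof (rule finite_subset)
    let ?S = "\<Union>a\<in>A. {\<sigma> \<in> spx j \<xi>. a \<in> \<sigma> ` standard_simplex ?p}"
    show "finite (\<Union>\<sigma>\<in>?S. simplex_map ?p \<sigma> ` Poly_Mapping.keys (star_op A j \<sigma>))"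
      using A \<xi>(2) by (auto simp: point_finite_def)
    show "spx j (push j j (star_op A j) \<xi>) \<subseteq> (\<Union>\<sigma>\<in>?S. simplex_map ?p \<sigma> ` Poly_Mapping.keys (star_op A j \<sigma>))"
    proof
      fix \<tau> assume "\<tau> \<in> spx j (push j j (star_op A j) \<xi>)"
      then obtain \<sigma> \<theta> where \<sigma>: "\<sigma> \<in> spx j \<xi>" "\<theta> \<in> Poly_Mapping.keys (star_op A j \<sigma>)" "\<tau> = simplex_map ?p \<sigma> \<theta>"
        by (rule spx_push[OF simplex_operator_star])
      then obtain i where i: "i \<le> ?p" "?v \<sigma> i \<in> A" using vertex[of A \<sigma>] by blast
      then have "?v \<sigma> i \<in> \<sigma> ` standard_simplex ?p" by simp
      then have "\<sigma> \<in> ?S" using i \<sigma> by blast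
      then show "\<tau> \<in> (\<Union>\<sigma>\<in>?S. simplex_map ?p \<sigma> ` Poly_Mapping.keys (star_op A j \<sigma>))"
        using \<sigma> by blast
    qed
  qed
  moreover have "supp j (push j j (star_op (- A) j) \<xi>) \<inter> F = {}"
  proof (rule ccontr)
    assume "supp j (push j j (star_op (- A) j) \<xi>) \<inter> F \<noteq> {}"
    then obtain \<tau> t where \<tau>: "\<tau> \<in> spx j (push j j (star_op (- A) j) \<xi>)" "t \<in> standard_simplex ?p" "\<tau> t \<in> F"
      by (auto simp: chain_support_def)
    obtain \<sigma> \<theta> where \<sigma>: "\<sigma> \<in> spx j \<xi>" "\<theta> \<in> Poly_Mapping.keys (star_op (- A) j \<sigma>)" "\<tau> = simplex_map ?p \<sigma> \<theta>"
      using \<tau>(1) by (rule spx_push[OF simplex_operator_star])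
    obtain i where i: "i \<le> ?p" "?v \<sigma> i \<notin> A" using vertex[of "- A" \<sigma>] \<sigma> by blast
    have "\<theta> t \<in> standard_simplex ?p"
      using simplex_operatorD(2)[OF simplex_operator_star spx_simplices[OF \<sigma>(1)] \<sigma>(2)] \<tau>(2)
      by (rule singular_std_simplex)
    moreover have "\<sigma> (\<theta> t) \<in> F" using \<tau> \<sigma> by (simp add: simplex_map_def)
    ultimately have "\<sigma> \<in> B" using \<sigma>(1) by (auto simp: B_def)
    then show False using i by (auto simp: A_def)
  qed
  ultimately show ?thesis by (rule that)
qed

end

section \<open>Chains with fibrewise compact support\<close>

text \<open>As the space is Hausdorff, the closed set is covered by open sets whose closures do not contain the
  point. The closure of the union of a locally finite refinement is the union of the closures, so it
  does not contain the point either.\<close>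

lemma paracompact_imp_regular_space:
  assumes X: "paracompact_space X"
  shows "regular_space X"
  unfolding regular_space_def
proof (intro allI impI)
  fix C a assume "closedin X C \<and> a \<in> topspace X - C"
  then have C: "closedin X C" and a: "a \<in> topspace X" "a \<notin> C" by auto
  have H: "Hausdorff_space X" using X by (simp add: paracompact_space_def)
  define \<Q> where "\<Q> = {Q. openin X Q \<and> a \<notin> X closure_of Q}"
  have Q: "\<exists>Q\<in>\<Q>. c \<in> Q" if c: "c \<in> C" for c
  proof -
    have "c \<in> topspace X" "c \<noteq> a" using c a C closedin_subset by auto
    then obtain P Q where PQ: "openin X P" "openin X Q" "a \<in> P" "c \<in> Q" "disjnt P Q"
      using H a(1) unfolding Hausdorff_space_def by metis
    then have "a \<notin> X closure_of Q" by (auto simp: in_closure_of disjnt_iff)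
    then show ?thesis using PQ by (auto simp: \<Q>_def)
  qed
  have "\<forall>U\<in>insert (topspace X - C) \<Q>. openin X U" using C by (auto simp: \<Q>_def)
  moreover have "\<Union>(insert (topspace X - C) \<Q>) = topspace X"
    using Q openin_subset by (auto simp: \<Q>_def)
  ultimately have "\<exists>\<V>. (\<forall>V\<in>\<V>. openin X V) \<and> \<Union>\<V> = topspace X \<and> locally_finite_in X \<V> \<and>
      (\<forall>V\<in>\<V>. \<exists>U\<in>insert (topspace X - C) \<Q>. V \<subseteq> U)"
    using X[unfolded paracompact_space_def, THEN conjunct2, THEN spec, of "insert (topspace X - C) \<Q>"]
    by (blast intro: conjI)
  then obtain \<V> where V: "\<forall>V\<in>\<V>. openin X V" "\<Union>\<V> = topspace X" "locally_finite_in X \<V>"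
    "\<forall>V\<in>\<V>. \<exists>U\<in>insert (topspace X - C) \<Q>. V \<subseteq> U"
    by (elim exE conjE) (rule that)
  define \<W> where "\<W> = {V \<in> \<V>. V \<inter> C \<noteq> {}}"
  have W: "locally_finite_in X \<W>" by (rule locally_finite_in_subset[OF V(3)]) (auto simp: \<W>_def)
  have cl: "X closure_of \<Union>\<W> = \<Union>((closure_of) X ` \<W>)"
    by (rule closure_of_locally_finite_Union[OF W])
  have "a \<notin> X closure_of V" if "V \<in> \<W>" for V
  proof -
    have "V \<in> \<V>" using that by (simp add: \<W>_def)
    then have "\<exists>U\<in>insert (topspace X - C) \<Q>. V \<subseteq> U" using V(4) by (rule bspec[rotated])
    then obtain U where U: "U \<in> insert (topspace X - C) \<Q>" "V \<subseteq> U" by (rule bexE)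
    then have "U \<in> \<Q>" using that by (auto simp: \<W>_def)
    then show ?thesis using closure_of_mono[OF U(2), of X] by (auto simp: \<Q>_def)
  qed
  then have "a \<in> topspace X - X closure_of \<Union>\<W>" using a cl by auto
  moreover have "openin X (topspace X - X closure_of \<Union>\<W>)"
    by (rule openin_diff[OF openin_topspace closedin_closure_of])
  moreover have "openin X (\<Union>\<W>)" using V(1) by (auto simp: \<W>_def)
  moreover have "C \<subseteq> \<Union>\<W>"
  proof
    fix c assume c: "c \<in> C"
    then have "c \<in> \<Union>\<V>" using V(2) closedin_subset[OF C] by auto
    then show "c \<in> \<Union>\<W>" using c by (auto simp: \<W>_def)
  qed
  moreover have "disjnt (topspace X - X closure_of \<Union>\<W>) (\<Union>\<W>)"
  proof -
    have "\<Union>\<W> \<subseteq> X closure_of \<Union>\<W>"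
      by (rule closure_of_subset) (use V(2) in \<open>auto simp: \<W>_def\<close>)
    then show ?thesis by (auto simp: disjnt_iff)
  qed
  ultimately show "\<exists>U V. openin X U \<and> openin X V \<and> a \<in> U \<and> C \<subseteq> V \<and> disjnt U V" by blast
qed

locale fibrewise_chains = allowable_chains R E \<G> pv
  for R :: "('r, 'm) ring_scheme" and E :: "'a filtered" and \<G> :: "('a, 'r, 'g) coefficients"
    and pv :: "nat \<Rightarrow> int" +
  fixes Y :: "'b filtered" and p :: "'a \<Rightarrow> 'b"
  assumes p: "continuous_map (ftop E) (ftop Y) p"
    and Hausdorff: "Hausdorff_space (ftop Y)" and regular: "regular_space (ftop Y)"
begin

abbreviation "T \<equiv> ftop Y"

text \<open>The description of fibrewise compact support by finiteness of chains, see \<open>carrier_IC_fc\<close>.\<close>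

definition fc :: "int \<Rightarrow> ('a, 'g) schain \<Rightarrow> bool" where
  "fc j \<xi> \<longleftrightarrow> allow j \<xi> \<and> (\<forall>y\<in>topspace T. \<exists>N. openin T N \<and> y \<in> N \<and> finite_near j \<xi> (p -` N))"

definition cc :: "int \<Rightarrow> ('a, 'g) schain \<Rightarrow> bool" where
  "cc j \<xi> \<longleftrightarrow> allow j \<xi> \<and> finite (spx j \<xi>)"

lemma simplex_compact: "\<sigma> \<in> simplices E j \<Longrightarrow> compactin (ftop E) (\<sigma> ` standard_simplex (nat j))"
  using simplices_singular[of \<sigma> E j] compactin_standard_simplex[of "nat j"]
  by (auto simp: singular_simplex_def
      intro!: image_compactin[of "subtopology (powertop_real UNIV) (standard_simplex (nat j))"])

lemma finite_near_compact:
  assumes lf: "locally_finite_chain E \<G> j \<xi>" and K: "compactin (ftop E) K"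
  shows "finite_near j \<xi> K"
proof -
  define \<U> where "\<U> = {N. openin (ftop E) N \<and> finite_near j \<xi> N}"
  have "K \<subseteq> \<Union>\<U>"
    using lf compactin_subset_topspace[OF K] unfolding locally_finite_chain_def \<U>_def by blast
  moreover have "\<forall>U\<in>\<U>. openin (ftop E) U" by (auto simp: \<U>_def)
  ultimately obtain \<F> where F: "finite \<F>" "\<F> \<subseteq> \<U>" "K \<subseteq> \<Union>\<F>"
    using K unfolding compactin_def by meson
  have "{\<sigma> \<in> spx j \<xi>. \<sigma> ` standard_simplex (nat j) \<inter> K \<noteq> {}}
      \<subseteq> (\<Union>N\<in>\<F>. {\<sigma> \<in> spx j \<xi>. \<sigma> ` standard_simplex (nat j) \<inter> N \<noteq> {}})"
    using F(3) by blast
  moreover have "finite (\<Union>N\<in>\<F>. {\<sigma> \<in> spx j \<xi>. \<sigma> ` standard_simplex (nat j) \<inter> N \<noteq> {}})"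
    using F(1,2) by (auto simp: \<U>_def)
  ultimately show ?thesis by (rule finite_subset)
qed

text \<open>A compact set meets only finitely many simplices of a locally finite chain. Conversely, finitely
  many simplices have a compact union, and a chain that is finite over small open sets of the base is
  locally finite.\<close>

lemma carrier_IC_fc: "\<xi> \<in> carrier (IC_fc E Y p pv \<G> j) \<longleftrightarrow> fc j \<xi>"
proof
  assume "\<xi> \<in> carrier (IC_fc E Y p pv \<G> j)"
  then have \<xi>: "\<xi> \<in> carrier (C j)" and lf: "locally_finite_chain E \<G> j \<xi>" and al: "allowable_chain E pv \<G> j \<xi>"
    and K: "\<And>y. y \<in> topspace T \<Longrightarrow> \<exists>N K. openin T N \<and> y \<in> N \<and> compactin (ftop E) K \<and>
          supp j \<xi> \<inter> p -` N = K \<inter> p -` N"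
    by (auto simp: IC_fc_def IC_inf_def)
  have "finite {\<sigma> \<in> spx j \<xi>. x \<in> \<sigma> ` standard_simplex (nat j)}" for x
  proof (cases "x \<in> topspace (ftop E)")
    case True
    then have "finite_near j \<xi> {x}" by (intro finite_near_compact[OF lf]) simp
    then show ?thesis by simp
  next
    case False
    then have "{\<sigma> \<in> spx j \<xi>. x \<in> \<sigma> ` standard_simplex (nat j)} = {}"
      using simplices_topspace spx_simplices by blast
    then show ?thesis by (metis finite.emptyI)
  qed
  then have "allow j \<xi>" using \<xi> al by (simp add: allow_def point_finite_def)
  moreover have "\<exists>N. openin T N \<and> y \<in> N \<and> finite_near j \<xi> (p -` N)" if "y \<in> topspace T" for y
  proof -
    obtain N K where N: "openin T N" "y \<in> N" "compactin (ftop E) K" "supp j \<xi> \<inter> p -` N = K \<inter> p -` N"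
      using K[OF \<open>y \<in> topspace T\<close>] by blast
    have "finite_near j \<xi> (p -` N)"
    proof (rule finite_subset[OF _ finite_near_compact[OF lf N(3)]], rule subsetI)
      fix \<sigma> assume "\<sigma> \<in> {\<sigma> \<in> spx j \<xi>. \<sigma> ` standard_simplex (nat j) \<inter> p -` N \<noteq> {}}"
      then have \<sigma>: "\<sigma> \<in> spx j \<xi>" and "\<sigma> ` standard_simplex (nat j) \<inter> p -` N \<noteq> {}" by auto
      then obtain x where x: "x \<in> \<sigma> ` standard_simplex (nat j)" "x \<in> p -` N" by blast
      then have "x \<in> K" using N(4) \<sigma> by (auto simp: chain_support_def)
      then show "\<sigma> \<in> {\<sigma> \<in> spx j \<xi>. \<sigma> ` standard_simplex (nat j) \<inter> K \<noteq> {}}" using \<sigma> x(1) by blast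
    qed
    then show ?thesis using N by blast
  qed
  ultimately show "fc j \<xi>" by (simp add: fc_def)
next
  assume "fc j \<xi>"
  then have al: "allow j \<xi>" and N: "\<And>y. y \<in> topspace T \<Longrightarrow> \<exists>N. openin T N \<and> y \<in> N \<and> finite_near j \<xi> (p -` N)"
    by (auto simp: fc_def)
  have "locally_finite_chain E \<G> j \<xi>"
    unfolding locally_finite_chain_def
  proof
    fix x assume x: "x \<in> topspace (ftop E)"
    then have "p x \<in> topspace T" using p by (auto simp: continuous_map_def)
    then obtain N where N: "openin T N" "p x \<in> N" "finite_near j \<xi> (p -` N)" using N by blast
    let ?N = "{x \<in> topspace (ftop E). p x \<in> N}"
    have "openin (ftop E) ?N" by (rule openin_continuous_map_preimage[OF p N(1)])
    moreover have "finite_near j \<xi> ?N" by (rule finite_subset[OF _ N(3)]) blast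
    ultimately show "\<exists>N. openin (ftop E) N \<and> x \<in> N \<and> finite_near j \<xi> N" using x N(2) by blast
  qed
  moreover have "\<exists>N K. openin T N \<and> y \<in> N \<and> compactin (ftop E) K \<and> supp j \<xi> \<inter> p -` N = K \<inter> p -` N"
    if y: "y \<in> topspace T" for y
  proof -
    obtain N where N: "openin T N" "y \<in> N" "finite_near j \<xi> (p -` N)" using N[OF y] by blast
    let ?S = "{\<sigma> \<in> spx j \<xi>. \<sigma> ` standard_simplex (nat j) \<inter> p -` N \<noteq> {}}"
    let ?K = "\<Union>\<sigma>\<in>?S. \<sigma> ` standard_simplex (nat j)"
    have "compactin (ftop E) ?K"
      by (rule compactin_Union) (use N(3) simplex_compact spx_simplices in auto)
    moreover have "supp j \<xi> \<inter> p -` N = ?K \<inter> p -` N" by (auto simp: chain_support_def)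
    ultimately show ?thesis using N by blast
  qed
  ultimately show "\<xi> \<in> carrier (IC_fc E Y p pv \<G> j)"
    using al by (auto simp: IC_fc_def IC_inf_def allow_def)
qed

lemma carrier_IC_c: "\<xi> \<in> carrier (IC_c E pv \<G> j) \<longleftrightarrow> cc j \<xi>"
  by (auto simp: IC_c_def cc_def allow_def point_finite_def)

lemma fcD: "fc j \<xi> \<Longrightarrow> allow j \<xi>" and ccD: "cc j \<xi> \<Longrightarrow> allow j \<xi>"
  by (simp_all add: fc_def cc_def)

lemma cc_imp_fc: "cc j \<xi> \<Longrightarrow> fc j \<xi>"
  unfolding fc_def cc_def by (auto intro!: exI[of _ "topspace T"])

lemma fc_if_finite_near:
  assumes "allow j \<xi>" "fc k \<eta>" "fc l \<zeta>"
    and "\<And>N. finite_near k \<eta> N \<Longrightarrow> finite_near l \<zeta> N \<Longrightarrow> finite_near j \<xi> N"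
  shows "fc j \<xi>"
  unfolding fc_def
proof (intro conjI ballI)
  fix y assume "y \<in> topspace T"
  then obtain N M where N: "openin T N" "y \<in> N" "finite_near k \<eta> (p -` N)"
    and M: "openin T M" "y \<in> M" "finite_near l \<zeta> (p -` M)"
    using assms(2,3) unfolding fc_def by meson
  have "finite_near k \<eta> (p -` (N \<inter> M))" by (rule finite_subset[OF _ N(3)]) blast
  moreover have "finite_near l \<zeta> (p -` (N \<inter> M))" by (rule finite_subset[OF _ M(3)]) blast
  ultimately have "finite_near j \<xi> (p -` (N \<inter> M))" by (rule assms(4))
  moreover have "openin T (N \<inter> M)" "y \<in> N \<inter> M" using N M by auto
  ultimately show "\<exists>N. openin T N \<and> y \<in> N \<and> finite_near j \<xi> (p -` N)" by blast
qed (rule assms(1))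

lemma fc_push:
  assumes "fc j \<xi>" "simplex_operator j m \<Theta>" "allow m (push j m \<Theta> \<xi>)"
  shows "fc m (push j m \<Theta> \<xi>)"
  by (rule fc_if_finite_near[OF assms(3,1,1)]) (rule finite_near_push[OF assms(2)])

lemma cc_push:
  assumes "cc j \<xi>" "simplex_operator j m \<Theta>" "allow m (push j m \<Theta> \<xi>)"
  shows "cc m (push j m \<Theta> \<xi>)"
  using assms finite_near_push[OF assms(2), of \<xi> UNIV] unfolding cc_def finite_near_UNIV by simp

lemma fc_star: "fc j \<xi> \<Longrightarrow> fc j (push j j (star_op A j) \<xi>)"
  using fc_push[OF _ simplex_operator_star] allow_star fcD by blast

lemma fc_hty: "fc j \<xi> \<Longrightarrow> fc (j + 1) (hty j \<xi>)"
  using fc_push[OF _ simplex_operator_homotopy] allow_hty fcD by blast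

lemma cc_hty: "cc j \<xi> \<Longrightarrow> cc (j + 1) (hty j \<xi>)"
  using cc_push[OF _ simplex_operator_homotopy] allow_hty ccD by blast

lemma fc_boundary: "fc j \<xi> \<Longrightarrow> fc (j - 1) (bd j \<xi>)"
  using fc_push[OF _ simplex_operator_face] allow_boundary boundary_eq_push allowD fcD by metis

lemma cc_boundary: "cc j \<xi> \<Longrightarrow> cc (j - 1) (bd j \<xi>)"
  using cc_push[OF _ simplex_operator_face] allow_boundary boundary_eq_push allowD ccD by metis

lemma cc_zero: "cc j \<zero>\<^bsub>C j\<^esub>"
  by (simp add: cc_def allow_zero spx_zero)

lemma fc_add: "fc j \<xi> \<Longrightarrow> fc j \<eta> \<Longrightarrow> fc j (\<xi> \<oplus>\<^bsub>C j\<^esub> \<eta>)"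
  by (rule fc_if_finite_near[OF allow_add[OF fcD fcD]]) (assumption | rule finite_near_mono[OF spx_add] order.refl)+

lemma cc_add: "cc j \<xi> \<Longrightarrow> cc j \<eta> \<Longrightarrow> cc j (\<xi> \<oplus>\<^bsub>C j\<^esub> \<eta>)"
  using allow_add finite_subset[OF spx_add[of j \<xi> \<eta>]] by (auto simp: cc_def)

lemma fc_smult: "fc j \<xi> \<Longrightarrow> r \<in> carrier R \<Longrightarrow> fc j (r \<odot>\<^bsub>C j\<^esub> \<xi>)"
  by (rule fc_if_finite_near[OF allow_smult[OF fcD], of j \<xi> r j \<xi> j \<xi>])
     (auto intro: finite_near_mono[of j "r \<odot>\<^bsub>C j\<^esub> \<xi>" \<xi> \<xi>] dest: subsetD[OF spx_smult])

lemma cc_smult: "cc j \<xi> \<Longrightarrow> r \<in> carrier R \<Longrightarrow> cc j (r \<odot>\<^bsub>C j\<^esub> \<xi>)"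
  using allow_smult finite_subset[OF spx_smult[of r j \<xi>]] by (auto simp: cc_def)

lemma submodule_fc: "submodule_of R (C j) {\<xi>. fc j \<xi>}"
  unfolding submodule_of_def using cc_imp_fc[OF cc_zero] fc_add fc_smult allowD(1) fcD by auto

lemma submodule_cc: "submodule_of R (C j) {\<xi>. cc j \<xi>}"
  unfolding submodule_of_def using cc_zero cc_add cc_smult allowD(1) ccD by auto

lemma fc_minus: "fc j \<xi> \<Longrightarrow> fc j \<eta> \<Longrightarrow> fc j (\<xi> \<ominus>\<^bsub>C j\<^esub> \<eta>)"
  using submodule_of_a_inv[OF left_module_chain submodule_fc] fc_add by (simp add: a_minus_def)

lemma cc_minus: "cc j \<xi> \<Longrightarrow> cc j \<eta> \<Longrightarrow> cc j (\<xi> \<ominus>\<^bsub>C j\<^esub> \<eta>)"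
  using submodule_of_a_inv[OF left_module_chain submodule_cc] cc_add by (simp add: a_minus_def)

lemma fc_finite_near_fibre:
  assumes "fc j \<xi>" "y \<in> topspace T"
  shows "finite_near j \<xi> (p -` {y})"
proof -
  obtain N where "openin T N" "y \<in> N" "finite_near j \<xi> (p -` N)"
    using assms unfolding fc_def by blast
  then show ?thesis by (auto elim!: finite_subset[rotated])
qed

abbreviation "misses j y \<xi> \<equiv> supp j \<xi> \<inter> p -` {y} = {}"

lemma misses_add: "misses j y \<xi> \<Longrightarrow> misses j y \<eta> \<Longrightarrow> misses j y (\<xi> \<oplus>\<^bsub>C j\<^esub> \<eta>)"
  using supp_mono[OF spx_add[of j \<xi> \<eta>]] by blast

lemma misses_minus:
  "\<eta> \<in> carrier (C j) \<Longrightarrow> misses j y \<xi> \<Longrightarrow> misses j y \<eta> \<Longrightarrow> misses j y (\<xi> \<ominus>\<^bsub>C j\<^esub> \<eta>)"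
  using supp_mono[OF spx_minus[of \<eta> j \<xi>]] by blast

lemma misses_push: "simplex_operator j m \<Theta> \<Longrightarrow> misses j y \<xi> \<Longrightarrow> misses m y (push j m \<Theta> \<xi>)"
  using chain_support_push[of j m \<Theta> \<xi>] by blast

lemma misses_boundary: "allow j \<xi> \<Longrightarrow> misses j y \<xi> \<Longrightarrow> misses (j - 1) y (bd j \<xi>)"
  using misses_push[OF simplex_operator_face] boundary_eq_push allowD by metis

text \<open>Subdivide the cycle, and let \<open>\<zeta>\<close> be the part of \<open>truncation\<close> that is finite. The error \<open>\<alpha>\<close> consists of
  the other part, which misses the fibre, and of the homotopy applied to the boundary, which misses the
  fibre because \<open>\<xi>\<close> is a relative cycle.\<close>

lemma relative_cycle_truncation:
  assumes y: "y \<in> topspace T" and \<xi>: "fc j \<xi>" and cyc: "misses (j - 1) y (bd j \<xi>)"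
  obtains \<zeta> \<eta> \<alpha> where "cc j \<zeta>" "fc (j + 1) \<eta>" "fc j \<alpha>" "misses j y \<alpha>"
    "bd (j + 1) \<eta> \<oplus>\<^bsub>C j\<^esub> \<xi> = \<zeta> \<oplus>\<^bsub>C j\<^esub> \<alpha>"
proof -
  interpret c: abelian_group "C j" by (rule left_module_abelian_group[OF left_module_chain])
  note x = allowD[OF fcD[OF \<xi>]]
  obtain A where A: "finite (spx j (push j j (star_op A j) \<xi>))" "misses j y (push j j (star_op (- A) j) \<xi>)"
    using truncation[OF x fc_finite_near_fibre[OF \<xi> y]] by metis
  let ?\<zeta> = "push j j (star_op A j) \<xi>" and ?\<beta> = "push j j (star_op (- A) j) \<xi>"
  let ?H = "push (j - 1) j (homotopy_op (j - 1)) (bd j \<xi>)"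
  have \<zeta>: "cc j ?\<zeta>" using A(1) allow_star[OF fcD[OF \<xi>]] by (simp add: cc_def)
  have \<beta>: "fc j ?\<beta>" by (rule fc_star[OF \<xi>])
  have H: "fc j ?H" using fc_hty[OF fc_boundary[OF \<xi>]] by simp
  have Hm: "misses j y ?H" by (rule misses_push[OF hty_operator cyc])
  note cl = allowD(1)[OF ccD[OF \<zeta>]] allowD(1)[OF fcD[OF \<beta>]] allowD(1)[OF fcD[OF H]]
  have b: "bd (j + 1) (hty j \<xi>) = ?\<zeta> \<oplus>\<^bsub>C j\<^esub> ?\<beta> \<ominus>\<^bsub>C j\<^esub> \<xi> \<ominus>\<^bsub>C j\<^esub> ?H"
    using boundary_hty[OF x] subdivide_split[OF x, of A] by simp
  have "bd (j + 1) (hty j \<xi>) \<oplus>\<^bsub>C j\<^esub> \<xi> = ?\<zeta> \<oplus>\<^bsub>C j\<^esub> (?\<beta> \<ominus>\<^bsub>C j\<^esub> ?H)"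
  proof -
    have "bd (j + 1) (hty j \<xi>) \<oplus>\<^bsub>C j\<^esub> \<xi>
        = (?\<zeta> \<oplus>\<^bsub>C j\<^esub> ?\<beta> \<oplus>\<^bsub>C j\<^esub> \<ominus>\<^bsub>C j\<^esub> ?H) \<oplus>\<^bsub>C j\<^esub> (\<ominus>\<^bsub>C j\<^esub> \<xi> \<oplus>\<^bsub>C j\<^esub> \<xi>)"
      unfolding b using cl x(1) by (simp add: a_minus_def c.a_ac)
    then show ?thesis using cl x(1) by (simp add: c.l_neg a_minus_def c.a_assoc)
  qed
  then show ?thesis
    by (rule that[OF \<zeta> fc_hty[OF \<xi>] fc_minus[OF \<beta> H] misses_minus[OF cl(3) A(2) Hm]])
qed

text \<open>Truncation of the bounding chain \<open>\<eta>\<close> yields a finite chain that bounds the subdivision of \<open>\<zeta>\<close>, up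
  to chains that miss the fibre. The homotopy leads back from the subdivision to \<open>\<zeta>\<close>, and it
  preserves finiteness since \<open>\<zeta>\<close> is finite.\<close>

lemma relative_boundary_truncation:
  assumes y: "y \<in> topspace T" and \<zeta>: "cc j \<zeta>" and cyc: "misses (j - 1) y (bd j \<zeta>)"
    and \<eta>: "fc (j + 1) \<eta>" and \<alpha>: "fc j \<alpha>" "misses j y \<alpha>" and eq: "\<zeta> = bd (j + 1) \<eta> \<oplus>\<^bsub>C j\<^esub> \<alpha>"
  obtains \<eta>' \<alpha>' where "cc (j + 1) \<eta>'" "cc j \<alpha>'" "misses j y \<alpha>'" "\<zeta> = bd (j + 1) \<eta>' \<oplus>\<^bsub>C j\<^esub> \<alpha>'"
proof -
  interpret c: abelian_group "C j" by (rule left_module_abelian_group[OF left_module_chain])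
  interpret c1: abelian_group "C (j + 1)" by (rule left_module_abelian_group[OF left_module_chain])
  note x = allowD[OF fcD[OF \<eta>]] and z = allowD[OF ccD[OF \<zeta>]] and a = allowD[OF fcD[OF \<alpha>(1)]]
  have bdx: "fc j (bd (j + 1) \<eta>)" using fc_boundary[OF \<eta>] by simp
  obtain A where A: "finite (spx (j + 1) (push (j + 1) (j + 1) (star_op A (j + 1)) \<eta>))"
    "misses (j + 1) y (push (j + 1) (j + 1) (star_op (- A) (j + 1)) \<eta>)"
    using truncation[OF x fc_finite_near_fibre[OF \<eta> y]] by metis
  let ?s = "push (j + 1) (j + 1) (star_op A (j + 1)) \<eta>" and ?t = "push (j + 1) (j + 1) (star_op (- A) (j + 1)) \<eta>"
  let ?H = "push (j - 1) j (homotopy_op (j - 1)) (bd j \<zeta>)"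
  have s: "cc (j + 1) ?s" using A(1) allow_star[OF fcD[OF \<eta>]] by (simp add: cc_def)
  have t: "fc (j + 1) ?t" by (rule fc_star[OF \<eta>])
  note sx = allowD[OF ccD[OF s]] and tx = allowD[OF fcD[OF t]]
  have bt: "fc j (bd (j + 1) ?t)" "misses j y (bd (j + 1) ?t)"
    using fc_boundary[OF t] misses_boundary[OF fcD[OF t] A(2)] by simp_all
  have bs: "fc j (bd (j + 1) ?s)" using fc_boundary[OF cc_imp_fc[OF s]] by simp
  have H: "fc j ?H" using fc_hty[OF fc_boundary[OF cc_imp_fc[OF \<zeta>]]] by simp
  have Hm: "misses j y ?H" by (rule misses_push[OF hty_operator cyc])
  have S\<alpha>: "fc j (subdivide j \<alpha>)" by (rule fc_star[OF \<alpha>(1)])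
  have S\<alpha>m: "misses j y (subdivide j \<alpha>)" by (rule misses_push[OF simplex_operator_star \<alpha>(2)])
  note h = allowD[OF ccD[OF cc_hty[OF \<zeta>]]]
  have bh: "fc j (bd (j + 1) (hty j \<zeta>))" using fc_boundary[OF fc_hty[OF cc_imp_fc[OF \<zeta>]]] by simp
  note cl = allowD(1)[OF fcD[OF bs]] allowD(1)[OF fcD[OF bt(1)]] allowD(1)[OF fcD[OF H]]
    allowD(1)[OF fcD[OF S\<alpha>]] allowD(1)[OF fcD[OF bh]]
  define \<eta>' where "\<eta>' = ?s \<ominus>\<^bsub>C (j + 1)\<^esub> hty j \<zeta>"
  have \<eta>': "cc (j + 1) \<eta>'" unfolding \<eta>'_def by (rule cc_minus[OF s cc_hty[OF \<zeta>]])
  note ex = allowD[OF ccD[OF \<eta>']]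
  have be: "cc j (bd (j + 1) \<eta>')" using cc_boundary[OF \<eta>'] by simp
  (* With this definition the error is finite; that it misses the fibre is seen from the equation
     below, where infinite chains occur. *)
  define \<alpha>' where "\<alpha>' = \<zeta> \<ominus>\<^bsub>C j\<^esub> bd (j + 1) \<eta>'"
  have \<alpha>': "cc j \<alpha>'" unfolding \<alpha>'_def by (rule cc_minus[OF \<zeta> be])
  have bcl: "bd (j + 1) \<eta>' \<in> carrier (C j)" by (rule allowD(1)[OF ccD[OF be]])
  have split: "bd (j + 1) \<eta>' \<oplus>\<^bsub>C j\<^esub> bd (j + 1) (hty j \<zeta>) = bd (j + 1) ?s"
  proof -
    have "\<eta>' \<oplus>\<^bsub>C (j + 1)\<^esub> hty j \<zeta> = ?s" unfolding \<eta>'_def by (rule c1.minus_add_cancel'[OF sx(1) h(1)])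
    then show ?thesis using boundary_add[OF ex h] by simp
  qed
  have sub: "subdivide j \<zeta> = bd (j + 1) ?s \<oplus>\<^bsub>C j\<^esub> bd (j + 1) ?t \<oplus>\<^bsub>C j\<^esub> subdivide j \<alpha>"
  proof -
    have "subdivide j \<zeta> = subdivide j (bd (j + 1) \<eta>) \<oplus>\<^bsub>C j\<^esub> subdivide j \<alpha>"
      unfolding eq by (rule push_add[OF allowD[OF fcD[OF bdx]] a simplex_operator_star])
    also have "subdivide j (bd (j + 1) \<eta>) = bd (j + 1) (subdivide (j + 1) \<eta>)"
      using boundary_subdivide[OF x] by simp
    also have "\<dots> = bd (j + 1) ?s \<oplus>\<^bsub>C j\<^esub> bd (j + 1) ?t"
      using boundary_add[OF sx tx] subdivide_split[OF x, of A] by simp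
    finally show ?thesis .
  qed
  have hom: "bd (j + 1) (hty j \<zeta>) \<oplus>\<^bsub>C j\<^esub> ?H \<oplus>\<^bsub>C j\<^esub> \<zeta> = subdivide j \<zeta>" by (rule boundary_homotopy[OF z])
  have "\<alpha>' \<oplus>\<^bsub>C j\<^esub> ?H = bd (j + 1) ?t \<oplus>\<^bsub>C j\<^esub> subdivide j \<alpha>"
  proof -
    have "\<zeta> = bd (j + 1) \<eta>' \<oplus>\<^bsub>C j\<^esub> \<alpha>'"
      unfolding \<alpha>'_def using c.minus_add_cancel'[OF z(1) bcl] z(1) bcl by (simp add: c.a_comm)
    then have "bd (j + 1) (hty j \<zeta>) \<oplus>\<^bsub>C j\<^esub> ?H \<oplus>\<^bsub>C j\<^esub> (bd (j + 1) \<eta>' \<oplus>\<^bsub>C j\<^esub> \<alpha>') = subdivide j \<zeta>"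
      using hom by simp
    then have "(bd (j + 1) \<eta>' \<oplus>\<^bsub>C j\<^esub> bd (j + 1) (hty j \<zeta>)) \<oplus>\<^bsub>C j\<^esub> (\<alpha>' \<oplus>\<^bsub>C j\<^esub> ?H) = subdivide j \<zeta>"
      using cl bcl allowD(1)[OF ccD[OF \<alpha>']] by (simp add: c.a_ac)
    then have "bd (j + 1) ?s \<oplus>\<^bsub>C j\<^esub> (\<alpha>' \<oplus>\<^bsub>C j\<^esub> ?H) = bd (j + 1) ?s \<oplus>\<^bsub>C j\<^esub> (bd (j + 1) ?t \<oplus>\<^bsub>C j\<^esub> subdivide j \<alpha>)"
      unfolding split sub using cl by (simp add: c.a_assoc)
    then show ?thesis using cl allowD(1)[OF ccD[OF \<alpha>']] 
      by (subst (asm) (1 2) c.a_comm) simp_all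
  qed
  then have "\<alpha>' = (bd (j + 1) ?t \<oplus>\<^bsub>C j\<^esub> subdivide j \<alpha>) \<ominus>\<^bsub>C j\<^esub> ?H"
    by (rule c.eq_minusI[OF allowD(1)[OF ccD[OF \<alpha>']] cl(3)])
  then have "misses j y \<alpha>'"
    using misses_minus[OF cl(3) misses_add[OF bt(2) S\<alpha>m] Hm] by simp
  moreover have "\<zeta> = bd (j + 1) \<eta>' \<oplus>\<^bsub>C j\<^esub> \<alpha>'"
    unfolding \<alpha>'_def using c.minus_add_cancel'[OF z(1) bcl] z(1) bcl by (simp add: c.a_comm)
  ultimately show ?thesis by (rule that[OF \<eta>' \<alpha>'])
qed

text \<open>This determines which chains vanish in the stalk at \<open>y\<close>. Over a neighbourhood of \<open>y\<close>, the support
  consists of finitely many simplices. If it misses the fibre, the image of these simplices in the base is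
  a closed set that does not contain \<open>y\<close>.\<close>

lemma away_iff:
  assumes y: "y \<in> topspace T" and \<xi>: "fc j \<xi>" and U: "openin T U" "y \<in> U"
  shows "(\<exists>W. openin T W \<and> y \<in> W \<and> W \<subseteq> U \<and> \<xi> \<in> IC_fc_away E Y p pv \<G> j W) \<longleftrightarrow> misses j y \<xi>"
proof
  assume "\<exists>W. openin T W \<and> y \<in> W \<and> W \<subseteq> U \<and> \<xi> \<in> IC_fc_away E Y p pv \<G> j W"
  then obtain W where W: "y \<in> W" "supp j \<xi> \<subseteq> topspace (ftop E) - ftop E closure_of (topspace (ftop E) \<inter> p -` W)"
    by (auto simp: IC_fc_away_def)
  have "topspace (ftop E) \<inter> p -` W \<subseteq> ftop E closure_of (topspace (ftop E) \<inter> p -` W)"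
    by (rule closure_of_subset) auto
  then show "misses j y \<xi>" using W by auto
next
  assume m: "misses j y \<xi>"
  obtain N where N: "openin T N" "y \<in> N" "finite_near j \<xi> (p -` N)"
    using \<xi> y unfolding fc_def by blast
  let ?S = "{\<sigma> \<in> spx j \<xi>. \<sigma> ` standard_simplex (nat j) \<inter> p -` N \<noteq> {}}"
  let ?K = "\<Union>\<sigma>\<in>?S. \<sigma> ` standard_simplex (nat j)"
  have "compactin (ftop E) ?K"
    by (rule compactin_Union) (use N(3) simplex_compact spx_simplices in auto)
  then have "compactin T (p ` ?K)" using p by (rule image_compactin)
  then have "closedin T (p ` ?K)" by (rule compactin_imp_closedin[OF Hausdorff])
  then have "openin T (U \<inter> N - p ` ?K)" using U(1) N(1) by auto
  moreover have "y \<notin> p ` ?K" using m by (auto simp: chain_support_def)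
  then have "y \<in> U \<inter> N - p ` ?K" using U N by auto
  (* The support has to avoid the closure of the preimage of W, hence the closed neighbourhood D. *)
  ultimately have "\<exists>W D. openin T W \<and> closedin T D \<and> y \<in> W \<and> W \<subseteq> D \<and> D \<subseteq> U \<inter> N - p ` ?K"
    using regular[folded neighbourhood_base_of_closedin, unfolded neighbourhood_base_of] by (simp only: simp_thms)
  then obtain W D where W: "openin T W" "closedin T D" "y \<in> W" "W \<subseteq> D" "D \<subseteq> U \<inter> N - p ` ?K" by blast
  have "closedin (ftop E) {x \<in> topspace (ftop E). p x \<in> D}"
    by (rule closedin_continuous_map_preimage[OF p W(2)])
  then have "ftop E closure_of (topspace (ftop E) \<inter> p -` W) \<subseteq> {x \<in> topspace (ftop E). p x \<in> D}"
    by (rule closure_of_minimal[rotated]) (use W(4) in auto)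
  moreover have "p x \<notin> D" if "x \<in> supp j \<xi>" for x
  proof
    assume d: "p x \<in> D"
    then have "p x \<in> N" using W(5) by auto
    obtain \<sigma> where "\<sigma> \<in> spx j \<xi>" "x \<in> \<sigma> ` standard_simplex (nat j)"
      using \<open>x \<in> supp j \<xi>\<close> by (auto simp: chain_support_def)
    then have "x \<in> ?K" using \<open>p x \<in> N\<close> by blast
    then have "p x \<in> p ` ?K" by (rule imageI[where f = p])
    moreover have "p x \<notin> p ` ?K" using subsetD[OF W(5) d] by (simp only: Diff_iff simp_thms)
    ultimately show False by contradiction
  qed
  ultimately have "supp j \<xi> \<subseteq> topspace (ftop E) - ftop E closure_of (topspace (ftop E) \<inter> p -` W)"
    using supp_topspace[of j \<xi>] by blast
  then have "\<xi> \<in> IC_fc_away E Y p pv \<G> j W" using \<xi> by (simp add: IC_fc_away_def carrier_IC_fc)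
  then show "\<exists>W. openin T W \<and> y \<in> W \<and> W \<subseteq> U \<and> \<xi> \<in> IC_fc_away E Y p pv \<G> j W"
    using W by blast
qed

end

section \<open>The stalk of the derived sheaf\<close>

lemma submodule_of_submodule:
  "submodule_of R M N \<Longrightarrow> N \<subseteq> S \<Longrightarrow> submodule_of R (M\<lparr>carrier := S\<rparr>) N"
  unfolding submodule_of_def by simp

context fibrewise_chains
begin

abbreviation "fc_chains j \<equiv> (C j)\<lparr>carrier := {\<xi>. fc j \<xi>}\<rparr>"
abbreviation "cc_chains j \<equiv> (C j)\<lparr>carrier := {\<xi>. cc j \<xi>}\<rparr>"
abbreviation "away j U \<equiv> IC_fc_away E Y p pv \<G> j U"
abbreviation "fc_pre j \<equiv> fc_presheaf E Y p pv \<G> j"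
abbreviation "fc_bd j \<equiv> fc_presheaf_boundary E Y p pv \<G> j"
abbreviation "sect j U \<xi> \<equiv> away j U +>\<^bsub>C j\<^esub> \<xi>"

lemma IC_fc_eq: "IC_fc E Y p pv \<G> j = fc_chains j"
proof -
  have "carrier (IC_fc E Y p pv \<G> j) = {\<xi>. fc j \<xi>}" using carrier_IC_fc by blast
  then show ?thesis by (simp add: IC_fc_def)
qed

lemma IC_c_eq: "IC_c E pv \<G> j = cc_chains j"
proof -
  have "carrier (IC_c E pv \<G> j) = {\<xi>. cc j \<xi>}" using carrier_IC_c by blast
  then show ?thesis by (simp add: IC_c_def)
qed

lemma left_module_fc: "left_module R (fc_chains j)"
  by (rule left_module_submodule[OF left_module_chain submodule_fc])

lemma left_module_cc: "left_module R (cc_chains j)"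
  by (rule left_module_submodule[OF left_module_chain submodule_cc])

lemma boundary_linear_fc: "linear_map R (fc_chains j) (fc_chains (j - 1)) (bd j)"
  unfolding linear_map_def
  using fc_boundary boundary_add boundary_smult allowD fcD by simp

lemma boundary_linear_cc: "linear_map R (cc_chains j) (cc_chains (j - 1)) (bd j)"
  unfolding linear_map_def
  using cc_boundary boundary_add boundary_smult allowD ccD by simp

lemma supp_zero: "supp j \<zero>\<^bsub>C j\<^esub> = {}"
  by (simp add: chain_support_def spx_zero)

lemma supp_boundary: "allow j \<xi> \<Longrightarrow> supp (j - 1) (bd j \<xi>) \<subseteq> supp j \<xi>"
  using chain_support_push[OF simplex_operator_face] boundary_eq_push allowD by metis

text \<open>Used for the chains in \<open>E\<close> minus the closure of the preimage of \<open>U\<close> and for those in the complement of the fibre.\<close>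

lemma submodule_supported:
  assumes S: "submodule_of R (C j) S"
  shows "submodule_of R (C j) {\<xi> \<in> S. supp j \<xi> \<subseteq> D}"
proof -
  have "supp j (\<xi> \<oplus>\<^bsub>C j\<^esub> \<eta>) \<subseteq> D" if "supp j \<xi> \<subseteq> D" "supp j \<eta> \<subseteq> D" for \<xi> \<eta>
    using supp_mono[OF spx_add[of j \<xi> \<eta>]] that by blast
  moreover have "supp j (r \<odot>\<^bsub>C j\<^esub> \<xi>) \<subseteq> D" if "supp j \<xi> \<subseteq> D" "r \<in> carrier R" for r \<xi>
    using supp_mono[of j "r \<odot>\<^bsub>C j\<^esub> \<xi>" \<xi> \<xi>] spx_smult[OF that(2)] that(1) by blast
  ultimately show ?thesis
    using S unfolding submodule_of_def by (auto simp: supp_zero)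
qed

lemma away_eq:
  "away j U = {\<xi> \<in> {\<xi>. fc j \<xi>}. supp j \<xi> \<subseteq> topspace (ftop E) - ftop E closure_of (topspace (ftop E) \<inter> p -` U)}"
  by (simp add: IC_fc_away_def IC_fc_eq)

lemma submodule_away: "submodule_of R (C j) (away j U)"
  unfolding away_eq by (rule submodule_supported[OF submodule_fc])

lemma submodule_away_fc: "submodule_of R (fc_chains j) (away j U)"
  by (rule submodule_of_submodule[OF submodule_away]) (auto simp: away_eq)

lemma away_mono: "V \<subseteq> U \<Longrightarrow> away j U \<subseteq> away j V"
  using closure_of_mono[of "topspace (ftop E) \<inter> p -` V" "topspace (ftop E) \<inter> p -` U" "ftop E"]
  unfolding away_eq by auto

lemma boundary_away: "bd j ` away j U \<subseteq> away (j - 1) U"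
proof (rule image_subsetI)
  fix \<xi> assume "\<xi> \<in> away j U"
  then have "fc j \<xi>" "supp j \<xi> \<subseteq> topspace (ftop E) - ftop E closure_of (topspace (ftop E) \<inter> p -` U)"
    by (simp_all add: away_eq)
  then show "bd j \<xi> \<in> away (j - 1) U"
    using supp_boundary[OF fcD, of j \<xi>] fc_boundary by (simp add: away_eq)
qed

lemma sections_fc: "sections (fc_pre j) U = quot_module (fc_chains j) (away j U)"
  by (simp add: fc_presheaf_def IC_fc_eq)

lemma carrier_sections_fc: "carrier (sections (fc_pre j) U) = sect j U ` {\<xi>. fc j \<xi>}"
  by (simp add: sections_fc carrier_quot_module coset_carrier_update)

lemma zero_sections_fc: "\<zero>\<^bsub>sections (fc_pre j) U\<^esub> = sect j U \<zero>\<^bsub>C j\<^esub>"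
  using zero_quot_module[OF left_module_fc submodule_away_fc] by (simp add: sections_fc coset_carrier_update)

lemma left_module_sections_fc: "left_module R (sections (fc_pre j) U)"
  unfolding sections_fc by (rule left_module_quot_module[OF left_module_fc submodule_away_fc])

lemma sect_linear: "linear_map R (fc_chains j) (sections (fc_pre j) U) (sect j U)"
  using linear_map_coset[OF left_module_fc submodule_away_fc] by (simp add: sections_fc coset_carrier_update)

lemma id_linear_fc: "linear_map R (fc_chains j) (fc_chains j) id"
  by (simp add: linear_map_def)

lemma restr_linear_fc:
  assumes "V \<subseteq> U"
  shows "linear_map R (sections (fc_pre j) U) (sections (fc_pre j) V) (restr (fc_pre j) U V)"
  using linear_map_coset_map[OF left_module_fc submodule_away_fc left_module_fc submodule_away_fc id_linear_fc]
    away_mono[OF assms] by (simp add: sections_fc fc_presheaf_def IC_fc_eq)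

lemma restr_sect: "V \<subseteq> U \<Longrightarrow> fc j \<xi> \<Longrightarrow> restr (fc_pre j) U V (sect j U \<xi>) = sect j V \<xi>"
  using coset_map_coset[OF left_module_fc submodule_away_fc left_module_fc submodule_away_fc id_linear_fc]
    away_mono[of V U j] by (simp add: fc_presheaf_def IC_fc_eq coset_carrier_update)

lemma fc_bd_linear: "linear_map R (sections (fc_pre j) U) (sections (fc_pre (j - 1)) U) (fc_bd j U)"
  using linear_map_coset_map[OF left_module_fc submodule_away_fc left_module_fc submodule_away_fc
      boundary_linear_fc boundary_away] by (simp add: sections_fc fc_presheaf_boundary_def IC_fc_eq)

lemma fc_bd_sect: "fc j \<xi> \<Longrightarrow> fc_bd j U (sect j U \<xi>) = sect (j - 1) U (bd j \<xi>)"
  using coset_map_coset[OF left_module_fc submodule_away_fc left_module_fc submodule_away_fc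
      boundary_linear_fc boundary_away]
  by (simp add: fc_presheaf_boundary_def IC_fc_eq coset_carrier_update)

lemma module_presheaf_fc: "module_presheaf R T (fc_pre j)"
proof (rule module_presheaf.intro)
  show "ring R" by (rule base_ring)
  fix U V W s
  show "left_module R (sections (fc_pre j) U)" by (rule left_module_sections_fc)
  show "linear_map R (sections (fc_pre j) U) (sections (fc_pre j) V) (restr (fc_pre j) U V)" if "V \<subseteq> U"
    by (rule restr_linear_fc[OF that])
  assume "s \<in> carrier (sections (fc_pre j) U)"
  then obtain \<xi> where \<xi>: "fc j \<xi>" "s = sect j U \<xi>" unfolding carrier_sections_fc by blast
  show "restr (fc_pre j) U U s = s" using restr_sect[of U U] \<xi> by simp
  show "restr (fc_pre j) V W (restr (fc_pre j) U V s) = restr (fc_pre j) U W s" if "W \<subseteq> V" "V \<subseteq> U"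
    using \<xi> restr_sect[OF that(2)] restr_sect[OF that(1)] restr_sect[OF order.trans[OF that]] by simp
qed

lemma presheaf_map_fc: "presheaf_map R T (fc_pre j) (fc_pre (j - 1)) (fc_bd j)"
proof (intro presheaf_map.intro presheaf_map_axioms.intro module_presheaf_fc fc_bd_linear)
  fix U V s assume V: "V \<subseteq> U" and "s \<in> carrier (sections (fc_pre j) U)"
  then obtain \<xi> where \<xi>: "fc j \<xi>" "s = sect j U \<xi>" unfolding carrier_sections_fc by blast
  then show "fc_bd j V (restr (fc_pre j) U V s) = restr (fc_pre (j - 1)) U V (fc_bd j U s)"
    by (simp add: restr_sect[OF V] fc_bd_sect fc_boundary)
qed

lemma three_term_presheaves_fc:
  "three_term_presheaves R T (fc_pre (j + 1)) (fc_bd (j + 1)) (fc_pre j) (fc_bd j) (fc_pre (j - 1))"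
proof (intro three_term_presheaves.intro three_term_presheaves_axioms.intro presheaf_map_fc)
  show "presheaf_map R T (fc_pre (j + 1)) (fc_pre j) (fc_bd (j + 1))"
    using presheaf_map_fc[of "j + 1"] by simp
  fix U s assume "s \<in> carrier (sections (fc_pre (j + 1)) U)"
  then obtain \<xi> where \<xi>: "fc (j + 1) \<xi>" "s = sect (j + 1) U \<xi>" unfolding carrier_sections_fc by blast
  have "fc j (bd (j + 1) \<xi>)" using fc_boundary[OF \<xi>(1)] by simp
  then have "fc_bd j U (fc_bd (j + 1) U s) = sect (j - 1) U (bd j (bd (j + 1) \<xi>))"
    using fc_bd_sect[OF \<xi>(1), of U] fc_bd_sect[of j "bd (j + 1) \<xi>" U] \<xi>(2) by simp
  also have "bd j (bd (j + 1) \<xi>) = \<zero>\<^bsub>C (j - 1)\<^esub>"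
    using boundary_boundary[OF allowD[OF fcD[OF \<xi>(1)]]] by simp
  finally show "fc_bd j U (fc_bd (j + 1) U s) = \<zero>\<^bsub>sections (fc_pre (j - 1)) U\<^esub>"
    by (simp add: zero_sections_fc)
qed

text \<open>Sections over \<open>U\<close> are classes of chains on all of \<open>E\<close>, hence every germ at \<open>y\<close> is the germ of a
  global chain. So the stalk is a quotient of the module of chains.\<close>

definition chain_germ :: "int \<Rightarrow> 'b \<Rightarrow> ('a, 'g) schain \<Rightarrow> ('b set \<times> ('a, 'g) schain set) set" where
  "chain_germ j y \<xi> = germ T (fc_pre j) y (topspace T) (sect j (topspace T) \<xi>)"

lemma germ_sect:
  assumes U: "openin T U" "y \<in> U" and \<xi>: "fc j \<xi>"
  shows "germ T (fc_pre j) y U (sect j U \<xi>) = chain_germ j y \<xi>"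
proof -
  interpret module_presheaf R T "fc_pre j" by (rule module_presheaf_fc)
  have sub: "U \<subseteq> topspace T" using U openin_subset by blast
  show ?thesis
    unfolding chain_germ_def
    by (rule germ_eqI[OF U(1) _ openin_topspace _ U subset_refl sub])
       (use \<xi> in \<open>auto simp: carrier_sections_fc restr_sect sub\<close>)
qed

lemma chain_germ_linear:
  assumes y: "y \<in> topspace T"
  shows "linear_map R (fc_chains j) (stalk T (fc_pre j) y) (chain_germ j y)"
proof -
  interpret module_presheaf R T "fc_pre j" by (rule module_presheaf_fc)
  have s: "sect j (topspace T) \<xi> \<in> carrier (sections (fc_pre j) (topspace T))" if "fc j \<xi>" for \<xi>
    using that by (simp add: carrier_sections_fc)
  note q = linear_mapD(2,3)[OF sect_linear[of j "topspace T"]]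
  show ?thesis
    unfolding linear_map_def chain_germ_def
    using s y q
    by (simp add: germ_in_stalk stalk_add[OF openin_topspace] stalk_smult[OF _ openin_topspace])
qed

lemma chain_germ_onto:
  assumes y: "y \<in> topspace T"
  shows "carrier (stalk T (fc_pre j) y) = chain_germ j y ` {\<xi>. fc j \<xi>}"
proof
  interpret module_presheaf R T "fc_pre j" by (rule module_presheaf_fc)
  show "chain_germ j y ` {\<xi>. fc j \<xi>} \<subseteq> carrier (stalk T (fc_pre j) y)"
    using linear_map_closed[OF chain_germ_linear[OF y]] by auto
  show "carrier (stalk T (fc_pre j) y) \<subseteq> chain_germ j y ` {\<xi>. fc j \<xi>}"
  proof
    fix c assume "c \<in> carrier (stalk T (fc_pre j) y)"
    then obtain U s where U: "openin T U" "y \<in> U" "s \<in> carrier (sections (fc_pre j) U)" "c = germ T (fc_pre j) y U s"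
      by (rule stalk_carrierE)
    then obtain \<xi> where "fc j \<xi>" "s = sect j U \<xi>" unfolding carrier_sections_fc by blast
    then show "c \<in> chain_germ j y ` {\<xi>. fc j \<xi>}" using germ_sect[OF U(1,2)] U(4) by simp
  qed
qed

lemma chain_germ_eq_iff:
  assumes y: "y \<in> topspace T" and \<xi>: "fc j \<xi>" and \<eta>: "fc j \<eta>"
  shows "chain_germ j y \<xi> = chain_germ j y \<eta> \<longleftrightarrow> misses j y (\<xi> \<ominus>\<^bsub>C j\<^esub> \<eta>)"
proof -
  interpret module_presheaf R T "fc_pre j" by (rule module_presheaf_fc)
  let ?T = "topspace T"
  have s: "sect j ?T \<xi> \<in> carrier (sections (fc_pre j) ?T)" "sect j ?T \<eta> \<in> carrier (sections (fc_pre j) ?T)"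
    using \<xi> \<eta> by (simp_all add: carrier_sections_fc)
  have "chain_germ j y \<xi> = chain_germ j y \<eta> \<longleftrightarrow> (\<exists>W. openin T W \<and> y \<in> W \<and> W \<subseteq> ?T \<and>
      restr (fc_pre j) ?T W (sect j ?T \<xi>) = restr (fc_pre j) ?T W (sect j ?T \<eta>))"
    using germ_eq_iff[OF openin_topspace y s(1) openin_topspace y s(2)] by (simp add: chain_germ_def)
  also have "\<dots> \<longleftrightarrow> (\<exists>W. openin T W \<and> y \<in> W \<and> W \<subseteq> ?T \<and> \<xi> \<ominus>\<^bsub>C j\<^esub> \<eta> \<in> away j W)"
    using coset_eq_iff[OF left_module_chain submodule_away allowD(1)[OF fcD[OF \<xi>]] allowD(1)[OF fcD[OF \<eta>]]]
    by (intro arg_cong[where f = Ex] ext conj_cong refl) (simp add: restr_sect \<xi> \<eta>)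
  also have "\<dots> \<longleftrightarrow> misses j y (\<xi> \<ominus>\<^bsub>C j\<^esub> \<eta>)"
    by (rule away_iff[OF y fc_minus[OF \<xi> \<eta>] openin_topspace y])
  finally show ?thesis .
qed

lemma chain_germ_boundary:
  assumes y: "y \<in> topspace T" and \<xi>: "fc j \<xi>"
  shows "stalk_map T (fc_pre (j - 1)) (fc_bd j) y (chain_germ j y \<xi>) = chain_germ (j - 1) y (bd j \<xi>)"
proof -
  interpret presheaf_map R T "fc_pre j" "fc_pre (j - 1)" "fc_bd j" by (rule presheaf_map_fc)
  show ?thesis
    using stalk_map_germ[OF openin_topspace y] \<xi>
    by (simp add: chain_germ_def carrier_sections_fc fc_bd_sect)
qed

subsection \<open>Relative homology and comparison\<close>

abbreviation "off y \<equiv> topspace (ftop E) - p -` {y}"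
abbreviation "cc_off j y \<equiv> IC_c_in E pv \<G> (off y) j"
abbreviation "rel_chains j y \<equiv> IC_c_rel E pv \<G> (off y) j"
abbreviation "rel_bd j y \<equiv> IC_c_rel_boundary E pv \<G> (off y) j"
abbreviation "rel_class j y \<xi> \<equiv> cc_off j y +>\<^bsub>C j\<^esub> \<xi>"

lemma cc_off_eq: "cc_off j y = {\<xi> \<in> {\<xi>. cc j \<xi>}. supp j \<xi> \<subseteq> off y}"
  by (simp add: IC_c_in_def IC_c_eq)

lemma mem_cc_off: "\<xi> \<in> cc_off j y \<longleftrightarrow> cc j \<xi> \<and> misses j y \<xi>"
  using supp_topspace[of j \<xi>] unfolding cc_off_eq by blast

lemma submodule_off: "submodule_of R (C j) (cc_off j y)"
  unfolding cc_off_eq by (rule submodule_supported[OF submodule_cc])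

lemma submodule_off_cc: "submodule_of R (cc_chains j) (cc_off j y)"
  by (rule submodule_of_submodule[OF submodule_off]) (auto simp: mem_cc_off)

lemma boundary_off: "bd j ` cc_off j y \<subseteq> cc_off (j - 1) y"
  using misses_boundary[OF ccD] cc_boundary by (auto simp: mem_cc_off)

lemma rel_chains_eq: "rel_chains j y = quot_module (cc_chains j) (cc_off j y)"
  by (simp add: IC_c_rel_def IC_c_eq)

lemma carrier_rel_chains: "carrier (rel_chains j y) = rel_class j y ` {\<xi>. cc j \<xi>}"
  by (simp add: rel_chains_eq carrier_quot_module coset_carrier_update)

lemma rel_class_linear: "linear_map R (cc_chains j) (rel_chains j y) (rel_class j y)"
  using linear_map_coset[OF left_module_cc submodule_off_cc] by (simp add: rel_chains_eq coset_carrier_update)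

lemma left_module_rel: "left_module R (rel_chains j y)"
  unfolding rel_chains_eq by (rule left_module_quot_module[OF left_module_cc submodule_off_cc])

lemma zero_rel: "\<zero>\<^bsub>rel_chains j y\<^esub> = rel_class j y \<zero>\<^bsub>C j\<^esub>"
  using zero_quot_module[OF left_module_cc submodule_off_cc] by (simp add: rel_chains_eq coset_carrier_update)

lemma rel_bd_linear: "linear_map R (rel_chains j y) (rel_chains (j - 1) y) (rel_bd j y)"
  using linear_map_coset_map[OF left_module_cc submodule_off_cc left_module_cc submodule_off_cc
      boundary_linear_cc boundary_off] by (simp add: rel_chains_eq IC_c_rel_boundary_def IC_c_eq)

lemma rel_bd_class: "cc j \<xi> \<Longrightarrow> rel_bd j y (rel_class j y \<xi>) = rel_class (j - 1) y (bd j \<xi>)"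
  using coset_map_coset[OF left_module_cc submodule_off_cc left_module_cc submodule_off_cc
      boundary_linear_cc boundary_off]
  by (simp add: IC_c_rel_boundary_def IC_c_eq coset_carrier_update)

lemma rel_class_eq_iff:
  assumes "cc j \<xi>" "cc j \<eta>"
  shows "rel_class j y \<xi> = rel_class j y \<eta> \<longleftrightarrow> misses j y (\<xi> \<ominus>\<^bsub>C j\<^esub> \<eta>)"
  using coset_eq_iff[OF left_module_chain submodule_off allowD(1)[OF ccD[OF assms(1)]] allowD(1)[OF ccD[OF assms(2)]]]
    cc_minus[OF assms] by (simp add: mem_cc_off)

lemma rel_complex:
  "three_term_complex R (rel_chains (j + 1) y) (rel_bd (j + 1) y) (rel_chains j y) (rel_bd j y) (rel_chains (j - 1) y)"
proof (intro three_term_complex.intro left_module_rel rel_bd_linear)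
  show "linear_map R (rel_chains (j + 1) y) (rel_chains j y) (rel_bd (j + 1) y)"
    using rel_bd_linear[of y "j + 1"] by simp
  fix a assume "a \<in> carrier (rel_chains (j + 1) y)"
  then obtain \<xi> where \<xi>: "cc (j + 1) \<xi>" "a = rel_class (j + 1) y \<xi>" unfolding carrier_rel_chains by blast
  have "cc j (bd (j + 1) \<xi>)" using cc_boundary[OF \<xi>(1)] by simp
  then have "rel_bd j y (rel_bd (j + 1) y a) = rel_class (j - 1) y (bd j (bd (j + 1) \<xi>))"
    using rel_bd_class[OF \<xi>(1), of y] rel_bd_class[of j "bd (j + 1) \<xi>" y] \<xi>(2) by simp
  also have "bd j (bd (j + 1) \<xi>) = \<zero>\<^bsub>C (j - 1)\<^esub>"
    using boundary_boundary[OF allowD[OF ccD[OF \<xi>(1)]]] by simp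
  finally show "rel_bd j y (rel_bd (j + 1) y a) = \<zero>\<^bsub>rel_chains (j - 1) y\<^esub>"
    by (simp add: zero_rel)
qed

lemma minus_zero_chain: "\<xi> \<in> carrier (C j) \<Longrightarrow> \<xi> \<ominus>\<^bsub>C j\<^esub> \<zero>\<^bsub>C j\<^esub> = \<xi>"
proof -
  interpret c: abelian_group "C j" by (rule left_module_abelian_group[OF left_module_chain])
  show "\<xi> \<in> carrier (C j) \<Longrightarrow> \<xi> \<ominus>\<^bsub>C j\<^esub> \<zero>\<^bsub>C j\<^esub> = \<xi>" by (simp add: a_minus_def)
qed

lemma rel_class_zero_iff:
  assumes "cc j \<xi>"
  shows "rel_class j y \<xi> = \<zero>\<^bsub>rel_chains j y\<^esub> \<longleftrightarrow> misses j y \<xi>"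
  using rel_class_eq_iff[OF assms cc_zero] minus_zero_chain[OF allowD(1)[OF ccD[OF assms]]]
  by (simp add: zero_rel)

lemma chain_germ_zero_iff:
  assumes y: "y \<in> topspace T" and \<xi>: "fc j \<xi>"
  shows "chain_germ j y \<xi> = \<zero>\<^bsub>stalk T (fc_pre j) y\<^esub> \<longleftrightarrow> misses j y \<xi>"
proof -
  interpret module_presheaf R T "fc_pre j" by (rule module_presheaf_fc)
  have "\<zero>\<^bsub>stalk T (fc_pre j) y\<^esub> = chain_germ j y \<zero>\<^bsub>C j\<^esub>"
    using stalk_zero[OF openin_topspace y] by (simp add: chain_germ_def zero_sections_fc)
  then show ?thesis
    using chain_germ_eq_iff[OF y \<xi> cc_imp_fc[OF cc_zero]] minus_zero_chain[OF allowD(1)[OF fcD[OF \<xi>]]]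
    by simp
qed

text \<open>Both homology modules are compared through \<open>Z\<close>, the finite relative cycles. On both sides a class
  vanishes precisely if the cycle is a boundary up to a chain that misses the fibre; the two conditions differ
  only in the kind of chains that are admitted as bounding chains.\<close>

theorem stalk_homology_fc:
  assumes y: "y \<in> topspace T"
  shows "modules_isomorphic R
    (homology_at (stalk T (fc_pre (j + 1)) y) (stalk_map T (fc_pre j) (fc_bd (j + 1)) y) (stalk T (fc_pre j) y)
       (stalk_map T (fc_pre (j - 1)) (fc_bd j) y) (stalk T (fc_pre (j - 1)) y))
    (IH_c_rel E pv \<G> (off y) j)" (is "modules_isomorphic R ?S _")
proof -
  interpret c: abelian_group "C j" by (rule left_module_abelian_group[OF left_module_chain])
  let ?f = "stalk_map T (fc_pre j) (fc_bd (j + 1)) y" and ?g = "stalk_map T (fc_pre (j - 1)) (fc_bd j) y"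
  let ?A = "stalk T (fc_pre (j + 1)) y" and ?M = "stalk T (fc_pre j) y"
  interpret S: three_term_complex R ?A ?f ?M ?g "stalk T (fc_pre (j - 1)) y"
    by (rule three_term_presheaves.stalk_complex[OF three_term_presheaves_fc y])
  interpret Q: three_term_complex R "rel_chains (j + 1) y" "rel_bd (j + 1) y" "rel_chains j y" "rel_bd j y"
    "rel_chains (j - 1) y" by (rule rel_complex)
  interpret S': abelian_group ?M by (rule left_module_abelian_group[OF S.M])
  let ?G = "chain_germ j y" and ?q = "rel_class j y"
  let ?u = "\<lambda>\<zeta>. homology_class ?A ?f ?M (?G \<zeta>)"
  let ?v = "\<lambda>\<zeta>. homology_class (rel_chains (j + 1) y) (rel_bd (j + 1) y) (rel_chains j y) (?q \<zeta>)"
  have IH: "IH_c_rel E pv \<G> (off y) j = homology_at (rel_chains (j + 1) y) (rel_bd (j + 1) y) (rel_chains j y)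
      (rel_bd j y) (rel_chains (j - 1) y)"
    by (simp add: IH_c_rel_def)
  define Z where "Z = {\<zeta>. cc j \<zeta> \<and> misses (j - 1) y (bd j \<zeta>)}"
  have bdf: "fc j (bd (j + 1) \<eta>)" if "fc (j + 1) \<eta>" for \<eta> using fc_boundary[OF that] by simp
  have bdc: "cc j (bd (j + 1) \<eta>)" if "cc (j + 1) \<eta>" for \<eta> using cc_boundary[OF that] by simp
  have fG: "?f (chain_germ (j + 1) y \<eta>) = ?G (bd (j + 1) \<eta>)" if "fc (j + 1) \<eta>" for \<eta>
    using chain_germ_boundary[OF y that] by simp
  have fq: "rel_bd (j + 1) y (rel_class (j + 1) y \<eta>) = ?q (bd (j + 1) \<eta>)" if "cc (j + 1) \<eta>" for \<eta>
    using rel_bd_class[OF that] by simp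
  have S_cycle: "?G \<xi> \<in> S.cycles \<longleftrightarrow> misses (j - 1) y (bd j \<xi>)" if "fc j \<xi>" for \<xi>
    using chain_germ_boundary[OF y that] chain_germ_zero_iff[OF y fc_boundary[OF that]]
      linear_map_closed[OF chain_germ_linear[OF y], of \<xi> j] that by (simp add: S.cycles_def)
  have Q_cycle: "?q \<xi> \<in> Q.cycles \<longleftrightarrow> misses (j - 1) y (bd j \<xi>)" if "cc j \<xi>" for \<xi>
    using rel_bd_class[OF that] rel_class_zero_iff[OF cc_boundary[OF that]]
      linear_map_closed[OF rel_class_linear, of \<xi> j] that by (simp add: Q.cycles_def)
  have G_add: "?G (\<xi> \<oplus>\<^bsub>C j\<^esub> \<eta>) = ?G \<xi> \<oplus>\<^bsub>?M\<^esub> ?G \<eta>" if "fc j \<xi>" "fc j \<eta>" for \<xi> \<eta>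
    using linear_map_add[OF chain_germ_linear[OF y]] that by simp
  have q_add: "?q (\<xi> \<oplus>\<^bsub>C j\<^esub> \<eta>) = ?q \<xi> \<oplus>\<^bsub>rel_chains j y\<^esub> ?q \<eta>" if "cc j \<xi>" "cc j \<eta>" for \<xi> \<eta>
    using linear_map_add[OF rel_class_linear] that by simp
  have S_eq: "?u \<xi> = ?u \<eta> \<longleftrightarrow> (\<exists>\<omega>. fc (j + 1) \<omega> \<and> misses j y (\<xi> \<ominus>\<^bsub>C j\<^esub> (\<eta> \<oplus>\<^bsub>C j\<^esub> bd (j + 1) \<omega>)))"
    if "fc j \<xi>" "fc j \<eta>" "misses (j - 1) y (bd j \<xi>)" "misses (j - 1) y (bd j \<eta>)" for \<xi> \<eta>
  proof -
    have "?u \<xi> = ?u \<eta> \<longleftrightarrow> (\<exists>a\<in>carrier ?A. ?G \<xi> = ?G \<eta> \<oplus>\<^bsub>?M\<^esub> ?f a)"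
      using S.homology_class_eq_iff S_cycle that by simp
    also have "\<dots> \<longleftrightarrow> (\<exists>\<omega>. fc (j + 1) \<omega> \<and> ?G \<xi> = ?G \<eta> \<oplus>\<^bsub>?M\<^esub> ?G (bd (j + 1) \<omega>))"
      unfolding chain_germ_onto[OF y] using fG by auto
    also have "\<dots> \<longleftrightarrow> (\<exists>\<omega>. fc (j + 1) \<omega> \<and> misses j y (\<xi> \<ominus>\<^bsub>C j\<^esub> (\<eta> \<oplus>\<^bsub>C j\<^esub> bd (j + 1) \<omega>)))"
    proof (intro arg_cong[where f = Ex] ext conj_cong refl)
      fix \<omega> assume "fc (j + 1) \<omega>"
      note b = bdf[OF this]
      show "?G \<xi> = ?G \<eta> \<oplus>\<^bsub>?M\<^esub> ?G (bd (j + 1) \<omega>) \<longleftrightarrow> misses j y (\<xi> \<ominus>\<^bsub>C j\<^esub> (\<eta> \<oplus>\<^bsub>C j\<^esub> bd (j + 1) \<omega>))"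
        using chain_germ_eq_iff[OF y that(1) fc_add[OF that(2) b]] G_add[OF that(2) b] by simp
    qed
    finally show ?thesis .
  qed
  have Q_eq: "?v \<xi> = ?v \<eta> \<longleftrightarrow> (\<exists>\<omega>. cc (j + 1) \<omega> \<and> misses j y (\<xi> \<ominus>\<^bsub>C j\<^esub> (\<eta> \<oplus>\<^bsub>C j\<^esub> bd (j + 1) \<omega>)))"
    if "cc j \<xi>" "cc j \<eta>" "misses (j - 1) y (bd j \<xi>)" "misses (j - 1) y (bd j \<eta>)" for \<xi> \<eta>
  proof -
    have "?v \<xi> = ?v \<eta> \<longleftrightarrow> (\<exists>a\<in>carrier (rel_chains (j + 1) y). ?q \<xi> = ?q \<eta> \<oplus>\<^bsub>rel_chains j y\<^esub> rel_bd (j + 1) y a)"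
      using Q.homology_class_eq_iff Q_cycle that by simp
    also have "\<dots> \<longleftrightarrow> (\<exists>\<omega>. cc (j + 1) \<omega> \<and> ?q \<xi> = ?q \<eta> \<oplus>\<^bsub>rel_chains j y\<^esub> ?q (bd (j + 1) \<omega>))"
      unfolding carrier_rel_chains using fq by auto
    also have "\<dots> \<longleftrightarrow> (\<exists>\<omega>. cc (j + 1) \<omega> \<and> misses j y (\<xi> \<ominus>\<^bsub>C j\<^esub> (\<eta> \<oplus>\<^bsub>C j\<^esub> bd (j + 1) \<omega>)))"
    proof (intro arg_cong[where f = Ex] ext conj_cong refl)
      fix \<omega> assume "cc (j + 1) \<omega>"
      note b = bdc[OF this]
      show "?q \<xi> = ?q \<eta> \<oplus>\<^bsub>rel_chains j y\<^esub> ?q (bd (j + 1) \<omega>) \<longleftrightarrow> misses j y (\<xi> \<ominus>\<^bsub>C j\<^esub> (\<eta> \<oplus>\<^bsub>C j\<^esub> bd (j + 1) \<omega>))"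
        using rel_class_eq_iff[OF that(1) cc_add[OF that(2) b], of y] q_add[OF that(2) b] by simp
    qed
    finally show ?thesis .
  qed
  have Z_cycles: "?G \<zeta> \<in> S.cycles" "?q \<zeta> \<in> Q.cycles" if "\<zeta> \<in> Z" for \<zeta>
    using that S_cycle[OF cc_imp_fc] Q_cycle by (auto simp: Z_def)
  show ?thesis
  proof (rule modules_isomorphicI)
    show "?v ` Z = carrier (IH_c_rel E pv \<G> (off y) j)"
    proof -
      have "Q.cycles = ?q ` Z"
      proof
        show "?q ` Z \<subseteq> Q.cycles" using Z_cycles by blast
        show "Q.cycles \<subseteq> ?q ` Z"
        proof
          fix c assume c: "c \<in> Q.cycles"
          then have "c \<in> carrier (rel_chains j y)" by (simp add: Q.cycles_def)
          then obtain \<xi> where "cc j \<xi>" "c = ?q \<xi>" unfolding carrier_rel_chains by blast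
          then show "c \<in> ?q ` Z" using c Q_cycle by (auto simp: Z_def)
        qed
      qed
      then show ?thesis unfolding IH Q.carrier_homology by (simp add: image_image)
    qed
    show "?u ` Z = carrier ?S"
    proof
      show "?u ` Z \<subseteq> carrier ?S" unfolding S.carrier_homology using Z_cycles by blast
      show "carrier ?S \<subseteq> ?u ` Z"
      proof
        fix h assume "h \<in> carrier ?S"
        then obtain c where c: "c \<in> S.cycles" "h = homology_class ?A ?f ?M c" unfolding S.carrier_homology by blast
        then have "c \<in> carrier ?M" by (simp add: S.cycles_def)
        then obtain \<xi> where \<xi>: "fc j \<xi>" "c = ?G \<xi>" unfolding chain_germ_onto[OF y] by blast
        then have cyc: "misses (j - 1) y (bd j \<xi>)" using c S_cycle by simp
        obtain \<zeta> \<eta> \<alpha> where z: "cc j \<zeta>" "fc (j + 1) \<eta>" "fc j \<alpha>" "misses j y \<alpha>"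
          "bd (j + 1) \<eta> \<oplus>\<^bsub>C j\<^esub> \<xi> = \<zeta> \<oplus>\<^bsub>C j\<^esub> \<alpha>"
          by (rule relative_cycle_truncation[OF y \<xi>(1) cyc])
        note b = bdf[OF z(2)]
        have cl: "?G \<xi> \<in> carrier ?M" "?G \<zeta> \<in> carrier ?M" "?G (bd (j + 1) \<eta>) \<in> carrier ?M"
          using \<xi>(1) cc_imp_fc[OF z(1)] b by (auto simp: chain_germ_onto[OF y])
        have "?G \<alpha> = \<zero>\<^bsub>?M\<^esub>" using chain_germ_zero_iff[OF y z(3)] z(4) by simp
        then have "?G (bd (j + 1) \<eta>) \<oplus>\<^bsub>?M\<^esub> ?G \<xi> = ?G \<zeta>"
          using G_add[OF b \<xi>(1)] G_add[OF cc_imp_fc[OF z(1)] z(3)] z(5) cl by simp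
        then have eq: "?G \<zeta> = ?G \<xi> \<oplus>\<^bsub>?M\<^esub> ?f (chain_germ (j + 1) y \<eta>)"
          using cl fG[OF z(2)] by (simp add: S'.a_comm)
        have a: "chain_germ (j + 1) y \<eta> \<in> carrier ?A" using z(2) by (simp add: chain_germ_onto[OF y])
        have "?f (chain_germ (j + 1) y \<eta>) \<in> S.cycles"
          using S.gf[OF a] linear_map_closed[OF S.f a] by (simp add: S.cycles_def)
        then have "?G \<zeta> \<in> S.cycles"
          unfolding eq using c(1) \<xi>(2) S.cycles_submodule by (simp add: submodule_of_def)
        moreover have "?u \<zeta> = ?u \<xi>"
          using S.homology_class_eq_iff[OF \<open>?G \<zeta> \<in> S.cycles\<close>, of "?G \<xi>"] c(1) \<xi>(2) eq a by blast
        moreover have "\<zeta> \<in> Z" using z(1) S_cycle[OF cc_imp_fc[OF z(1)]] \<open>?G \<zeta> \<in> S.cycles\<close> by (simp add: Z_def)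
        ultimately show "h \<in> ?u ` Z" using c(2) \<xi>(2) by (simp add: image_iff) blast
      qed
    qed
    fix \<zeta> \<zeta>' assume zz: "\<zeta> \<in> Z" "\<zeta>' \<in> Z"
    then have z: "cc j \<zeta>" "misses (j - 1) y (bd j \<zeta>)" "cc j \<zeta>'" "misses (j - 1) y (bd j \<zeta>')"
      by (auto simp: Z_def)
    note zx = allowD[OF ccD[OF z(1)]] and zx' = allowD[OF ccD[OF z(3)]]
    have bdadd: "bd j (\<zeta> \<oplus>\<^bsub>C j\<^esub> \<zeta>') = bd j \<zeta> \<oplus>\<^bsub>C (j - 1)\<^esub> bd j \<zeta>'" by (rule boundary_add[OF zx zx'])
    show "?u \<zeta> = ?u \<zeta>' \<longleftrightarrow> ?v \<zeta> = ?v \<zeta>'"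
      unfolding S_eq[OF cc_imp_fc[OF z(1)] cc_imp_fc[OF z(3)] z(2,4)] Q_eq[OF z(1,3,2,4)]
    proof
      assume "\<exists>\<omega>. cc (j + 1) \<omega> \<and> misses j y (\<zeta> \<ominus>\<^bsub>C j\<^esub> (\<zeta>' \<oplus>\<^bsub>C j\<^esub> bd (j + 1) \<omega>))"
      then show "\<exists>\<omega>. fc (j + 1) \<omega> \<and> misses j y (\<zeta> \<ominus>\<^bsub>C j\<^esub> (\<zeta>' \<oplus>\<^bsub>C j\<^esub> bd (j + 1) \<omega>))"
        using cc_imp_fc by blast
    next
      assume "\<exists>\<omega>. fc (j + 1) \<omega> \<and> misses j y (\<zeta> \<ominus>\<^bsub>C j\<^esub> (\<zeta>' \<oplus>\<^bsub>C j\<^esub> bd (j + 1) \<omega>))"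
      then obtain \<omega> where w: "fc (j + 1) \<omega>" "misses j y (\<zeta> \<ominus>\<^bsub>C j\<^esub> (\<zeta>' \<oplus>\<^bsub>C j\<^esub> bd (j + 1) \<omega>))" by blast
      let ?x = "\<zeta> \<ominus>\<^bsub>C j\<^esub> \<zeta>'" and ?b = "bd (j + 1) \<omega>"
      have xc: "cc j ?x" by (rule cc_minus[OF z(1,3)])
      note x1 = allowD[OF ccD[OF xc]] and b1 = allowD[OF fcD[OF bdf[OF w(1)]]]
      have mv: "\<zeta> \<ominus>\<^bsub>C j\<^esub> (\<zeta>' \<oplus>\<^bsub>C j\<^esub> b) = ?x \<ominus>\<^bsub>C j\<^esub> b" if "b \<in> carrier (C j)" for b
        using that zx zx' by (simp add: a_minus_def c.minus_add c.a_assoc)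
      have al: "fc j (?x \<ominus>\<^bsub>C j\<^esub> ?b)" "misses j y (?x \<ominus>\<^bsub>C j\<^esub> ?b)"
        using fc_minus[OF cc_imp_fc[OF xc] bdf[OF w(1)]] w(2) mv[OF b1(1)] by simp_all
      have ex: "?x = ?b \<oplus>\<^bsub>C j\<^esub> (?x \<ominus>\<^bsub>C j\<^esub> ?b)"
        using c.minus_add_cancel'[OF x1(1) b1(1)] x1(1) b1(1) c.a_comm by simp
      have "misses (j - 1) y (bd j ?x)"
      proof -
        have mz': "allow (j - 1) (bd j \<zeta>')" by (rule allow_boundary[OF ccD[OF z(3)]])
        have "?x \<oplus>\<^bsub>C j\<^esub> \<zeta>' = \<zeta>" by (rule c.minus_add_cancel'[OF zx(1) zx'(1)])
        then have "bd j ?x \<oplus>\<^bsub>C (j - 1)\<^esub> bd j \<zeta>' = bd j \<zeta>" using boundary_add[OF x1 zx'] by simp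
        then have "bd j ?x = bd j \<zeta> \<ominus>\<^bsub>C (j - 1)\<^esub> bd j \<zeta>'"
          by (rule abelian_group.eq_minusI[OF left_module_abelian_group[OF left_module_chain]
                allowD(1)[OF allow_boundary[OF ccD[OF xc]]] allowD(1)[OF mz']])
        then show ?thesis using misses_minus[OF allowD(1)[OF mz'] z(2,4)] by simp
      qed
      then obtain \<eta>' \<alpha>' where e: "cc (j + 1) \<eta>'" "cc j \<alpha>'" "misses j y \<alpha>'" "?x = bd (j + 1) \<eta>' \<oplus>\<^bsub>C j\<^esub> \<alpha>'"
        by (rule relative_boundary_truncation[OF y xc _ w(1) al ex])
      note e1 = allowD[OF ccD[OF bdc[OF e(1)]]] and a1 = allowD[OF ccD[OF e(2)]]
      have "\<alpha>' \<oplus>\<^bsub>C j\<^esub> bd (j + 1) \<eta>' = ?x" using e(4) c.a_comm[OF e1(1) a1(1)] by simp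
      then have "\<alpha>' = ?x \<ominus>\<^bsub>C j\<^esub> bd (j + 1) \<eta>'" by (rule c.eq_minusI[OF a1(1) e1(1)])
      then have "misses j y (\<zeta> \<ominus>\<^bsub>C j\<^esub> (\<zeta>' \<oplus>\<^bsub>C j\<^esub> bd (j + 1) \<eta>'))" using e(3) mv[OF e1(1)] by simp
      then show "\<exists>\<omega>. cc (j + 1) \<omega> \<and> misses j y (\<zeta> \<ominus>\<^bsub>C j\<^esub> (\<zeta>' \<oplus>\<^bsub>C j\<^esub> bd (j + 1) \<omega>))"
        using e(1) by blast
    qed
    show "\<exists>v\<in>Z. ?u v = ?u \<zeta> \<oplus>\<^bsub>?S\<^esub> ?u \<zeta>' \<and> ?v v = ?v \<zeta> \<oplus>\<^bsub>IH_c_rel E pv \<G> (off y) j\<^esub> ?v \<zeta>'"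
    proof (rule bexI[of _ "\<zeta> \<oplus>\<^bsub>C j\<^esub> \<zeta>'"], rule conjI)
      show "\<zeta> \<oplus>\<^bsub>C j\<^esub> \<zeta>' \<in> Z"
        unfolding Z_def using cc_add[OF z(1,3)] misses_add[OF z(2,4)] bdadd by simp
      show "?u (\<zeta> \<oplus>\<^bsub>C j\<^esub> \<zeta>') = ?u \<zeta> \<oplus>\<^bsub>?S\<^esub> ?u \<zeta>'"
        unfolding S.homology_class_add[OF Z_cycles(1)[OF zz(1)] Z_cycles(1)[OF zz(2)]]
        by (simp only: G_add[OF cc_imp_fc[OF z(1)] cc_imp_fc[OF z(3)]])
      show "?v (\<zeta> \<oplus>\<^bsub>C j\<^esub> \<zeta>') = ?v \<zeta> \<oplus>\<^bsub>IH_c_rel E pv \<G> (off y) j\<^esub> ?v \<zeta>'"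
        unfolding IH Q.homology_class_add[OF Z_cycles(2)[OF zz(1)] Z_cycles(2)[OF zz(2)]]
        by (simp only: q_add[OF z(1,3)])
    qed
  next
    fix r \<zeta> assume r: "r \<in> carrier R" and zz: "\<zeta> \<in> Z"
    then have z: "cc j \<zeta>" "misses (j - 1) y (bd j \<zeta>)" by (auto simp: Z_def)
    note zx = allowD[OF ccD[OF z(1)]]
    show "\<exists>v\<in>Z. ?u v = r \<odot>\<^bsub>?S\<^esub> ?u \<zeta> \<and> ?v v = r \<odot>\<^bsub>IH_c_rel E pv \<G> (off y) j\<^esub> ?v \<zeta>"
    proof (rule bexI[of _ "r \<odot>\<^bsub>C j\<^esub> \<zeta>"], rule conjI)
      have "misses (j - 1) y (r \<odot>\<^bsub>C (j - 1)\<^esub> bd j \<zeta>)"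
        using supp_mono[of "j - 1" "r \<odot>\<^bsub>C (j - 1)\<^esub> bd j \<zeta>" "bd j \<zeta>" "bd j \<zeta>"] spx_smult[OF r] z(2) by blast
      then show "r \<odot>\<^bsub>C j\<^esub> \<zeta> \<in> Z"
        unfolding Z_def using cc_smult[OF z(1) r] boundary_smult[OF zx r] by simp
      have "?G (r \<odot>\<^bsub>C j\<^esub> \<zeta>) = r \<odot>\<^bsub>?M\<^esub> ?G \<zeta>"
        using linear_map_smult[OF chain_germ_linear[OF y] r, of \<zeta> j] cc_imp_fc[OF z(1)] by simp
      then show "?u (r \<odot>\<^bsub>C j\<^esub> \<zeta>) = r \<odot>\<^bsub>?S\<^esub> ?u \<zeta>"
        unfolding S.homology_class_smult[OF r Z_cycles(1)[OF zz]] by (simp only:)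
      have "?q (r \<odot>\<^bsub>C j\<^esub> \<zeta>) = r \<odot>\<^bsub>rel_chains j y\<^esub> ?q \<zeta>"
        using linear_map_smult[OF rel_class_linear r, of \<zeta> j] z(1) by simp
      then show "?v (r \<odot>\<^bsub>C j\<^esub> \<zeta>) = r \<odot>\<^bsub>IH_c_rel E pv \<G> (off y) j\<^esub> ?v \<zeta>"
        unfolding IH Q.homology_class_smult[OF r Z_cycles(2)[OF zz]] by (simp only:)
    qed
  qed
qed

theorem stalk_derived_sheaf:
  assumes y: "y \<in> topspace T"
  shows "modules_isomorphic R
           (stalk T (derived_sheaf T (fc_sheaf E Y p pv \<G>) (fc_coboundary E Y p pv \<G>) i) y)
           (IH_c_rel E pv \<G> (off y) (int (fdim E) - i))"
proof -
  define j where "j = int (fdim E) - i"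
  have idx: "int (fdim E) - (i - 1) = j + 1" "int (fdim E) - (i + 1) = j - 1" "int (fdim E) - i = j"
    by (simp_all add: j_def)
  interpret F: three_term_presheaves R T "fc_pre (j + 1)" "fc_bd (j + 1)" "fc_pre j" "fc_bd j" "fc_pre (j - 1)"
    by (rule three_term_presheaves_fc)
  interpret S: three_term_presheaves R T "sheafify T (fc_pre (j + 1))" "sheafify_map T (fc_pre j) (fc_bd (j + 1))"
    "sheafify T (fc_pre j)" "sheafify_map T (fc_pre (j - 1)) (fc_bd j)" "sheafify T (fc_pre (j - 1))"
    by (rule F.three_term_presheaves_sheafify)
  have eq: "derived_sheaf T (fc_sheaf E Y p pv \<G>) (fc_coboundary E Y p pv \<G>) i = sheafify T S.H"
    by (simp add: derived_sheaf_def cohomology_presheaf_eq fc_sheaf_def fc_coboundary_def idx)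
  have "modules_isomorphic R (stalk T (sheafify T S.H) y) (stalk T S.H y)"
    by (rule module_presheaf.stalk_sheafify[OF S.module_presheaf_H])
  then show ?thesis
    unfolding eq idx
    by (rule modules_isomorphic_trans[OF _ modules_isomorphic_trans[OF
          F.stalk_homology_sheafify[OF y] stalk_homology_fc[OF y]]])
qed

end

theorem corollary3p7:
  fixes R :: "('r, 'm) ring_scheme"
    and E :: "'a filtered" and Y :: "'b filtered" and p :: "'a \<Rightarrow> 'b"
    and pv :: "nat \<Rightarrow> int" and \<G> :: "('a, 'r, 'g) coefficients"
    and y :: 'b and i :: int
  assumes "ring R"
    and "perversity pv"
    and "filtered_space E"
    and "filtered_space Y"
    and "coefficient_system R E \<G>"
    and "stratified_fibration E Y p"
    and "paracompact_space (ftop Y)"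
    and "y \<in> topspace (ftop Y)"
  shows "modules_isomorphic R
           (stalk (ftop Y)
              (derived_sheaf (ftop Y) (fc_sheaf E Y p pv \<G>) (fc_coboundary E Y p pv \<G>) i) y)
           (IH_c_rel E pv \<G> (topspace (ftop E) - p -` {y}) (int (fdim E) - i))"
proof -
  interpret fibrewise_chains R E \<G> pv Y p
  proof (intro fibrewise_chains.intro allowable_chains.intro chain_coefficients.intro fibrewise_chains_axioms.intro)
    show "continuous_map (ftop E) (ftop Y) p" using assms(6) by (simp add: stratified_fibration_def)
    show "Hausdorff_space (ftop Y)" using assms(7) by (simp add: paracompact_space_def)
    show "regular_space (ftop Y)" by (rule paracompact_imp_regular_space[OF assms(7)])
  qed (fact assms)+
  show ?thesis by (rule stalk_derived_sheaf[OF assms(8)])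
qed

end
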